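(* Let $0<\beta<\tfrac12$ and let $p>\max\{1,q_0\}$ be a natural number. Suppose that $b:(\mathcal{S})^{-1}_{-p}\to(\mathcal{S})^{-1}_{-p}$ and $\sigma:(\mathcal{S})^{-1}_{-p}\to(\mathcal{S})^{-1}_{-p}$ satisfy, for some constant $C$ independent of $Y,Z$ and all $Y,Z\in(\mathcal{S})^{-1}_{-p}$, $$\|b(Y)\|_{-p,-1}\le C(1+\|Y\|_{-p,-1}),\qquad \|b(Y)-b(Z)\|_{-p,-1}\le C\|Y-Z\|_{-p,-1},$$ $$\|\sigma(Y)\|_{-p,-1}\le C(1+\|Y\|_{-p,-1}),\qquad \|\sigma(Y)-\sigma(Z)\|_{-p,-1}\le C\|Y-Z\|_{-p,-1}.$$ Let $U_0\in(\mathcal{S})^{-1}_{-p}$. Then the equation $$U(t)=U_0+\int_0^tb(U(s))\,ds+\int_0^t\sigma(U(s))\diamond\dot X^\beta_s\,ds,\qquad t\ge0,$$ has a unique continuous solution $U:[0,\infty)\to(\mathcal{S})^{-1}_{-p}$.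
   Context: **White noise framework.** Let $\mathbb{R}_0=\mathbb{R}\setminus\{0\}$, $\mathbb{U}=\mathbb{R}\times\mathbb{R}_0$, let $\nu$ be a Lévy measure on $\mathbb{R}_0$ with $\int_{\mathbb{R}_0}|x|^2\,d\nu(x)<\infty$, and let $\pi=\lambda\times\nu$ with $\lambda$ Lebesgue measure on $\mathbb{R}$. Let $(\xi_n)$ be the Hermite functions (an orthonormal basis of $L^2(\mathbb{R})$), $\xi_\alpha=\prod_i\xi_{\alpha_i}(x_i)$, and on the Schwartz space $\mathcal{S}(\mathbb{R}^2)$ set $\|\phi\|_p^2=\sum_{\alpha}(1+\alpha)^{2p}(\phi,\xi_\alpha)^2_{L^2(\mathbb{R}^2)}$, $(1+\alpha)^{2p}=\prod_i(1+\alpha_i)^{2p}$. Put $\mathcal{S}(\mathbb{U})=\{\phi\in\mathcal{S}(\mathbb{R}^2):\phi(x,0)=\frac{\partial\phi}{\partial y}(x,0)=0\}$, $\mathcal{N}_\pi=\{\phi\in\mathcal{S}(\mathbb{U}):\|\phi\|_{L^2(\pi)}=0\}$, $\widetilde{\mathcal{S}}(\mathbb{U})=\mathcal{S}(\mathbb{U})/\mathcal{N}_\pi$ with norms $\|\widehat\phi\|_{p,\pi}=\inf_{\psi\in\mathcal{N}_\pi}\|\phi+\psi\|_p$. Let $\widetilde{\mathcal{S}}_p(\mathbb{U})$ be the completion for $\|\cdot\|_{p,\pi}$, $\widetilde{\mathcal{S}}'_{-p}(\mathbb{U})$ its dual (norm $\|\cdot\|_{-p,\pi}$; the same notation is used on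 symmetric tensor powers $\widehat\otimes n$), and $\widetilde{\mathcal{S}}'(\mathbb{U})$ the dual of $\widetilde{\mathcal{S}}(\mathbb{U})$. Let $1\otimes\dot\nu$ be the functional $\phi\mapsto\int_{\mathbb{U}}\phi\,d\pi$. The probability space is $\Omega=\widetilde{\mathcal{S}}'(\mathbb{U})$ with the measure $\mu_\pi$ determined by $\int e^{i\langle\omega,\phi\rangle}d\mu_\pi(\omega)=\exp\{\int_{\mathbb{U}}(e^{i\phi}-1)d\pi\}$, $\phi\in\widetilde{\mathcal{S}}(\mathbb{U})$. Fix natural numbers $p_0<q_0$ (they exist) such that $1\otimes\dot\nu\in\widetilde{\mathcal{S}}'_{-p_0}(\mathbb{U})$, the embedding $\widetilde{\mathcal{S}}'_{-p_0}(\mathbb{U})\hookrightarrow\widetilde{\mathcal{S}}'_{-q_0}(\mathbb{U})$ is Hilbert–Schmidt and $\mu_\pi(\widetilde{\mathcal{S}}'_{-q_0}(\mathbb{U}))=1$. The generalized Charlier polynomials $C_n(\omega)$ are determined by $\widetilde e(\phi,\omega):=\exp(\langle\omega,\ln(1+\phi)\rangle-\langle1\otimes\dot\nu,\phi\rangle)=\sum_{n\ge0}\frac1{n!}\langle C_n(\omega),\phi^{\otimes n}\rangle$; in particular $C_1(\omega)=\omega-1\otimes\dot\nu$, and $\langle C_1,f\rangle$ extends to $f\in L^2(\mathbb{U},\pi)$ by the isometry $\|\langle C_1,f\rangle\|_{L^2(\mu_\pi)}=\|f\|_{L^2(\pi)}$. For $p\ge q_0$, $(\mathcal{S})^1_p$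 is the completion of the continuous polynomials $f=\sum_n\langle C_n,f_n\rangle$ (finite sums, $f_n\in\widetilde{\mathcal{S}}(\mathbb{U})^{\widehat\otimes n}$) under $\|f\|_{p,1}^2=\sum_n(n!)^2\|f_n\|_{p,\pi}^2$, $(\mathcal{S})^1$ is the projective limit, $(\mathcal{S})^{-1}_{-p}$ is the dual of $(\mathcal{S})^1_p$, and $(\mathcal{S})^{-1}$ (the stochastic distributions) is the inductive limit of the $(\mathcal{S})^{-1}_{-p}$, $p\ge q_0$. Elements of $(\mathcal{S})^{-1}_{-p}$ are the formal series $F=\sum_n\langle C_n(\omega),F_n\rangle$, $F_n\in\widetilde{\mathcal{S}}'(\mathbb{U})^{\widehat\otimes n}$, with $\|F\|_{-p,-1}^2=\sum_n\|F_n\|_{-p,\pi}^2<\infty$, acting by $\langle\langle F,f\rangle\rangle=\sum_n n!\langle F_n,f_n\rangle_\pi$, where $\langle\cdot,\cdot\rangle_\pi$ extends the inner product of $L^2(\pi^{\otimes n})$ (so functions act by integration against $\pi$). With $U_p=\{\phi\in\widetilde{\mathcal{S}}(\mathbb{U}):\|\phi\|_{p,\pi}<1\}$, the S-transform of $F\in(\mathcal{S})^{-1}_{-p}$ is $S(F)(\xi)=\langle\langle F,\widetilde e(\xi,\cdot)\rangle\rangle=\sum_n\langle F_n,\xi^{\otimes n}\rangle_\pi$, $\xi\in U_p$; it is an isomorphism of $(\mathcal{S})^{-1}$ onto the algebra of germs of functions holomorphic near $0$. The Wick product of $F,G\in(\mathcal{S})^{-1}$ is $F\diamond G=S^{-1}(S(F)S(G))$.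 **Fractional Lévy process and noise.** $(I_-^\beta f)(t)=\frac1{\Gamma(\beta)}\int_t^\infty(s-t)^{\beta-1}f(s)\,ds$; $\chi_{[0,t]}(s)=1$ if $0<s<t$, $-1$ if $t<s<0$, $0$ otherwise; $(K^\beta f)(s,x)=x\,I_-^\beta f(s)$. The two-sided square-integrable pure-jump Lévy process is $X_t=\langle C_1,x\chi_{[0,t]}(s)\rangle$ and the $\beta$-fractional Lévy process is $X^\beta_t=\int_{\mathbb{R}}I_-^\beta\chi_{[0,t]}(s)\,dX_s=\langle C_1,K^\beta\chi_{[0,t]}\rangle$. The fractional Lévy noise $\dot X^\beta_t\in(\mathcal{S})^{-1}$ is defined by $S\dot X^\beta_t(\eta)=\frac{d}{dt}SX^\beta_t(\eta)$; it equals $\langle C_1,\lambda_t\rangle$ with $\lambda_t(u,y)=y(t-u)_+^{\beta-1}/\Gamma(\beta)$. **Integrals.** For $G:\mathbb{R}\to(\mathcal{S})^{-1}$ with $\langle\langle G(s),f\rangle\rangle\in L^1(\mathbb{R},ds)$ for all $f\in(\mathcal{S})^1$, $\int_{\mathbb{R}}G(s)ds\in(\mathcal{S})^{-1}$ is the unique element with $\langle\langle\int G(s)ds,f\rangle\rangle=\int\langle\langle G(s),f\rangle\rangle ds$, and $\int_0^tG(s)ds=\int_{\mathbb{R}}1_{[0,t]}(s)G(s)ds$. In differential form the equation is $\frac{dU(t)}{dt}=b(U(t))+\sigma(U(t))\diamond\dot X^\beta_t$, $U(0)=U_0$. *)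

theory Defs
  imports "HOL-Probability.Probability" "HOL-Library.Function_Algebras"
begin

section \<open>Hermite functions and the Schwartz space on the plane\<close>

fun hermite_poly :: "nat \<Rightarrow> real \<Rightarrow> real" where
  "hermite_poly 0 x = 1"
| "hermite_poly (Suc 0) x = 2 * x"
| "hermite_poly (Suc (Suc n)) x =
     2 * x * hermite_poly (Suc n) x - 2 * real (Suc n) * hermite_poly n x"

definition hermite_fun :: "nat \<Rightarrow> real \<Rightarrow> real" where
  "hermite_fun n x =
     hermite_poly n x * exp (- x\<^sup>2 / 2) / sqrt (2 ^ n * fact n * sqrt pi)"

type_synonym pfun = "real \<times> real \<Rightarrow> real"

text \<open>\<open>D i j\<close> is the partial derivative of order \<open>i\<close> in the first and \<open>j\<close> in the second variable.\<close>

definition schwartz :: "pfun set" where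
  "schwartz = {\<phi>. \<exists>D :: nat \<Rightarrow> nat \<Rightarrow> pfun. D 0 0 = \<phi> \<and>
     (\<forall>i j z. (D i j has_derivative
        (\<lambda>h. fst h * D (Suc i) j z + snd h * D i (Suc j) z)) (at z)) \<and>
     (\<forall>i j k l. \<exists>B. \<forall>x y. \<bar>x ^ k * y ^ l * D i j (x, y)\<bar> \<le> B)}"

definition hermite_coeff :: "pfun \<Rightarrow> nat \<times> nat \<Rightarrow> real" where
  "hermite_coeff \<phi> \<alpha> =
     (LINT z|lborel. \<phi> z * (hermite_fun (fst \<alpha>) (fst z) * hermite_fun (snd \<alpha>) (snd z)))"

definition hnorm :: "nat \<Rightarrow> pfun \<Rightarrow> real" where
  "hnorm p \<phi> = sqrt (\<Sum>\<^sub>\<infinity>\<alpha>\<in>UNIV.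
     ((1 + real (fst \<alpha>)) * (1 + real (snd \<alpha>))) ^ (2 * p) * (hermite_coeff \<phi> \<alpha>)\<^sup>2)"

definition SU :: "pfun set" where
  "SU = {\<phi> \<in> schwartz. \<forall>x. \<phi> (x, 0) = 0 \<and>
     ((\<lambda>y. \<phi> (x, y)) has_real_derivative 0) (at 0)}"


section \<open>The quotient space and its dual\<close>

text \<open>A measure on the punctured line is a Borel measure on the line that does not charge the origin.\<close>

definition levy_measure :: "real measure \<Rightarrow> bool" where
  "levy_measure \<nu> \<longleftrightarrow> sets \<nu> = sets borel \<and> emeasure \<nu> {0} = 0 \<and>
     (\<integral>\<^sup>+x. ennreal (min 1 (x\<^sup>2)) \<partial>\<nu>) < \<infinity>"

definition pi_measure :: "real measure \<Rightarrow> (real \<times> real) measure" where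
  "pi_measure \<nu> = lborel \<Otimes>\<^sub>M \<nu>"

definition Npi :: "real measure \<Rightarrow> pfun set" where
  "Npi \<nu> = {\<phi> \<in> SU. (\<integral>\<^sup>+z. ennreal ((\<phi> z)\<^sup>2) \<partial>pi_measure \<nu>) = 0}"

definition qnorm :: "real measure \<Rightarrow> nat \<Rightarrow> pfun \<Rightarrow> real" where
  "qnorm \<nu> p \<phi> = (INF \<psi>\<in>Npi \<nu>. hnorm p (\<phi> + \<psi>))"

definition polar :: "(('a \<Rightarrow> real) \<Rightarrow> real) \<Rightarrow> ('a \<Rightarrow> real) \<Rightarrow> ('a \<Rightarrow> real) \<Rightarrow> real" where
  "polar N x y = ((N (x + y))\<^sup>2 - (N (x - y))\<^sup>2) / 4"

text \<open>
  The quotient of \<^const>\<open>SU\<close> by \<^const>\<open>Npi\<close> is not formed as a type. Its elements are represented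
  by elements of \<^const>\<open>SU\<close>, and a functional on the quotient is a functional on \<^const>\<open>SU\<close>;
  a bound by \<^const>\<open>qnorm\<close> forces it to vanish on \<^const>\<open>Npi\<close>. Functionals take the value \<open>0\<close>
  outside their domain, so that equality in HOL is equality of functionals.
  As \<^const>\<open>SU\<close> is dense in the completion for \<^const>\<open>qnorm\<close>, \<open>Sdual \<nu> p\<close> is the dual of
  that completion.
\<close>

type_synonym functional = "pfun \<Rightarrow> real"

definition Sdual :: "real measure \<Rightarrow> nat \<Rightarrow> functional set" where
  "Sdual \<nu> p = {\<omega>. (\<forall>\<phi>. \<phi> \<notin> SU \<longrightarrow> \<omega> \<phi> = 0) \<and>
     (\<forall>\<phi>\<in>SU. \<forall>\<psi>\<in>SU. \<forall>a b. \<omega> (\<lambda>z. a * \<phi> z + b * \<psi> z) = a * \<omega> \<phi> + b * \<omega> \<psi>) \<and>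
     (\<exists>K. \<forall>\<phi>\<in>SU. \<bar>\<omega> \<phi>\<bar> \<le> K * qnorm \<nu> p \<phi>)}"

definition Sdual_norm :: "real measure \<Rightarrow> nat \<Rightarrow> functional \<Rightarrow> real" where
  "Sdual_norm \<nu> p \<omega> = Sup {\<bar>\<omega> \<phi>\<bar> | \<phi>. \<phi> \<in> SU \<and> qnorm \<nu> p \<phi> \<le> 1}"

text \<open>The norms increase with \<open>p\<close>, so a linear functional is continuous for the topology they
  generate together iff it is bounded for one of them.\<close>

definition Omega :: "real measure \<Rightarrow> functional set" where
  "Omega \<nu> = (\<Union>p. Sdual \<nu> p)"

definition one_nudot :: "real measure \<Rightarrow> functional" where
  "one_nudot \<nu> \<phi> = (if \<phi> \<in> SU then LINT z|pi_measure \<nu>. \<phi> z else 0)"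

definition HS_embedding :: "real measure \<Rightarrow> nat \<Rightarrow> nat \<Rightarrow> bool" where
  "HS_embedding \<nu> p0 q0 \<longleftrightarrow> Sdual \<nu> p0 \<subseteq> Sdual \<nu> q0 \<and>
     (\<exists>E \<subseteq> Sdual \<nu> p0.
        (\<forall>e\<in>E. \<forall>e'\<in>E. polar (Sdual_norm \<nu> p0) e e' = (if e = e' then 1 else 0)) \<and>
        (\<forall>\<omega>\<in>Sdual \<nu> p0. (\<forall>e\<in>E. polar (Sdual_norm \<nu> p0) \<omega> e = 0) \<longrightarrow> \<omega> = 0) \<and>
        (\<lambda>e. (Sdual_norm \<nu> q0 e)\<^sup>2) summable_on E)"

definition white_noise_measure :: "real measure \<Rightarrow> functional measure \<Rightarrow> bool" where
  "white_noise_measure \<nu> \<mu> \<longleftrightarrow> prob_space \<mu> \<and> space \<mu> = Omega \<nu> \<and>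
     sets \<mu> = sigma_sets (Omega \<nu>)
       {{\<omega> \<in> Omega \<nu>. \<omega> \<phi> \<in> B} | \<phi> B. \<phi> \<in> SU \<and> B \<in> sets borel} \<and>
     (\<forall>\<phi>\<in>SU. (LINT \<omega>|\<mu>. exp (\<i> * complex_of_real (\<omega> \<phi>))) =
        exp (LINT z|pi_measure \<nu>. (exp (\<i> * complex_of_real (\<phi> z)) - 1)))"


section \<open>Symmetric tensor powers\<close>

text \<open>
  A list of pairs \<open>(c, [\<phi>\<^sub>1, \<dots>, \<phi>\<^sub>n])\<close> stands for the sum of the terms
  \<open>c \<cdot> \<phi>\<^sub>1 \<otimes>\<^sub>s \<dots> \<otimes>\<^sub>s \<phi>\<^sub>n\<close> in the algebraic symmetric tensor power, where
  \<open>\<phi>\<^sub>1 \<otimes>\<^sub>s \<dots> \<otimes>\<^sub>s \<phi>\<^sub>n = (1/n!) \<Sum>\<^sub>\<sigma> \<phi>\<^bsub>\<sigma>(1)\<^esub> \<otimes> \<dots> \<otimes> \<phi>\<^bsub>\<sigma>(n)\<^esub>\<close>.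
  The inner product is that of the Hilbert space tensor power, so
  \<open>\<phi>\<^sup>\<otimes>\<^sup>n\<close> has norm \<open>\<parallel>\<phi>\<parallel>\<^sup>n\<close>.
\<close>

type_synonym tensor = "(real \<times> pfun list) list"

definition tensors :: "nat \<Rightarrow> tensor set" where
  "tensors n = {t. \<forall>(c, \<phi>s) \<in> set t. length \<phi>s = n \<and> set \<phi>s \<subseteq> SU}"

definition sym_inner :: "real measure \<Rightarrow> nat \<Rightarrow> pfun list \<Rightarrow> pfun list \<Rightarrow> real" where
  "sym_inner \<nu> p \<phi>s \<psi>s =
     (\<Sum>\<sigma> | \<sigma> permutes {..<length \<phi>s}.
        \<Prod>k<length \<phi>s. polar (qnorm \<nu> p) (\<phi>s ! k) (\<psi>s ! \<sigma> k)) / fact (length \<phi>s)"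

definition tensor_norm :: "real measure \<Rightarrow> nat \<Rightarrow> tensor \<Rightarrow> real" where
  "tensor_norm \<nu> p t =
     sqrt (\<Sum>(c, \<phi>s)\<leftarrow>t. \<Sum>(d, \<psi>s)\<leftarrow>t. c * d * sym_inner \<nu> p \<phi>s \<psi>s)"

definition tensor_diff :: "tensor \<Rightarrow> tensor \<Rightarrow> tensor" where
  "tensor_diff t s = t @ map (\<lambda>(c, \<phi>s). (- c, \<phi>s)) s"

text \<open>A linear functional on the \<open>n\<close>-th symmetric tensor power is a symmetric \<open>n\<close>-linear form,
  here a function on lists of length \<open>n\<close>.\<close>

definition sym_form :: "nat \<Rightarrow> (pfun list \<Rightarrow> real) set" where
  "sym_form n = {F.
     (\<forall>\<phi>s. \<not> (length \<phi>s = n \<and> set \<phi>s \<subseteq> SU) \<longrightarrow> F \<phi>s = 0) \<and>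
     (\<forall>\<phi>s \<psi>s. mset \<phi>s = mset \<psi>s \<longrightarrow> F \<phi>s = F \<psi>s) \<and>
     (\<forall>\<phi>s \<phi> \<psi> a b. Suc (length \<phi>s) = n \<longrightarrow> set \<phi>s \<subseteq> SU \<longrightarrow> \<phi> \<in> SU \<longrightarrow> \<psi> \<in> SU \<longrightarrow>
        F ((\<lambda>z. a * \<phi> z + b * \<psi> z) # \<phi>s) = a * F (\<phi> # \<phi>s) + b * F (\<psi> # \<phi>s))}"

definition tensor_pair :: "(pfun list \<Rightarrow> real) \<Rightarrow> tensor \<Rightarrow> real" where
  "tensor_pair F t = (\<Sum>(c, \<phi>s)\<leftarrow>t. c * F \<phi>s)"

definition tdual :: "real measure \<Rightarrow> nat \<Rightarrow> nat \<Rightarrow> (pfun list \<Rightarrow> real) set" where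
  "tdual \<nu> p n = {F \<in> sym_form n.
     \<exists>K. \<forall>t\<in>tensors n. \<bar>tensor_pair F t\<bar> \<le> K * tensor_norm \<nu> p t}"

definition tdual_norm :: "real measure \<Rightarrow> nat \<Rightarrow> nat \<Rightarrow> (pfun list \<Rightarrow> real) \<Rightarrow> real" where
  "tdual_norm \<nu> p n F = Sup {\<bar>tensor_pair F t\<bar> | t. t \<in> tensors n \<and> tensor_norm \<nu> p t \<le> 1}"


section \<open>Stochastic distributions and test functions\<close>

text \<open>The formal series \<open>\<Sum>\<^sub>n \<langle>C\<^sub>n, F\<^sub>n\<rangle>\<close> in the generalized Charlier polynomials is
  represented by its sequence of coefficients \<open>F n\<close>; addition and subtraction are pointwise.\<close>

type_synonym sdist = "nat \<Rightarrow> pfun list \<Rightarrow> real"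

definition Sminus :: "real measure \<Rightarrow> nat \<Rightarrow> sdist set" where
  "Sminus \<nu> p = {F. (\<forall>n. F n \<in> tdual \<nu> p n) \<and> summable (\<lambda>n. (tdual_norm \<nu> p n (F n))\<^sup>2)}"

definition Snorm :: "real measure \<Rightarrow> nat \<Rightarrow> sdist \<Rightarrow> real" where
  "Snorm \<nu> p F = sqrt (\<Sum>n. (tdual_norm \<nu> p n (F n))\<^sup>2)"

definition Sdist :: "real measure \<Rightarrow> nat \<Rightarrow> sdist set" where
  "Sdist \<nu> q0 = (\<Union>p\<in>{q0..}. Sminus \<nu> p)"

text \<open>\<open>P\<close> stands for the continuous polynomial \<open>\<Sum>\<^sub>n \<langle>C\<^sub>n, P n\<rangle>\<close>.\<close>

type_synonym spoly = "nat \<Rightarrow> tensor"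

definition spolys :: "spoly set" where
  "spolys = {P. finite {n. P n \<noteq> []} \<and> (\<forall>n. P n \<in> tensors n)}"

definition spoly_norm :: "real measure \<Rightarrow> nat \<Rightarrow> spoly \<Rightarrow> real" where
  "spoly_norm \<nu> p P = sqrt (\<Sum>n | P n \<noteq> []. (fact n)\<^sup>2 * (tensor_norm \<nu> p (P n))\<^sup>2)"

definition spoly_pair :: "sdist \<Rightarrow> spoly \<Rightarrow> real" where
  "spoly_pair F P = (\<Sum>n | P n \<noteq> []. fact n * tensor_pair (F n) (P n))"

text \<open>
  The projective limit over \<open>p \<ge> q0\<close> of the completions of the polynomials is their completion for
  all the norms together. A test function is given by a sequence of polynomials that is Cauchy
  in each norm; the pairing extends by continuity.
\<close>

definition test_funs :: "real measure \<Rightarrow> nat \<Rightarrow> (nat \<Rightarrow> spoly) set" where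
  "test_funs \<nu> q0 = {f. (\<forall>k. f k \<in> spolys) \<and>
     (\<forall>p\<ge>q0. \<forall>\<epsilon>>0. \<exists>N. \<forall>j\<ge>N. \<forall>k\<ge>N.
        spoly_norm \<nu> p (\<lambda>n. tensor_diff (f j n) (f k n)) < \<epsilon>)}"

definition test_pair :: "sdist \<Rightarrow> (nat \<Rightarrow> spoly) \<Rightarrow> real" where
  "test_pair F f = lim (\<lambda>k. spoly_pair F (f k))"


section \<open>S-transform and Wick product\<close>

definition S_transform :: "sdist \<Rightarrow> pfun \<Rightarrow> real" where
  "S_transform F \<xi> = (\<Sum>n. F n (replicate n \<xi>))"

text \<open>\<open>P\<close> holds on a neighbourhood of the origin in the space of test functions on the plane.\<close>

definition near_zero :: "real measure \<Rightarrow> nat \<Rightarrow> (pfun \<Rightarrow> bool) \<Rightarrow> bool" where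
  "near_zero \<nu> q0 P \<longleftrightarrow> (\<exists>r\<ge>q0. \<exists>\<epsilon>>0. \<forall>\<xi>\<in>SU. qnorm \<nu> r \<xi> < \<epsilon> \<longrightarrow> P \<xi>)"

definition wick :: "real measure \<Rightarrow> nat \<Rightarrow> sdist \<Rightarrow> sdist \<Rightarrow> sdist" where
  "wick \<nu> q0 F G = (THE H. H \<in> Sdist \<nu> q0 \<and>
     near_zero \<nu> q0 (\<lambda>\<xi>. S_transform H \<xi> = S_transform F \<xi> * S_transform G \<xi>))"


section \<open>Fractional Levy process and noise\<close>

definition frac_int :: "real \<Rightarrow> (real \<Rightarrow> real) \<Rightarrow> real \<Rightarrow> real" where
  "frac_int \<beta> f t = (LINT s:{t<..}|lborel. (s - t) powr (\<beta> - 1) * f s) / Gamma \<beta>"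

definition chi :: "real \<Rightarrow> real \<Rightarrow> real" where
  "chi t s = (if 0 < s \<and> s < t then 1 else if t < s \<and> s < 0 then -1 else 0)"

definition K_op :: "real \<Rightarrow> (real \<Rightarrow> real) \<Rightarrow> pfun" where
  "K_op \<beta> f = (\<lambda>(s, x). x * frac_int \<beta> f s)"

text \<open>\<open>\<langle>C\<^sub>1, f\<rangle>\<close> for a function \<open>f\<close>, which acts by integration against \<open>\<pi>\<close>.\<close>

definition first_chaos :: "real measure \<Rightarrow> pfun \<Rightarrow> sdist" where
  "first_chaos \<nu> f n \<phi>s =
     (if n = 1 \<and> length \<phi>s = 1 \<and> set \<phi>s \<subseteq> SU
      then LINT z|pi_measure \<nu>. f z * (hd \<phi>s) z else 0)"

definition frac_levy :: "real measure \<Rightarrow> real \<Rightarrow> real \<Rightarrow> sdist" where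
  "frac_levy \<nu> \<beta> t = first_chaos \<nu> (K_op \<beta> (chi t))"

definition frac_levy_noise :: "real measure \<Rightarrow> nat \<Rightarrow> real \<Rightarrow> real \<Rightarrow> sdist" where
  "frac_levy_noise \<nu> q0 \<beta> t = (THE H. H \<in> Sdist \<nu> q0 \<and>
     near_zero \<nu> q0 (\<lambda>\<eta>. ((\<lambda>r. S_transform (frac_levy \<nu> \<beta> r) \<eta>)
        has_real_derivative S_transform H \<eta>) (at t)))"


section \<open>Integrals and the equation\<close>

definition sdist_has_integral :: "real measure \<Rightarrow> nat \<Rightarrow> (real \<Rightarrow> sdist) \<Rightarrow> sdist \<Rightarrow> bool" where
  "sdist_has_integral \<nu> q0 G I \<longleftrightarrow> (\<forall>s. G s \<in> Sdist \<nu> q0) \<and> I \<in> Sdist \<nu> q0 \<and>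
     (\<forall>f\<in>test_funs \<nu> q0. integrable lborel (\<lambda>s. test_pair (G s) f) \<and>
        test_pair I f = (LINT s|lborel. test_pair (G s) f))"

definition sdist_has_integral_to ::
  "real measure \<Rightarrow> nat \<Rightarrow> (real \<Rightarrow> sdist) \<Rightarrow> real \<Rightarrow> sdist \<Rightarrow> bool" where
  "sdist_has_integral_to \<nu> q0 G t I \<longleftrightarrow>
     sdist_has_integral \<nu> q0 (\<lambda>s. if s \<in> {0..t} then G s else 0) I"

definition continuous_solution ::
  "real measure \<Rightarrow> nat \<Rightarrow> real \<Rightarrow> nat \<Rightarrow> (sdist \<Rightarrow> sdist) \<Rightarrow> (sdist \<Rightarrow> sdist) \<Rightarrow> sdist \<Rightarrow>
     (real \<Rightarrow> sdist) \<Rightarrow> bool" where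
  "continuous_solution \<nu> q0 \<beta> p b \<sigma> U0 U \<longleftrightarrow>
     (\<forall>t\<ge>0. U t \<in> Sminus \<nu> p) \<and>
     (\<forall>t\<ge>0. ((\<lambda>s. Snorm \<nu> p (U s - U t)) \<longlongrightarrow> 0) (at t within {0..})) \<and>
     (\<forall>t\<ge>0. \<exists>I J.
        sdist_has_integral_to \<nu> q0 (\<lambda>s. b (U s)) t I \<and>
        sdist_has_integral_to \<nu> q0
          (\<lambda>s. wick \<nu> q0 (\<sigma> (U s)) (frac_levy_noise \<nu> q0 \<beta> s)) t J \<and>
        U t = U0 + I + J)"

end

theory Submission
  imports Defs
begin

text \<open>
  The noise \<open>\<langle>C\<^sub>1, \<lambda>\<^sub>t\<rangle>\<close> lies in the first chaos, and Wick multiplication by it maps \<open>F\<^sub>n\<close> to the symmetrised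
  tensor product of \<open>F\<^sub>n\<close> with \<open>\<lambda>\<^sub>t\<close>. Symmetrisation is a contraction, so this is a linear operator on the
  distributions of order \<open>-p\<close> whose norm is at most that of \<open>\<lambda>\<^sub>t\<close>; no loss of regularity occurs.
  That norm is bounded, and \<open>\<lambda>\<^sub>t\<close> is Lipschitz, uniformly in \<open>t\<close>: one expands a test function in
  Hermite functions, whose fractional integrals grow polynomially in the index (the kernel
  \<open>v\<^sup>\<beta>\<^sup>-\<^sup>1\<close> is square integrable at infinity precisely when \<open>\<beta> < 1/2\<close>), and controls the resulting
  sum by the norm of order \<open>p \<ge> 2\<close>. The right-hand side of the equation is therefore globally
  Lipschitz in the unknown and continuous in time, and the contraction principle in an
  exponentially weighted supremum norm applies.
\<close>

section \<open>Positive semidefinite kernels\<close>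

definition psd_on :: "'a set \<Rightarrow> ('a \<Rightarrow> 'a \<Rightarrow> real) \<Rightarrow> bool" where
  "psd_on X K \<longleftrightarrow> (\<forall>x\<in>X. \<forall>y\<in>X. K x y = K y x) \<and>
     (\<forall>I c. finite I \<longrightarrow> I \<subseteq> X \<longrightarrow> 0 \<le> (\<Sum>i\<in>I. \<Sum>j\<in>I. c i * c j * K i j))"

lemma psd_on_sym: "psd_on X K \<Longrightarrow> x \<in> X \<Longrightarrow> y \<in> X \<Longrightarrow> K x y = K y x"
  by (auto simp: psd_on_def)

lemma psd_on_subset: "psd_on X K \<Longrightarrow> Y \<subseteq> X \<Longrightarrow> psd_on Y K"
  unfolding psd_on_def by blast

lemma psd_on_sum:
  assumes "psd_on X K" "finite T" "f ` T \<subseteq> X"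
  shows "0 \<le> (\<Sum>s\<in>T. \<Sum>t\<in>T. c s * c t * K (f s) (f t))"
proof -
  define C where "C y = (\<Sum>s\<in>{s\<in>T. f s = y}. c s)" for y
  have gr: "(\<Sum>s\<in>T. c s * g (f s)) = (\<Sum>y\<in>f ` T. C y * g y)" for g
  proof -
    have "(\<Sum>s\<in>T. c s * g (f s)) = (\<Sum>y\<in>f ` T. \<Sum>s\<in>{s\<in>T. f s = y}. c s * g (f s))"
      by (rule sum.image_gen[OF assms(2)])
    also have "\<dots> = (\<Sum>y\<in>f ` T. C y * g y)"
      unfolding C_def by (intro sum.cong refl) (simp add: sum_distrib_right)
    finally show ?thesis .
  qed
  have "(\<Sum>s\<in>T. \<Sum>t\<in>T. c s * c t * K (f s) (f t)) = (\<Sum>s\<in>T. c s * (\<Sum>t\<in>T. c t * K (f s) (f t)))"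
    by (simp add: sum_distrib_left mult.assoc)
  also have "\<dots> = (\<Sum>x\<in>f ` T. C x * (\<Sum>y\<in>f ` T. C y * K x y))"
    by (simp add: gr[where g="\<lambda>y. K _ y"] gr[where g="\<lambda>x. \<Sum>y\<in>f ` T. C y * K x y"])
  also have "\<dots> = (\<Sum>x\<in>f ` T. \<Sum>y\<in>f ` T. C x * C y * K x y)"
    by (simp add: sum_distrib_left mult.assoc)
  also have "\<dots> \<ge> 0" using assms by (simp add: psd_on_def)
  finally show ?thesis .
qed

lemma psd_on_compose:
  assumes "psd_on Y K" "f ` X \<subseteq> Y"
  shows "psd_on X (\<lambda>x y. K (f x) (f y))"
  unfolding psd_on_def
proof (intro conjI allI impI ballI)
  fix I c assume "finite I" "I \<subseteq> X"
  then show "0 \<le> (\<Sum>i\<in>I. \<Sum>j\<in>I. c i * c j * K (f i) (f j))"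
    using assms by (intro psd_on_sum) auto
qed (use assms(2) psd_on_sym[OF assms(1)] in \<open>simp add: image_subset_iff\<close>)

lemma psd_on_combination:
  assumes "psd_on X K" "finite S" "\<And>x s. x \<in> Y \<Longrightarrow> s \<in> S \<Longrightarrow> f x s \<in> X"
  shows "psd_on Y (\<lambda>x y. \<Sum>s\<in>S. \<Sum>t\<in>S. a s * a t * K (f x s) (f y t))"
  unfolding psd_on_def
proof (intro conjI allI impI ballI)
  fix x y assume "x \<in> Y" "y \<in> Y"
  have "(\<Sum>s\<in>S. \<Sum>t\<in>S. a s * a t * K (f x s) (f y t)) = (\<Sum>s\<in>S. \<Sum>t\<in>S. a t * a s * K (f y t) (f x s))"
    using \<open>x \<in> Y\<close> \<open>y \<in> Y\<close> assms psd_on_sym[OF assms(1)] by (intro sum.cong refl) auto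
  then show "(\<Sum>s\<in>S. \<Sum>t\<in>S. a s * a t * K (f x s) (f y t)) = (\<Sum>s\<in>S. \<Sum>t\<in>S. a s * a t * K (f y s) (f x t))"
    by (subst sum.swap) simp
next
  fix I c assume I: "finite I" "I \<subseteq> Y"
  have "0 \<le> (\<Sum>p\<in>I \<times> S. \<Sum>q\<in>I \<times> S. (c (fst p) * a (snd p)) * (c (fst q) * a (snd q)) *
      K (f (fst p) (snd p)) (f (fst q) (snd q)))"
    using I assms by (intro psd_on_sum[where f="\<lambda>p. f (fst p) (snd p)"]) auto
  also have "\<dots> = (\<Sum>i\<in>I. \<Sum>s\<in>S. \<Sum>j\<in>I. \<Sum>t\<in>S. (c i * a s) * (c j * a t) * K (f i s) (f j t))"
    by (simp add: sum.cartesian_product' sum.cartesian_product[symmetric] split_beta)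
  also have "\<dots> = (\<Sum>i\<in>I. \<Sum>j\<in>I. \<Sum>s\<in>S. \<Sum>t\<in>S. (c i * a s) * (c j * a t) * K (f i s) (f j t))"
    by (intro sum.cong refl sum.swap)
  also have "\<dots> = (\<Sum>i\<in>I. \<Sum>j\<in>I. c i * c j * (\<Sum>s\<in>S. \<Sum>t\<in>S. a s * a t * K (f i s) (f j t)))"
    by (simp add: sum_distrib_left mult_ac)
  finally show "0 \<le> \<dots>" .
qed

lemma psd_on_add: "psd_on X K \<Longrightarrow> psd_on X L \<Longrightarrow> psd_on X (\<lambda>x y. K x y + L x y)"
  unfolding psd_on_def by (auto simp: distrib_left sum.distrib intro!: add_nonneg_nonneg)

lemma psd_on_cong:
  "psd_on X K \<Longrightarrow> (\<And>x y. x \<in> X \<Longrightarrow> y \<in> X \<Longrightarrow> K x y = L x y) \<Longrightarrow> psd_on X L"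
  unfolding psd_on_def
proof (intro conjI allI impI ballI, goal_cases)
  case (2 I c)
  then have "(\<Sum>i\<in>I. \<Sum>j\<in>I. c i * c j * L i j) = (\<Sum>i\<in>I. \<Sum>j\<in>I. c i * c j * K i j)"
    by (intro sum.cong refl) (metis subset_iff)
  with 2 show ?case by simp
qed metis

lemma psd_on_factor:
  fixes K :: "'a \<Rightarrow> 'a \<Rightarrow> real"
  assumes "finite I" "psd_on I K"
  shows "\<exists>V :: ('a \<Rightarrow> real) list. \<forall>i\<in>I. \<forall>j\<in>I. K i j = (\<Sum>v\<leftarrow>V. v i * v j)"
  using assms
proof (induction I arbitrary: K rule: finite_induct)
  case empty
  then show ?case by simp
next
  case (insert a J K)
  note sym = psd_on_sym[OF insert.prems]
  have q: "0 \<le> (\<Sum>i\<in>S. \<Sum>j\<in>S. c i * c j * K i j)" if "finite S" "S \<subseteq> insert a J" for S c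
    using insert.prems that unfolding psd_on_def by blast
  have aa: "0 \<le> K a a" using q[of "{a}" "\<lambda>_. 1"] by simp
  have upd: "(\<Sum>v\<leftarrow>map (\<lambda>v. v(a := 0)) V. v i * v j) =
      (if i = a \<or> j = a then 0 else (\<Sum>v\<leftarrow>V. v i * v j))" for V :: "('a \<Rightarrow> real) list" and i j
    by (induction V) auto
  show ?case
  proof (cases "K a a = 0")
    case True
    have z: "K a j = 0" if "j \<in> J" for j
    proof (rule ccontr)
      assume nz: "K a j \<noteq> 0"
      have "a \<noteq> j" using that insert.hyps by auto
      define s where "s = - (K j j + 1) / (2 * K a j)"
      have "0 \<le> (\<Sum>i\<in>{a,j}. \<Sum>l\<in>{a,j}. (if i = a then s else 1) * (if l = a then s else 1) * K i l)"
        using that by (intro q) auto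
      also have "\<dots> = 2 * s * K a j + K j j"
        using \<open>a \<noteq> j\<close> True sym[of a j] that by simp
      also have "\<dots> = -1" unfolding s_def using nz by (simp add: field_simps)
      finally show False by simp
    qed
    have "psd_on J K" using insert.prems psd_on_subset by blast
    then obtain V :: "('a \<Rightarrow> real) list" where V: "\<forall>i\<in>J. \<forall>j\<in>J. K i j = (\<Sum>v\<leftarrow>V. v i * v j)"
      using insert.IH by blast
    show ?thesis
      using V z True sym insert.hyps
      by (intro exI[of _ "map (\<lambda>v. v(a := 0)) V"]) (auto simp: upd simp del: map_map list.map_comp)
  next
    case False
    then have pos: "0 < K a a" using aa by simp
    define L where "L i j = K i j - K i a * K a j / K a a" for i j
    have "psd_on J L" unfolding psd_on_def
    proof (intro conjI allI impI ballI)
      fix x y assume "x \<in> J" "y \<in> J"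
      then show "L x y = L y x" using sym[of x y] sym[of x a] sym[of y a] by (simp add: L_def)
    next
      fix S :: "'a set" and c :: "'a \<Rightarrow> real" assume S: "finite S" "S \<subseteq> J"
      have aS: "a \<notin> S" using S insert.hyps by auto
      define r where "r = (\<Sum>j\<in>S. c j * K a j)"
      define d where "d = c(a := - r / K a a)"
      have dS: "\<And>i. i \<in> S \<Longrightarrow> d i = c i" using aS by (auto simp: d_def)
      have da: "d a = - r / K a a" by (simp add: d_def)
      have r': "(\<Sum>i\<in>S. c i * K i a) = r"
        unfolding r_def using sym S by (intro sum.cong refl) auto
      have "0 \<le> (\<Sum>i\<in>insert a S. \<Sum>j\<in>insert a S. d i * d j * K i j)"
        using S by (intro q) auto
      also have "\<dots> = d a * d a * K a a + (\<Sum>j\<in>S. d a * c j * K a j) +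
          ((\<Sum>i\<in>S. c i * d a * K i a) + (\<Sum>i\<in>S. \<Sum>j\<in>S. c i * c j * K i j))"
        using S aS by (simp add: sum.distrib dS)
      also have "(\<Sum>j\<in>S. d a * c j * K a j) = d a * r"
        by (simp add: r_def sum_distrib_left mult_ac)
      also have "(\<Sum>i\<in>S. c i * d a * K i a) = d a * r"
        by (simp add: r'[symmetric] sum_distrib_left mult_ac)
      also have "d a * d a * K a a + d a * r + (d a * r + (\<Sum>i\<in>S. \<Sum>j\<in>S. c i * c j * K i j)) =
          (\<Sum>i\<in>S. \<Sum>j\<in>S. c i * c j * K i j) - r * r / K a a"
        using pos by (simp add: da field_simps)
      also have "r * r / K a a = (\<Sum>i\<in>S. \<Sum>j\<in>S. c i * c j * (K i a * K a j / K a a))"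
        by (subst (1) r'[symmetric], unfold r_def)
          (simp add: sum_product sum_divide_distrib mult_ac)
      also have "(\<Sum>i\<in>S. \<Sum>j\<in>S. c i * c j * K i j) - \<dots> = (\<Sum>i\<in>S. \<Sum>j\<in>S. c i * c j * L i j)"
        by (simp add: L_def right_diff_distrib sum_subtractf)
      finally show "0 \<le> (\<Sum>i\<in>S. \<Sum>j\<in>S. c i * c j * L i j)" .
    qed
    then obtain V :: "('a \<Rightarrow> real) list" where V: "\<forall>i\<in>J. \<forall>j\<in>J. L i j = (\<Sum>v\<leftarrow>V. v i * v j)"
      using insert.IH by blast
    define w where "w i = K i a / sqrt (K a a)" for i
    have ww: "w i * w j = K i a * K j a / K a a" for i j
      using pos by (simp add: w_def)
    have "K i j = (\<Sum>v\<leftarrow>w # map (\<lambda>v. v(a := 0)) V. v i * v j)" if "i \<in> insert a J" "j \<in> insert a J" for i j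
    proof (cases "i = a \<or> j = a")
      case True
      then show ?thesis
        using that sym[of i j] pos by (auto simp: upd ww simp del: map_map)
    next
      case False
      then have "L i j = (\<Sum>v\<leftarrow>V. v i * v j)" using V that by auto
      then show ?thesis using False that sym[of a j]
        by (auto simp: upd ww L_def simp del: map_map)
    qed
    then show ?thesis by blast
  qed
qed

lemma psd_on_mult:
  assumes "psd_on X K" "psd_on X L"
  shows "psd_on X (\<lambda>x y. K x y * L x y)"
  unfolding psd_on_def
proof (intro conjI allI impI ballI)
  fix I :: "'a set" and c :: "'a \<Rightarrow> real" assume I: "finite I" "I \<subseteq> X"
  then have "psd_on I K" using assms(1) psd_on_subset by blast
  then obtain V :: "('a \<Rightarrow> real) list" where V: "\<forall>i\<in>I. \<forall>j\<in>I. K i j = (\<Sum>v\<leftarrow>V. v i * v j)"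
    using psd_on_factor I by blast
  have *: "(\<Sum>i\<in>I. \<Sum>j\<in>I. c i * c j * ((\<Sum>v\<leftarrow>W. v i * v j) * L i j)) =
     (\<Sum>v\<leftarrow>W. \<Sum>i\<in>I. \<Sum>j\<in>I. (c i * v i) * (c j * v j) * L i j)" for W :: "('a \<Rightarrow> real) list"
    by (induction W) (simp_all add: distrib_left distrib_right sum.distrib mult_ac)
  have "(\<Sum>i\<in>I. \<Sum>j\<in>I. c i * c j * (K i j * L i j)) =
      (\<Sum>v\<leftarrow>V. \<Sum>i\<in>I. \<Sum>j\<in>I. (c i * v i) * (c j * v j) * L i j)"
    using V by (simp add: *[symmetric])
  also have "\<dots> \<ge> 0"
    using assms(2) I unfolding psd_on_def by (intro sum_list_nonneg) auto
  finally show "0 \<le> (\<Sum>i\<in>I. \<Sum>j\<in>I. c i * c j * (K i j * L i j))" .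
qed (simp add: psd_on_sym[OF assms(1)] psd_on_sym[OF assms(2)])

lemma psd_on_rank_one: "psd_on X (\<lambda>x y. l x * l y)"
  unfolding psd_on_def
proof (intro conjI allI impI ballI)
  fix I :: "'a set" and c :: "'a \<Rightarrow> real"
  have "(\<Sum>i\<in>I. \<Sum>j\<in>I. c i * c j * (l i * l j)) = (\<Sum>i\<in>I. c i * l i) * (\<Sum>i\<in>I. c i * l i)"
    by (simp add: sum_product mult_ac)
  then show "0 \<le> (\<Sum>i\<in>I. \<Sum>j\<in>I. c i * c j * (l i * l j))" by simp
qed (simp add: mult.commute)

lemma psd_on_prod:
  assumes "\<And>i. i < n \<Longrightarrow> psd_on X (K i)"
  shows "psd_on X (\<lambda>x y. \<Prod>i<(n::nat). K i x y)"
  using assms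
proof (induction n)
  case 0
  show ?case using psd_on_rank_one[of X "\<lambda>_. 1"] by simp
next
  case (Suc n)
  then have "psd_on X (\<lambda>x y. (\<Prod>i<n. K i x y) * K n x y)"
    by (intro psd_on_mult) auto
  then show ?case by simp
qed

section \<open>Norms with the parallelogram law\<close>

locale quadratic_norm =
  fixes V :: "('a \<Rightarrow> real) set" and N :: "('a \<Rightarrow> real) \<Rightarrow> real"
  assumes zero_mem: "(\<lambda>z. 0) \<in> V"
    and lin_mem: "\<And>\<phi> \<psi> a b. \<phi> \<in> V \<Longrightarrow> \<psi> \<in> V \<Longrightarrow> (\<lambda>z. a * \<phi> z + b * \<psi> z) \<in> V"
    and nonneg: "\<And>\<phi>. \<phi> \<in> V \<Longrightarrow> 0 \<le> N \<phi>"
    and homog: "\<And>\<phi> a. \<phi> \<in> V \<Longrightarrow> N (\<lambda>z. a * \<phi> z) = \<bar>a\<bar> * N \<phi>"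
    and parallelogram: "\<And>\<phi> \<psi>. \<phi> \<in> V \<Longrightarrow> \<psi> \<in> V \<Longrightarrow>
      (N (\<phi> + \<psi>))\<^sup>2 + (N (\<phi> - \<psi>))\<^sup>2 = 2 * (N \<phi>)\<^sup>2 + 2 * (N \<psi>)\<^sup>2"

lemma additive_bounded_imp_linear:
  fixes f :: "real \<Rightarrow> real"
  assumes add: "\<And>x y. f (x + y) = f x + f y" and bd: "\<And>x. \<bar>x\<bar> \<le> 1 \<Longrightarrow> \<bar>f x\<bar> \<le> B"
  shows "f a = a * f 1"
proof -
  have f0: "f 0 = 0" using add[of 0 0] by simp
  have fn: "f (real n * x) = real n * f x" for n x
    by (induction n) (simp_all add: f0 add distrib_right)
  have fm: "f (- x) = - f x" for x using add[of x "- x"] f0 by simp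
  have fi: "f (of_int i) = of_int i * f 1" for i
    by (cases i rule: int_cases2) (use fn[of _ 1] fm in simp_all)
  have "\<bar>f a - a * f 1\<bar> * real n \<le> B + \<bar>f 1\<bar>" for n
  proof -
    define r where "r = real n * a - of_int \<lfloor>real n * a\<rfloor>"
    have r: "0 \<le> r" "r \<le> 1" by (auto simp: r_def) linarith
    have "real n * f a = f (of_int \<lfloor>real n * a\<rfloor> + r)" by (simp add: r_def fn)
    also have "\<dots> = of_int \<lfloor>real n * a\<rfloor> * f 1 + f r" by (simp add: add fi)
    finally have "(f a - a * f 1) * real n = f r - r * f 1"
      by (simp add: r_def algebra_simps)
    then have "\<bar>f a - a * f 1\<bar> * real n = \<bar>f r - r * f 1\<bar>"
      by (metis abs_mult abs_of_nat)
    also have "\<dots> \<le> \<bar>f r\<bar> + r * \<bar>f 1\<bar>"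
      using r by (metis abs_mult abs_of_nonneg abs_triangle_ineq4)
    also have "\<dots> \<le> B + 1 * \<bar>f 1\<bar>"
      using r bd[of r] by (intro add_mono mult_right_mono) auto
    finally show ?thesis by simp
  qed
  then show ?thesis
    by (metis abs_eq_0 abs_ge_zero eq_iff_diff_eq_0 less_eq_real_def linorder_not_less mult.commute reals_Archimedean3)
qed

context quadratic_norm
begin

lemma add_mem: "\<phi> \<in> V \<Longrightarrow> \<psi> \<in> V \<Longrightarrow> \<phi> + \<psi> \<in> V"
  using lin_mem[of \<phi> \<psi> 1 1] by (simp add: plus_fun_def)

lemma diff_mem: "\<phi> \<in> V \<Longrightarrow> \<psi> \<in> V \<Longrightarrow> \<phi> - \<psi> \<in> V"
  using lin_mem[of \<phi> \<psi> 1 "-1"] by (simp add: fun_diff_def)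

lemma scale_mem: "\<phi> \<in> V \<Longrightarrow> (\<lambda>z. a * \<phi> z) \<in> V"
  using lin_mem[of \<phi> \<phi> a 0] by simp

lemma sum_mem: "finite I \<Longrightarrow> (\<And>i. i \<in> I \<Longrightarrow> f i \<in> V) \<Longrightarrow> (\<lambda>z. \<Sum>i\<in>I. c i * f i z) \<in> V"
proof (induction I rule: finite_induct)
  case (insert i I)
  then show ?case using lin_mem[of "f i" "\<lambda>z. \<Sum>i\<in>I. c i * f i z" "c i" 1] by simp
qed (simp add: zero_mem)

lemma norm_minus_commute: "\<phi> \<in> V \<Longrightarrow> \<psi> \<in> V \<Longrightarrow> N (\<phi> - \<psi>) = N (\<psi> - \<phi>)"
  using homog[of "\<phi> - \<psi>" "-1"] diff_mem[of \<phi> \<psi>] by (simp add: fun_diff_def algebra_simps)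

lemma norm_zero: "N (\<lambda>z. 0) = 0"
  using homog[OF zero_mem, of 0] by simp

lemma polar_commute: "\<phi> \<in> V \<Longrightarrow> \<psi> \<in> V \<Longrightarrow> polar N \<phi> \<psi> = polar N \<psi> \<phi>"
  unfolding polar_def by (simp add: norm_minus_commute[of \<phi> \<psi>] add.commute)

lemma polar_self: "\<phi> \<in> V \<Longrightarrow> polar N \<phi> \<phi> = (N \<phi>)\<^sup>2"
  using homog[of \<phi> 2] norm_zero
  unfolding polar_def plus_fun_def fun_diff_def by (simp add: power2_eq_square)

lemma polar_add_left:
  assumes [simp]: "\<phi> \<in> V" "\<psi> \<in> V" "\<theta> \<in> V"
  shows "polar N (\<phi> + \<psi>) \<theta> = polar N \<phi> \<theta> + polar N \<psi> \<theta>"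
proof -
  have arith: "(c - d) / 4 + (e - f) / 4 = 2 * ((a - b) / 4)"
    if "e + c = 2 * a + 2 * y" "f + d = 2 * b + 2 * y" for a b c d e f y :: real
    using that by (simp add: field_simps)
  have 1: "polar N (x + y) z + polar N (x - y) z = 2 * polar N x z"
    if [simp]: "x \<in> V" "y \<in> V" "z \<in> V" for x y z
    unfolding polar_def
  proof (rule arith)
    show "(N (x - y + z))\<^sup>2 + (N (x + y + z))\<^sup>2 = 2 * (N (x + z))\<^sup>2 + 2 * (N y)\<^sup>2"
      using parallelogram[of "x + z" y] add_mem[of x z] by (simp add: algebra_simps)
    show "(N (x - y - z))\<^sup>2 + (N (x + y - z))\<^sup>2 = 2 * (N (x - z))\<^sup>2 + 2 * (N y)\<^sup>2"
      using parallelogram[of "x - z" y] diff_mem[of x z] by (simp add: algebra_simps)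
  qed
  define x where "x = (\<lambda>z. 1/2 * \<phi> z + 1/2 * \<psi> z)"
  define y where "y = (\<lambda>z. 1/2 * \<phi> z - 1/2 * \<psi> z)"
  have xV: "x \<in> V" "y \<in> V"
    unfolding x_def y_def using lin_mem[of \<phi> \<psi> "1/2" "1/2"] lin_mem[of \<phi> \<psi> "1/2" "-1/2"] by simp_all
  have e: "x + y = \<phi>" "x - y = \<psi>" "x + x = \<phi> + \<psi>" "x - x = 0" by (auto simp: x_def y_def)
  have p0: "polar N 0 \<theta> = 0"
    using norm_minus_commute[of 0 \<theta>] zero_mem unfolding polar_def zero_fun_def[symmetric] by simp
  show ?thesis using 1[OF xV assms(3)] 1[OF xV(1) xV(1) assms(3)] by (simp add: e p0)
qed

lemma polar_scale_left:
  assumes [simp]: "\<phi> \<in> V" "\<theta> \<in> V"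
  shows "polar N (\<lambda>z. a * \<phi> z) \<theta> = a * polar N \<phi> \<theta>"
proof -
  have arith: "p \<le> E + D" if "C \<le> E" "p \<le> (A + B) / 4" "A + B = 2 * C + 2 * D" "0 \<le> E" "0 \<le> D"
    for p A B C D E :: real using that by (simp add: field_simps)
  have m: "(\<lambda>z. c * \<phi> z) \<in> V" for c by (simp add: scale_mem)
  have "polar N (\<lambda>z. a * \<phi> z) \<theta> = a * polar N (\<lambda>z. 1 * \<phi> z) \<theta>"
  proof (rule additive_bounded_imp_linear[where f="\<lambda>a. polar N (\<lambda>z. a * \<phi> z) \<theta>"])
    fix x y show "polar N (\<lambda>z. (x + y) * \<phi> z) \<theta> = polar N (\<lambda>z. x * \<phi> z) \<theta> + polar N (\<lambda>z. y * \<phi> z) \<theta>"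
      using polar_add_left[OF m[of x] m[of y], of \<theta>] by (simp add: plus_fun_def distrib_right)
  next
    fix x :: real assume "\<bar>x\<bar> \<le> 1"
    then have x: "x\<^sup>2 \<le> 1" by (simp add: abs_square_le_1)
    have "(N (\<lambda>z. x * \<phi> z))\<^sup>2 \<le> (N \<phi>)\<^sup>2"
      using mult_right_mono[OF x, of "(N \<phi>)\<^sup>2"] by (simp add: homog power_mult_distrib)
    moreover have "\<bar>polar N (\<lambda>z. x * \<phi> z) \<theta>\<bar> \<le>
        ((N ((\<lambda>z. x * \<phi> z) + \<theta>))\<^sup>2 + (N ((\<lambda>z. x * \<phi> z) - \<theta>))\<^sup>2) / 4"
      unfolding polar_def by (simp add: abs_le_iff field_simps)
    ultimately show "\<bar>polar N (\<lambda>z. x * \<phi> z) \<theta>\<bar> \<le> (N \<phi>)\<^sup>2 + (N \<theta>)\<^sup>2"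
      using parallelogram[OF m[of x] assms(2)] by (rule arith) simp_all
  qed
  then show ?thesis by simp
qed

lemma polar_lin_left:
  "\<phi> \<in> V \<Longrightarrow> \<psi> \<in> V \<Longrightarrow> \<theta> \<in> V \<Longrightarrow>
    polar N (\<lambda>z. a * \<phi> z + b * \<psi> z) \<theta> = a * polar N \<phi> \<theta> + b * polar N \<psi> \<theta>"
  using polar_add_left[OF scale_mem[of \<phi> a] scale_mem[of \<psi> b], of \<theta>]
  by (simp add: polar_scale_left plus_fun_def)

lemma polar_sum_left:
  assumes "finite I" "\<And>i. i \<in> I \<Longrightarrow> f i \<in> V" "\<theta> \<in> V"
  shows "polar N (\<lambda>z. \<Sum>i\<in>I. c i * f i z) \<theta> = (\<Sum>i\<in>I. c i * polar N (f i) \<theta>)"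
  using assms
proof (induction I rule: finite_induct)
  case empty
  then show ?case using polar_scale_left[OF zero_mem, of \<theta> 0] by simp
next
  case (insert i I)
  then show ?case
    using polar_lin_left[of "f i" "\<lambda>z. \<Sum>i\<in>I. c i * f i z" \<theta> "c i" 1] sum_mem[of I f c] by simp
qed

lemma polar_sum_sum:
  assumes "finite I" "\<And>i. i \<in> I \<Longrightarrow> f i \<in> V"
  shows "(\<Sum>i\<in>I. \<Sum>j\<in>I. c i * c j * polar N (f i) (f j)) = (N (\<lambda>z. \<Sum>i\<in>I. c i * f i z))\<^sup>2"
proof -
  let ?S = "\<lambda>z. \<Sum>i\<in>I. c i * f i z"
  have S: "?S \<in> V" using assms by (rule sum_mem)
  have "(N ?S)\<^sup>2 = (\<Sum>i\<in>I. c i * polar N (f i) ?S)"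
    using S assms by (simp add: polar_self[symmetric] polar_sum_left)
  also have "\<dots> = (\<Sum>i\<in>I. c i * (\<Sum>j\<in>I. c j * polar N (f j) (f i)))"
    using S assms by (intro sum.cong refl) (simp add: polar_commute[OF _ S] polar_sum_left)
  also have "\<dots> = (\<Sum>i\<in>I. \<Sum>j\<in>I. c i * c j * polar N (f i) (f j))"
    using assms by (auto simp: sum_distrib_left mult.assoc polar_commute intro!: sum.cong)
  finally show ?thesis by simp
qed

lemma psd_on_polar: "psd_on V (polar N)"
  unfolding psd_on_def
proof (intro conjI allI impI ballI)
  fix I :: "('a \<Rightarrow> real) set" and c :: "('a \<Rightarrow> real) \<Rightarrow> real" assume "finite I" "I \<subseteq> V"
  then show "0 \<le> (\<Sum>i\<in>I. \<Sum>j\<in>I. c i * c j * polar N i j)"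
    using polar_sum_sum[of I "\<lambda>i. i" c] by (simp add: subset_iff)
qed (rule polar_commute)

lemma psd_on_polar_minus_functional:
  assumes lin: "\<And>\<phi> \<psi> a b. \<phi> \<in> V \<Longrightarrow> \<psi> \<in> V \<Longrightarrow> l (\<lambda>z. a * \<phi> z + b * \<psi> z) = a * l \<phi> + b * l \<psi>"
    and bd: "\<And>\<phi>. \<phi> \<in> V \<Longrightarrow> \<bar>l \<phi>\<bar> \<le> L * N \<phi>"
  shows "psd_on V (\<lambda>\<phi> \<psi>. L\<^sup>2 * polar N \<phi> \<psi> - l \<phi> * l \<psi>)"
  unfolding psd_on_def
proof (intro conjI allI impI ballI)
  fix I :: "('a \<Rightarrow> real) set" and c :: "('a \<Rightarrow> real) \<Rightarrow> real" assume I: "finite I" "I \<subseteq> V"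
  let ?S = "\<lambda>z. \<Sum>i\<in>I. c i * i z"
  have lS: "l ?S = (\<Sum>i\<in>I. c i * l i)" using I
  proof (induction I rule: finite_induct)
    case empty
    then show ?case using lin[OF zero_mem zero_mem, of 0 0] by simp
  next
    case (insert i I)
    then show ?case
      using lin[of i "\<lambda>z. \<Sum>i\<in>I. c i * i z" "c i" 1] sum_mem[of I "\<lambda>i. i" c] by auto
  qed
  have S: "?S \<in> V" using I by (intro sum_mem) auto
  have "(\<Sum>i\<in>I. \<Sum>j\<in>I. c i * c j * (L\<^sup>2 * polar N i j - l i * l j)) =
      L\<^sup>2 * (\<Sum>i\<in>I. \<Sum>j\<in>I. c i * c j * polar N i j) - (\<Sum>i\<in>I. \<Sum>j\<in>I. (c i * l i) * (c j * l j))"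
    by (simp add: right_diff_distrib sum_subtractf sum_distrib_left mult_ac)
  also have "\<dots> = (L * N ?S)\<^sup>2 - (l ?S)\<^sup>2"
    using I polar_sum_sum[of I "\<lambda>i. i" c]
    by (auto simp: lS power_mult_distrib power2_eq_square sum_product)
  also have "\<dots> \<ge> 0"
    using abs_le_square_iff[of "l ?S" "L * N ?S"] bd[OF S] by auto
  finally show "0 \<le> (\<Sum>i\<in>I. \<Sum>j\<in>I. c i * c j * (L\<^sup>2 * polar N i j - l i * l j))" .
qed (simp add: polar_commute)

end

text \<open>The distance to a subspace obeys the parallelogram law: the inequality \<open>\<le>\<close> passes to the
  infimum, and it yields its own converse when applied to \<open>\<phi> + \<psi>\<close> and \<open>\<phi> - \<psi>\<close>.\<close>

lemma quadratic_norm_INF: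
  assumes V: "quadratic_norm V N" and WV: "W \<subseteq> V"
    and W0: "(\<lambda>z. 0) \<in> W"
    and Wlin: "\<And>\<phi> \<psi> a b. \<phi> \<in> W \<Longrightarrow> \<psi> \<in> W \<Longrightarrow> (\<lambda>z. a * \<phi> z + b * \<psi> z) \<in> W"
  shows "quadratic_norm V (\<lambda>\<phi>. INF \<psi>\<in>W. N (\<phi> + \<psi>))"
proof -
  interpret quadratic_norm V N by fact
  define q where "q \<phi> = (INF \<psi>\<in>W. N (\<phi> + \<psi>))" for \<phi>
  have V_add: "\<phi> + \<psi> \<in> V" if "\<phi> \<in> V" "\<psi> \<in> W" for \<phi> \<psi> using that WV add_mem by blast
  have W_add: "\<phi> + \<psi> \<in> W" "\<phi> - \<psi> \<in> W" if "\<phi> \<in> W" "\<psi> \<in> W" for \<phi> \<psi>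
    using Wlin[OF that, of 1 1] Wlin[OF that, of 1 "-1"] by (simp_all add: plus_fun_def fun_diff_def)
  have bdd: "bdd_below ((\<lambda>\<psi>. N (\<phi> + \<psi>)) ` W)" if "\<phi> \<in> V" for \<phi>
    using that V_add nonneg by (intro bdd_belowI[of _ 0]) auto
  have ne: "W \<noteq> {}" using W0 by auto
  have q_le: "q \<phi> \<le> N (\<phi> + \<psi>)" if "\<phi> \<in> V" "\<psi> \<in> W" for \<phi> \<psi>
    unfolding q_def by (rule cINF_lower[OF bdd]) (use that in auto)
  have q_nn: "0 \<le> q \<phi>" if "\<phi> \<in> V" for \<phi>
    unfolding q_def by (rule cINF_greatest[OF ne]) (use that V_add nonneg in auto)
  have q_ap: "\<exists>\<psi>\<in>W. N (\<phi> + \<psi>) < q \<phi> + e" if "\<phi> \<in> V" "e > 0" for \<phi> e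
    using cInf_lessD[of "(\<lambda>\<psi>. N (\<phi> + \<psi>)) ` W" "q \<phi> + e"] ne that unfolding q_def by auto
  have q_ap2: "\<exists>\<psi>\<in>W. (N (\<phi> + \<psi>))\<^sup>2 < (q \<phi>)\<^sup>2 + e" if "\<phi> \<in> V" "e > 0" for \<phi> e
  proof -
    have "sqrt ((q \<phi>)\<^sup>2 + e) - q \<phi> > 0"
      using that(2) q_nn[OF that(1)] by (simp add: real_less_rsqrt)
    from q_ap[OF that(1) this] obtain \<psi> where \<psi>: "\<psi> \<in> W" "N (\<phi> + \<psi>) < sqrt ((q \<phi>)\<^sup>2 + e)" by auto
    then have "(N (\<phi> + \<psi>))\<^sup>2 < (sqrt ((q \<phi>)\<^sup>2 + e))\<^sup>2"
      using nonneg[OF V_add[OF that(1) \<psi>(1)]] by (intro power_strict_mono) auto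
    with \<psi>(1) that(2) show ?thesis by (intro bexI[of _ \<psi>]) auto
  qed
  have q_sc: "q (\<lambda>z. a * \<phi> z) \<le> \<bar>a\<bar> * q \<phi>" if "\<phi> \<in> V" for a \<phi>
  proof (rule field_le_epsilon)
    fix e :: real assume "e > 0"
    define d where "d = e / (\<bar>a\<bar> + 1)"
    have "d > 0" using \<open>e > 0\<close> by (simp add: d_def add_nonneg_pos)
    then obtain \<psi> where \<psi>: "\<psi> \<in> W" "N (\<phi> + \<psi>) < q \<phi> + d" using q_ap[OF \<open>\<phi> \<in> V\<close>] by blast
    have "q (\<lambda>z. a * \<phi> z) \<le> N ((\<lambda>z. a * \<phi> z) + (\<lambda>z. a * \<psi> z))"
      using that \<psi> Wlin[of \<psi> \<psi> a 0] scale_mem by (intro q_le) auto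
    also have "(\<lambda>z. a * \<phi> z) + (\<lambda>z. a * \<psi> z) = (\<lambda>z. a * (\<phi> + \<psi>) z)"
      by (auto simp: distrib_left)
    also have "N \<dots> = \<bar>a\<bar> * N (\<phi> + \<psi>)" by (rule homog[OF V_add[OF that \<psi>(1)]])
    also have "\<dots> \<le> \<bar>a\<bar> * (q \<phi> + d)" using \<psi> by (intro mult_left_mono) auto
    also have "\<dots> \<le> \<bar>a\<bar> * q \<phi> + (\<bar>a\<bar> + 1) * d" using \<open>d > 0\<close> by (simp add: algebra_simps)
    also have "(\<bar>a\<bar> + 1) * d = e" by (simp add: d_def add_nonneg_eq_0_iff)
    finally show "q (\<lambda>z. a * \<phi> z) \<le> \<bar>a\<bar> * q \<phi> + e" .
  qed
  have q_hom: "q (\<lambda>z. a * \<phi> z) = \<bar>a\<bar> * q \<phi>" if "\<phi> \<in> V" for a \<phi>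
  proof (cases "a = 0")
    case True
    then show ?thesis using q_sc[OF that, of a] q_nn[OF scale_mem[OF that, of a]] by simp
  next
    case False
    have "q (\<lambda>z. (1/a) * (a * \<phi> z)) \<le> \<bar>1/a\<bar> * q (\<lambda>z. a * \<phi> z)"
      by (rule q_sc[OF scale_mem[OF that]])
    then have "\<bar>a\<bar> * q \<phi> \<le> q (\<lambda>z. a * \<phi> z)" using False by (simp add: field_simps)
    with q_sc[OF that, of a] show ?thesis by simp
  qed
  have q_par: "(q (\<phi> + \<psi>))\<^sup>2 + (q (\<phi> - \<psi>))\<^sup>2 \<le> 2 * (q \<phi>)\<^sup>2 + 2 * (q \<psi>)\<^sup>2"
    if "\<phi> \<in> V" "\<psi> \<in> V" for \<phi> \<psi>
  proof (rule field_le_epsilon)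
    fix e :: real assume "e > 0"
    then have "e / 4 > 0" by simp
    obtain a where a: "a \<in> W" "(N (\<phi> + a))\<^sup>2 < (q \<phi>)\<^sup>2 + e / 4" using q_ap2[OF \<open>\<phi> \<in> V\<close> \<open>e / 4 > 0\<close>] by blast
    obtain b where b: "b \<in> W" "(N (\<psi> + b))\<^sup>2 < (q \<psi>)\<^sup>2 + e / 4" using q_ap2[OF \<open>\<psi> \<in> V\<close> \<open>e / 4 > 0\<close>] by blast
    have "q (\<phi> + \<psi>) \<le> N ((\<phi> + \<psi>) + (a + b))" "q (\<phi> - \<psi>) \<le> N ((\<phi> - \<psi>) + (a - b))"
      using that a b by (auto intro!: q_le W_add add_mem diff_mem)
    then have "(q (\<phi> + \<psi>))\<^sup>2 + (q (\<phi> - \<psi>))\<^sup>2 \<le> (N ((\<phi> + \<psi>) + (a + b)))\<^sup>2 + (N ((\<phi> - \<psi>) + (a - b)))\<^sup>2"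
      using that by (intro add_mono power_mono) (auto intro!: q_nn add_mem diff_mem)
    also have "(\<phi> + \<psi>) + (a + b) = (\<phi> + a) + (\<psi> + b)" by (simp add: algebra_simps)
    also have "(\<phi> - \<psi>) + (a - b) = (\<phi> + a) - (\<psi> + b)" by (simp add: algebra_simps)
    also have "(N ((\<phi> + a) + (\<psi> + b)))\<^sup>2 + (N ((\<phi> + a) - (\<psi> + b)))\<^sup>2 =
        2 * (N (\<phi> + a))\<^sup>2 + 2 * (N (\<psi> + b))\<^sup>2"
      using V_add that a b by (intro parallelogram) auto
    also have "\<dots> \<le> 2 * (q \<phi>)\<^sup>2 + 2 * (q \<psi>)\<^sup>2 + e" using a(2) b(2) by linarith
    finally show "(q (\<phi> + \<psi>))\<^sup>2 + (q (\<phi> - \<psi>))\<^sup>2 \<le> 2 * (q \<phi>)\<^sup>2 + 2 * (q \<psi>)\<^sup>2 + e" .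
  qed
  have "quadratic_norm V q"
  proof
    fix \<phi> \<psi> assume [simp]: "\<phi> \<in> V" "\<psi> \<in> V"
    have "(q ((\<phi> + \<psi>) + (\<phi> - \<psi>)))\<^sup>2 + (q ((\<phi> + \<psi>) - (\<phi> - \<psi>)))\<^sup>2 \<le> 2 * (q (\<phi> + \<psi>))\<^sup>2 + 2 * (q (\<phi> - \<psi>))\<^sup>2"
      by (rule q_par) (auto intro: add_mem diff_mem)
    also have "(\<phi> + \<psi>) + (\<phi> - \<psi>) = (\<lambda>z. 2 * \<phi> z)" by auto
    also have "(\<phi> + \<psi>) - (\<phi> - \<psi>) = (\<lambda>z. 2 * \<psi> z)" by auto
    finally show "(q (\<phi> + \<psi>))\<^sup>2 + (q (\<phi> - \<psi>))\<^sup>2 = 2 * (q \<phi>)\<^sup>2 + 2 * (q \<psi>)\<^sup>2"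
      using q_par[of \<phi> \<psi>] by (simp add: q_hom power_mult_distrib plus_fun_def fun_diff_def)
  qed (auto simp: zero_mem lin_mem q_nn q_hom)
  then show ?thesis by (simp add: q_def[abs_def])
qed

section \<open>Kernels on symmetric tensors\<close>

definition lists_of :: "'a set \<Rightarrow> nat \<Rightarrow> 'a list set" where
  "lists_of V n = {xs. length xs = n \<and> set xs \<subseteq> V}"

definition prod_kernel :: "('a \<Rightarrow> 'a \<Rightarrow> real) \<Rightarrow> 'a list \<Rightarrow> 'a list \<Rightarrow> real" where
  "prod_kernel k xs ys = (\<Prod>i<length xs. k (xs ! i) (ys ! i))"

definition sym_kernel :: "('a \<Rightarrow> 'a \<Rightarrow> real) \<Rightarrow> 'a list \<Rightarrow> 'a list \<Rightarrow> real" where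
  "sym_kernel k xs ys = (\<Sum>\<sigma> | \<sigma> permutes {..<length xs}. prod_kernel k xs (map (\<lambda>i. ys ! \<sigma> i) [0..<length xs])) / fact (length xs)"

lemma lists_ofD: "xs \<in> lists_of V n \<Longrightarrow> length xs = n" "xs \<in> lists_of V n \<Longrightarrow> i < n \<Longrightarrow> xs ! i \<in> V"
  by (auto simp: lists_of_def)

lemma permute_list_lists_of: "\<sigma> permutes {..<n} \<Longrightarrow> xs \<in> lists_of V n \<Longrightarrow> permute_list \<sigma> xs \<in> lists_of V n"
  by (auto simp: lists_of_def)

lemma sym_kernel_right:
  "length ys = length xs \<Longrightarrow>
    sym_kernel k xs ys = (\<Sum>\<sigma> | \<sigma> permutes {..<length xs}. prod_kernel k xs (permute_list \<sigma> ys)) / fact (length xs)"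
  unfolding sym_kernel_def permute_list_def by simp

lemma sym_kernel_left:
  assumes "length ys = length xs"
  shows "sym_kernel k xs ys = (\<Sum>\<sigma> | \<sigma> permutes {..<length xs}. prod_kernel k (permute_list \<sigma> xs) ys) / fact (length xs)"
proof -
  have "prod_kernel k (permute_list \<sigma> xs) ys = prod_kernel k xs (permute_list (inv \<sigma>) ys)"
    if \<sigma>: "\<sigma> permutes {..<length xs}" for \<sigma>
  proof -
    have "prod_kernel k (permute_list \<sigma> xs) ys = (\<Prod>i<length xs. k (xs ! \<sigma> i) (ys ! inv \<sigma> (\<sigma> i)))"
      unfolding prod_kernel_def length_permute_list
      by (intro prod.cong refl) (simp add: permute_list_nth[OF \<sigma>] permutes_inverses[OF \<sigma>])
    also have "\<dots> = (\<Prod>i<length xs. k (xs ! i) (ys ! inv \<sigma> i))"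
      using prod.permute[OF \<sigma>, of "\<lambda>i. k (xs ! i) (ys ! inv \<sigma> i)"] by (simp add: o_def)
    also have "\<dots> = prod_kernel k xs (permute_list (inv \<sigma>) ys)"
      unfolding prod_kernel_def using permute_list_nth[of "inv \<sigma>" ys] permutes_inv[OF \<sigma>] assms
      by (intro prod.cong refl) simp
    finally show ?thesis .
  qed
  then have "(\<Sum>\<sigma> | \<sigma> permutes {..<length xs}. prod_kernel k (permute_list \<sigma> xs) ys) =
      (\<Sum>\<sigma> | \<sigma> permutes {..<length xs}. prod_kernel k xs (permute_list (inv \<sigma>) ys))"
    by simp
  then show ?thesis
    using sum_permutations_inverse[of "\<lambda>\<sigma>. prod_kernel k xs (permute_list \<sigma> ys)" "{..<length xs}"] assms
    by (simp add: sym_kernel_right)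
qed

lemma sym_kernel_permute_right:
  assumes "length ys = length xs" "\<tau> permutes {..<length xs}"
  shows "sym_kernel k xs (permute_list \<tau> ys) = sym_kernel k xs ys"
proof -
  have "(\<Sum>\<sigma> | \<sigma> permutes {..<length xs}. prod_kernel k xs (permute_list \<sigma> (permute_list \<tau> ys))) =
      (\<Sum>\<sigma> | \<sigma> permutes {..<length xs}. prod_kernel k xs (permute_list (\<tau> \<circ> \<sigma>) ys))"
    using assms by (intro sum.cong refl) (simp add: permute_list_compose)
  also have "\<dots> = (\<Sum>\<sigma> | \<sigma> permutes {..<length xs}. prod_kernel k xs (permute_list \<sigma> ys))"
    using setum_permutations_compose_left[OF assms(2), of "\<lambda>\<sigma>. prod_kernel k xs (permute_list \<sigma> ys)"] by simp
  finally show ?thesis using assms by (simp add: sym_kernel_right)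
qed

lemma sym_kernel_permute_left:
  assumes "length ys = length xs" "\<tau> permutes {..<length xs}"
  shows "sym_kernel k (permute_list \<tau> xs) ys = sym_kernel k xs ys"
proof -
  have "(\<Sum>\<sigma> | \<sigma> permutes {..<length xs}. prod_kernel k (permute_list \<sigma> (permute_list \<tau> xs)) ys) =
      (\<Sum>\<sigma> | \<sigma> permutes {..<length xs}. prod_kernel k (permute_list (\<tau> \<circ> \<sigma>) xs) ys)"
    using assms by (intro sum.cong refl) (simp add: permute_list_compose)
  also have "\<dots> = (\<Sum>\<sigma> | \<sigma> permutes {..<length xs}. prod_kernel k (permute_list \<sigma> xs) ys)"
    using setum_permutations_compose_left[OF assms(2), of "\<lambda>\<sigma>. prod_kernel k (permute_list \<sigma> xs) ys"] by simp
  finally show ?thesis using assms by (simp add: sym_kernel_left)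
qed

lemma sym_kernel_mset_cong:
  assumes "mset xs = mset xs'" "mset ys = mset ys'" "length ys = length xs"
  shows "sym_kernel k xs ys = sym_kernel k xs' ys'"
proof -
  have l: "length xs' = length xs" "length ys' = length xs" using assms by (metis size_mset)+
  obtain \<sigma> where "\<sigma> permutes {..<length xs'}" "permute_list \<sigma> xs' = xs"
    using mset_eq_permutation[OF assms(1)] by blast
  moreover obtain \<tau> where "\<tau> permutes {..<length ys'}" "permute_list \<tau> ys' = ys"
    using mset_eq_permutation[OF assms(2)] by blast
  ultimately show ?thesis
    using sym_kernel_permute_left[of ys xs' \<sigma> k] sym_kernel_permute_right[of ys' xs' \<tau> k] l assms(3) by simp
qed

lemma card_permutes_lessThan [simp]: "card {\<sigma>. \<sigma> permutes {..<n::nat}} = fact n"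
  by (simp add: card_permutations)

lemma sym_kernel_double:
  assumes "length ys = length xs"
  shows "sym_kernel k xs ys = (\<Sum>\<sigma> | \<sigma> permutes {..<length xs}. \<Sum>\<tau> | \<tau> permutes {..<length xs}.
      prod_kernel k (permute_list \<sigma> xs) (permute_list \<tau> ys)) / (fact (length xs))\<^sup>2"
proof -
  have "(\<Sum>\<tau> | \<tau> permutes {..<length xs}. prod_kernel k (permute_list \<sigma> xs) (permute_list \<tau> ys)) =
      fact (length xs) * sym_kernel k xs ys" if \<sigma>: "\<sigma> permutes {..<length xs}" for \<sigma>
    using sym_kernel_right[of ys "permute_list \<sigma> xs" k] sym_kernel_permute_left[OF assms \<sigma>, of k] assms by simp
  then show ?thesis by (simp add: power2_eq_square)
qed

lemma psd_on_prod_kernel: "psd_on V k \<Longrightarrow> psd_on (lists_of V n) (prod_kernel k)"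
  by (rule psd_on_cong[where K="\<lambda>x y. \<Prod>i<n. k (x ! i) (y ! i)"])
    (auto intro!: psd_on_prod psd_on_compose[where Y=V and f="\<lambda>x. x ! _"] simp: lists_ofD prod_kernel_def)

lemma psd_on_sym_kernel:
  assumes "psd_on V k"
  shows "psd_on (lists_of V n) (sym_kernel k)"
proof (rule psd_on_cong)
  let ?S = "{\<sigma>. \<sigma> permutes {..<n}}"
  show "psd_on (lists_of V n) (\<lambda>xs ys. \<Sum>\<sigma>\<in>?S. \<Sum>\<tau>\<in>?S.
      (1 / fact n) * (1 / fact n) * prod_kernel k (permute_list \<sigma> xs) (permute_list \<tau> ys))"
    by (rule psd_on_combination[OF psd_on_prod_kernel[OF assms, of n], where S="?S" and f="\<lambda>xs \<sigma>. permute_list \<sigma> xs"])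
      (auto simp: finite_permutations permute_list_lists_of)
qed (simp add: sym_kernel_double lists_ofD sum_distrib_left sum_divide_distrib power2_eq_square)

text \<open>Symmetrisation is an orthogonal projection, so it does not increase norms.\<close>

lemma psd_on_prod_kernel_minus_sym_kernel:
  assumes "psd_on V k"
  shows "psd_on (lists_of V n) (\<lambda>xs ys. prod_kernel k xs ys - sym_kernel k xs ys)"
proof (rule psd_on_cong)
  let ?S = "{\<sigma>. \<sigma> permutes {..<n}}"
  let ?T = "insert None (Some ` ?S)"
  let ?a = "\<lambda>s. case s of None \<Rightarrow> (1::real) | Some \<sigma> \<Rightarrow> - (1::real) / fact n"
  let ?f = "\<lambda>xs s. case s of None \<Rightarrow> xs | Some \<sigma> \<Rightarrow> permute_list \<sigma> xs"
  show "psd_on (lists_of V n) (\<lambda>xs ys. \<Sum>s\<in>?T. \<Sum>t\<in>?T. ?a s * ?a t * prod_kernel k (?f xs s) (?f ys t))"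
    by (rule psd_on_combination[OF psd_on_prod_kernel[OF assms, of n]])
      (auto simp: finite_permutations permute_list_lists_of)
  fix xs ys assume xy: "xs \<in> lists_of V n" "ys \<in> lists_of V n"
  have T: "(\<Sum>s\<in>?T. g s) = g None + (\<Sum>\<sigma>\<in>?S. g (Some \<sigma>))" for g :: "_ \<Rightarrow> real"
    by (simp add: finite_permutations sum.reindex)
  have r: "(\<Sum>\<tau>\<in>?S. prod_kernel k xs (permute_list \<tau> ys)) = fact n * sym_kernel k xs ys"
    using sym_kernel_right[of ys xs k] xy by (simp add: lists_ofD)
  have l: "(\<Sum>\<sigma>\<in>?S. prod_kernel k (permute_list \<sigma> xs) ys) = fact n * sym_kernel k xs ys"
    using sym_kernel_left[of ys xs k] xy by (simp add: lists_ofD)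
  have d: "(\<Sum>\<sigma>\<in>?S. \<Sum>\<tau>\<in>?S. prod_kernel k (permute_list \<sigma> xs) (permute_list \<tau> ys)) = (fact n)\<^sup>2 * sym_kernel k xs ys"
    using sym_kernel_double[of ys xs k] xy by (simp add: lists_ofD)
  show "(\<Sum>s\<in>?T. \<Sum>t\<in>?T. ?a s * ?a t * prod_kernel k (?f xs s) (?f ys t)) =
      prod_kernel k xs ys - sym_kernel k xs ys"
    unfolding T
    by (simp add: sum.distrib sum_negf sum_subtractf sum_divide_distrib[symmetric] sum_distrib_left[symmetric] l r d power2_eq_square)
qed

lemma sum_permutes_apply:
  fixes g :: "nat \<Rightarrow> real"
  assumes "j < n"
  shows "real n * (\<Sum>\<sigma> | \<sigma> permutes {..<n}. g (\<sigma> j)) = fact n * (\<Sum>i<n. g i)"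
proof -
  have "(\<Sum>\<sigma> | \<sigma> permutes {..<n}. g (\<sigma> j)) = (\<Sum>\<sigma> | \<sigma> permutes {..<n}. g (\<sigma> i))" if "i < n" for i
    using sum_permutations_compose_right[OF permutes_swap_id[of j "{..<n}" i], of "\<lambda>\<sigma>. g (\<sigma> j)"] assms that by simp
  then have "(\<Sum>i<n. \<Sum>\<sigma> | \<sigma> permutes {..<n}. g (\<sigma> i)) = (\<Sum>i<n. \<Sum>\<sigma> | \<sigma> permutes {..<n}. g (\<sigma> j))"
    by (intro sum.cong[OF refl, where A="{..<n}"]) (simp only: lessThan_iff)
  then have "real n * (\<Sum>\<sigma> | \<sigma> permutes {..<n}. g (\<sigma> j)) = (\<Sum>i<n. \<Sum>\<sigma> | \<sigma> permutes {..<n}. g (\<sigma> i))"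
    by simp
  also have "\<dots> = (\<Sum>\<sigma> | \<sigma> permutes {..<n}. \<Sum>i<n. g (\<sigma> i))" by (rule sum.swap)
  also have "\<dots> = (\<Sum>\<sigma> | \<sigma> permutes {..<n}. \<Sum>i<n. g i)"
    using sum.permute[of _ "{..<n}" g] by (intro sum.cong[OF refl, where A="{\<sigma>. \<sigma> permutes {..<n}}"]) (simp add: o_def)
  finally show ?thesis by simp
qed

lemma sum_permutes_hd_tl:
  fixes h :: "'a \<Rightarrow> 'a list \<Rightarrow> real"
  assumes len: "length xs = Suc n"
    and h: "\<And>x us vs. mset us = mset vs \<Longrightarrow> length us = n \<Longrightarrow> h x us = h x vs"
  shows "(\<Sum>\<sigma> | \<sigma> permutes {..<Suc n}. h (hd (permute_list \<sigma> xs)) (tl (permute_list \<sigma> xs))) =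
    fact n * (\<Sum>x\<leftarrow>xs. h x (remove1 x xs))"
proof -
  have "h (hd (permute_list \<sigma> xs)) (tl (permute_list \<sigma> xs)) = h (xs ! \<sigma> 0) (remove1 (xs ! \<sigma> 0) xs)"
    if \<sigma>: "\<sigma> permutes {..<Suc n}" for \<sigma>
  proof -
    have *: "permute_list \<sigma> xs = hd (permute_list \<sigma> xs) # tl (permute_list \<sigma> xs)"
      using len by (metis hd_Cons_tl length_0_conv length_permute_list nat.distinct(1))
    have hd: "hd (permute_list \<sigma> xs) = xs ! \<sigma> 0"
      using permute_list_nth[of \<sigma> xs 0] \<sigma> len * by (metis nth_Cons_0 zero_less_Suc)
    have "mset xs = add_mset (xs ! \<sigma> 0) (mset (tl (permute_list \<sigma> xs)))"
      using * hd \<sigma> len by (metis mset.simps(2) mset_permute_list)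
    then have "mset (tl (permute_list \<sigma> xs)) = mset (remove1 (xs ! \<sigma> 0) xs)" by simp
    then show ?thesis using hd len by (simp add: h)
  qed
  then have "(\<Sum>\<sigma> | \<sigma> permutes {..<Suc n}. h (hd (permute_list \<sigma> xs)) (tl (permute_list \<sigma> xs))) =
     (\<Sum>\<sigma> | \<sigma> permutes {..<Suc n}. h (xs ! \<sigma> 0) (remove1 (xs ! \<sigma> 0) xs))" by simp
  also have "real (Suc n) * \<dots> = fact (Suc n) * (\<Sum>i<Suc n. h (xs ! i) (remove1 (xs ! i) xs))"
    by (rule sum_permutes_apply) simp
  also have "(\<Sum>i<Suc n. h (xs ! i) (remove1 (xs ! i) xs)) = (\<Sum>x\<leftarrow>xs. h x (remove1 x xs))"
    using len by (simp add: sum_list_sum_nth atLeast0LessThan)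
  finally have "real (Suc n) * (\<Sum>\<sigma> | \<sigma> permutes {..<Suc n}. h (hd (permute_list \<sigma> xs)) (tl (permute_list \<sigma> xs))) =
      real (Suc n) * (fact n * (\<Sum>x\<leftarrow>xs. h x (remove1 x xs)))" by simp
  then show ?thesis by (simp del: of_nat_Suc)
qed

text \<open>Contraction by a functional of norm at most \<open>L\<close> is bounded by \<open>L\<close> on symmetric tensors:
  the kernel is a symmetrisation of \<open>(L\<^sup>2 k - l \<otimes> l) P + (l \<otimes> l) (P - S)\<close> with \<open>P\<close> and \<open>S\<close> the
  product and the symmetrised kernel of the remaining factors.\<close>

lemma psd_on_contraction:
  assumes k: "psd_on V k" and kl: "psd_on V (\<lambda>x y. L\<^sup>2 * k x y - l x * l y)"
  shows "psd_on (lists_of V (Suc n)) (\<lambda>xs ys. L\<^sup>2 * sym_kernel k xs ys -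
     (\<Sum>x\<leftarrow>xs. \<Sum>y\<leftarrow>ys. l x * l y * sym_kernel k (remove1 x xs) (remove1 y ys)) / (real (Suc n))\<^sup>2)"
proof -
  let ?S = "{\<sigma>. \<sigma> permutes {..<Suc n}}"
  let ?P = "prod_kernel k" and ?Q = "sym_kernel k"
  define M where "M xs ys = L\<^sup>2 * (k (hd xs) (hd ys) * ?P (tl xs) (tl ys)) - l (hd xs) * l (hd ys) * ?Q (tl xs) (tl ys)" for xs ys
  have sub: "hd ` lists_of V (Suc n) \<subseteq> V" "tl ` lists_of V (Suc n) \<subseteq> lists_of V n"
    by (auto simp: lists_of_def length_Suc_conv)
  have "psd_on (lists_of V (Suc n)) (\<lambda>xs ys. (L\<^sup>2 * k (hd xs) (hd ys) - l (hd xs) * l (hd ys)) * ?P (tl xs) (tl ys) +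
      (l (hd xs) * l (hd ys)) * (?P (tl xs) (tl ys) - ?Q (tl xs) (tl ys)))"
    by (intro psd_on_add psd_on_mult psd_on_compose[OF kl sub(1)] psd_on_rank_one[of _ "\<lambda>x. l (hd x)"]
      psd_on_compose[OF psd_on_prod_kernel[OF k] sub(2)]
      psd_on_compose[OF psd_on_prod_kernel_minus_sym_kernel[OF k] sub(2)])
  then have M: "psd_on (lists_of V (Suc n)) M"
    by (rule psd_on_cong) (simp add: M_def algebra_simps)
  show ?thesis
  proof (rule psd_on_cong)
    show "psd_on (lists_of V (Suc n)) (\<lambda>xs ys. \<Sum>\<sigma>\<in>?S. \<Sum>\<tau>\<in>?S.
      (1 / fact (Suc n)) * (1 / fact (Suc n)) * M (permute_list \<sigma> xs) (permute_list \<tau> ys))"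
      by (rule psd_on_combination[OF M, where S="?S" and f="\<lambda>xs \<sigma>. permute_list \<sigma> xs"])
        (auto simp: finite_permutations permute_list_lists_of)
    fix xs ys assume xy: "xs \<in> lists_of V (Suc n)" "ys \<in> lists_of V (Suc n)"
    then have len: "length xs = Suc n" "length ys = Suc n" by (auto simp: lists_of_def)
    have P: "k (hd us) (hd vs) * ?P (tl us) (tl vs) = ?P us vs" if "length us = Suc n" "length vs = Suc n" for us vs :: "'a list"
      using that unfolding prod_kernel_def
      by (cases us; cases vs) (auto simp: prod.lessThan_Suc_shift simp del: prod.lessThan_Suc)
    have 1: "(\<Sum>\<sigma>\<in>?S. \<Sum>\<tau>\<in>?S. k (hd (permute_list \<sigma> xs)) (hd (permute_list \<tau> ys)) *
        ?P (tl (permute_list \<sigma> xs)) (tl (permute_list \<tau> ys))) = (fact (Suc n))\<^sup>2 * ?Q xs ys"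
      using sym_kernel_double[of ys xs k] len by (simp add: P del: fact_Suc)
    have i: "(\<Sum>\<tau>\<in>?S. l x * l (hd (permute_list \<tau> ys)) * ?Q us (tl (permute_list \<tau> ys))) =
        fact n * (\<Sum>y\<leftarrow>ys. l x * l y * ?Q us (remove1 y ys))" if "length us = n" for us :: "'a list" and x
      by (rule sum_permutes_hd_tl[where h="\<lambda>y vs. l x * l y * ?Q us vs"]) (use len that in \<open>auto intro: sym_kernel_mset_cong\<close>)
    have "(\<Sum>\<sigma>\<in>?S. \<Sum>\<tau>\<in>?S. l (hd (permute_list \<sigma> xs)) * l (hd (permute_list \<tau> ys)) *
        ?Q (tl (permute_list \<sigma> xs)) (tl (permute_list \<tau> ys))) =
        (\<Sum>\<sigma>\<in>?S. fact n * (\<Sum>y\<leftarrow>ys. l (hd (permute_list \<sigma> xs)) * l y * ?Q (tl (permute_list \<sigma> xs)) (remove1 y ys)))"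
      using len by (intro sum.cong refl i) simp
    also have "\<dots> = fact n * (\<Sum>x\<leftarrow>xs. fact n * (\<Sum>y\<leftarrow>ys. l x * l y * ?Q (remove1 x xs) (remove1 y ys)))"
    proof (rule sum_permutes_hd_tl[where h="\<lambda>x us. fact n * (\<Sum>y\<leftarrow>ys. l x * l y * ?Q us (remove1 y ys))"])
      fix x :: 'a and us vs :: "'a list" assume "mset us = mset vs" "length us = n"
      then show "fact n * (\<Sum>y\<leftarrow>ys. l x * l y * ?Q us (remove1 y ys)) = fact n * (\<Sum>y\<leftarrow>ys. l x * l y * ?Q vs (remove1 y ys))"
        using len by (intro arg_cong[where f="\<lambda>u. fact n * u"] arg_cong[where f=sum_list] map_cong refl)
          (auto simp: length_remove1 intro!: sym_kernel_mset_cong)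
    qed (use len in simp)
    also have "\<dots> = (fact n)\<^sup>2 * (\<Sum>x\<leftarrow>xs. \<Sum>y\<leftarrow>ys. l x * l y * ?Q (remove1 x xs) (remove1 y ys))"
      by (simp add: sum_list_const_mult power2_eq_square)
    finally have 2: "(\<Sum>\<sigma>\<in>?S. \<Sum>\<tau>\<in>?S. l (hd (permute_list \<sigma> xs)) * l (hd (permute_list \<tau> ys)) *
        ?Q (tl (permute_list \<sigma> xs)) (tl (permute_list \<tau> ys))) = \<dots>" .
    have "(\<Sum>\<sigma>\<in>?S. \<Sum>\<tau>\<in>?S. M (permute_list \<sigma> xs) (permute_list \<tau> ys)) =
        L\<^sup>2 * ((fact (Suc n))\<^sup>2 * ?Q xs ys) - (fact n)\<^sup>2 * (\<Sum>x\<leftarrow>xs. \<Sum>y\<leftarrow>ys. l x * l y * ?Q (remove1 x xs) (remove1 y ys))"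
      unfolding M_def by (simp only: sum_subtractf sum_distrib_left[symmetric] 1 2)
    moreover have arith: "1 / (N * f) * (1 / (N * f)) * (A * ((N * f)\<^sup>2 * q) - f\<^sup>2 * s) = A * q - s / N\<^sup>2"
      if "N \<noteq> 0" "f \<noteq> 0" for N f A q s :: real
      using that by (simp add: field_simps power2_eq_square)
    ultimately show "(\<Sum>\<sigma>\<in>?S. \<Sum>\<tau>\<in>?S. (1 / fact (Suc n)) * (1 / fact (Suc n)) * M (permute_list \<sigma> xs) (permute_list \<tau> ys)) =
       L\<^sup>2 * ?Q xs ys - (\<Sum>x\<leftarrow>xs. \<Sum>y\<leftarrow>ys. l x * l y * ?Q (remove1 x xs) (remove1 y ys)) / (real (Suc n))\<^sup>2"
      by (simp only: sum_distrib_left[symmetric] fact_Suc) (rule arith; simp)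
  qed
qed

section \<open>Hermite functions\<close>

definition rapid :: "(real \<Rightarrow> real) \<Rightarrow> bool" where
  "rapid f \<longleftrightarrow> (\<forall>k. \<exists>B. \<forall>x. \<bar>x ^ k * f x\<bar> \<le> B)"

lemma rapid_bounded: "rapid f \<Longrightarrow> \<exists>B. \<forall>x. \<bar>f x\<bar> \<le> B"
  unfolding rapid_def by (metis mult_1 power_0)

lemma rapid_add: assumes "rapid f" "rapid g" shows "rapid (\<lambda>x. f x + g x)"
  unfolding rapid_def
proof
  fix k
  obtain A B where AB: "\<And>x. \<bar>x ^ k * f x\<bar> \<le> A" "\<And>x. \<bar>x ^ k * g x\<bar> \<le> B"
    using assms unfolding rapid_def by meson
  have "\<bar>x ^ k * (f x + g x)\<bar> \<le> A + B" for x
    using AB[of x] by (simp add: distrib_left)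
  then show "\<exists>B. \<forall>x. \<bar>x ^ k * (f x + g x)\<bar> \<le> B" by blast
qed

lemma rapid_mult_bounded: assumes "rapid f" "\<And>x. \<bar>g x\<bar> \<le> C" shows "rapid (\<lambda>x. g x * f x)"
  unfolding rapid_def
proof
  fix k
  obtain A where A: "\<And>x. \<bar>x ^ k * f x\<bar> \<le> A" using assms unfolding rapid_def by meson
  have "\<bar>x ^ k * (g x * f x)\<bar> \<le> C * A" for x
  proof -
    have "\<bar>x ^ k * (g x * f x)\<bar> = \<bar>g x\<bar> * \<bar>x ^ k * f x\<bar>" by (simp add: abs_mult)
    also have "\<dots> \<le> C * A" using A assms(2) abs_ge_zero order_trans by (intro mult_mono) blast+
    finally show ?thesis .
  qed
  then show "\<exists>B. \<forall>x. \<bar>x ^ k * (g x * f x)\<bar> \<le> B" by blast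
qed

lemma rapid_cmult: "rapid f \<Longrightarrow> rapid (\<lambda>x. c * f x)"
  by (rule rapid_mult_bounded[where g="\<lambda>_. c" and C="\<bar>c\<bar>"]) auto

lemma rapid_diff: "rapid f \<Longrightarrow> rapid g \<Longrightarrow> rapid (\<lambda>x. f x - g x)"
  using rapid_add[of f "\<lambda>x. -1 * g x"] rapid_cmult[of g "-1"] by simp

lemma rapid_mult: "rapid f \<Longrightarrow> rapid g \<Longrightarrow> rapid (\<lambda>x. f x * g x)"
  using rapid_mult_bounded[of g f] rapid_bounded[of f] by blast

lemma rapid_times: assumes "rapid f" shows "rapid (\<lambda>x. x * f x)"
  unfolding rapid_def
proof
  fix k
  show "\<exists>B. \<forall>x. \<bar>x ^ k * (x * f x)\<bar> \<le> B"
    using assms[unfolded rapid_def, rule_format, of "Suc k"] by (simp add: mult_ac)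
qed

lemma integrable_inverse_one_plus_square: "integrable lborel (\<lambda>x::real. inverse (1 + x\<^sup>2))"
  using integrable_inverse_1_plus_square unfolding set_integrable_def by simp

lemma rapid_integrable:
  assumes "rapid f" "f \<in> borel_measurable borel"
  shows "integrable lborel f"
proof -
  obtain A B where AB: "\<And>x. \<bar>f x\<bar> \<le> A" "\<And>x. \<bar>x\<^sup>2 * f x\<bar> \<le> B"
    using assms(1) rapid_bounded unfolding rapid_def by meson
  have "integrable lborel (\<lambda>x::real. (A + B) * inverse (1 + x\<^sup>2))"
    using integrable_inverse_one_plus_square by simp
  then show ?thesis
  proof (rule Bochner_Integration.integrable_bound)
    show "AE x in lborel. norm (f x) \<le> norm ((A + B) * inverse (1 + x\<^sup>2))"
    proof (intro AE_I2)
      fix x :: real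
      have "\<bar>f x\<bar> * (1 + x\<^sup>2) \<le> A + B" using AB[of x] by (simp add: distrib_left abs_mult mult.commute)
      moreover have "0 < 1 + x\<^sup>2" by (simp add: add_pos_nonneg)
      ultimately have "\<bar>f x\<bar> \<le> (A + B) * inverse (1 + x\<^sup>2)"
        by (simp add: field_simps)
      then show "norm (f x) \<le> norm ((A + B) * inverse (1 + x\<^sup>2))" by simp
    qed
  qed (use assms in simp)
qed

lemma rapid_tendsto_zero:
  assumes "rapid f"
  shows "(f \<longlongrightarrow> 0) at_top" "(f \<longlongrightarrow> 0) at_bot"
proof -
  obtain B where B: "\<And>x. \<bar>x * f x\<bar> \<le> B"
    using assms[unfolded rapid_def, rule_format, of 1] by auto
  have bd: "norm (f x) \<le> B * inverse \<bar>x\<bar>" if "x \<noteq> 0" for x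
    using B[of x] that by (simp add: abs_mult field_simps)
  have "((\<lambda>x. B * inverse \<bar>x\<bar>) \<longlongrightarrow> 0) at_top" "((\<lambda>x. B * inverse \<bar>x\<bar>) \<longlongrightarrow> 0) at_bot" by real_asymp+
  moreover have "eventually (\<lambda>x. norm (f x) \<le> B * inverse \<bar>x\<bar>) at_top"
    using eventually_gt_at_top[of 0] by eventually_elim (rule bd, simp)
  moreover have "eventually (\<lambda>x. norm (f x) \<le> B * inverse \<bar>x\<bar>) at_bot"
    using eventually_gt_at_bot[of 0] by eventually_elim (rule bd, simp)
  ultimately show "(f \<longlongrightarrow> 0) at_top" "(f \<longlongrightarrow> 0) at_bot"
    by (auto intro: Lim_null_comparison)
qed

lemma integral_deriv_rapid:
  assumes F: "\<And>x. (F has_real_derivative f x) (at x)" and f: "continuous_on UNIV f"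
    and "rapid F" "integrable lborel f"
  shows "(LINT x|lborel. f x) = 0"
proof -
  have "(LBINT x=-\<infinity>..\<infinity>. f x) = 0 - 0"
  proof (rule interval_integral_FTC_integrable[where F=F])
    show "(F has_vector_derivative f x) (at x)" for x
      using F by (simp add: has_real_derivative_iff_has_vector_derivative)
    show "isCont f x" for x using f by (simp add: continuous_on_eq_continuous_at)
    show "set_integrable lborel (einterval (- \<infinity>) \<infinity>) f" using assms(4) by (simp add: set_integrable_def)
    show "((F \<circ> real_of_ereal) \<longlongrightarrow> 0) (at_right (- \<infinity>))" "((F \<circ> real_of_ereal) \<longlongrightarrow> 0) (at_left \<infinity>)"
      using rapid_tendsto_zero[OF assms(3)] by (simp_all add: ereal_tendsto_simps1)
  qed simp
  then show ?thesis by (simp add: interval_lebesgue_integral_def set_lebesgue_integral_def)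
qed

lemma square_le_integral:
  assumes F: "\<And>x. (F has_real_derivative f x) (at x)" and f: "continuous_on UNIV f"
    and r: "rapid F" "rapid f"
  shows "(F x)\<^sup>2 \<le> (LINT y|lborel. (F y)\<^sup>2) + (LINT y|lborel. (f y)\<^sup>2)"
proof -
  have Fc: "continuous_on UNIV F" using F by (meson DERIV_continuous continuous_at_imp_continuous_on)
  have meas: "F \<in> borel_measurable borel" "f \<in> borel_measurable borel"
    using Fc f by (auto intro: borel_measurable_continuous_onI)
  have i2: "integrable lborel (\<lambda>y. (F y)\<^sup>2)" "integrable lborel (\<lambda>y. (f y)\<^sup>2)"
    unfolding power2_eq_square by (intro rapid_integrable rapid_mult r; use meas in measurable)+
  have iF: "integrable lborel (\<lambda>y. 2 * (F y * f y))"
    by (intro integrable_mult_right rapid_integrable rapid_mult r; use meas in measurable)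
  have "(LBINT y=-\<infinity>..x. 2 * (F y * f y)) = (F x)\<^sup>2 - 0"
  proof (rule interval_integral_FTC_integrable[where F="\<lambda>y. (F y)\<^sup>2"])
    show "((\<lambda>y. (F y)\<^sup>2) has_vector_derivative 2 * (F y * f y)) (at y)" for y
      unfolding has_real_derivative_iff_has_vector_derivative[symmetric]
      by (auto intro!: derivative_eq_intros F)
    show "isCont (\<lambda>y. 2 * (F y * f y)) y" for y
      using f Fc by (intro continuous_intros) (auto simp: continuous_on_eq_continuous_at)
    show "set_integrable lborel (einterval (- \<infinity>) x) (\<lambda>y. 2 * (F y * f y))"
      unfolding set_integrable_def by (rule integrable_mult_indicator[OF _ iF]) simp
    show "(((\<lambda>y. (F y)\<^sup>2) \<circ> real_of_ereal) \<longlongrightarrow> 0) (at_right (- \<infinity>))"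
      using tendsto_power[OF rapid_tendsto_zero(2)[OF r(1)], of 2] by (simp add: ereal_tendsto_simps1)
    have "isCont (\<lambda>y. (F y)\<^sup>2) x" using Fc by (intro continuous_intros) (auto simp: continuous_on_eq_continuous_at)
    then show "(((\<lambda>y. (F y)\<^sup>2) \<circ> real_of_ereal) \<longlongrightarrow> (F x)\<^sup>2) (at_left (ereal x))"
      unfolding ereal_tendsto_simps1 by (simp add: isCont_def filterlim_at_split)
  qed simp
  then have "(F x)\<^sup>2 = (LINT y|lborel. indicator (einterval (-\<infinity>) x) y * (2 * (F y * f y)))"
    by (simp add: interval_lebesgue_integral_def set_lebesgue_integral_def mult_ac)
  also have "\<dots> \<le> (LINT y|lborel. (F y)\<^sup>2 + (f y)\<^sup>2)"
  proof (rule integral_mono)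
    show "integrable lborel (\<lambda>y. indicator (einterval (-\<infinity>) x) y * (2 * (F y * f y)))"
      using integrable_mult_indicator[OF _ iF, of "einterval (-\<infinity>) x"] by simp
    show "indicator (einterval (-\<infinity>) x) y * (2 * (F y * f y)) \<le> (F y)\<^sup>2 + (f y)\<^sup>2" for y
      using sum_squares_bound[of "F y" "f y"] by (auto simp: indicator_def mult.assoc)
  qed (use i2 in simp)
  also have "\<dots> = (LINT y|lborel. (F y)\<^sup>2) + (LINT y|lborel. (f y)\<^sup>2)" using i2 by simp
  finally show ?thesis .
qed

lemma hermite_poly_rec: "2 * x * hermite_poly n x = hermite_poly (Suc n) x + 2 * real n * hermite_poly (n - 1) x"
  by (cases n) simp_all

lemma hermite_poly_deriv: "(hermite_poly n has_real_derivative 2 * real n * hermite_poly (n - 1) x) (at x)"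
proof (induction n x rule: hermite_poly.induct)
  case (1 x)
  have "hermite_poly 0 = (\<lambda>x. 1)" by auto
  then show ?case by simp
next
  case (2 x)
  have "hermite_poly (Suc 0) = (\<lambda>x. 2 * x)" by auto
  then show ?case by (auto intro!: derivative_eq_intros)
next
  case (3 n x)
  have *: "hermite_poly (Suc (Suc n)) = (\<lambda>x. 2 * x * hermite_poly (Suc n) x - 2 * real (Suc n) * hermite_poly n x)"
    by auto
  have "((\<lambda>x. 2 * x * hermite_poly (Suc n) x - 2 * real (Suc n) * hermite_poly n x) has_real_derivative
      2 * hermite_poly (Suc n) x + 2 * x * (2 * real (Suc n) * hermite_poly n x) -
      2 * real (Suc n) * (2 * real n * hermite_poly (n - 1) x)) (at x)"
    using 3 by (auto intro!: derivative_eq_intros)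
  also have "2 * hermite_poly (Suc n) x + 2 * x * (2 * real (Suc n) * hermite_poly n x) -
      2 * real (Suc n) * (2 * real n * hermite_poly (n - 1) x) =
      2 * hermite_poly (Suc n) x + 2 * real (Suc n) * (2 * x * hermite_poly n x - 2 * real n * hermite_poly (n - 1) x)"
    by (simp add: algebra_simps)
  also have "\<dots> = 2 * real (Suc (Suc n)) * hermite_poly (Suc n) x"
    unfolding hermite_poly_rec[of x n] by (simp add: algebra_simps)
  finally show ?case by (simp add: *)
qed

definition hermite_norm :: "nat \<Rightarrow> real" where
  "hermite_norm n = sqrt (2 ^ n * fact n * sqrt pi)"

lemma hermite_norm_pos: "0 < hermite_norm n" by (simp add: hermite_norm_def)

lemma hermite_norm_Suc: "hermite_norm (Suc n) = sqrt (2 * real (Suc n)) * hermite_norm n"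
  unfolding hermite_norm_def by (simp add: real_sqrt_mult[symmetric] mult_ac del: of_nat_Suc)

lemma hermite_fun_eq: "hermite_fun n x = hermite_poly n x * exp (- x\<^sup>2 / 2) / hermite_norm n"
  by (simp add: hermite_fun_def hermite_norm_def)

lemma hermite_fun_Suc_scaled:
  "sqrt (2 * real (Suc n)) * hermite_fun (Suc n) x = hermite_poly (Suc n) x * exp (- x\<^sup>2 / 2) / hermite_norm n"
  by (simp add: hermite_fun_eq hermite_norm_Suc del: hermite_poly.simps of_nat_Suc)

lemma hermite_fun_pred_scaled:
  "sqrt (2 * real n) * hermite_fun (n - 1) x = 2 * real n * hermite_poly (n - 1) x * exp (- x\<^sup>2 / 2) / hermite_norm n"
proof (cases n)
  case (Suc m)
  have "sqrt (2 * real (Suc m)) * (sqrt (2 * real (Suc m)) * hermite_norm m) = 2 * real (Suc m) * hermite_norm m"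
    by (simp del: of_nat_Suc)
  then show ?thesis
    using hermite_norm_pos[of m] by (simp add: Suc hermite_fun_eq hermite_norm_Suc field_simps del: of_nat_Suc)
qed simp

lemma hermite_fun_rec:
  "2 * x * hermite_fun n x = sqrt (2 * real (Suc n)) * hermite_fun (Suc n) x + sqrt (2 * real n) * hermite_fun (n - 1) x"
  unfolding hermite_fun_Suc_scaled hermite_fun_pred_scaled hermite_fun_eq[of n]
  by (simp only: add_divide_distrib[symmetric] distrib_right[symmetric] hermite_poly_rec[symmetric]) simp

definition hermite_deriv :: "nat \<Rightarrow> real \<Rightarrow> real" where
  "hermite_deriv n x = sqrt (2 * real n) * hermite_fun (n - 1) x - x * hermite_fun n x"

lemma hermite_deriv_eq: "hermite_deriv n x = x * hermite_fun n x - sqrt (2 * real (Suc n)) * hermite_fun (Suc n) x"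
  using hermite_fun_rec[of x n] unfolding hermite_deriv_def by linarith

lemma hermite_deriv_eq2:
  "hermite_deriv n x = (sqrt (2 * real n) * hermite_fun (n - 1) x - sqrt (2 * real (Suc n)) * hermite_fun (Suc n) x) / 2"
  using hermite_fun_rec[of x n] unfolding hermite_deriv_def by (simp add: field_simps)

lemma hermite_fun_has_deriv: "(hermite_fun n has_real_derivative hermite_deriv n x) (at x)"
proof -
  have *: "hermite_fun n = (\<lambda>x. hermite_poly n x * exp (- x\<^sup>2 / 2) / hermite_norm n)"
    by (auto simp: hermite_fun_eq)
  have "((\<lambda>x. hermite_poly n x * exp (- x\<^sup>2 / 2) / hermite_norm n) has_real_derivative
     (2 * real n * hermite_poly (n - 1) x * exp (- x\<^sup>2 / 2) + hermite_poly n x * (exp (- x\<^sup>2 / 2) * (- x))) / hermite_norm n) (at x)"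
    using hermite_norm_pos[of n] by (auto intro!: derivative_eq_intros hermite_poly_deriv)
  then show ?thesis
    unfolding * hermite_deriv_def hermite_fun_pred_scaled by (simp add: add_divide_distrib diff_divide_distrib mult_ac)
qed

lemma hermite_deriv_has_deriv:
  "(hermite_deriv n has_real_derivative (x\<^sup>2 - real (2 * n + 1)) * hermite_fun n x) (at x)"
proof -
  have *: "hermite_deriv n = (\<lambda>x. sqrt (2 * real n) * hermite_fun (n - 1) x - x * hermite_fun n x)"
    by (auto simp: hermite_deriv_def)
  have "((\<lambda>x. sqrt (2 * real n) * hermite_fun (n - 1) x - x * hermite_fun n x) has_real_derivative
    sqrt (2 * real n) * hermite_deriv (n - 1) x - (hermite_fun n x + x * hermite_deriv n x)) (at x)"
    by (auto intro!: derivative_eq_intros hermite_fun_has_deriv)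
  also have "sqrt (2 * real n) * hermite_deriv (n - 1) x =
      x * (sqrt (2 * real n) * hermite_fun (n - 1) x) - 2 * real n * hermite_fun n x"
  proof (cases n)
    case (Suc m)
    have "s * (x * a - s * b) = x * (s * a) - (s * s) * b" for s a b by (simp add: algebra_simps)
    from this[of "sqrt (2 * real n)" "hermite_fun m x" "hermite_fun n x"] show ?thesis
      by (simp add: Suc hermite_deriv_eq[of m] del: of_nat_Suc)
  qed simp
  also have "\<dots> - (hermite_fun n x + x * hermite_deriv n x) = (x\<^sup>2 - real (2 * n + 1)) * hermite_fun n x"
    by (simp add: hermite_deriv_def algebra_simps power2_eq_square)
  finally show ?thesis by (simp add: *)
qed

lemma rapid_gaussian: "rapid (\<lambda>x. exp (- x\<^sup>2 / 2))"
  unfolding rapid_def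
proof
  fix k
  have "\<bar>x ^ k * exp (- x\<^sup>2 / 2)\<bar> \<le> 1 + 2 ^ k * fact k" for x :: real
  proof -
    have "(x\<^sup>2 / 2) ^ k / fact k \<le> exp (x\<^sup>2 / 2)"
      using sum_le_suminf[OF summable_exp, of "{k}" "x\<^sup>2 / 2"] by (simp add: exp_def field_simps)
    then have "(x\<^sup>2) ^ k \<le> 2 ^ k * fact k * exp (x\<^sup>2 / 2)"
      by (simp add: field_simps power_divide)
    then have "x ^ (2 * k) \<le> 2 ^ k * fact k * exp (x\<^sup>2 / 2)"
      unfolding power_mult .
    moreover have "\<bar>x\<bar> ^ k \<le> 1 + x ^ (2 * k)"
    proof (cases "\<bar>x\<bar> \<le> 1")
      case True
      then have "\<bar>x\<bar> ^ k \<le> 1" by (simp add: power_le_one)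
      moreover have "0 \<le> x ^ (2 * k)" by simp
      ultimately show ?thesis by linarith
    next
      case False
      then have "\<bar>x\<bar> ^ k \<le> \<bar>x\<bar> ^ (2 * k)" by (intro power_increasing) auto
      then show ?thesis by (simp add: power_even_abs)
    qed
    moreover have "1 \<le> exp (x\<^sup>2 / 2)" by simp
    ultimately have "\<bar>x\<bar> ^ k \<le> (1 + 2 ^ k * fact k) * exp (x\<^sup>2 / 2)"
      unfolding distrib_right by linarith
    then show ?thesis by (simp add: abs_mult power_abs exp_minus field_simps)
  qed
  then show "\<exists>B. \<forall>x::real. \<bar>x ^ k * exp (- x\<^sup>2 / 2)\<bar> \<le> B" by blast
qed

lemma rapid_hermite_fun: "rapid (hermite_fun n)"
proof (induction n rule: less_induct)
  case (less n)
  show ?case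
  proof (cases n)
    case 0
    have "hermite_fun 0 = (\<lambda>x. (1 / hermite_norm 0) * exp (- x\<^sup>2 / 2))" by (auto simp: hermite_fun_eq)
    then show ?thesis using rapid_cmult[OF rapid_gaussian, of "1 / hermite_norm 0"] 0 by simp
  next
    case (Suc m)
    have r: "rapid (\<lambda>x. (1 / sqrt (2 * real (Suc m))) *
      (2 * (x * hermite_fun m x) - sqrt (2 * real m) * hermite_fun (m - 1) x))"
      by (intro rapid_cmult rapid_diff rapid_times less) (simp_all add: Suc)
    have "(1 / sqrt (2 * real (Suc m))) * (2 * (x * hermite_fun m x) - sqrt (2 * real m) * hermite_fun (m - 1) x)
        = hermite_fun n x" for x
      using hermite_fun_rec[of x m] unfolding Suc by (simp add: field_simps del: of_nat_Suc)
    with r show ?thesis by simp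
  qed
qed

lemma rapid_hermite_deriv: "rapid (hermite_deriv n)"
  unfolding hermite_deriv_def[abs_def]
  by (intro rapid_diff rapid_cmult rapid_times rapid_hermite_fun)

lemma continuous_hermite_fun: "continuous_on S (hermite_fun n)"
  by (meson hermite_fun_has_deriv DERIV_continuous continuous_at_imp_continuous_on)

lemma continuous_hermite_deriv: "continuous_on S (hermite_deriv n)"
  by (meson hermite_deriv_has_deriv DERIV_continuous continuous_at_imp_continuous_on)

lemma measurable_hermite [measurable]:
  "hermite_fun n \<in> borel_measurable borel" "hermite_deriv n \<in> borel_measurable borel"
  by (auto intro: borel_measurable_continuous_onI continuous_hermite_fun continuous_hermite_deriv)

lemma integrable_hermite_fun: "integrable lborel (hermite_fun n)"
  by (intro rapid_integrable rapid_hermite_fun) simp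

lemma integrable_hermite_mult: "integrable lborel (\<lambda>x. hermite_fun m x * hermite_fun n x)"
  by (intro rapid_integrable rapid_mult rapid_hermite_fun) simp

lemma hermite_orthogonal:
  assumes "m \<noteq> n"
  shows "(LINT x|lborel. hermite_fun m x * hermite_fun n x) = 0"
proof -
  have "(LINT x|lborel. 2 * (real n - real m) * (hermite_fun m x * hermite_fun n x)) = 0"
  proof (rule integral_deriv_rapid)
    show "((\<lambda>x. hermite_deriv m x * hermite_fun n x - hermite_fun m x * hermite_deriv n x) has_real_derivative
      2 * (real n - real m) * (hermite_fun m x * hermite_fun n x)) (at x)" for x
      by (auto intro!: derivative_eq_intros hermite_fun_has_deriv hermite_deriv_has_deriv simp: algebra_simps)
    show "rapid (\<lambda>x. hermite_deriv m x * hermite_fun n x - hermite_fun m x * hermite_deriv n x)"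
      by (intro rapid_diff rapid_mult rapid_hermite_fun rapid_hermite_deriv)
  qed (auto intro!: continuous_intros continuous_hermite_fun integrable_hermite_mult)
  then show ?thesis using assms by simp
qed

lemma hermite_normalized: "(LINT x|lborel. (hermite_fun n x)\<^sup>2) = 1"
proof (induction n)
  case 0
  have "(hermite_fun 0 x)\<^sup>2 = normal_density 0 (sqrt (1/2)) x" for x
    by (simp add: hermite_fun_eq hermite_norm_def normal_density_def power_divide real_sqrt_divide
        power_mult_distrib flip: exp_double)
  then show ?case by simp
next
  case (Suc n)
  have "(LINT x|lborel. sqrt (2 * real (Suc n)) * ((hermite_fun n x)\<^sup>2 - (hermite_fun (Suc n) x)\<^sup>2)) = 0"
  proof (rule integral_deriv_rapid)
    show "((\<lambda>x. hermite_fun n x * hermite_fun (Suc n) x) has_real_derivative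
      sqrt (2 * real (Suc n)) * ((hermite_fun n x)\<^sup>2 - (hermite_fun (Suc n) x)\<^sup>2)) (at x)" for x
    proof -
      have "((\<lambda>x. hermite_fun n x * hermite_fun (Suc n) x) has_real_derivative
        hermite_deriv n x * hermite_fun (Suc n) x + hermite_deriv (Suc n) x * hermite_fun n x) (at x)"
        by (intro DERIV_mult hermite_fun_has_deriv)
      then show ?thesis
        unfolding hermite_deriv_eq[of n] hermite_deriv_def[of "Suc n"]
        by (simp add: algebra_simps power2_eq_square del: of_nat_Suc)
    qed
    show "rapid (\<lambda>x. hermite_fun n x * hermite_fun (Suc n) x)"
      by (intro rapid_mult rapid_hermite_fun)
  qed (auto intro!: continuous_intros continuous_hermite_fun integrable_hermite_mult simp: power2_eq_square simp del: of_nat_Suc)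
  then show ?case
    using Suc integrable_hermite_mult[of n n] integrable_hermite_mult[of "Suc n" "Suc n"]
    by (simp add: power2_eq_square del: of_nat_Suc)
qed

lemma hermite_orthonormal: "(LINT x|lborel. hermite_fun m x * hermite_fun n x) = (if m = n then 1 else 0)"
  using hermite_orthogonal hermite_normalized[of n] by (simp add: power2_eq_square)

lemma hermite_deriv_normalized: "(LINT x|lborel. (hermite_deriv n x)\<^sup>2) = real n + 1/2"
proof -
  let ?a = "sqrt (2 * real n)" and ?b = "sqrt (2 * real (Suc n))"
  have "(hermite_deriv n x)\<^sup>2 = (2 * real n) / 4 * (hermite_fun (n-1) x * hermite_fun (n-1) x)
     - ?a * ?b / 2 * (hermite_fun (n-1) x * hermite_fun (Suc n) x)
     + (2 * real (Suc n)) / 4 * (hermite_fun (Suc n) x * hermite_fun (Suc n) x)" for x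
  proof -
    have "(hermite_deriv n x)\<^sup>2 = ?a\<^sup>2 / 4 * (hermite_fun (n-1) x * hermite_fun (n-1) x)
     - ?a * ?b / 2 * (hermite_fun (n-1) x * hermite_fun (Suc n) x)
     + ?b\<^sup>2 / 4 * (hermite_fun (Suc n) x * hermite_fun (Suc n) x)"
      unfolding hermite_deriv_eq2 by (simp add: power2_eq_square field_simps del: of_nat_Suc real_sqrt_mult_self)
    then show ?thesis by simp
  qed
  moreover have "n - 1 \<noteq> Suc n" by simp
  ultimately show ?thesis
    using integrable_hermite_mult by (simp add: hermite_orthonormal) (simp add: field_simps)
qed

lemma hermite_fun_bound: "\<bar>hermite_fun n x\<bar> \<le> sqrt (2 * real (Suc n))"
proof -
  have "(hermite_fun n x)\<^sup>2 \<le> (LINT y|lborel. (hermite_fun n y)\<^sup>2) + (LINT y|lborel. (hermite_deriv n y)\<^sup>2)"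
    by (intro square_le_integral hermite_fun_has_deriv continuous_hermite_deriv rapid_hermite_fun rapid_hermite_deriv)
  also have "\<dots> \<le> 2 * real (Suc n)" by (simp add: hermite_normalized hermite_deriv_normalized)
  finally have "sqrt ((hermite_fun n x)\<^sup>2) \<le> sqrt (2 * real (Suc n))" by (rule real_sqrt_le_mono)
  then show ?thesis by simp
qed

lemma hermite_fun_bound': "\<bar>hermite_fun n x\<bar> \<le> 2 * real (Suc n)"
proof -
  have "sqrt (2 * real (Suc n)) \<le> sqrt ((2 * real (Suc n))\<^sup>2)"
    by (intro real_sqrt_le_mono) (simp add: power2_eq_square)
  then show ?thesis using hermite_fun_bound[of n x] by simp
qed

lemma hermite_deriv_bound: "\<bar>hermite_deriv n x\<bar> \<le> 2 * real (Suc n)"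
proof -
  have 1: "sqrt (2 * real n) * \<bar>hermite_fun (n - 1) x\<bar> \<le> 2 * real n"
  proof (cases n)
    case (Suc m)
    have "sqrt (2 * real n) * \<bar>hermite_fun (n - 1) x\<bar> \<le> sqrt (2 * real n) * sqrt (2 * real n)"
      using hermite_fun_bound[of m x] Suc by (intro mult_left_mono) auto
    then show ?thesis by simp
  qed simp
  have "sqrt (2 * real (Suc n)) * \<bar>hermite_fun (Suc n) x\<bar> \<le> sqrt (2 * real (Suc n)) * sqrt (2 * real (Suc (Suc n)))"
    by (intro mult_left_mono hermite_fun_bound) auto
  also have "\<dots> \<le> sqrt (2 * real (Suc (Suc n))) * sqrt (2 * real (Suc (Suc n)))"
    by (intro mult_right_mono real_sqrt_le_mono) auto
  also have "\<dots> = 2 * real (Suc (Suc n))" by simp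
  finally have 2: "sqrt (2 * real (Suc n)) * \<bar>hermite_fun (Suc n) x\<bar> \<le> 2 * real (Suc (Suc n))" .
  have "\<bar>hermite_deriv n x\<bar> \<le> (sqrt (2 * real n) * \<bar>hermite_fun (n - 1) x\<bar> + sqrt (2 * real (Suc n)) * \<bar>hermite_fun (Suc n) x\<bar>) / 2"
    unfolding hermite_deriv_eq2
    using abs_triangle_ineq4[of "sqrt (2 * real n) * hermite_fun (n - 1) x" "sqrt (2 * real (Suc n)) * hermite_fun (Suc n) x"]
    by (simp add: abs_mult del: of_nat_Suc)
  also have "\<dots> \<le> (2 * real n + 2 * real (Suc (Suc n))) / 2" using 1 2 by simp
  finally show ?thesis by simp
qed

lemma hermite_fun_lipschitz: "\<bar>hermite_fun n x - hermite_fun n y\<bar> \<le> 2 * real (Suc n) * \<bar>x - y\<bar>"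
  using field_differentiable_bound[of UNIV "hermite_fun n" "hermite_deriv n" "2 * real (Suc n)" x y]
    hermite_fun_has_deriv hermite_deriv_bound by (simp add: has_field_derivative_at_within del: of_nat_Suc)

lemma continuous_AE_zero:
  fixes f :: "real \<Rightarrow> real"
  assumes "continuous_on UNIV f" "AE x in lborel. f x = 0"
  shows "f x = 0"
proof (rule ccontr)
  assume "f x \<noteq> 0"
  have o: "open {x. f x \<noteq> 0}"
    using open_Collect_neq[OF assms(1) continuous_on_const[of UNIV 0]] by simp
  have "f \<in> borel_measurable borel" using assms(1) by (rule borel_measurable_continuous_onI)
  then have "{x. f x \<noteq> 0} \<in> null_sets lborel"
    using assms(2) by (subst AE_iff_null_sets) auto
  then have "negligible {x. f x \<noteq> 0}"
    by (simp add: negligible_iff_null_sets null_sets_completionI)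
  with open_not_negligible[OF o] \<open>f x \<noteq> 0\<close> show False by auto
qed

lemma integral_gaussian_moments_zero:
  assumes meas: "f \<in> borel_measurable borel" and bd: "\<And>x. \<bar>f x\<bar> \<le> B"
    and z: "\<And>n. (LINT x|lborel. f x * hermite_fun n x) = 0"
  shows "(LINT x|lborel. f x * (x ^ k * exp (- x\<^sup>2 / 2))) = 0"
proof -
  have rk: "rapid (\<lambda>x. x ^ k * hermite_fun n x)" for k n
    by (induction k) (simp_all add: rapid_hermite_fun mult.assoc rapid_times)
  have int: "integrable lborel (\<lambda>x. f x * (x ^ k * hermite_fun n x))" for k n
    by (rule rapid_integrable[OF rapid_mult_bounded[OF rk bd]]) (use meas in measurable)
  have "(LINT x|lborel. f x * (x ^ k * hermite_fun n x)) = 0" for k n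
  proof (induction k arbitrary: n)
    case (Suc k)
    have "f x * (x ^ Suc k * hermite_fun n x) =
        sqrt (2 * real (Suc n)) / 2 * (f x * (x ^ k * hermite_fun (Suc n) x)) +
        sqrt (2 * real n) / 2 * (f x * (x ^ k * hermite_fun (n - 1) x))" for x
    proof -
      have "f x * (x ^ Suc k * hermite_fun n x) = f x * x ^ k * (2 * x * hermite_fun n x) / 2" by simp
      also have "\<dots> = sqrt (2 * real (Suc n)) / 2 * (f x * (x ^ k * hermite_fun (Suc n) x)) +
        sqrt (2 * real n) / 2 * (f x * (x ^ k * hermite_fun (n - 1) x))"
        unfolding hermite_fun_rec by (simp add: field_simps del: of_nat_Suc)
      finally show ?thesis .
    qed
    then show ?case using int Suc by (simp del: of_nat_Suc)
  qed (simp add: z)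
  from this[of k 0] have "(LINT x|lborel. (1 / hermite_norm 0) * (f x * (x ^ k * exp (- x\<^sup>2 / 2)))) = 0"
    by (simp add: hermite_fun_eq)
  then show ?thesis using hermite_norm_pos[of 0] by simp
qed

lemma gaussian_times_exp_le: "exp \<bar>t * x\<bar> * exp (- x\<^sup>2 / 2) \<le> exp (t\<^sup>2) * exp (- x\<^sup>2 / 4)" for t x :: real
proof -
  have "0 \<le> (\<bar>t\<bar> - \<bar>x\<bar> / 2)\<^sup>2" by simp
  then have "\<bar>t * x\<bar> \<le> t\<^sup>2 + x\<^sup>2 / 4" by (simp add: power2_diff abs_mult field_simps)
  then show ?thesis by (simp flip: exp_add)
qed

lemma integral_gaussian_fourier_zero:
  assumes meas: "f \<in> borel_measurable borel" and bd: "\<And>x. \<bar>f x\<bar> \<le> B"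
    and z: "\<And>k. (LINT x|lborel. f x * (x ^ k * exp (- x\<^sup>2 / 2))) = 0"
  shows "(CLINT x|lborel. complex_of_real (f x * exp (- x\<^sup>2 / 2)) * iexp (t * x)) = 0"
proof -
  let ?w = "\<lambda>x::real. exp (- x\<^sup>2 / 2)"
  define s where "s n x = (\<Sum>k<n. complex_of_real (f x * ?w x) * ((\<i> * complex_of_real (t * x)) ^ k /\<^sub>R fact k))" for n x
  have rk: "rapid (\<lambda>x. x ^ k * ?w x)" for k
    by (induction k) (simp_all add: rapid_gaussian[simplified] mult.assoc rapid_times)
  have int: "integrable lborel (\<lambda>x. f x * (x ^ k * ?w x))" for k
    by (rule rapid_integrable[OF rapid_mult_bounded[OF rk bd]]) (use meas in measurable)
  have B0: "0 \<le> B" using bd[of 0] by linarith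
  have "(\<lambda>n. LINT x|lborel. s n x) \<longlonglongrightarrow> (CLINT x|lborel. complex_of_real (f x * ?w x) * iexp (t * x))"
  proof (rule integral_dominated_convergence[where w="\<lambda>x. B * (exp (t\<^sup>2) * exp (- x\<^sup>2 / 4))"])
    have "integrable lborel (\<lambda>x::real. B * (exp (t\<^sup>2) * (sqrt (2 * pi * 2) * normal_density 0 (sqrt 2) x)))"
      by (intro integrable_mult_right) simp
    then show "integrable lborel (\<lambda>x. B * (exp (t\<^sup>2) * exp (- x\<^sup>2 / 4)))"
      by (simp add: normal_density_def)
    show "AE x in lborel. (\<lambda>n. s n x) \<longlonglongrightarrow> complex_of_real (f x * ?w x) * iexp (t * x)"
    proof (intro AE_I2)
      fix x
      have "(\<lambda>k. (\<i> * complex_of_real (t * x)) ^ k /\<^sub>R fact k) sums iexp (t * x)" by (rule exp_converges)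
      then have "(\<lambda>k. complex_of_real (f x * ?w x) * ((\<i> * complex_of_real (t * x)) ^ k /\<^sub>R fact k)) sums
        (complex_of_real (f x * ?w x) * iexp (t * x))" by (rule sums_mult)
      then show "(\<lambda>n. s n x) \<longlonglongrightarrow> complex_of_real (f x * ?w x) * iexp (t * x)" unfolding sums_def s_def .
    qed
    show "AE x in lborel. norm (s n x) \<le> B * (exp (t\<^sup>2) * exp (- x\<^sup>2 / 4))" for n
    proof (intro AE_I2)
      fix x
      have "norm (s n x) \<le> (\<Sum>k<n. \<bar>f x\<bar> * ?w x * (\<bar>t * x\<bar> ^ k /\<^sub>R fact k))"
        unfolding s_def by (rule sum_norm_le) (simp add: norm_mult norm_power abs_mult)
      also have "\<dots> = \<bar>f x\<bar> * (?w x * (\<Sum>k<n. \<bar>t * x\<bar> ^ k /\<^sub>R fact k))"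
        by (simp add: sum_distrib_left mult.assoc)
      also have "\<dots> \<le> B * (?w x * exp \<bar>t * x\<bar>)"
      proof (intro mult_mono mult_left_mono bd)
        show "(\<Sum>k<n. \<bar>t * x\<bar> ^ k /\<^sub>R fact k) \<le> exp \<bar>t * x\<bar>"
          unfolding exp_def by (intro sum_le_suminf summable_exp_generic) auto
      qed (auto intro!: mult_nonneg_nonneg sum_nonneg B0)
      also have "\<dots> \<le> B * (exp (t\<^sup>2) * exp (- x\<^sup>2 / 4))"
        using gaussian_times_exp_le[of t x] B0 by (intro mult_left_mono) (auto simp: mult.commute)
      finally show "norm (s n x) \<le> B * (exp (t\<^sup>2) * exp (- x\<^sup>2 / 4))" .
    qed
  qed (use meas in \<open>simp_all add: s_def\<close>)
  moreover have "(LINT x|lborel. s n x) = 0" for n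
  proof -
    have e: "complex_of_real (f x * ?w x) * ((\<i> * complex_of_real (t * x)) ^ k /\<^sub>R fact k) =
       ((\<i> * complex_of_real t) ^ k /\<^sub>R fact k) * complex_of_real (f x * (x ^ k * ?w x))" for k x
      by (simp add: power_mult_distrib scaleR_conv_of_real)
    have int': "integrable lborel (\<lambda>x. ((\<i> * complex_of_real t) ^ k /\<^sub>R fact k) * complex_of_real (f x * (x ^ k * ?w x)))" for k
      by (intro integrable_mult_right integrable_of_real int)
    show ?thesis unfolding s_def e
      by (simp only: Bochner_Integration.integral_sum[OF int'] integral_mult_right_zero integral_complex_of_real z) simp
  qed
  ultimately have "(\<lambda>n. 0) \<longlonglongrightarrow> (CLINT x|lborel. complex_of_real (f x * ?w x) * iexp (t * x))"
    by (simp only:)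
  then show ?thesis by (simp only: LIMSEQ_const_iff)
qed

lemma hermite_complete:
  assumes cont: "continuous_on UNIV f" and bd: "\<And>x. \<bar>f x\<bar> \<le> B"
    and z: "\<And>n. (LINT x|lborel. f x * hermite_fun n x) = 0"
  shows "f x = 0"
proof -
  define C where "C = max 1 B"
  have C: "C > 0" "\<And>x. \<bar>f x\<bar> \<le> C" using bd by (auto simp: C_def intro: max.coboundedI2)
  have meas [measurable]: "f \<in> borel_measurable borel" using cont by (rule borel_measurable_continuous_onI)
  let ?n = "std_normal_density"
  define g where "g x = ?n x * (1 + f x / C)" for x
  have g0: "0 \<le> g x" for x
    using C(2)[of x] C(1) normal_density_nonneg[of 0 1 x] unfolding g_def
    by (intro mult_nonneg_nonneg) (auto simp: abs_le_iff field_simps)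
  have gm [measurable]: "g \<in> borel_measurable borel" unfolding g_def[abs_def] by measurable
  have fn_int: "integrable lborel (\<lambda>x. ?n x * f x)"
    by (rule Bochner_Integration.integrable_bound[where f="\<lambda>x. C * ?n x"])
      (use C in \<open>auto simp: abs_mult mult.commute intro!: mult_mono AE_I2\<close>)
  have mom: "(LINT x|lborel. f x * (x ^ k * exp (- x\<^sup>2 / 2))) = 0" for k
    by (rule integral_gaussian_moments_zero[OF meas bd z])
  have g_eq: "g x = ?n x + (1 / C) * (?n x * f x)" for x by (simp add: g_def algebra_simps)
  have g_int: "integrable lborel g" unfolding g_eq[abs_def]
    using fn_int by (intro Bochner_Integration.integrable_add integrable_mult_right) auto
  have nf: "(LINT x|lborel. ?n x * f x) = 0"
  proof -
    have "(LINT x|lborel. ?n x * f x) = (LINT x|lborel. (1 / sqrt (2 * pi)) * (f x * (x ^ 0 * exp (- x\<^sup>2 / 2))))"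
      by (intro Bochner_Integration.integral_cong refl) (simp add: std_normal_density_def)
    then show ?thesis unfolding integral_mult_right_zero mom by simp
  qed
  have g1: "(LINT x|lborel. g x) = 1" unfolding g_eq[abs_def] using fn_int nf by simp
  have "(\<integral>\<^sup>+x. ennreal (g x) \<partial>lborel) = 1"
    using g_int g1 g0 by (subst nn_integral_eq_integral) auto
  then have pg: "prob_space (density lborel g)"
    by (intro prob_spaceI) (simp add: emeasure_density)
  have rg: "real_distribution (density lborel g)"
    using pg by (simp add: real_distribution_def real_distribution_axioms_def)
  have rn: "real_distribution (density lborel ?n)"
    using prob_space_normal_density[of 1 0] by (simp add: real_distribution_def real_distribution_axioms_def)
  have "char (density lborel g) t = char (density lborel ?n) t" for t
  proof -
    have i1: "integrable lborel (\<lambda>x. complex_of_real (?n x) * iexp (t * x))"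
      by (rule Bochner_Integration.integrable_bound[where f="?n"]) (auto simp: norm_mult)
    have i2: "integrable lborel (\<lambda>x. complex_of_real (?n x * f x) * iexp (t * x))"
      by (rule Bochner_Integration.integrable_bound[OF fn_int]) (auto simp: norm_mult)
    have "char (density lborel g) t = (CLINT x|lborel. g x *\<^sub>R iexp (t * x))"
      unfolding char_def by (subst integral_density) (auto simp: g0)
    also have "\<dots> = (CLINT x|lborel. complex_of_real (?n x) * iexp (t * x) + complex_of_real (1 / C) * (complex_of_real (?n x * f x) * iexp (t * x)))"
      by (intro Bochner_Integration.integral_cong refl) (simp add: g_eq scaleR_conv_of_real algebra_simps)
    also have "\<dots> = (CLINT x|lborel. complex_of_real (?n x) * iexp (t * x)) + complex_of_real (1 / C) * (CLINT x|lborel. complex_of_real (?n x * f x) * iexp (t * x))"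
      using i1 i2 by (subst Bochner_Integration.integral_add) (auto intro: integrable_mult_right)
    also have "(CLINT x|lborel. complex_of_real (?n x * f x) * iexp (t * x)) =
        (CLINT x|lborel. complex_of_real (1 / sqrt (2 * pi)) * (complex_of_real (f x * exp (- x\<^sup>2 / 2)) * iexp (t * x)))"
      by (intro Bochner_Integration.integral_cong refl) (simp add: std_normal_density_def)
    also have "\<dots> = 0" unfolding integral_mult_right_zero integral_gaussian_fourier_zero[OF meas bd mom] by simp
    also have "(CLINT x|lborel. complex_of_real (?n x) * iexp (t * x)) = char (density lborel ?n) t"
      unfolding char_def by (subst integral_density) (auto simp: scaleR_conv_of_real)
    finally show ?thesis by simp
  qed
  then have "density lborel g = density lborel ?n" by (intro Levy_uniqueness rg rn ext)
  then have "AE x in lborel. ennreal (g x) = ennreal (?n x)"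
    by (subst (asm) sigma_finite_measure.density_unique_iff[OF sigma_finite_lborel]) auto
  then have "AE x in lborel. f x = 0"
  proof eventually_elim
    case (elim x)
    then have "g x = ?n x" using g0 by simp
    then show ?case using C(1) normal_density_pos[of 1 0 x] by (simp add: g_def)
  qed
  then show ?thesis using cont continuous_AE_zero by blast
qed

lemma lborel_product:
  fixes f g :: "real \<Rightarrow> real"
  assumes "integrable lborel f" "integrable lborel g"
  shows lborel_product_integrable: "integrable (lborel \<Otimes>\<^sub>M lborel) (\<lambda>z. f (fst z) * g (snd z))"
    and lborel_product_integral: "(LINT z|(lborel \<Otimes>\<^sub>M lborel). f (fst z) * g (snd z)) = (LINT x|lborel. f x) * (LINT x|lborel. g x)"
proof -
  have [measurable]: "f \<in> borel_measurable borel" "g \<in> borel_measurable borel" using assms by auto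
  show i: "integrable (lborel \<Otimes>\<^sub>M lborel) (\<lambda>z. f (fst z) * g (snd z))"
  proof (rule lborel_pair.Fubini_integrable)
    show "integrable lborel (\<lambda>x. LINT y|lborel. norm (f (fst (x, y)) * g (snd (x, y))))"
      using assms by (simp add: abs_mult)
  qed (use assms in \<open>auto intro!: AE_I2\<close>)
  show "(LINT z|(lborel \<Otimes>\<^sub>M lborel). f (fst z) * g (snd z)) = (LINT x|lborel. f x) * (LINT x|lborel. g x)"
    using lborel_pair.integral_fst'[OF i] by simp
qed

lemma hermite_complete_plane:
  fixes f :: "real \<times> real \<Rightarrow> real"
  assumes cont: "continuous_on UNIV f" and bd: "\<And>z. \<bar>f z\<bar> \<le> B"
    and z: "\<And>m n. (LINT z|lborel. f z * (hermite_fun m (fst z) * hermite_fun n (snd z))) = 0"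
  shows "f (x, y) = 0"
proof -
  have meas [measurable]: "f \<in> borel_measurable borel" using cont by (rule borel_measurable_continuous_onI)
  have meas2 [measurable]: "f \<in> borel_measurable (borel \<Otimes>\<^sub>M borel)" using meas unfolding borel_prod .
  have B0: "0 \<le> B" using bd[of 0] by linarith
  define a where "a n x = (LINT y|lborel. f (x, y) * hermite_fun n y)" for n x
  have h1: "integrable lborel (\<lambda>y. B * \<bar>hermite_fun n y\<bar>)" for n
    using integrable_hermite_fun by (intro integrable_mult_right integrable_abs)
  have ib: "norm (f (x, y) * hermite_fun n y) \<le> B * \<bar>hermite_fun n y\<bar>" for x y n
    using bd by (auto simp: abs_mult intro!: mult_right_mono)
  have a_int: "integrable lborel (\<lambda>y. f (x, y) * hermite_fun n y)" for x n
    by (rule Bochner_Integration.integrable_bound[OF h1[of n]]) (use order_trans[OF ib abs_ge_self] in \<open>auto intro!: AE_I2\<close>)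
  have a_cont: "continuous_on UNIV (a n)" for n
    unfolding continuous_on_sequentially
  proof (intro allI ballI impI)
    fix u :: "nat \<Rightarrow> real" and l assume "(\<forall>n. u n \<in> UNIV) \<and> u \<longlonglongrightarrow> l"
    then have u: "u \<longlonglongrightarrow> l" by simp
    show "(a n \<circ> u) \<longlonglongrightarrow> a n l"
      unfolding a_def o_def
    proof (rule integral_dominated_convergence[OF _ _ h1[of n]])
      show "AE y in lborel. (\<lambda>i. f (u i, y) * hermite_fun n y) \<longlonglongrightarrow> f (l, y) * hermite_fun n y"
        using u by (intro AE_I2 tendsto_intros continuous_on_tendsto_compose[OF cont]) auto
    qed (use ib in \<open>auto intro!: AE_I2\<close>)
  qed
  have "norm (a n x) \<le> (LINT y|lborel. B * \<bar>hermite_fun n y\<bar>)" for n x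
    unfolding a_def
    by (rule order_trans[OF integral_norm_bound]) (intro integral_mono integrable_norm a_int h1 ib)
  note a_bd = this[unfolded real_norm_def]
  have "a n x = 0" for n x
  proof (rule hermite_complete[OF a_cont a_bd])
    fix m
    have int: "integrable (lborel \<Otimes>\<^sub>M lborel) (\<lambda>z. hermite_fun m (fst z) * hermite_fun n (snd z))"
      by (rule lborel_product_integrable) (rule integrable_hermite_fun)+
    have "integrable (lborel \<Otimes>\<^sub>M lborel) (\<lambda>z. f z * (hermite_fun m (fst z) * hermite_fun n (snd z)))"
    proof (rule Bochner_Integration.integrable_bound)
      show "integrable (lborel \<Otimes>\<^sub>M lborel) (\<lambda>z. B * (hermite_fun m (fst z) * hermite_fun n (snd z)))"
        using int by simp
      show "AE z in lborel \<Otimes>\<^sub>M lborel. norm (f z * (hermite_fun m (fst z) * hermite_fun n (snd z)))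
          \<le> norm (B * (hermite_fun m (fst z) * hermite_fun n (snd z)))"
        using bd B0 by (intro AE_I2) (auto simp: abs_mult intro!: mult_right_mono)
    qed measurable
    then have "(LINT x|lborel. LINT y|lborel. f (x, y) * (hermite_fun m x * hermite_fun n y)) =
       (LINT z|(lborel \<Otimes>\<^sub>M lborel). f z * (hermite_fun m (fst z) * hermite_fun n (snd z)))"
      by (subst lborel_pair.integral_fst'[symmetric]) auto
    also have "\<dots> = 0" using z[of m n] by (simp add: lborel_prod)
    finally show "(LINT x|lborel. a n x * hermite_fun m x) = 0"
      unfolding a_def integral_mult_left_zero[symmetric] by (simp add: mult_ac)
  qed
  then have "(LINT y|lborel. f (x, y) * hermite_fun n y) = 0" for n by (simp add: a_def)
  moreover have "continuous_on UNIV (\<lambda>y. f (x, y))"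
    by (rule continuous_on_compose2[OF cont]) (auto intro!: continuous_intros)
  ultimately show ?thesis using hermite_complete[of "\<lambda>y. f (x, y)" B y] bd by blast
qed

section \<open>Hermite expansions of Schwartz functions\<close>

definition schwartz_family :: "(nat \<Rightarrow> nat \<Rightarrow> pfun) \<Rightarrow> bool" where
  "schwartz_family D \<longleftrightarrow>
     (\<forall>i j z. (D i j has_derivative
        (\<lambda>h. fst h * D (Suc i) j z + snd h * D i (Suc j) z)) (at z)) \<and>
     (\<forall>i j k l. \<exists>B. \<forall>x y. \<bar>x ^ k * y ^ l * D i j (x, y)\<bar> \<le> B)"

lemma schwartz_iff: "\<phi> \<in> schwartz \<longleftrightarrow> (\<exists>D. D 0 0 = \<phi> \<and> schwartz_family D)"
  unfolding schwartz_def schwartz_family_def by blast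

lemma schwartz_familyD:
  "schwartz_family D \<Longrightarrow> (D i j has_derivative (\<lambda>h. fst h * D (Suc i) j z + snd h * D i (Suc j) z)) (at z)"
  "schwartz_family D \<Longrightarrow> \<exists>B. \<forall>x y. \<bar>x ^ k * y ^ l * D i j (x, y)\<bar> \<le> B"
  unfolding schwartz_family_def by blast+

lemma schwartz_family_shift:
  assumes "schwartz_family D" shows "schwartz_family (\<lambda>i j. D (i + m) (j + n))"
  unfolding schwartz_family_def
  using schwartz_familyD(1)[OF assms, of "_ + m" "_ + n"] schwartz_familyD(2)[OF assms] by simp

lemma schwartz_family_lin:
  assumes D: "schwartz_family D" and E: "schwartz_family E"
  shows "schwartz_family (\<lambda>i j z. a * D i j z + b * E i j z)"
  unfolding schwartz_family_def
proof (intro conjI allI)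
  fix i j z
  show "((\<lambda>z. a * D i j z + b * E i j z) has_derivative
    (\<lambda>h. fst h * (a * D (Suc i) j z + b * E (Suc i) j z) + snd h * (a * D i (Suc j) z + b * E i (Suc j) z))) (at z)"
    by (rule derivative_eq_intros schwartz_familyD(1)[OF D] schwartz_familyD(1)[OF E] refl | simp add: algebra_simps)+
next
  fix i j k l
  obtain A B where AB: "\<And>x y. \<bar>x ^ k * y ^ l * D i j (x, y)\<bar> \<le> A" "\<And>x y. \<bar>x ^ k * y ^ l * E i j (x, y)\<bar> \<le> B"
    using schwartz_familyD(2)[OF D] schwartz_familyD(2)[OF E] by metis
  have "\<bar>x ^ k * y ^ l * (a * D i j (x, y) + b * E i j (x, y))\<bar> \<le> \<bar>a\<bar> * A + \<bar>b\<bar> * B" for x y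
  proof -
    have "\<bar>x ^ k * y ^ l * (a * D i j (x, y) + b * E i j (x, y))\<bar> =
        \<bar>a * (x ^ k * y ^ l * D i j (x, y)) + b * (x ^ k * y ^ l * E i j (x, y))\<bar>"
      by (simp add: algebra_simps)
    also have "\<dots> \<le> \<bar>a\<bar> * \<bar>x ^ k * y ^ l * D i j (x, y)\<bar> + \<bar>b\<bar> * \<bar>x ^ k * y ^ l * E i j (x, y)\<bar>"
      using abs_triangle_ineq[of "a * (x ^ k * y ^ l * D i j (x, y))" "b * (x ^ k * y ^ l * E i j (x, y))"]
      by (simp only: abs_mult)
    also have "\<dots> \<le> \<bar>a\<bar> * A + \<bar>b\<bar> * B" by (intro add_mono mult_left_mono AB) auto
    finally show ?thesis .
  qed
  then show "\<exists>B. \<forall>x y. \<bar>x ^ k * y ^ l * (a * D i j (x, y) + b * E i j (x, y))\<bar> \<le> B" by blast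
qed

lemma schwartz_family_times_fst:
  assumes D: "schwartz_family D"
  shows "schwartz_family (\<lambda>i j z. fst z * D i j z + real i * D (i - 1) j z)"
  unfolding schwartz_family_def
proof (intro conjI allI)
  fix i j z
  show "((\<lambda>z. fst z * D i j z + real i * D (i - 1) j z) has_derivative
    (\<lambda>h. fst h * (fst z * D (Suc i) j z + real (Suc i) * D (Suc i - 1) j z) +
      snd h * (fst z * D i (Suc j) z + real i * D (i - 1) (Suc j) z))) (at z)"
    by (cases i; (rule derivative_eq_intros schwartz_familyD(1)[OF D] refl | simp add: algebra_simps)+)
next
  fix i j k l
  obtain A B where AB: "\<And>x y. \<bar>x ^ Suc k * y ^ l * D i j (x, y)\<bar> \<le> A" "\<And>x y. \<bar>x ^ k * y ^ l * D (i - 1) j (x, y)\<bar> \<le> B"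
    using schwartz_familyD(2)[OF D] by metis
  have "\<bar>x ^ k * y ^ l * (fst (x, y) * D i j (x, y) + real i * D (i - 1) j (x, y))\<bar> \<le> A + real i * B" for x y
  proof -
    have "\<bar>x ^ k * y ^ l * (fst (x, y) * D i j (x, y) + real i * D (i - 1) j (x, y))\<bar> =
        \<bar>x ^ Suc k * y ^ l * D i j (x, y) + real i * (x ^ k * y ^ l * D (i - 1) j (x, y))\<bar>"
      by (simp add: algebra_simps)
    also have "\<dots> \<le> \<bar>x ^ Suc k * y ^ l * D i j (x, y)\<bar> + real i * \<bar>x ^ k * y ^ l * D (i - 1) j (x, y)\<bar>"
      using abs_triangle_ineq[of "x ^ Suc k * y ^ l * D i j (x, y)" "real i * (x ^ k * y ^ l * D (i - 1) j (x, y))"]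
      by (simp only: abs_mult[of "real i"] abs_of_nat)
    also have "\<dots> \<le> A + real i * B" by (intro add_mono mult_left_mono AB) auto
    finally show ?thesis .
  qed
  then show "\<exists>B. \<forall>x y. \<bar>x ^ k * y ^ l * (fst (x, y) * D i j (x, y) + real i * D (i - 1) j (x, y))\<bar> \<le> B" by blast
qed

lemma schwartz_family_swap:
  assumes D: "schwartz_family D"
  shows "schwartz_family (\<lambda>i j z. D j i (snd z, fst z))"
  unfolding schwartz_family_def
proof (intro conjI allI)
  fix i j z
  have "((\<lambda>z. D j i (snd z, fst z)) has_derivative (\<lambda>h. fst (snd h, fst h) * D (Suc j) i (snd z, fst z) +
     snd (snd h, fst h) * D j (Suc i) (snd z, fst z))) (at z)"
    by (rule has_derivative_compose[where f="\<lambda>z. (snd z, fst z)" and g="D j i", OF _ schwartz_familyD(1)[OF D]])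
      (auto intro!: derivative_eq_intros)
  then show "((\<lambda>z. D j i (snd z, fst z)) has_derivative (\<lambda>h. fst h * D j (Suc i) (snd z, fst z) +
      snd h * D (Suc j) i (snd z, fst z))) (at z)"
    by (simp add: add.commute)
next
  fix i j k l
  obtain B where B: "\<And>x y. \<bar>x ^ l * y ^ k * D j i (x, y)\<bar> \<le> B"
    using schwartz_familyD(2)[OF D] by metis
  have "\<bar>x ^ k * y ^ l * D j i (snd (x, y), fst (x, y))\<bar> \<le> B" for x y using B[of y x] by (simp add: mult_ac)
  then show "\<exists>B. \<forall>x y. \<bar>x ^ k * y ^ l * D j i (snd (x, y), fst (x, y))\<bar> \<le> B" by blast
qed

lemma schwartz_lin: "\<phi> \<in> schwartz \<Longrightarrow> \<psi> \<in> schwartz \<Longrightarrow> (\<lambda>z. a * \<phi> z + b * \<psi> z) \<in> schwartz"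
  unfolding schwartz_iff
proof (elim exE conjE)
  fix D E assume "D 0 0 = \<phi>" "schwartz_family D" "E 0 0 = \<psi>" "schwartz_family E"
  then show "\<exists>D. D 0 0 = (\<lambda>z. a * \<phi> z + b * \<psi> z) \<and> schwartz_family D"
    by (intro exI[of _ "\<lambda>i j z. a * D i j z + b * E i j z"] conjI schwartz_family_lin) auto
qed

lemma schwartz_swap: "\<phi> \<in> schwartz \<Longrightarrow> (\<lambda>z. \<phi> (snd z, fst z)) \<in> schwartz"
  unfolding schwartz_iff
proof (elim exE conjE)
  fix D assume "D 0 0 = \<phi>" "schwartz_family D"
  then show "\<exists>D. D 0 0 = (\<lambda>z. \<phi> (snd z, fst z)) \<and> schwartz_family D"
    by (intro exI[of _ "\<lambda>i j z. D j i (snd z, fst z)"] conjI schwartz_family_swap) auto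
qed

lemma schwartz_times_fst: assumes "\<phi> \<in> schwartz" shows "(\<lambda>z. fst z * \<phi> z) \<in> schwartz"
proof -
  obtain D where "D 0 0 = \<phi>" "schwartz_family D" using assms unfolding schwartz_iff by blast
  then show ?thesis unfolding schwartz_iff
    by (intro exI[of _ "\<lambda>i j z. fst z * D i j z + real i * D (i - 1) j z"] conjI schwartz_family_times_fst) auto
qed

lemma schwartz_family_mem: assumes "schwartz_family D" shows "D i j \<in> schwartz"
  unfolding schwartz_iff using schwartz_family_shift[OF assms, of i j]
  by (intro exI[of _ "\<lambda>i' j'. D (i' + i) (j' + j)"]) auto

lemma schwartz_zero: "(\<lambda>z. 0) \<in> schwartz"
  unfolding schwartz_iff by (intro exI[of _ "\<lambda>_ _ _. 0"]) (auto simp: schwartz_family_def)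

lemma schwartz_continuous: assumes "\<phi> \<in> schwartz" shows "continuous_on S \<phi>"
proof -
  obtain D where "D 0 0 = \<phi>" "schwartz_family D" using assms unfolding schwartz_iff by blast
  then have "isCont \<phi> z" for z using schwartz_familyD(1)[of D 0 0 z] has_derivative_continuous by blast
  then show ?thesis by (simp add: continuous_at_imp_continuous_on)
qed

lemma schwartz_measurable: "\<phi> \<in> schwartz \<Longrightarrow> \<phi> \<in> borel_measurable borel"
  by (intro borel_measurable_continuous_onI schwartz_continuous)

lemma schwartz_moment_bounded:
  assumes "\<phi> \<in> schwartz" shows "\<exists>B. \<forall>x y. \<bar>x ^ k * y ^ l * \<phi> (x, y)\<bar> \<le> B"
  using assms schwartz_familyD(2) unfolding schwartz_iff by blast

lemma schwartz_bounded: "\<phi> \<in> schwartz \<Longrightarrow> \<exists>B. \<forall>z. \<bar>\<phi> z\<bar> \<le> B"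
  using schwartz_moment_bounded[of \<phi> 0 0] by auto

lemma schwartz_rapid: "\<phi> \<in> schwartz \<Longrightarrow> rapid (\<lambda>x. \<phi> (x, y))"
  unfolding rapid_def using schwartz_moment_bounded[of \<phi> _ 0] by simp meson

lemma schwartz_integrable:
  assumes "\<phi> \<in> schwartz" shows "integrable lborel \<phi>"
proof -
  obtain A B C E where A: "\<And>x y. \<bar>x ^ 0 * y ^ 0 * \<phi> (x, y)\<bar> \<le> A" and B: "\<And>x y. \<bar>x ^ 2 * y ^ 0 * \<phi> (x, y)\<bar> \<le> B"
    and C: "\<And>x y. \<bar>x ^ 0 * y ^ 2 * \<phi> (x, y)\<bar> \<le> C" and E: "\<And>x y. \<bar>x ^ 2 * y ^ 2 * \<phi> (x, y)\<bar> \<le> E"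
    using schwartz_moment_bounded[OF assms] by metis
  have bd: "\<bar>\<phi> z\<bar> \<le> (A + B + C + E) * (inverse (1 + (fst z)\<^sup>2) * inverse (1 + (snd z)\<^sup>2))" for z
  proof (cases z)
    case (Pair x y)
    have "\<bar>\<phi> z\<bar> * ((1 + x\<^sup>2) * (1 + y\<^sup>2)) =
      \<bar>\<phi> (x, y)\<bar> + \<bar>x\<^sup>2 * \<phi> (x, y)\<bar> + \<bar>y\<^sup>2 * \<phi> (x, y)\<bar> + \<bar>x\<^sup>2 * y\<^sup>2 * \<phi> (x, y)\<bar>"
      by (simp add: Pair abs_mult algebra_simps)
    also have "\<dots> \<le> A + B + C + E" using A[of x y] B[of x y] C[of x y] E[of x y] by simp
    finally have "\<bar>\<phi> z\<bar> \<le> (A + B + C + E) / ((1 + x\<^sup>2) * (1 + y\<^sup>2))"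
      using add_pos_nonneg[OF zero_less_one zero_le_power2[of x]] add_pos_nonneg[OF zero_less_one zero_le_power2[of y]]
      by (subst pos_le_divide_eq) auto
    then show ?thesis by (simp add: Pair divide_inverse)
  qed
  have "integrable (lborel \<Otimes>\<^sub>M lborel) (\<lambda>z. (A + B + C + E) * (inverse (1 + (fst z)\<^sup>2) * inverse (1 + (snd z :: real)\<^sup>2)))"
    by (intro integrable_mult_right lborel_product_integrable integrable_inverse_one_plus_square)
  then have "integrable lborel (\<lambda>z. (A + B + C + E) * (inverse (1 + (fst z)\<^sup>2) * inverse (1 + (snd z :: real)\<^sup>2)))"
    by (simp add: lborel_prod)
  then show ?thesis
    by (rule Bochner_Integration.integrable_bound)
      (use schwartz_measurable[OF assms] order_trans[OF bd abs_ge_self] in auto)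
qed

lemma schwartz_coeff_integrable:
  assumes "\<phi> \<in> schwartz"
  shows "integrable lborel (\<lambda>z. \<phi> z * (hermite_fun m (fst z) * hermite_fun n (snd z)))"
proof (rule Bochner_Integration.integrable_bound)
  show "integrable lborel (\<lambda>z. (2 * real (Suc m) * (2 * real (Suc n))) * \<phi> z)"
    using schwartz_integrable[OF assms] by (rule integrable_mult_right)
  have [measurable]: "\<phi> \<in> borel_measurable borel" by (rule schwartz_measurable[OF assms])
  have "\<phi> \<in> borel_measurable (borel \<Otimes>\<^sub>M borel)" by (simp add: borel_prod)
  then have "(\<lambda>z. \<phi> z * (hermite_fun m (fst z) * hermite_fun n (snd z))) \<in> borel_measurable (borel \<Otimes>\<^sub>M borel)" by measurable
  then show "(\<lambda>z. \<phi> z * (hermite_fun m (fst z) * hermite_fun n (snd z))) \<in> borel_measurable lborel" by (simp add: borel_prod)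
  have "\<bar>\<phi> z\<bar> * (\<bar>hermite_fun m (fst z)\<bar> * \<bar>hermite_fun n (snd z)\<bar>) \<le> \<bar>\<phi> z\<bar> * (2 * real (Suc m) * (2 * real (Suc n)))" for z
    by (intro mult_left_mono mult_mono hermite_fun_bound') auto
  then show "AE z in lborel. norm (\<phi> z * (hermite_fun m (fst z) * hermite_fun n (snd z)))
      \<le> norm ((2 * real (Suc m) * (2 * real (Suc n))) * \<phi> z)"
    by (intro AE_I2) (simp add: abs_mult mult.commute del: of_nat_Suc)
qed

lemma hermite_coeff_bound:
  assumes "\<phi> \<in> schwartz"
  shows "\<bar>hermite_coeff \<phi> (m, n)\<bar> \<le> 4 * (LINT z|lborel. \<bar>\<phi> z\<bar>) * (real (Suc m) * real (Suc n))"
proof -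
  have le: "\<bar>\<phi> z\<bar> * (\<bar>hermite_fun m (fst z)\<bar> * \<bar>hermite_fun n (snd z)\<bar>) \<le> \<bar>\<phi> z\<bar> * (2 * real (Suc m) * (2 * real (Suc n)))" for z
    by (intro mult_left_mono mult_mono hermite_fun_bound') auto
  have "\<bar>hermite_coeff \<phi> (m, n)\<bar> \<le> (LINT z|lborel. norm (\<phi> z * (hermite_fun m (fst z) * hermite_fun n (snd z))))"
    unfolding hermite_coeff_def fst_conv snd_conv
    using integral_norm_bound[of lborel "\<lambda>z. \<phi> z * (hermite_fun m (fst z) * hermite_fun n (snd z))"] by simp
  also have "\<dots> \<le> (LINT z|lborel. \<bar>\<phi> z\<bar> * (2 * real (Suc m) * (2 * real (Suc n))))"
    by (intro integral_mono integrable_norm schwartz_coeff_integrable assms integrable_mult_left integrable_abs schwartz_integrable)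
      (use le in \<open>simp add: abs_mult\<close>)
  also have "\<dots> = 4 * (LINT z|lborel. \<bar>\<phi> z\<bar>) * (real (Suc m) * real (Suc n))"
    unfolding integral_mult_left_zero by (simp add: algebra_simps)
  finally show ?thesis .
qed

lemma hermite_coeff_lin:
  assumes "\<phi> \<in> schwartz" "\<psi> \<in> schwartz"
  shows "hermite_coeff (\<lambda>z. a * \<phi> z + b * \<psi> z) \<alpha> = a * hermite_coeff \<phi> \<alpha> + b * hermite_coeff \<psi> \<alpha>"
  unfolding hermite_coeff_def
  using schwartz_coeff_integrable[OF assms(1), of "fst \<alpha>" "snd \<alpha>"] schwartz_coeff_integrable[OF assms(2), of "fst \<alpha>" "snd \<alpha>"]
  by (simp add: distrib_right mult.assoc)

lemma hermite_coeff_swap: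
  assumes "\<phi> \<in> schwartz"
  shows "hermite_coeff (\<lambda>z. \<phi> (snd z, fst z)) (m, n) = hermite_coeff \<phi> (n, m)"
proof -
  have "(\<lambda>z. \<phi> z * (hermite_fun n (fst z) * hermite_fun m (snd z))) \<in> borel_measurable (lborel \<Otimes>\<^sub>M lborel)"
    using schwartz_coeff_integrable[OF assms, of n m] by (simp add: lborel_prod)
  from lborel_pair.integral_product_swap[OF this] show ?thesis
    unfolding hermite_coeff_def by (simp add: lborel_prod split_beta' mult_ac)
qed

lemma hermite_oscillator:
  assumes f: "\<And>x. (f has_real_derivative f' x) (at x)" "\<And>x. (f' has_real_derivative f'' x) (at x)"
    and r: "rapid f" "rapid f'" "rapid f''" and c: "continuous_on UNIV f''"
  shows "(LINT x|lborel. (x\<^sup>2 * f x - f'' x) * hermite_fun n x) = real (2 * n + 1) * (LINT x|lborel. f x * hermite_fun n x)"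
proof -
  have fc: "continuous_on UNIV f" using f(1) by (meson DERIV_continuous continuous_at_imp_continuous_on)
  have [measurable]: "f \<in> borel_measurable borel" "f'' \<in> borel_measurable borel"
    using fc c by (auto intro: borel_measurable_continuous_onI)
  have r2: "rapid (\<lambda>x. x\<^sup>2 * f x - f'' x)"
    using rapid_diff[OF rapid_times[OF rapid_times[OF r(1)]] r(3)] by (simp add: power2_eq_square mult.assoc)
  have i1: "integrable lborel (\<lambda>x. (x\<^sup>2 * f x - f'' x) * hermite_fun n x)"
    by (intro rapid_integrable rapid_mult r2 rapid_hermite_fun) simp
  have i2: "integrable lborel (\<lambda>x. f x * hermite_fun n x)"
    by (intro rapid_integrable rapid_mult r rapid_hermite_fun) simp
  have "(LINT x|lborel. (x\<^sup>2 * f x - f'' x) * hermite_fun n x - real (2 * n + 1) * (f x * hermite_fun n x)) = 0"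
  proof (rule integral_deriv_rapid)
    show "((\<lambda>x. f x * hermite_deriv n x - f' x * hermite_fun n x) has_real_derivative
      (x\<^sup>2 * f x - f'' x) * hermite_fun n x - real (2 * n + 1) * (f x * hermite_fun n x)) (at x)" for x
    proof -
      have "((\<lambda>x. f x * hermite_deriv n x - f' x * hermite_fun n x) has_real_derivative
        (f' x * hermite_deriv n x + (x\<^sup>2 - real (2 * n + 1)) * hermite_fun n x * f x) -
        (f'' x * hermite_fun n x + hermite_deriv n x * f' x)) (at x)"
        by (intro DERIV_diff DERIV_mult f hermite_fun_has_deriv hermite_deriv_has_deriv)
      then show ?thesis by (simp add: algebra_simps)
    qed
    show "rapid (\<lambda>x. f x * hermite_deriv n x - f' x * hermite_fun n x)"
      by (intro rapid_diff rapid_mult r rapid_hermite_fun rapid_hermite_deriv)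
    show "continuous_on UNIV (\<lambda>x. (x\<^sup>2 * f x - f'' x) * hermite_fun n x - real (2 * n + 1) * (f x * hermite_fun n x))"
      by (intro continuous_intros fc c continuous_hermite_fun)
    show "integrable lborel (\<lambda>x. (x\<^sup>2 * f x - f'' x) * hermite_fun n x - real (2 * n + 1) * (f x * hermite_fun n x))"
      using i1 i2 by (intro Bochner_Integration.integrable_diff integrable_mult_right)
  qed
  then show ?thesis using i1 i2 by simp
qed

lemma schwartz_oscillator_fst:
  assumes "\<phi> \<in> schwartz"
  shows "\<exists>\<psi>\<in>schwartz. \<forall>m n. hermite_coeff \<psi> (m, n) = real (2 * m + 1) * hermite_coeff \<phi> (m, n)"
proof -
  obtain D where D: "D 0 0 = \<phi>" "schwartz_family D" using assms unfolding schwartz_iff by blast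
  define \<psi> where "\<psi> z = 1 * (fst z * (fst z * \<phi> z)) + (-1) * D (Suc (Suc 0)) 0 z" for z
  have \<psi>: "\<psi> \<in> schwartz"
    unfolding \<psi>_def[abs_def] by (intro schwartz_lin schwartz_times_fst assms schwartz_family_mem D)
  have int: "integrable (lborel \<Otimes>\<^sub>M lborel) (case_prod (\<lambda>x y. \<theta> (x, y) * (hermite_fun m x * hermite_fun n y)))"
    if "\<theta> \<in> schwartz" for \<theta> m n
    using schwartz_coeff_integrable[OF that, of m n] by (simp add: lborel_prod split_beta')
  have co: "hermite_coeff \<theta> (m, n) = (LINT y|lborel. (LINT x|lborel. \<theta> (x, y) * hermite_fun m x) * hermite_fun n y)"
    if "\<theta> \<in> schwartz" for \<theta> m n
    using lborel_pair.integral_snd[OF int[OF that, of m n]]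
    unfolding hermite_coeff_def by (simp add: lborel_prod split_beta' integral_mult_left_zero[symmetric] mult.assoc del: integral_mult_left_zero)
  have pd: "((\<lambda>x. D i 0 (x, y)) has_real_derivative D (Suc i) 0 (x, y)) (at x)" for i x y
  proof -
    have "((\<lambda>x. (x, y)) has_derivative (\<lambda>h. (h, 0))) (at x)" by (auto intro!: derivative_eq_intros)
    from has_derivative_compose[OF this schwartz_familyD(1)[OF D(2), of i 0]]
    have "((\<lambda>x. D i 0 (x, y)) has_derivative (\<lambda>h. h * D (Suc i) 0 (x, y))) (at x)" by simp
    then show ?thesis by (simp add: has_field_derivative_def mult_commute_abs)
  qed
  have "(LINT x|lborel. \<psi> (x, y) * hermite_fun m x) = real (2 * m + 1) * (LINT x|lborel. \<phi> (x, y) * hermite_fun m x)" for m y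
  proof -
    have "(LINT x|lborel. (x\<^sup>2 * D 0 0 (x, y) - D (Suc (Suc 0)) 0 (x, y)) * hermite_fun m x) =
        real (2 * m + 1) * (LINT x|lborel. D 0 0 (x, y) * hermite_fun m x)"
    proof (rule hermite_oscillator)
      show "continuous_on UNIV (\<lambda>x. D (Suc (Suc 0)) 0 (x, y))"
        by (rule continuous_on_compose2[OF schwartz_continuous[OF schwartz_family_mem[OF D(2)], of UNIV]])
          (auto intro!: continuous_intros)
    qed (rule pd schwartz_rapid schwartz_family_mem D)+
    then show ?thesis by (simp add: \<psi>_def D(1) power2_eq_square mult.assoc)
  qed
  then show ?thesis using \<psi> assms by (intro bexI[of _ \<psi>]) (auto simp: co mult.assoc)
qed

lemma schwartz_oscillator:
  assumes "\<phi> \<in> schwartz"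
  shows "\<exists>\<psi>\<in>schwartz. \<forall>m n. hermite_coeff \<psi> (m, n) = (real (2 * m + 1) * real (2 * n + 1)) ^ k * hermite_coeff \<phi> (m, n)"
proof (induction k)
  case (Suc k)
  then obtain \<psi> where 1: "\<psi> \<in> schwartz" "\<And>m n. hermite_coeff \<psi> (m, n) = (real (2 * m + 1) * real (2 * n + 1)) ^ k * hermite_coeff \<phi> (m, n)"
    by blast
  obtain \<psi>' where 2: "\<psi>' \<in> schwartz" "\<And>m n. hermite_coeff \<psi>' (m, n) = real (2 * m + 1) * hermite_coeff \<psi> (m, n)"
    using schwartz_oscillator_fst[OF 1(1)] by blast
  obtain \<theta> where 3: "\<theta> \<in> schwartz" "\<And>m n. hermite_coeff \<theta> (m, n) = real (2 * m + 1) * hermite_coeff (\<lambda>z. \<psi>' (snd z, fst z)) (m, n)"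
    using schwartz_oscillator_fst[OF schwartz_swap[OF 2(1)]] by blast
  show ?case
    by (rule bexI[OF _ schwartz_swap[OF 3(1)]])
      (simp add: hermite_coeff_swap[OF 3(1)] hermite_coeff_swap[OF 2(1)] 1 2 3 mult_ac)
qed (use assms in auto)

lemma hermite_coeff_decay:
  assumes "\<phi> \<in> schwartz"
  shows "\<exists>K\<ge>0. \<forall>m n. (real (Suc m) * real (Suc n)) ^ k * \<bar>hermite_coeff \<phi> (m, n)\<bar> \<le> K"
proof -
  obtain \<psi> where \<psi>: "\<psi> \<in> schwartz" "\<And>m n. hermite_coeff \<psi> (m, n) = (real (2 * m + 1) * real (2 * n + 1)) ^ Suc k * hermite_coeff \<phi> (m, n)"
    using schwartz_oscillator[OF assms] by blast
  let ?K = "4 * (LINT z|lborel. \<bar>\<psi> z\<bar>)"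
  have "(real (Suc m) * real (Suc n)) ^ k * \<bar>hermite_coeff \<phi> (m, n)\<bar> \<le> ?K" for m n
  proof -
    let ?w = "real (Suc m) * real (Suc n)"
    have "?w ^ Suc k * \<bar>hermite_coeff \<phi> (m, n)\<bar> \<le> (real (2 * m + 1) * real (2 * n + 1)) ^ Suc k * \<bar>hermite_coeff \<phi> (m, n)\<bar>"
      by (intro mult_right_mono power_mono mult_mono) auto
    also have "\<dots> = \<bar>hermite_coeff \<psi> (m, n)\<bar>" by (simp add: \<psi>(2) abs_mult)
    also have "\<dots> \<le> ?K * ?w" by (rule hermite_coeff_bound[OF \<psi>(1)])
    finally have "?w * (?w ^ k * \<bar>hermite_coeff \<phi> (m, n)\<bar>) \<le> ?w * ?K" by (simp add: mult_ac)
    moreover have "?w > 0" by simp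
    ultimately show ?thesis using mult_le_cancel_left_pos by blast
  qed
  moreover have "?K \<ge> 0" by simp
  ultimately show ?thesis by blast
qed

definition hweight :: "nat \<times> nat \<Rightarrow> real" where
  "hweight \<alpha> = (1 + real (fst \<alpha>)) * (1 + real (snd \<alpha>))"

lemma hweight_ge_1: "1 \<le> hweight \<alpha>"
proof -
  have "1 * 1 \<le> (1 + real (fst \<alpha>)) * (1 + real (snd \<alpha>))" by (intro mult_mono) auto
  then show ?thesis by (simp add: hweight_def)
qed

lemma hweight_pos: "0 < hweight \<alpha>" using hweight_ge_1[of \<alpha>] by linarith

lemma hnorm_eq: "hnorm p \<phi> = sqrt (\<Sum>\<^sub>\<infinity>\<alpha>. hweight \<alpha> ^ (2 * p) * (hermite_coeff \<phi> \<alpha>)\<^sup>2)"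
  by (simp add: hnorm_def hweight_def)

lemma summable_on_hweight: "(\<lambda>\<alpha>. inverse ((hweight \<alpha>)\<^sup>2)) summable_on UNIV"
proof (rule nonneg_bdd_above_summable_on)
  let ?f = "\<lambda>n. inverse ((1 + real n)\<^sup>2)"
  have s: "summable ?f"
    using inverse_power_summable[of 2, where 'a=real] summable_Suc_iff[of "\<lambda>n. inverse ((real n)\<^sup>2)"]
    by (simp add: add.commute)
  show "bdd_above (sum (\<lambda>\<alpha>. inverse ((hweight \<alpha>)\<^sup>2)) ` {F. F \<subseteq> UNIV \<and> finite F})"
  proof (rule bdd_aboveI2)
    fix F :: "(nat \<times> nat) set" assume "F \<in> {F. F \<subseteq> UNIV \<and> finite F}"
    then have F: "finite F" by simp
    have "sum (\<lambda>\<alpha>. inverse ((hweight \<alpha>)\<^sup>2)) F \<le> sum (\<lambda>\<alpha>. inverse ((hweight \<alpha>)\<^sup>2)) (fst ` F \<times> snd ` F)"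
      using F by (intro sum_mono2) (force simp: image_iff)+
    also have "\<dots> = (\<Sum>m\<in>fst ` F. ?f m) * (\<Sum>n\<in>snd ` F. ?f n)"
      by (simp add: hweight_def power_mult_distrib sum_product sum.cartesian_product split_beta)
    also have "\<dots> \<le> suminf ?f * suminf ?f"
      using F s by (intro mult_mono sum_le_suminf sum_nonneg suminf_nonneg) auto
    finally show "sum (\<lambda>\<alpha>. inverse ((hweight \<alpha>)\<^sup>2)) F \<le> suminf ?f * suminf ?f" .
  qed
qed simp

lemma hnorm_summable:
  assumes "\<phi> \<in> schwartz"
  shows "(\<lambda>\<alpha>. hweight \<alpha> ^ (2 * p) * (hermite_coeff \<phi> \<alpha>)\<^sup>2) summable_on UNIV"
proof -
  obtain K where K: "K \<ge> 0" "\<And>m n. (real (Suc m) * real (Suc n)) ^ Suc p * \<bar>hermite_coeff \<phi> (m, n)\<bar> \<le> K"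
    using hermite_coeff_decay[OF assms] by meson
  have "hweight \<alpha> ^ (2 * p) * (hermite_coeff \<phi> \<alpha>)\<^sup>2 \<le> inverse ((hweight \<alpha>)\<^sup>2) * K\<^sup>2" for \<alpha>
  proof -
    have "hweight \<alpha> ^ Suc p * \<bar>hermite_coeff \<phi> \<alpha>\<bar> \<le> K"
      using K(2)[of "fst \<alpha>" "snd \<alpha>"] by (simp add: hweight_def)
    then have "(hweight \<alpha> ^ Suc p * \<bar>hermite_coeff \<phi> \<alpha>\<bar>)\<^sup>2 \<le> K\<^sup>2"
      using hweight_pos[of \<alpha>] by (intro power_mono) auto
    then have "(hweight \<alpha>)\<^sup>2 * (hweight \<alpha> ^ (2 * p) * (hermite_coeff \<phi> \<alpha>)\<^sup>2) \<le> K\<^sup>2"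
      by (simp add: power_mult_distrib power_even_eq mult.assoc mult.left_commute)
    then show ?thesis using hweight_pos[of \<alpha>] by (simp add: field_simps)
  qed
  then show ?thesis
    by (intro summable_on_comparison_test[OF summable_on_cmult_left[OF summable_on_hweight, of "K\<^sup>2"]])
      (use hweight_pos in \<open>auto simp: less_imp_le\<close>)
qed

lemma hnorm_square:
  "(hnorm p \<phi>)\<^sup>2 = (\<Sum>\<^sub>\<infinity>\<alpha>. hweight \<alpha> ^ (2 * p) * (hermite_coeff \<phi> \<alpha>)\<^sup>2)"
  unfolding hnorm_eq by (intro real_sqrt_pow2 infsum_nonneg) (use hweight_pos in \<open>auto simp: less_imp_le\<close>)

lemma quadratic_norm_hnorm: "quadratic_norm schwartz (hnorm p)"
proof
  fix \<phi> :: pfun and a assume \<phi>: "\<phi> \<in> schwartz"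
  have "hermite_coeff (\<lambda>z. a * \<phi> z) \<alpha> = a * hermite_coeff \<phi> \<alpha>" for \<alpha>
    using hermite_coeff_lin[OF \<phi> \<phi>, of a 0] by simp
  then have "(\<Sum>\<^sub>\<infinity>\<alpha>. hweight \<alpha> ^ (2 * p) * (hermite_coeff (\<lambda>z. a * \<phi> z) \<alpha>)\<^sup>2) =
     (\<Sum>\<^sub>\<infinity>\<alpha>. a\<^sup>2 * (hweight \<alpha> ^ (2 * p) * (hermite_coeff \<phi> \<alpha>)\<^sup>2))"
    by (simp add: power_mult_distrib mult_ac)
  then show "hnorm p (\<lambda>z. a * \<phi> z) = \<bar>a\<bar> * hnorm p \<phi>"
    unfolding hnorm_eq infsum_cmult_right' by (simp add: real_sqrt_mult)
next
  fix \<phi> \<psi> :: pfun assume \<phi>: "\<phi> \<in> schwartz" and \<psi>: "\<psi> \<in> schwartz"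
  have c: "hermite_coeff (\<phi> + \<psi>) \<alpha> = hermite_coeff \<phi> \<alpha> + hermite_coeff \<psi> \<alpha>"
      "hermite_coeff (\<phi> - \<psi>) \<alpha> = hermite_coeff \<phi> \<alpha> - hermite_coeff \<psi> \<alpha>" for \<alpha>
    using hermite_coeff_lin[OF \<phi> \<psi>, of 1 1] hermite_coeff_lin[OF \<phi> \<psi>, of 1 "-1"]
    by (simp_all add: plus_fun_def fun_diff_def)
  have m: "\<phi> + \<psi> \<in> schwartz" "\<phi> - \<psi> \<in> schwartz"
    using schwartz_lin[OF \<phi> \<psi>, of 1 1] schwartz_lin[OF \<phi> \<psi>, of 1 "-1"]
    by (simp_all add: plus_fun_def fun_diff_def)
  let ?w = "\<lambda>\<alpha>. hweight \<alpha> ^ (2 * p)"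
  have "(hnorm p (\<phi> + \<psi>))\<^sup>2 + (hnorm p (\<phi> - \<psi>))\<^sup>2 =
      (\<Sum>\<^sub>\<infinity>\<alpha>. ?w \<alpha> * (hermite_coeff (\<phi> + \<psi>) \<alpha>)\<^sup>2 + ?w \<alpha> * (hermite_coeff (\<phi> - \<psi>) \<alpha>)\<^sup>2)"
    unfolding hnorm_square by (rule infsum_add[symmetric]) (intro hnorm_summable m)+
  also have "\<dots> = (\<Sum>\<^sub>\<infinity>\<alpha>. 2 * (?w \<alpha> * (hermite_coeff \<phi> \<alpha>)\<^sup>2) + 2 * (?w \<alpha> * (hermite_coeff \<psi> \<alpha>)\<^sup>2))"
    by (intro infsum_cong) (simp add: c power2_eq_square algebra_simps)
  also have "\<dots> = 2 * (hnorm p \<phi>)\<^sup>2 + 2 * (hnorm p \<psi>)\<^sup>2"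
    unfolding hnorm_square infsum_cmult_right'[symmetric]
    by (rule infsum_add) (intro summable_on_cmult_right hnorm_summable \<phi> \<psi>)+
  finally show "(hnorm p (\<phi> + \<psi>))\<^sup>2 + (hnorm p (\<phi> - \<psi>))\<^sup>2 = 2 * (hnorm p \<phi>)\<^sup>2 + 2 * (hnorm p \<psi>)\<^sup>2" .
next
  fix \<phi> :: pfun
  show "0 \<le> hnorm p \<phi>" unfolding hnorm_eq
    by (intro real_sqrt_ge_zero infsum_nonneg) (use hweight_pos in \<open>auto simp: less_imp_le\<close>)
qed (auto intro: schwartz_zero schwartz_lin)

definition hweight_const :: real where
  "hweight_const = sqrt (\<Sum>\<^sub>\<infinity>\<alpha>. inverse ((hweight \<alpha>)\<^sup>2))"

lemma hweight_const_nonneg: "0 \<le> hweight_const"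
  unfolding hweight_const_def by (intro real_sqrt_ge_zero infsum_nonneg) auto

text \<open>Cauchy--Schwarz, with \<open>\<Sum> (1+\<alpha>)\<^sup>2\<^sup>-\<^sup>2\<^sup>p\<close> convergent precisely because \<open>p \<ge> 2\<close>.\<close>

lemma sum_hermite_coeff_le:
  assumes "\<phi> \<in> schwartz" "p \<ge> 2" "finite F"
  shows "(\<Sum>\<alpha>\<in>F. \<bar>hermite_coeff \<phi> \<alpha>\<bar> * hweight \<alpha>) \<le> hweight_const * hnorm p \<phi>"
proof -
  have e: "\<bar>hermite_coeff \<phi> \<alpha>\<bar> * hweight \<alpha> \<le> (hweight \<alpha> ^ p * \<bar>hermite_coeff \<phi> \<alpha>\<bar>) * inverse (hweight \<alpha>)" for \<alpha>
  proof -
    have "hweight \<alpha> ^ 2 \<le> hweight \<alpha> ^ p" using assms hweight_ge_1 by (intro power_increasing)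
    then have "\<bar>hermite_coeff \<phi> \<alpha>\<bar> * hweight \<alpha> ^ 2 \<le> \<bar>hermite_coeff \<phi> \<alpha>\<bar> * hweight \<alpha> ^ p" by (rule mult_left_mono) simp
    then show ?thesis using hweight_pos[of \<alpha>] by (simp add: field_simps power2_eq_square)
  qed
  have "(\<Sum>\<alpha>\<in>F. \<bar>hermite_coeff \<phi> \<alpha>\<bar> * hweight \<alpha>) \<le> (\<Sum>\<alpha>\<in>F. (hweight \<alpha> ^ p * \<bar>hermite_coeff \<phi> \<alpha>\<bar>) * inverse (hweight \<alpha>))"
    by (intro sum_mono e)
  also have "\<dots> \<le> sqrt ((\<Sum>\<alpha>\<in>F. (hweight \<alpha> ^ p * \<bar>hermite_coeff \<phi> \<alpha>\<bar>)\<^sup>2) * (\<Sum>\<alpha>\<in>F. (inverse (hweight \<alpha>))\<^sup>2))"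
    by (intro real_le_rsqrt Cauchy_Schwarz_ineq_sum)
  also have "\<dots> = sqrt (\<Sum>\<alpha>\<in>F. hweight \<alpha> ^ (2 * p) * (hermite_coeff \<phi> \<alpha>)\<^sup>2) * sqrt (\<Sum>\<alpha>\<in>F. inverse ((hweight \<alpha>)\<^sup>2))"
    by (simp add: real_sqrt_mult power_mult_distrib power_inverse power_even_eq)
  also have "\<dots> \<le> hnorm p \<phi> * hweight_const"
    unfolding hnorm_eq hweight_const_def
    by (intro mult_mono real_sqrt_le_mono finite_sum_le_infsum hnorm_summable summable_on_hweight assms
        real_sqrt_ge_zero infsum_nonneg sum_nonneg) (use hweight_pos in \<open>auto simp: less_imp_le\<close>)
  finally show ?thesis by (simp add: mult.commute)
qed

definition hcoef :: "pfun \<Rightarrow> nat \<Rightarrow> real" where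
  "hcoef \<phi> k = hermite_coeff \<phi> (prod_decode k)"

definition hfst :: "nat \<Rightarrow> nat" where "hfst k = fst (prod_decode k)"
definition hsnd :: "nat \<Rightarrow> nat" where "hsnd k = snd (prod_decode k)"

lemma hweight_prod_decode: "hweight (prod_decode k) = real (Suc (hfst k)) * real (Suc (hsnd k))"
  by (simp add: hweight_def hfst_def hsnd_def)

lemma summable_hcoef:
  assumes "\<phi> \<in> schwartz" "p \<ge> 2"
  shows "summable (\<lambda>k. \<bar>hcoef \<phi> k\<bar> * (real (Suc (hfst k)) * real (Suc (hsnd k))))"
    and "(\<Sum>k. \<bar>hcoef \<phi> k\<bar> * (real (Suc (hfst k)) * real (Suc (hsnd k)))) \<le> hweight_const * hnorm p \<phi>"
proof -
  let ?f = "\<lambda>k. \<bar>hcoef \<phi> k\<bar> * (real (Suc (hfst k)) * real (Suc (hsnd k)))"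
  have le: "(\<Sum>k<n. ?f k) \<le> hweight_const * hnorm p \<phi>" for n
  proof -
    have "(\<Sum>k<n. ?f k) = (\<Sum>\<alpha>\<in>prod_decode ` {..<n}. \<bar>hermite_coeff \<phi> \<alpha>\<bar> * hweight \<alpha>)"
      by (subst sum.reindex) (auto simp: inj_prod_decode hcoef_def hweight_prod_decode)
    also have "\<dots> \<le> hweight_const * hnorm p \<phi>" by (rule sum_hermite_coeff_le[OF assms]) simp
    finally show ?thesis .
  qed
  show s: "summable ?f" by (rule summableI_nonneg_bounded[OF _ le]) simp
  show "suminf ?f \<le> hweight_const * hnorm p \<phi>" by (rule suminf_le_const[OF s le])
qed

lemma hermite_product_bound:
  "\<bar>hermite_fun (hfst k) x * hermite_fun (hsnd k) y\<bar> \<le> 4 * (real (Suc (hfst k)) * real (Suc (hsnd k)))"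
proof -
  have "\<bar>hermite_fun (hfst k) x * hermite_fun (hsnd k) y\<bar> \<le> (2 * real (Suc (hfst k))) * (2 * real (Suc (hsnd k)))"
    unfolding abs_mult by (intro mult_mono hermite_fun_bound') auto
  then show ?thesis by (simp add: algebra_simps)
qed

lemma hermite_expansion:
  assumes \<phi>: "\<phi> \<in> schwartz"
  shows "(\<lambda>k. hcoef \<phi> k * (hermite_fun (hfst k) x * hermite_fun (hsnd k) y)) sums \<phi> (x, y)"
proof -
  define e where "e k z = hermite_fun (hfst k) (fst z) * hermite_fun (hsnd k) (snd z)" for k z
  define M where "M k = 4 * (\<bar>hcoef \<phi> k\<bar> * (real (Suc (hfst k)) * real (Suc (hsnd k))))" for k
  define g where "g z = (\<Sum>k. hcoef \<phi> k * e k z)" for z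
  have M: "summable M" unfolding M_def by (intro summable_mult summable_hcoef(1)[OF \<phi>, of 2]) simp
  have eM: "norm (hcoef \<phi> k * e k z) \<le> M k" for k z
  proof -
    have "\<bar>hcoef \<phi> k\<bar> * \<bar>e k z\<bar> \<le> \<bar>hcoef \<phi> k\<bar> * (4 * (real (Suc (hfst k)) * real (Suc (hsnd k))))"
      unfolding e_def by (intro mult_left_mono hermite_product_bound) auto
    then show ?thesis by (simp add: M_def abs_mult mult_ac)
  qed
  have sm: "summable (\<lambda>k. hcoef \<phi> k * e k z)" "summable (\<lambda>k. norm (hcoef \<phi> k * e k z))" for z
    by (rule summable_comparison_test'[OF M, of 0]; use eM in simp)+
  have e_cont: "continuous_on UNIV (e k)" for k
    unfolding e_def[abs_def] by (intro continuous_intros continuous_on_compose2[OF continuous_hermite_fun[of UNIV]]) auto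
  have "uniform_limit UNIV (\<lambda>n z. \<Sum>k<n. hcoef \<phi> k * e k z) g sequentially"
    unfolding g_def[abs_def] by (rule Weierstrass_m_test[OF eM M])
  then have g_cont: "continuous_on UNIV g"
    by (rule uniform_limit_theorem[rotated]) (auto intro!: always_eventually continuous_intros e_cont)
  have g_bd: "\<bar>g z\<bar> \<le> suminf M" for z
    using order_trans[OF summable_norm[OF sm(2)] suminf_le[OF eM sm(2) M]] by (simp add: g_def)
  obtain B where B: "\<And>z. \<bar>\<phi> z\<bar> \<le> B" using schwartz_bounded[OF \<phi>] by blast
  have g_meas [measurable]: "g \<in> borel_measurable (borel \<Otimes>\<^sub>M borel)"
    using borel_measurable_continuous_onI[OF g_cont] by (simp add: borel_prod)
  have e_meas [measurable]: "e k \<in> borel_measurable (borel \<Otimes>\<^sub>M borel)" for k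
    unfolding e_def[abs_def] by measurable
  have ee: "integrable (lborel \<Otimes>\<^sub>M lborel) (e k)" for k
    unfolding e_def[abs_def] by (intro lborel_product_integrable integrable_hermite_fun)
  have e_prod: "integrable (lborel \<Otimes>\<^sub>M lborel) (\<lambda>z. e k z * e l z)" 
       "(LINT z|(lborel \<Otimes>\<^sub>M lborel). e k z * e l z) = (if k = l then 1 else 0)" for k l
  proof -
    have *: "e k z * e l z = (hermite_fun (hfst k) (fst z) * hermite_fun (hfst l) (fst z)) *
        (hermite_fun (hsnd k) (snd z) * hermite_fun (hsnd l) (snd z))" for z by (simp add: e_def)
    have "k = l \<longleftrightarrow> hfst k = hfst l \<and> hsnd k = hsnd l"
      unfolding hfst_def hsnd_def by (metis prod.collapse prod_decode_inverse)
    then show "integrable (lborel \<Otimes>\<^sub>M lborel) (\<lambda>z. e k z * e l z)"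
       "(LINT z|(lborel \<Otimes>\<^sub>M lborel). e k z * e l z) = (if k = l then 1 else 0)"
      unfolding * using lborel_product_integrable[OF integrable_hermite_mult[of "hfst k" "hfst l"] integrable_hermite_mult[of "hsnd k" "hsnd l"]]
        lborel_product_integral[OF integrable_hermite_mult[of "hfst k" "hfst l"] integrable_hermite_mult[of "hsnd k" "hsnd l"]]
      by (auto simp: hermite_orthonormal)
  qed
  have g_coef: "(LINT z|(lborel \<Otimes>\<^sub>M lborel). g z * e l z) = hcoef \<phi> l" for l
  proof -
    have "(LINT z|(lborel \<Otimes>\<^sub>M lborel). (\<Sum>k. hcoef \<phi> k * e k z * e l z)) =
        (\<Sum>k. LINT z|(lborel \<Otimes>\<^sub>M lborel). hcoef \<phi> k * e k z * e l z)"
    proof (rule integral_suminf)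
      show "integrable (lborel \<Otimes>\<^sub>M lborel) (\<lambda>z. hcoef \<phi> k * e k z * e l z)" for k
        using e_prod(1)[of k l] by (simp add: mult.assoc)
      show "AE z in lborel \<Otimes>\<^sub>M lborel. summable (\<lambda>k. norm (hcoef \<phi> k * e k z * e l z))"
        using sm(2) by (intro AE_I2) (simp add: abs_mult summable_mult2)
      show "summable (\<lambda>k. LINT z|(lborel \<Otimes>\<^sub>M lborel). norm (hcoef \<phi> k * e k z * e l z))"
      proof (rule summable_comparison_test'[where g="\<lambda>k. M k * (LINT z|(lborel \<Otimes>\<^sub>M lborel). norm (e l z))" and N=0])
        show "summable (\<lambda>k. M k * (LINT z|(lborel \<Otimes>\<^sub>M lborel). norm (e l z)))" by (intro summable_mult2 M)
        fix k
        have "(LINT z|(lborel \<Otimes>\<^sub>M lborel). norm (hcoef \<phi> k * e k z * e l z)) \<le> (LINT z|(lborel \<Otimes>\<^sub>M lborel). M k * norm (e l z))"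
        proof (intro integral_mono integrable_norm integrable_mult_right ee)
          show "integrable (lborel \<Otimes>\<^sub>M lborel) (\<lambda>z. hcoef \<phi> k * e k z * e l z)"
            using e_prod(1)[of k l] by (simp add: mult.assoc)
          show "norm (hcoef \<phi> k * e k z * e l z) \<le> M k * norm (e l z)" for z
            unfolding norm_mult[of _ "e l z"] by (rule mult_right_mono[OF eM norm_ge_zero])
        qed
        then show "norm (LINT z|(lborel \<Otimes>\<^sub>M lborel). norm (hcoef \<phi> k * e k z * e l z)) \<le> M k * (LINT z|(lborel \<Otimes>\<^sub>M lborel). norm (e l z))"
          by simp
      qed
    qed
    also have "\<dots> = (\<Sum>k. if k = l then hcoef \<phi> l else 0)"
      by (intro suminf_cong) (simp add: mult.assoc e_prod(2))
    also have "\<dots> = hcoef \<phi> l" using sums_single[of l "\<lambda>_. hcoef \<phi> l"] by (simp add: sums_iff eq_commute)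
    finally show ?thesis by (simp add: g_def suminf_mult2[OF sm(1)])
  qed
  have "\<phi> (x, y) - g (x, y) = 0"
  proof (rule hermite_complete_plane[where f="\<lambda>z. \<phi> z - g z"])
    show "continuous_on UNIV (\<lambda>z. \<phi> z - g z)" by (intro continuous_intros schwartz_continuous \<phi> g_cont)
    show "\<bar>\<phi> z - g z\<bar> \<le> B + suminf M" for z using B[of z] g_bd[of z] by linarith
    fix m n
    define l where "l = prod_encode (m, n)"
    have el: "e l z = hermite_fun m (fst z) * hermite_fun n (snd z)" for z by (simp add: e_def l_def hfst_def hsnd_def)
    have i1: "integrable (lborel \<Otimes>\<^sub>M lborel) (\<lambda>z. \<phi> z * e l z)"
      using schwartz_coeff_integrable[OF \<phi>, of m n] by (simp add: el lborel_prod)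
    have i2: "integrable (lborel \<Otimes>\<^sub>M lborel) (\<lambda>z. g z * e l z)"
    proof (rule Bochner_Integration.integrable_bound)
      show "integrable (lborel \<Otimes>\<^sub>M lborel) (\<lambda>z. suminf M * e l z)" by (intro integrable_mult_right ee)
      show "AE z in lborel \<Otimes>\<^sub>M lborel. norm (g z * e l z) \<le> norm (suminf M * e l z)"
        using order_trans[OF g_bd abs_ge_self] by (intro AE_I2) (auto simp: abs_mult intro!: mult_right_mono)
    qed measurable
    have "(LINT z|(lborel \<Otimes>\<^sub>M lborel). (\<phi> z - g z) * e l z) = 0"
      using i1 i2 g_coef[of l] by (simp add: left_diff_distrib hcoef_def l_def hermite_coeff_def lborel_prod el[unfolded l_def])
    then show "(LINT z|lborel. (\<phi> z - g z) * (hermite_fun m (fst z) * hermite_fun n (snd z))) = 0"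
      by (simp add: lborel_prod el)
  qed
  then show ?thesis using summable_sums[OF sm(1)[of "(x, y)"]] by (simp add: g_def e_def)
qed

section \<open>Fractional integrals of Hermite functions\<close>

lemma nn_integral_powr_kernel_le:
  fixes f :: "real \<Rightarrow> real"
  assumes \<beta>: "0 < \<beta>" "\<beta> < 1/2" and f [measurable]: "f \<in> borel_measurable borel"
    and S: "\<And>v. \<bar>f v\<bar> \<le> S" and Q: "(\<integral>\<^sup>+v. ennreal ((f v)\<^sup>2) \<partial>lborel) \<le> ennreal Q" and d: "\<delta> > 0" and Q0: "Q \<ge> 0"
  shows "(\<integral>\<^sup>+v. ennreal (indicator {0<..} v * v powr (\<beta> - 1) * \<bar>f v\<bar>) \<partial>lborel)
    \<le> ennreal (S / \<beta> + \<delta> / (1 - 2 * \<beta>) + Q / \<delta>)"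
proof -
  have S0: "S \<ge> 0" using S[of 0] by linarith
  have le: "ennreal (indicator {0<..} v * v powr (\<beta> - 1) * \<bar>f v\<bar>) \<le>
     ennreal S * ennreal (indicator {0..1} v * v powr (\<beta> - 1)) +
     (ennreal \<delta> * ennreal (indicator {1..} v * v powr (2 * \<beta> - 2)) + ennreal (1 / \<delta>) * ennreal ((f v)\<^sup>2))" for v :: real
  proof (cases "v \<le> 1")
    case True
    then have "indicator {0<..} v * v powr (\<beta> - 1) * \<bar>f v\<bar> \<le> S * (indicator {0..1} v * v powr (\<beta> - 1))"
      using S[of v] S0 by (auto simp: indicator_def mult.commute intro!: mult_right_mono)
    also have "\<dots> \<le> S * (indicator {0..1} v * v powr (\<beta> - 1)) +
        (\<delta> * (indicator {1..} v * v powr (2 * \<beta> - 2)) + 1 / \<delta> * (f v)\<^sup>2)"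
      using d by simp
    finally show ?thesis using S0 d by (simp add: ennreal_plus[symmetric] ennreal_mult[symmetric] del: ennreal_plus)
  next
    case False
    have "0 \<le> (\<delta> * v powr (\<beta> - 1) - \<bar>f v\<bar>)\<^sup>2" by simp
    then have 1: "2 * (\<delta> * (v powr (\<beta> - 1) * \<bar>f v\<bar>)) \<le> \<delta>\<^sup>2 * (v powr (\<beta> - 1))\<^sup>2 + (f v)\<^sup>2"
      by (simp add: power2_diff power_mult_distrib mult_ac)
    have 2: "(v powr (\<beta> - 1))\<^sup>2 = v powr (2 * \<beta> - 2)"
      by (simp add: power2_eq_square powr_add[symmetric])
    have 3: "0 \<le> \<delta> * (v powr (\<beta> - 1) * \<bar>f v\<bar>)" using d by simp
    have "\<delta> * (v powr (\<beta> - 1) * \<bar>f v\<bar>) \<le> \<delta>\<^sup>2 * v powr (2 * \<beta> - 2) + (f v)\<^sup>2"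
      using 1[unfolded 2] 3 by linarith
    then have "v powr (\<beta> - 1) * \<bar>f v\<bar> \<le> \<delta> * v powr (2 * \<beta> - 2) + (f v)\<^sup>2 / \<delta>"
      using d by (simp add: field_simps power2_eq_square)
    then have "indicator {0<..} v * v powr (\<beta> - 1) * \<bar>f v\<bar> \<le> S * (indicator {0..1} v * v powr (\<beta> - 1)) +
        (\<delta> * (indicator {1..} v * v powr (2 * \<beta> - 2)) + 1 / \<delta> * (f v)\<^sup>2)"
      using False by simp
    then show ?thesis using S0 d by (simp add: ennreal_plus[symmetric] ennreal_mult[symmetric] del: ennreal_plus)
  qed
  have I1: "(\<integral>\<^sup>+v. ennreal (indicator {0..1} v * v powr (\<beta> - 1)) \<partial>lborel) = ennreal (1 / \<beta>)"
  proof (rule nn_integral_has_integral_lborel)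
    have "((\<lambda>v::real. v powr (\<beta> - 1)) has_integral 1 / \<beta>) {0..1}"
      using has_integral_powr_from_0[of "\<beta> - 1" 1] \<beta> by simp
    then have "((\<lambda>v::real. if v \<in> {0..1} then v powr (\<beta> - 1) else 0) has_integral 1 / \<beta>) UNIV"
      by (simp only: has_integral_restrict_UNIV)
    then show "((\<lambda>v::real. indicator {0..1} v * v powr (\<beta> - 1)) has_integral 1 / \<beta>) UNIV"
      by (rule has_integral_eq[rotated]) (simp add: indicator_def)
  qed auto
  have I2: "(\<integral>\<^sup>+v. ennreal (indicator {1..} v * v powr (2 * \<beta> - 2)) \<partial>lborel) = ennreal (1 / (1 - 2 * \<beta>))"
  proof (rule nn_integral_has_integral_lborel)
    have "((\<lambda>v::real. v powr (2 * \<beta> - 2)) has_integral 1 / (1 - 2 * \<beta>)) {1..}"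
    proof -
      have "- (1 powr (2 * \<beta> - 2 + 1)) / (2 * \<beta> - 2 + 1) = 1 / (1 - 2 * \<beta>)"
        using \<beta> by (simp add: minus_divide_left[symmetric] minus_divide_right)
      then show ?thesis using has_integral_powr_to_inf[of "2 * \<beta> - 2" 1] \<beta> by simp
    qed
    then have "((\<lambda>v::real. if v \<in> {1..} then v powr (2 * \<beta> - 2) else 0) has_integral 1 / (1 - 2 * \<beta>)) UNIV"
      by (simp only: has_integral_restrict_UNIV)
    then show "((\<lambda>v::real. indicator {1..} v * v powr (2 * \<beta> - 2)) has_integral 1 / (1 - 2 * \<beta>)) UNIV"
      by (rule has_integral_eq[rotated]) (simp add: indicator_def)
  qed auto
  have "(\<integral>\<^sup>+v. ennreal (indicator {0<..} v * v powr (\<beta> - 1) * \<bar>f v\<bar>) \<partial>lborel) \<le>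
    (\<integral>\<^sup>+v. ennreal S * ennreal (indicator {0..1} v * v powr (\<beta> - 1)) +
     (ennreal \<delta> * ennreal (indicator {1..} v * v powr (2 * \<beta> - 2)) + ennreal (1 / \<delta>) * ennreal ((f v)\<^sup>2)) \<partial>lborel)"
    by (intro nn_integral_mono le)
  also have "\<dots> = ennreal S * ennreal (1 / \<beta>) + (ennreal \<delta> * ennreal (1 / (1 - 2 * \<beta>)) + ennreal (1 / \<delta>) * (\<integral>\<^sup>+v. ennreal ((f v)\<^sup>2) \<partial>lborel))"
    by (simp add: nn_integral_add nn_integral_cmult I1 I2)
  also have "\<dots> \<le> ennreal S * ennreal (1 / \<beta>) + (ennreal \<delta> * ennreal (1 / (1 - 2 * \<beta>)) + ennreal (1 / \<delta>) * ennreal Q)"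
    by (intro add_left_mono mult_left_mono Q) auto
  also have "\<dots> = ennreal (S / \<beta> + \<delta> / (1 - 2 * \<beta>) + Q / \<delta>)"
    using S0 d \<beta> Q0 by (simp add: ennreal_plus[symmetric] ennreal_mult[symmetric] add.assoc del: ennreal_plus)
  finally show ?thesis .
qed

lemma nn_integral_reflect:
  fixes t :: real assumes [measurable]: "f \<in> borel_measurable borel"
  shows "(\<integral>\<^sup>+v. f (t - v) \<partial>lborel) = (\<integral>\<^sup>+v. f v \<partial>lborel)"
  using nn_integral_real_affine[of f "-1" t] by simp

lemma hermite_difference_square:
  assumes "s < t"
  shows "(\<integral>\<^sup>+v. ennreal ((hermite_fun m (t - v) - hermite_fun m (s - v))\<^sup>2) \<partial>lborel) \<le> ennreal ((t - s)\<^sup>2 * (real m + 1/2))"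
proof -
  have [measurable]: "(\<lambda>p. indicator {s - fst p .. t - fst p} (snd p) :: real) \<in> borel_measurable (borel \<Otimes>\<^sub>M borel)"
  proof -
    have "(\<lambda>p. indicator {s - fst p .. t - fst p} (snd p) :: real) =
       indicator {p \<in> space (borel \<Otimes>\<^sub>M borel). s - fst p \<le> snd p \<and> snd p \<le> t - fst p}"
      by (auto simp: indicator_def fun_eq_iff space_pair_measure)
    also have "\<dots> \<in> borel_measurable (borel \<Otimes>\<^sub>M borel)" by (intro borel_measurable_indicator) measurable
    finally show ?thesis .
  qed
  have int2: "integrable lborel (\<lambda>x. (hermite_deriv m x)\<^sup>2)"
    unfolding power2_eq_square by (intro rapid_integrable rapid_mult rapid_hermite_deriv) simp
  have sq: "ennreal ((hermite_fun m (t - v) - hermite_fun m (s - v))\<^sup>2) \<le>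
      ennreal (t - s) * (\<integral>\<^sup>+x. ennreal (indicator {s - v .. t - v} x * (hermite_deriv m x)\<^sup>2) \<partial>lborel)" for v
  proof -
    let ?I = "indicator {s - v .. t - v} :: real \<Rightarrow> real"
    let ?a = "hermite_fun m (t - v) - hermite_fun m (s - v)"
    have i1: "integrable lborel (\<lambda>x. ?I x * hermite_deriv m x)"
      using integrable_mult_indicator[OF _ rapid_integrable[OF rapid_hermite_deriv[of m] measurable_hermite(2)], of "{s - v .. t - v}"]
      by simp
    have i2: "integrable lborel (\<lambda>x. ?I x * (hermite_deriv m x)\<^sup>2)"
      using integrable_mult_indicator[OF _ int2, of "{s - v .. t - v}"] by simp
    have a: "(LINT x|lborel. ?I x * hermite_deriv m x) = ?a"
    proof -
      have "(LINT x|lborel. ?I x *\<^sub>R hermite_deriv m x) = ?a"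
      proof (rule integral_FTC_atLeastAtMost)
        show "(hermite_fun m has_vector_derivative hermite_deriv m x) (at x within {s - v..t - v})" for x
          unfolding has_real_derivative_iff_has_vector_derivative[symmetric]
          by (rule has_field_derivative_at_within[OF hermite_fun_has_deriv])
      qed (use assms in \<open>auto intro: continuous_hermite_deriv\<close>)
      then show ?thesis by simp
    qed
    have "0 \<le> (LINT x|lborel. ?I x * (hermite_deriv m x - ?a / (t - s))\<^sup>2)"
      by (intro integral_nonneg_AE AE_I2) simp
    also have "\<dots> = (LINT x|lborel. ?I x * (hermite_deriv m x)\<^sup>2 - 2 * (?a / (t - s)) * (?I x * hermite_deriv m x) + (?a / (t - s))\<^sup>2 * ?I x)"
      by (intro Bochner_Integration.integral_cong refl) (simp add: power2_diff algebra_simps)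
    also have "\<dots> = (LINT x|lborel. ?I x * (hermite_deriv m x)\<^sup>2) - 2 * (?a / (t - s)) * ?a + (?a / (t - s))\<^sup>2 * (t - s)"
      using i1 i2 a assms by (simp add: measure_def)
    also have "\<dots> = (LINT x|lborel. ?I x * (hermite_deriv m x)\<^sup>2) - ?a\<^sup>2 / (t - s)"
    proof -
      have "J - 2 * (a / d) * a + (a / d)\<^sup>2 * d = J - a\<^sup>2 / d" if "d > 0" for J a d :: real
        using that by (simp add: field_simps power2_eq_square)
      from this[of "t - s"] show ?thesis using assms by (simp only: diff_gt_0_iff_gt)
    qed
    finally have "?a\<^sup>2 / (t - s) \<le> (LINT x|lborel. ?I x * (hermite_deriv m x)\<^sup>2)" by simp
    then have "?a\<^sup>2 \<le> (t - s) * (LINT x|lborel. ?I x * (hermite_deriv m x)\<^sup>2)"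
      using assms by (simp only: pos_divide_le_eq diff_gt_0_iff_gt mult.commute)
    then show ?thesis using assms i2
      by (subst nn_integral_eq_integral) (auto simp: ennreal_mult[symmetric] integral_nonneg_AE intro!: ennreal_leI)
  qed
  have "(\<integral>\<^sup>+v. ennreal ((hermite_fun m (t - v) - hermite_fun m (s - v))\<^sup>2) \<partial>lborel) \<le>
     (\<integral>\<^sup>+v. ennreal (t - s) * (\<integral>\<^sup>+x. ennreal (indicator {s - v .. t - v} x * (hermite_deriv m x)\<^sup>2) \<partial>lborel) \<partial>lborel)"
    by (intro nn_integral_mono sq)
  also have "\<dots> = ennreal (t - s) * (\<integral>\<^sup>+v. (\<integral>\<^sup>+x. ennreal (indicator {s - v .. t - v} x * (hermite_deriv m x)\<^sup>2) \<partial>lborel) \<partial>lborel)"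
    by (intro nn_integral_cmult) measurable
  also have "(\<integral>\<^sup>+v. (\<integral>\<^sup>+x. ennreal (indicator {s - v .. t - v} x * (hermite_deriv m x)\<^sup>2) \<partial>lborel) \<partial>lborel) =
     (\<integral>\<^sup>+x. (\<integral>\<^sup>+v. ennreal (indicator {s - v .. t - v} x * (hermite_deriv m x)\<^sup>2) \<partial>lborel) \<partial>lborel)"
    by (rule lborel_pair.Fubini'[symmetric]) measurable
  also have "\<dots> = (\<integral>\<^sup>+x. ennreal (t - s) * ennreal ((hermite_deriv m x)\<^sup>2) \<partial>lborel)"
  proof (intro nn_integral_cong)
    fix x :: real
    have "(\<integral>\<^sup>+v. ennreal (indicator {s - v .. t - v} x * (hermite_deriv m x)\<^sup>2) \<partial>lborel) =
       (\<integral>\<^sup>+v. ennreal ((hermite_deriv m x)\<^sup>2) * indicator {s - x .. t - x} v \<partial>lborel)"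
      by (intro nn_integral_cong) (auto simp: indicator_def)
    also have "\<dots> = ennreal (t - s) * ennreal ((hermite_deriv m x)\<^sup>2)"
      using assms by (subst nn_integral_cmult_indicator) (auto simp: mult.commute)
    finally show "(\<integral>\<^sup>+v. ennreal (indicator {s - v .. t - v} x * (hermite_deriv m x)\<^sup>2) \<partial>lborel) = \<dots>" .
  qed
  also have "\<dots> = ennreal (t - s) * ennreal (real m + 1/2)"
    using int2 by (subst nn_integral_cmult) (auto simp: nn_integral_eq_integral hermite_deriv_normalized)
  also have "ennreal (t - s) * (ennreal (t - s) * ennreal (real m + 1/2)) = ennreal ((t - s)\<^sup>2 * (real m + 1/2))"
    using assms by (simp add: ennreal_mult[symmetric] power2_eq_square mult.assoc del: ennreal_plus)
  finally show ?thesis .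
qed

definition frac_const :: "real \<Rightarrow> real" where
  "frac_const \<beta> = 2 / \<beta> + 1 / (1 - 2 * \<beta>) + 1"

lemma frac_const_nonneg: "0 < \<beta> \<Longrightarrow> \<beta> < 1/2 \<Longrightarrow> 0 \<le> frac_const \<beta>"
  by (simp add: frac_const_def)

lemma frac_hermite_le:
  assumes "0 < \<beta>" "\<beta> < 1/2"
  shows "(\<integral>\<^sup>+v. ennreal (indicator {0<..} v * v powr (\<beta> - 1) * \<bar>hermite_fun m (t - v)\<bar>) \<partial>lborel) \<le> ennreal (frac_const \<beta> * real (Suc m))"
proof -
  have "(\<integral>\<^sup>+v. ennreal ((hermite_fun m (t - v))\<^sup>2) \<partial>lborel) = (\<integral>\<^sup>+v. ennreal ((hermite_fun m v)\<^sup>2) \<partial>lborel)"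
    by (rule nn_integral_reflect[where f="\<lambda>v. ennreal ((hermite_fun m v)\<^sup>2)"]) simp
  also have "\<dots> = 1"
    using hermite_normalized[of m] integrable_hermite_mult[of m m]
    by (subst nn_integral_eq_integral) (auto simp: power2_eq_square)
  finally have "(\<integral>\<^sup>+v. ennreal (indicator {0<..} v * v powr (\<beta> - 1) * \<bar>hermite_fun m (t - v)\<bar>) \<partial>lborel) \<le>
      ennreal (2 * real (Suc m) / \<beta> + 1 / (1 - 2 * \<beta>) + 1 / 1)"
    by (intro nn_integral_powr_kernel_le assms hermite_fun_bound') auto
  also have "\<dots> \<le> ennreal (frac_const \<beta> * real (Suc m))"
  proof (intro ennreal_leI)
    have "1 / (1 - 2 * \<beta>) * 1 \<le> 1 / (1 - 2 * \<beta>) * real (Suc m)" using assms by (intro mult_left_mono) auto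
    then show "2 * real (Suc m) / \<beta> + 1 / (1 - 2 * \<beta>) + 1 / 1 \<le> frac_const \<beta> * real (Suc m)"
      unfolding frac_const_def distrib_right by simp
  qed
  finally show ?thesis .
qed

lemma frac_hermite_difference_le:
  assumes \<beta>: "0 < \<beta>" "\<beta> < 1/2"
  shows "(\<integral>\<^sup>+v. ennreal (indicator {0<..} v * v powr (\<beta> - 1) * \<bar>hermite_fun m (t - v) - hermite_fun m (s - v)\<bar>) \<partial>lborel)
     \<le> ennreal (frac_const \<beta> * real (Suc m) * \<bar>t - s\<bar>)"
proof -
  have *: "(\<integral>\<^sup>+v. ennreal (indicator {0<..} v * v powr (\<beta> - 1) * \<bar>hermite_fun m (t - v) - hermite_fun m (s - v)\<bar>) \<partial>lborel)
     \<le> ennreal (frac_const \<beta> * real (Suc m) * (t - s))" if "s < t" for s t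
  proof -
    have "(\<integral>\<^sup>+v. ennreal ((hermite_fun m (t - v) - hermite_fun m (s - v))\<^sup>2) \<partial>lborel) \<le> ennreal ((t - s)\<^sup>2 * real (Suc m))"
      by (rule order_trans[OF hermite_difference_square[OF that]]) (intro ennreal_leI mult_left_mono, auto)
    then have "(\<integral>\<^sup>+v. ennreal (indicator {0<..} v * v powr (\<beta> - 1) * \<bar>hermite_fun m (t - v) - hermite_fun m (s - v)\<bar>) \<partial>lborel)
      \<le> ennreal (2 * real (Suc m) * (t - s) / \<beta> + (t - s) / (1 - 2 * \<beta>) + ((t - s)\<^sup>2 * real (Suc m)) / (t - s))"
      using that order_trans[OF hermite_fun_lipschitz[of m "t - _" "s - _"]]
      by (intro nn_integral_powr_kernel_le \<beta>) (auto simp del: of_nat_Suc)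
    also have "\<dots> \<le> ennreal (frac_const \<beta> * real (Suc m) * (t - s))"
    proof (intro ennreal_leI)
      have "(t - s) / (1 - 2 * \<beta>) * 1 \<le> (t - s) / (1 - 2 * \<beta>) * real (Suc m)"
        using \<beta> that by (intro mult_left_mono) auto
      moreover have "((t - s)\<^sup>2 * real (Suc m)) / (t - s) = real (Suc m) * (t - s)"
        using that by (simp add: power2_eq_square)
      ultimately show "2 * real (Suc m) * (t - s) / \<beta> + (t - s) / (1 - 2 * \<beta>) + ((t - s)\<^sup>2 * real (Suc m)) / (t - s)
          \<le> frac_const \<beta> * real (Suc m) * (t - s)"
        unfolding frac_const_def distrib_right by (simp add: mult_ac del: of_nat_Suc)
    qed
    finally show ?thesis .
  qed
  consider "s < t" | "s = t" | "t < s" by linarith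
  then show ?thesis
  proof cases
    case 3
    then show ?thesis using *[OF 3] by (simp add: abs_minus_commute)
  qed (use * in auto)
qed

lemma SU_schwartz: "\<eta> \<in> SU \<Longrightarrow> \<eta> \<in> schwartz" by (simp add: SU_def)

lemma SU_lin: assumes "\<phi> \<in> SU" "\<psi> \<in> SU" shows "(\<lambda>z. a * \<phi> z + b * \<psi> z) \<in> SU"
proof -
  have "((\<lambda>y. a * \<phi> (x, y) + b * \<psi> (x, y)) has_real_derivative a * 0 + b * 0) (at 0)" for x
    using assms unfolding SU_def by (intro DERIV_add DERIV_cmult) auto
  then show ?thesis using assms schwartz_lin[of \<phi> \<psi> a b] by (simp add: SU_def)
qed

lemma SU_zero: "(\<lambda>z. 0) \<in> SU" by (simp add: SU_def schwartz_zero)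

definition envelope_coef :: "pfun \<Rightarrow> nat \<Rightarrow> real" where
  "envelope_coef \<eta> k = 2 * (\<bar>hcoef \<eta> k\<bar> * real (Suc (hsnd k)))"

lemma envelope_coef_nonneg: "0 \<le> envelope_coef \<eta> k" by (simp add: envelope_coef_def)

lemma summable_envelope_coef:
  assumes "\<eta> \<in> SU" "p \<ge> 2"
  shows "summable (\<lambda>k. envelope_coef \<eta> k * real (Suc (hfst k)))"
    and "(\<Sum>k. envelope_coef \<eta> k * real (Suc (hfst k))) \<le> 2 * hweight_const * hnorm p \<eta>"
proof -
  have e: "envelope_coef \<eta> k * real (Suc (hfst k)) = 2 * (\<bar>hcoef \<eta> k\<bar> * (real (Suc (hfst k)) * real (Suc (hsnd k))))" for k
    by (simp add: envelope_coef_def mult_ac)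
  note s = summable_hcoef[OF SU_schwartz[OF assms(1)] assms(2)]
  show "summable (\<lambda>k. envelope_coef \<eta> k * real (Suc (hfst k)))" unfolding e by (rule summable_mult[OF s(1)])
  show "(\<Sum>k. envelope_coef \<eta> k * real (Suc (hfst k))) \<le> 2 * hweight_const * hnorm p \<eta>"
    unfolding e suminf_mult[OF s(1)] using s(2) by simp
qed

lemma SU_difference_le:
  assumes \<eta>: "\<eta> \<in> SU"
  shows "summable (\<lambda>k. envelope_coef \<eta> k * \<bar>hermite_fun (hfst k) u\<bar>)"
    and "\<bar>\<eta> (u, y)\<bar> \<le> \<bar>y\<bar> * (\<Sum>k. envelope_coef \<eta> k * \<bar>hermite_fun (hfst k) u\<bar>)"
    and "summable (\<lambda>k. envelope_coef \<eta> k * \<bar>hermite_fun (hfst k) u - hermite_fun (hfst k) u'\<bar>)"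
    and "\<bar>\<eta> (u, y) - \<eta> (u', y)\<bar> \<le> \<bar>y\<bar> * (\<Sum>k. envelope_coef \<eta> k * \<bar>hermite_fun (hfst k) u - hermite_fun (hfst k) u'\<bar>)"
proof -
  note S = summable_envelope_coef(1)[OF \<eta> order_refl]
  have sm: "summable (\<lambda>k. envelope_coef \<eta> k * f k)" if "\<And>k. 0 \<le> f k" "\<And>k. f k \<le> C * real (Suc (hfst k))" for f C
  proof (rule summable_comparison_test'[OF summable_mult[OF S, of C], of 0])
    show "norm (envelope_coef \<eta> k * f k) \<le> C * (envelope_coef \<eta> k * real (Suc (hfst k)))" for k
      using mult_left_mono[OF that(2)[of k] envelope_coef_nonneg[of \<eta> k]] that(1)[of k] envelope_coef_nonneg[of \<eta> k]
      by (simp add: abs_mult mult_ac)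
  qed
  have gen: "\<bar>\<Sum>k. hcoef \<eta> k * (f k * (hermite_fun (hsnd k) y - hermite_fun (hsnd k) 0))\<bar>
      \<le> \<bar>y\<bar> * (\<Sum>k. envelope_coef \<eta> k * \<bar>f k\<bar>)" if s: "summable (\<lambda>k. envelope_coef \<eta> k * \<bar>f k\<bar>)" for f
  proof -
    have le: "norm (hcoef \<eta> k * (f k * (hermite_fun (hsnd k) y - hermite_fun (hsnd k) 0))) \<le> \<bar>y\<bar> * (envelope_coef \<eta> k * \<bar>f k\<bar>)" for k
    proof -
      have "\<bar>hcoef \<eta> k\<bar> * (\<bar>f k\<bar> * \<bar>hermite_fun (hsnd k) y - hermite_fun (hsnd k) 0\<bar>) \<le>
          \<bar>hcoef \<eta> k\<bar> * (\<bar>f k\<bar> * (2 * real (Suc (hsnd k)) * \<bar>y - 0\<bar>))"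
        by (intro mult_left_mono hermite_fun_lipschitz) auto
      then show ?thesis by (simp add: abs_mult envelope_coef_def mult_ac del: of_nat_Suc)
    qed
    have "norm (\<Sum>k. hcoef \<eta> k * (f k * (hermite_fun (hsnd k) y - hermite_fun (hsnd k) 0))) \<le> (\<Sum>k. \<bar>y\<bar> * (envelope_coef \<eta> k * \<bar>f k\<bar>))"
      by (intro norm_suminf_le le summable_mult s)
    then show ?thesis by (simp add: suminf_mult[OF s])
  qed
  have ex: "(\<lambda>k. hcoef \<eta> k * (hermite_fun (hfst k) u * (hermite_fun (hsnd k) y - hermite_fun (hsnd k) 0))) sums \<eta> (u, y)" for u
  proof -
    have "\<eta> (u, 0) = 0" using \<eta> by (simp add: SU_def)
    then show ?thesis
      using sums_diff[OF hermite_expansion[OF SU_schwartz[OF \<eta>], of u y] hermite_expansion[OF SU_schwartz[OF \<eta>], of u 0]]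
      by (simp add: algebra_simps)
  qed
  show s1: "summable (\<lambda>k. envelope_coef \<eta> k * \<bar>hermite_fun (hfst k) u\<bar>)"
    by (rule sm[where C=2]) (use hermite_fun_bound' in auto)
  show s2: "summable (\<lambda>k. envelope_coef \<eta> k * \<bar>hermite_fun (hfst k) u - hermite_fun (hfst k) u'\<bar>)"
  proof (rule sm[where C="2 * \<bar>u - u'\<bar>"])
    show "\<bar>hermite_fun (hfst k) u - hermite_fun (hfst k) u'\<bar> \<le> 2 * \<bar>u - u'\<bar> * real (Suc (hfst k))" for k
      using hermite_fun_lipschitz[of "hfst k" u u'] by (simp add: mult_ac del: of_nat_Suc)
  qed simp
  show "\<bar>\<eta> (u, y)\<bar> \<le> \<bar>y\<bar> * (\<Sum>k. envelope_coef \<eta> k * \<bar>hermite_fun (hfst k) u\<bar>)"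
    using gen[OF s1] ex[of u] by (simp add: sums_iff)
  have "(\<lambda>k. hcoef \<eta> k * ((hermite_fun (hfst k) u - hermite_fun (hfst k) u') * (hermite_fun (hsnd k) y - hermite_fun (hsnd k) 0))) sums (\<eta> (u, y) - \<eta> (u', y))"
    using sums_diff[OF ex[of u] ex[of u']] by (simp add: algebra_simps)
  then show "\<bar>\<eta> (u, y) - \<eta> (u', y)\<bar> \<le> \<bar>y\<bar> * (\<Sum>k. envelope_coef \<eta> k * \<bar>hermite_fun (hfst k) u - hermite_fun (hfst k) u'\<bar>)"
    using gen[OF s2] by (simp add: sums_iff)
qed

lemma nn_integral_envelope_le:
  fixes f :: "nat \<Rightarrow> real \<Rightarrow> real"
  assumes "\<eta> \<in> SU" "p \<ge> 2" and f [measurable]: "\<And>m. f m \<in> borel_measurable borel" and D: "0 \<le> D"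
    and s: "\<And>v. summable (\<lambda>k. envelope_coef \<eta> k * \<bar>f (hfst k) v\<bar>)"
    and le: "\<And>m. (\<integral>\<^sup>+v. ennreal (indicator {0<..} v * v powr (\<beta> - 1) * \<bar>f m v\<bar>) \<partial>lborel) \<le> ennreal (D * real (Suc m))"
  shows "(\<integral>\<^sup>+v. ennreal (indicator {0<..} v * v powr (\<beta> - 1) * (\<Sum>k. envelope_coef \<eta> k * \<bar>f (hfst k) v\<bar>)) \<partial>lborel)
     \<le> ennreal (D * (2 * hweight_const * hnorm p \<eta>))"
proof -
  note S = summable_envelope_coef[OF assms(1,2)]
  have "(\<integral>\<^sup>+v. ennreal (indicator {0<..} v * v powr (\<beta> - 1) * (\<Sum>k. envelope_coef \<eta> k * \<bar>f (hfst k) v\<bar>)) \<partial>lborel) =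
     (\<integral>\<^sup>+v. (\<Sum>k. ennreal (envelope_coef \<eta> k) * ennreal (indicator {0<..} v * v powr (\<beta> - 1) * \<bar>f (hfst k) v\<bar>)) \<partial>lborel)"
  proof (intro nn_integral_cong)
    fix v :: real
    have "(\<Sum>k. ennreal (envelope_coef \<eta> k) * ennreal (indicator {0<..} v * v powr (\<beta> - 1) * \<bar>f (hfst k) v\<bar>)) =
       (\<Sum>k. ennreal ((indicator {0<..} v * v powr (\<beta> - 1)) * (envelope_coef \<eta> k * \<bar>f (hfst k) v\<bar>)))"
      by (intro suminf_cong) (simp add: envelope_coef_nonneg ennreal_mult[symmetric] mult_ac)
    also have "\<dots> = ennreal (\<Sum>k. (indicator {0<..} v * v powr (\<beta> - 1)) * (envelope_coef \<eta> k * \<bar>f (hfst k) v\<bar>))"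
      by (intro suminf_ennreal2 summable_mult s) (simp add: envelope_coef_nonneg)
    finally show "ennreal (indicator {0<..} v * v powr (\<beta> - 1) * (\<Sum>k. envelope_coef \<eta> k * \<bar>f (hfst k) v\<bar>)) =
       (\<Sum>k. ennreal (envelope_coef \<eta> k) * ennreal (indicator {0<..} v * v powr (\<beta> - 1) * \<bar>f (hfst k) v\<bar>))"
      by (simp add: suminf_mult[OF s])
  qed
  also have "\<dots> = (\<Sum>k. ennreal (envelope_coef \<eta> k) * (\<integral>\<^sup>+v. ennreal (indicator {0<..} v * v powr (\<beta> - 1) * \<bar>f (hfst k) v\<bar>) \<partial>lborel))"
    by (subst nn_integral_suminf) (auto simp: nn_integral_cmult)
  also have "\<dots> \<le> (\<Sum>k. ennreal (D * (envelope_coef \<eta> k * real (Suc (hfst k)))))"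
  proof (intro suminf_le)
    fix k
    have "ennreal (envelope_coef \<eta> k) * (\<integral>\<^sup>+v. ennreal (indicator {0<..} v * v powr (\<beta> - 1) * \<bar>f (hfst k) v\<bar>) \<partial>lborel)
      \<le> ennreal (envelope_coef \<eta> k) * ennreal (D * real (Suc (hfst k)))" by (intro mult_left_mono le) auto
    also have "\<dots> = ennreal (D * (envelope_coef \<eta> k * real (Suc (hfst k))))"
      using D by (simp add: envelope_coef_nonneg ennreal_mult[symmetric] mult_ac)
    finally show "ennreal (envelope_coef \<eta> k) * (\<integral>\<^sup>+v. ennreal (indicator {0<..} v * v powr (\<beta> - 1) * \<bar>f (hfst k) v\<bar>) \<partial>lborel) \<le> \<dots>" .
  qed auto
  also have "\<dots> = ennreal (\<Sum>k. D * (envelope_coef \<eta> k * real (Suc (hfst k))))"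
    using D by (intro suminf_ennreal2 summable_mult S(1)) (simp add: envelope_coef_nonneg)
  also have "\<dots> \<le> ennreal (D * (2 * hweight_const * hnorm p \<eta>))"
    unfolding suminf_mult[OF S(1)] using D S(2) by (intro ennreal_leI mult_left_mono)
  finally show ?thesis .
qed

section \<open>Fractional noise as a functional on test functions\<close>

locale levy_noise =
  fixes \<nu> :: "real measure" and \<beta> :: real
  assumes sets_nu [measurable_cong, simp]: "sets \<nu> = sets borel"
    and nu_zero: "emeasure \<nu> {0} = 0"
    and nu_finite: "(\<integral>\<^sup>+x. ennreal (\<bar>x\<bar>\<^sup>2) \<partial>\<nu>) < \<infinity>"
    and beta: "0 < \<beta>" "\<beta> < 1/2"
begin

lemma space_nu [simp]: "space \<nu> = UNIV"
  using sets_eq_imp_space_eq[OF sets_nu] by simp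

lemma integrable_square: "integrable \<nu> (\<lambda>x. x\<^sup>2)"
  using nu_finite by (intro integrableI_bounded) auto

definition M2 :: real where "M2 = (LINT x|\<nu>. x\<^sup>2)"

lemma M2_nonneg: "0 \<le> M2" unfolding M2_def by (intro integral_nonneg_AE) auto

lemma sigma_finite_nu: "sigma_finite_measure \<nu>"
proof (intro sigma_finite_measure.intro exI conjI ballI)
  let ?A = "insert {0} (range (\<lambda>n. {x::real. 1 \<le> real (Suc n) * \<bar>x\<bar>}))"
  show "countable ?A" by simp
  show "?A \<subseteq> sets \<nu>" by auto
  show "\<Union>?A = space \<nu>"
  proof -
    have "\<exists>n. 1 \<le> real (Suc n) * \<bar>x\<bar>" if "x \<noteq> 0" for x :: real
    proof -
      obtain n where "1 / \<bar>x\<bar> < real n" using reals_Archimedean2 by blast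
      then have "1 \<le> real (Suc n) * \<bar>x\<bar>" using that by (simp add: field_simps)
      then show ?thesis by blast
    qed
    then show ?thesis by auto
  qed
  fix a assume "a \<in> ?A"
  then consider "a = {0}" | n where "a = {x::real. 1 \<le> real (Suc n) * \<bar>x\<bar>}" by auto
  then show "emeasure \<nu> a \<noteq> \<infinity>"
  proof cases
    case 2
    have "emeasure \<nu> a = (\<integral>\<^sup>+x. indicator a x \<partial>\<nu>)" using 2 by simp
    also have "\<dots> \<le> (\<integral>\<^sup>+x. ennreal ((real (Suc n))\<^sup>2) * ennreal (\<bar>x\<bar>\<^sup>2) \<partial>\<nu>)"
    proof (intro nn_integral_mono)
      fix x
      have "1 \<le> (real (Suc n) * \<bar>x\<bar>)\<^sup>2" if "x \<in> a" using that 2 by (intro one_le_power) auto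
      then have "1 \<le> ennreal ((real (Suc n))\<^sup>2) * ennreal (\<bar>x\<bar>\<^sup>2)" if "x \<in> a"
        using that by (simp add: ennreal_mult[symmetric] power_mult_distrib del: of_nat_Suc)
      then show "indicator a x \<le> ennreal ((real (Suc n))\<^sup>2) * ennreal (\<bar>x\<bar>\<^sup>2)" by (auto simp: indicator_def)
    qed
    also have "\<dots> = ennreal ((real (Suc n))\<^sup>2) * (\<integral>\<^sup>+x. ennreal (\<bar>x\<bar>\<^sup>2) \<partial>\<nu>)" by (rule nn_integral_cmult) simp
    also have "\<dots> < \<infinity>" using nu_finite by (simp add: ennreal_mult_less_top)
    finally show ?thesis by simp
  qed (simp add: nu_zero)
qed

lemma SU_slice_measurable [measurable]:
  assumes "\<eta> \<in> SU" shows "(\<lambda>y. \<eta> (u, y)) \<in> borel_measurable borel"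
  by (rule borel_measurable_continuous_onI[OF continuous_on_compose2[OF schwartz_continuous[OF SU_schwartz[OF assms], of UNIV]]])
    (auto intro!: continuous_intros)

definition envelope :: "pfun \<Rightarrow> real \<Rightarrow> real" where
  "envelope \<eta> u = M2 * (\<Sum>k. envelope_coef \<eta> k * \<bar>hermite_fun (hfst k) u\<bar>)"

definition slice :: "pfun \<Rightarrow> real \<Rightarrow> real" where
  "slice \<eta> u = (LINT y|\<nu>. y * \<eta> (u, y))"

lemma slice_integrable:
  assumes "\<eta> \<in> SU"
  shows "integrable \<nu> (\<lambda>y. y * \<eta> (u, y))"
proof (rule Bochner_Integration.integrable_bound)
  let ?E = "\<Sum>k. envelope_coef \<eta> k * \<bar>hermite_fun (hfst k) u\<bar>"
  show "integrable \<nu> (\<lambda>y. ?E * y\<^sup>2)" using integrable_square by simp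
  show "AE y in \<nu>. norm (y * \<eta> (u, y)) \<le> norm (?E * y\<^sup>2)"
  proof (intro AE_I2)
    fix y
    have "\<bar>y\<bar> * \<bar>\<eta> (u, y)\<bar> \<le> \<bar>y\<bar> * (\<bar>y\<bar> * ?E)" by (intro mult_left_mono SU_difference_le(2)[OF assms]) auto
    also have "\<dots> \<le> \<bar>?E * y\<^sup>2\<bar>" by (auto simp: power2_eq_square abs_mult mult_ac intro!: mult_left_mono abs_ge_self)
    finally show "norm (y * \<eta> (u, y)) \<le> norm (?E * y\<^sup>2)" by (simp add: abs_mult)
  qed
  show "(\<lambda>y. y * \<eta> (u, y)) \<in> borel_measurable \<nu>" using SU_slice_measurable[OF assms] by measurable
qed

lemma integral_slice_le:
  assumes f: "integrable \<nu> (\<lambda>y. y * f y)" and le: "\<And>y. \<bar>f y\<bar> \<le> \<bar>y\<bar> * E"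
  shows "\<bar>LINT y|\<nu>. y * f y\<bar> \<le> M2 * E"
proof -
  have "\<bar>LINT y|\<nu>. y * f y\<bar> \<le> (LINT y|\<nu>. norm (y * f y))"
    using integral_norm_bound[of \<nu> "\<lambda>y. y * f y"] by simp
  also have "\<dots> \<le> (LINT y|\<nu>. E * y\<^sup>2)"
  proof (intro integral_mono integrable_norm f)
    show "integrable \<nu> (\<lambda>y. E * y\<^sup>2)" using integrable_square by simp
    show "norm (y * f y) \<le> E * y\<^sup>2" for y
      using mult_left_mono[OF le[of y], of "\<bar>y\<bar>"] by (simp add: abs_mult power2_eq_square mult_ac)
  qed
  finally show ?thesis by (simp add: M2_def mult.commute)
qed

lemma slice_le: "\<eta> \<in> SU \<Longrightarrow> \<bar>slice \<eta> u\<bar> \<le> envelope \<eta> u"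
  unfolding slice_def envelope_def by (intro integral_slice_le slice_integrable SU_difference_le(2))

lemma slice_diff_le:
  assumes "\<eta> \<in> SU"
  shows "\<bar>slice \<eta> u - slice \<eta> u'\<bar> \<le> M2 * (\<Sum>k. envelope_coef \<eta> k * \<bar>hermite_fun (hfst k) u - hermite_fun (hfst k) u'\<bar>)"
proof -
  have e: "slice \<eta> u - slice \<eta> u' = (LINT y|\<nu>. y * (\<eta> (u, y) - \<eta> (u', y)))"
    unfolding slice_def using slice_integrable[OF assms] by (simp add: right_diff_distrib)
  have "integrable \<nu> (\<lambda>y. y * (\<eta> (u, y) - \<eta> (u', y)))"
    using slice_integrable[OF assms] by (simp add: right_diff_distrib)
  then show ?thesis unfolding e by (rule integral_slice_le[OF _ SU_difference_le(4)[OF assms]])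
qed

lemma slice_continuous:
  assumes "\<eta> \<in> SU" shows "continuous_on UNIV (slice \<eta>)"
proof -
  note S = summable_envelope_coef(1)[OF assms order_refl]
  let ?S = "\<Sum>k. envelope_coef \<eta> k * real (Suc (hfst k))"
  have "\<bar>slice \<eta> u - slice \<eta> u'\<bar> \<le> (M2 * (2 * ?S)) * \<bar>u - u'\<bar>" for u u'
  proof -
    have "(\<Sum>k. envelope_coef \<eta> k * \<bar>hermite_fun (hfst k) u - hermite_fun (hfst k) u'\<bar>) \<le>
        (\<Sum>k. (2 * \<bar>u - u'\<bar>) * (envelope_coef \<eta> k * real (Suc (hfst k))))"
    proof (intro suminf_le SU_difference_le(3) assms summable_mult S)
      fix k
      have "envelope_coef \<eta> k * \<bar>hermite_fun (hfst k) u - hermite_fun (hfst k) u'\<bar> \<le> envelope_coef \<eta> k * (2 * real (Suc (hfst k)) * \<bar>u - u'\<bar>)"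
        by (intro mult_left_mono hermite_fun_lipschitz envelope_coef_nonneg)
      then show "envelope_coef \<eta> k * \<bar>hermite_fun (hfst k) u - hermite_fun (hfst k) u'\<bar> \<le> (2 * \<bar>u - u'\<bar>) * (envelope_coef \<eta> k * real (Suc (hfst k)))"
        by (simp add: algebra_simps)
    qed
    from order_trans[OF slice_diff_le[OF assms] mult_left_mono[OF this M2_nonneg]]
    show ?thesis unfolding suminf_mult[OF S] by (simp add: mult_ac)
  qed
  then have "(M2 * (2 * ?S))-lipschitz_on UNIV (slice \<eta>)"
    using suminf_nonneg[OF S] M2_nonneg by (intro lipschitz_onI) (auto simp: dist_real_def envelope_coef_nonneg)
  then show ?thesis by (rule lipschitz_on_continuous_on)
qed

lemma slice_measurable [measurable]: "\<eta> \<in> SU \<Longrightarrow> slice \<eta> \<in> borel_measurable borel"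
  by (intro borel_measurable_continuous_onI slice_continuous)

lemma envelope_measurable [measurable]: "envelope \<eta> \<in> borel_measurable borel"
  unfolding envelope_def[abs_def] by measurable

lemma envelope_nonneg: "\<eta> \<in> SU \<Longrightarrow> 0 \<le> envelope \<eta> u"
  using slice_le[of \<eta> u] by linarith

definition noise_const :: real where
  "noise_const = M2 * frac_const \<beta> * 2 * hweight_const"

lemma noise_const_nonneg: "0 \<le> noise_const"
  unfolding noise_const_def
  by (intro mult_nonneg_nonneg M2_nonneg frac_const_nonneg beta hweight_const_nonneg) auto

lemma kernel_envelope_le:
  assumes "\<eta> \<in> SU" "p \<ge> 2"
  shows "(\<integral>\<^sup>+v. ennreal (indicator {0<..} v * v powr (\<beta> - 1) * envelope \<eta> (t - v)) \<partial>lborel) \<le> ennreal (noise_const * hnorm p \<eta>)"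
proof -
  have "(\<integral>\<^sup>+v. ennreal (indicator {0<..} v * v powr (\<beta> - 1) * envelope \<eta> (t - v)) \<partial>lborel) =
    (\<integral>\<^sup>+v. ennreal M2 * ennreal (indicator {0<..} v * v powr (\<beta> - 1) * (\<Sum>k. envelope_coef \<eta> k * \<bar>hermite_fun (hfst k) (t - v)\<bar>)) \<partial>lborel)"
    using M2_nonneg by (intro nn_integral_cong) (simp add: envelope_def ennreal_mult'[symmetric] mult_ac)
  also have "\<dots> = ennreal M2 * (\<integral>\<^sup>+v. ennreal (indicator {0<..} v * v powr (\<beta> - 1) * (\<Sum>k. envelope_coef \<eta> k * \<bar>hermite_fun (hfst k) (t - v)\<bar>)) \<partial>lborel)"
    by (rule nn_integral_cmult) measurable
  also have "\<dots> \<le> ennreal M2 * ennreal (frac_const \<beta> * (2 * hweight_const * hnorm p \<eta>))"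
    by (intro mult_left_mono nn_integral_envelope_le[where f="\<lambda>m v. hermite_fun m (t - v)"] assms frac_const_nonneg beta
      SU_difference_le(1) frac_hermite_le) auto
  also have "\<dots> = ennreal (noise_const * hnorm p \<eta>)"
    using M2_nonneg by (simp add: ennreal_mult'[symmetric] noise_const_def mult_ac)
  finally show ?thesis .
qed

lemma kernel_slice_difference_le:
  assumes "\<eta> \<in> SU" "p \<ge> 2"
  shows "(\<integral>\<^sup>+v. ennreal (indicator {0<..} v * v powr (\<beta> - 1) * \<bar>slice \<eta> (t - v) - slice \<eta> (s - v)\<bar>) \<partial>lborel)
    \<le> ennreal (noise_const * hnorm p \<eta> * \<bar>t - s\<bar>)"
proof -
  let ?D = "\<lambda>v k. envelope_coef \<eta> k * \<bar>hermite_fun (hfst k) (t - v) - hermite_fun (hfst k) (s - v)\<bar>"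
  have "(\<integral>\<^sup>+v. ennreal (indicator {0<..} v * v powr (\<beta> - 1) * \<bar>slice \<eta> (t - v) - slice \<eta> (s - v)\<bar>) \<partial>lborel) \<le>
    (\<integral>\<^sup>+v. ennreal M2 * ennreal (indicator {0<..} v * v powr (\<beta> - 1) * suminf (?D v)) \<partial>lborel)"
  proof (intro nn_integral_mono)
    fix v :: real
    have "indicator {0<..} v * v powr (\<beta> - 1) * \<bar>slice \<eta> (t - v) - slice \<eta> (s - v)\<bar> \<le>
        indicator {0<..} v * v powr (\<beta> - 1) * (M2 * suminf (?D v))"
      by (intro mult_left_mono slice_diff_le assms) auto
    then show "ennreal (indicator {0<..} v * v powr (\<beta> - 1) * \<bar>slice \<eta> (t - v) - slice \<eta> (s - v)\<bar>) \<le>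
        ennreal M2 * ennreal (indicator {0<..} v * v powr (\<beta> - 1) * suminf (?D v))"
      using M2_nonneg by (simp add: ennreal_mult'[symmetric] mult_ac ennreal_leI)
  qed
  also have "\<dots> = ennreal M2 * (\<integral>\<^sup>+v. ennreal (indicator {0<..} v * v powr (\<beta> - 1) * suminf (?D v)) \<partial>lborel)"
    by (rule nn_integral_cmult) measurable
  also have "\<dots> \<le> ennreal M2 * ennreal ((frac_const \<beta> * \<bar>t - s\<bar>) * (2 * hweight_const * hnorm p \<eta>))"
  proof (intro mult_left_mono nn_integral_envelope_le[where f="\<lambda>m v. hermite_fun m (t - v) - hermite_fun m (s - v)"] assms SU_difference_le(3))
    show "0 \<le> frac_const \<beta> * \<bar>t - s\<bar>" by (intro mult_nonneg_nonneg frac_const_nonneg beta) auto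
    show "(\<integral>\<^sup>+v. ennreal (indicator {0<..} v * v powr (\<beta> - 1) * \<bar>hermite_fun m (t - v) - hermite_fun m (s - v)\<bar>) \<partial>lborel)
      \<le> ennreal (frac_const \<beta> * \<bar>t - s\<bar> * real (Suc m))" for m
      using frac_hermite_difference_le[OF beta, of m t s] by (simp add: mult_ac del: of_nat_Suc)
  qed auto
  also have "\<dots> = ennreal (noise_const * hnorm p \<eta> * \<bar>t - s\<bar>)"
    using M2_nonneg by (simp add: ennreal_mult'[symmetric] noise_const_def mult_ac)
  finally show ?thesis .
qed

definition noise :: "real \<Rightarrow> pfun \<Rightarrow> real" where
  "noise t \<eta> = (LINT v|lborel. indicator {0<..} v * v powr (\<beta> - 1) * slice \<eta> (t - v)) / Gamma \<beta>"

lemma Gamma_pos: "0 < Gamma \<beta>" using beta by (simp add: Gamma_real_pos)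

lemma noise_integrable:
  assumes "\<eta> \<in> SU"
  shows "integrable lborel (\<lambda>v. indicator {0<..} v * v powr (\<beta> - 1) * slice \<eta> (t - v))"
proof (rule integrableI_bounded)
  have "(\<integral>\<^sup>+v. ennreal (norm (indicator {0<..} v * v powr (\<beta> - 1) * slice \<eta> (t - v))) \<partial>lborel) \<le>
      (\<integral>\<^sup>+v. ennreal (indicator {0<..} v * v powr (\<beta> - 1) * envelope \<eta> (t - v)) \<partial>lborel)"
    using slice_le[OF assms] by (intro nn_integral_mono ennreal_leI) (auto simp: abs_mult intro!: mult_left_mono)
  also have "\<dots> < \<infinity>"
    unfolding infinity_ennreal_def by (rule le_less_trans[OF kernel_envelope_le[OF assms order_refl] ennreal_less_top])
  finally show "(\<integral>\<^sup>+v. ennreal (norm (indicator {0<..} v * v powr (\<beta> - 1) * slice \<eta> (t - v))) \<partial>lborel) < \<infinity>" .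
qed (use assms in measurable)

lemma noise_diff_le:
  assumes "\<eta> \<in> SU" "p \<ge> 2"
  shows "\<bar>noise t \<eta> - noise s \<eta>\<bar> \<le> noise_const / Gamma \<beta> * \<bar>t - s\<bar> * hnorm p \<eta>"
proof -
  let ?k = "\<lambda>v::real. indicator {0<..} v * v powr (\<beta> - 1)"
  have h0: "0 \<le> hnorm p \<eta>" using quadratic_norm.nonneg[OF quadratic_norm_hnorm SU_schwartz[OF assms(1)]] .
  have i: "integrable lborel (\<lambda>v. ?k v * slice \<eta> (t - v) - ?k v * slice \<eta> (s - v))"
    by (intro Bochner_Integration.integrable_diff noise_integrable assms)
  have "noise t \<eta> - noise s \<eta> = (LINT v|lborel. ?k v * slice \<eta> (t - v) - ?k v * slice \<eta> (s - v)) / Gamma \<beta>"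
    unfolding noise_def using noise_integrable[OF assms(1)] by (simp add: diff_divide_distrib)
  moreover have "\<bar>LINT v|lborel. ?k v * slice \<eta> (t - v) - ?k v * slice \<eta> (s - v)\<bar> \<le> noise_const * hnorm p \<eta> * \<bar>t - s\<bar>"
  proof -
    have "ennreal \<bar>LINT v|lborel. ?k v * slice \<eta> (t - v) - ?k v * slice \<eta> (s - v)\<bar> \<le>
       (\<integral>\<^sup>+v. ennreal (norm (?k v * slice \<eta> (t - v) - ?k v * slice \<eta> (s - v))) \<partial>lborel)"
      using integral_norm_bound_ennreal[OF i] by simp
    also have "\<dots> = (\<integral>\<^sup>+v. ennreal (?k v * \<bar>slice \<eta> (t - v) - slice \<eta> (s - v)\<bar>) \<partial>lborel)"
      by (intro nn_integral_cong) (simp add: abs_mult flip: right_diff_distrib)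
    also have "\<dots> \<le> ennreal (noise_const * hnorm p \<eta> * \<bar>t - s\<bar>)" by (rule kernel_slice_difference_le[OF assms])
    finally show ?thesis using noise_const_nonneg h0 by (subst (asm) ennreal_le_iff) auto
  qed
  ultimately show ?thesis using Gamma_pos by (simp add: divide_right_mono mult_ac)
qed

lemma noise_le:
  assumes "\<eta> \<in> SU" "p \<ge> 2"
  shows "\<bar>noise t \<eta>\<bar> \<le> noise_const / Gamma \<beta> * hnorm p \<eta>"
proof -
  let ?k = "\<lambda>v::real. indicator {0<..} v * v powr (\<beta> - 1)"
  have h0: "0 \<le> hnorm p \<eta>" using quadratic_norm.nonneg[OF quadratic_norm_hnorm SU_schwartz[OF assms(1)]] .
  have "ennreal \<bar>LINT v|lborel. ?k v * slice \<eta> (t - v)\<bar> \<le> (\<integral>\<^sup>+v. ennreal (norm (?k v * slice \<eta> (t - v))) \<partial>lborel)"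
    using integral_norm_bound_ennreal[OF noise_integrable[OF assms(1)], of t] by simp
  also have "\<dots> \<le> (\<integral>\<^sup>+v. ennreal (?k v * envelope \<eta> (t - v)) \<partial>lborel)"
    using slice_le[OF assms(1)] by (intro nn_integral_mono ennreal_leI) (auto simp: abs_mult intro!: mult_left_mono)
  also have "\<dots> \<le> ennreal (noise_const * hnorm p \<eta>)" by (rule kernel_envelope_le[OF assms])
  finally have "\<bar>LINT v|lborel. ?k v * slice \<eta> (t - v)\<bar> \<le> noise_const * hnorm p \<eta>"
    using noise_const_nonneg h0 by (subst (asm) ennreal_le_iff) auto
  then show ?thesis using Gamma_pos by (simp add: noise_def abs_mult divide_right_mono)
qed

lemma noise_lin:
  assumes "\<phi> \<in> SU" "\<psi> \<in> SU"
  shows "noise t (\<lambda>z. a * \<phi> z + b * \<psi> z) = a * noise t \<phi> + b * noise t \<psi>"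
proof -
  have sl: "slice (\<lambda>z. a * \<phi> z + b * \<psi> z) u = a * slice \<phi> u + b * slice \<psi> u" for u
  proof -
    have "slice (\<lambda>z. a * \<phi> z + b * \<psi> z) u = (LINT y|\<nu>. a * (y * \<phi> (u, y)) + b * (y * \<psi> (u, y)))"
      unfolding slice_def by (intro Bochner_Integration.integral_cong refl) (simp add: algebra_simps)
    also have "\<dots> = a * slice \<phi> u + b * slice \<psi> u"
      using slice_integrable[OF assms(1)] slice_integrable[OF assms(2)] by (simp add: slice_def)
    finally show ?thesis .
  qed
  let ?k = "\<lambda>v::real. indicator {0<..} v * v powr (\<beta> - 1)"
  have "(LINT v|lborel. ?k v * slice (\<lambda>z. a * \<phi> z + b * \<psi> z) (t - v)) =
     (LINT v|lborel. a * (?k v * slice \<phi> (t - v)) + b * (?k v * slice \<psi> (t - v)))"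
    by (intro Bochner_Integration.integral_cong refl) (simp add: sl algebra_simps)
  also have "\<dots> = a * (LINT v|lborel. ?k v * slice \<phi> (t - v)) + b * (LINT v|lborel. ?k v * slice \<psi> (t - v))"
    using noise_integrable[OF assms(1)] noise_integrable[OF assms(2)] by simp
  finally show ?thesis by (simp add: noise_def add_divide_distrib)
qed

lemma SU_measurable_pair: "\<eta> \<in> SU \<Longrightarrow> \<eta> \<in> borel_measurable (borel \<Otimes>\<^sub>M borel)"
  using schwartz_measurable[OF SU_schwartz] by (simp add: borel_prod)

lemma noise_Npi:
  assumes "\<psi> \<in> Npi \<nu>" shows "noise t \<psi> = 0"
proof -
  interpret sigma_finite_measure \<nu> by (rule sigma_finite_nu)
  have \<psi>: "\<psi> \<in> SU" and z: "(\<integral>\<^sup>+z. ennreal ((\<psi> z)\<^sup>2) \<partial>(lborel \<Otimes>\<^sub>M \<nu>)) = 0"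
    using assms by (auto simp: Npi_def pi_measure_def)
  note [measurable] = SU_measurable_pair[OF \<psi>]
  have "(\<integral>\<^sup>+u. \<integral>\<^sup>+y. ennreal ((\<psi> (u, y))\<^sup>2) \<partial>\<nu> \<partial>lborel) = 0"
    using z by (subst nn_integral_fst) auto
  then have "AE u in lborel. (\<integral>\<^sup>+y. ennreal ((\<psi> (u, y))\<^sup>2) \<partial>\<nu>) = 0"
    by (subst (asm) nn_integral_0_iff_AE) auto
  then have ae: "AE u in lborel. slice \<psi> u = 0"
  proof eventually_elim
    case (elim u)
    then have "AE y in \<nu>. ennreal ((\<psi> (u, y))\<^sup>2) = 0"
      using SU_slice_measurable[OF \<psi>] by (subst (asm) nn_integral_0_iff_AE) auto
    then have "AE y in \<nu>. y * \<psi> (u, y) = 0" by eventually_elim (simp add: ennreal_eq_0_iff)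
    then show ?case unfolding slice_def by (rule integral_eq_zero_AE)
  qed
  have "AE v in lborel. slice \<psi> (t - v) = 0"
  proof -
    have "(\<integral>\<^sup>+v. ennreal \<bar>slice \<psi> (t - v)\<bar> \<partial>lborel) = (\<integral>\<^sup>+v. ennreal \<bar>slice \<psi> v\<bar> \<partial>lborel)"
      by (rule nn_integral_reflect[where f="\<lambda>v. ennreal \<bar>slice \<psi> v\<bar>"]) (use \<psi> in measurable)
    also have "\<dots> = 0" using ae \<psi> by (subst nn_integral_0_iff_AE) auto
    finally show ?thesis using \<psi> by (subst (asm) nn_integral_0_iff_AE) auto
  qed
  then have "AE v in lborel. indicator {0<..} v * v powr (\<beta> - 1) * slice \<psi> (t - v) = 0" by eventually_elim simp
  then have "(LINT v|lborel. indicator {0<..} v * v powr (\<beta> - 1) * slice \<psi> (t - v)) = 0" by (rule integral_eq_zero_AE)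
  then show ?thesis by (simp add: noise_def)
qed

lemma Npi_lin: assumes "\<phi> \<in> Npi \<nu>" "\<psi> \<in> Npi \<nu>" shows "(\<lambda>z. a * \<phi> z + b * \<psi> z) \<in> Npi \<nu>"
proof -
  have SU: "\<phi> \<in> SU" "\<psi> \<in> SU" using assms by (auto simp: Npi_def)
  note [measurable] = SU(1)[THEN SU_measurable_pair] SU(2)[THEN SU_measurable_pair]
  have "AE z in lborel \<Otimes>\<^sub>M \<nu>. \<phi> z = 0" "AE z in lborel \<Otimes>\<^sub>M \<nu>. \<psi> z = 0"
    using assms unfolding Npi_def pi_measure_def by (auto simp: nn_integral_0_iff_AE)
  then have "AE z in lborel \<Otimes>\<^sub>M \<nu>. ennreal ((a * \<phi> z + b * \<psi> z)\<^sup>2) = 0" by eventually_elim simp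
  then have "(\<integral>\<^sup>+z. ennreal ((a * \<phi> z + b * \<psi> z)\<^sup>2) \<partial>(lborel \<Otimes>\<^sub>M \<nu>)) = 0"
    by (subst nn_integral_0_iff_AE) auto
  then show ?thesis using SU_lin[OF SU] by (simp add: Npi_def pi_measure_def)
qed

lemma quadratic_norm_qnorm: "quadratic_norm SU (qnorm \<nu> p)"
proof -
  have "quadratic_norm SU (hnorm p)"
  proof
    interpret quadratic_norm schwartz "hnorm p" by (rule quadratic_norm_hnorm)
    fix \<phi> \<psi> :: pfun and a :: real
    assume "\<phi> \<in> SU"
    then have \<phi>: "\<phi> \<in> schwartz" by (rule SU_schwartz)
    then show "0 \<le> hnorm p \<phi>" "hnorm p (\<lambda>z. a * \<phi> z) = \<bar>a\<bar> * hnorm p \<phi>" by (rule nonneg, rule homog)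
    assume "\<psi> \<in> SU"
    show "(hnorm p (\<phi> + \<psi>))\<^sup>2 + (hnorm p (\<phi> - \<psi>))\<^sup>2 = 2 * (hnorm p \<phi>)\<^sup>2 + 2 * (hnorm p \<psi>)\<^sup>2"
      by (rule parallelogram[OF \<phi> SU_schwartz[OF \<open>\<psi> \<in> SU\<close>]])
  qed (rule SU_zero, rule SU_lin)
  moreover have "(\<lambda>z. 0) \<in> Npi \<nu>" by (simp add: Npi_def SU_zero)
  ultimately have "quadratic_norm SU (\<lambda>\<phi>. INF \<psi>\<in>Npi \<nu>. hnorm p (\<phi> + \<psi>))"
    by (intro quadratic_norm_INF Npi_lin) (auto simp: Npi_def)
  then show ?thesis by (simp add: qnorm_def[abs_def])
qed

lemma le_qnorm:
  assumes l: "\<And>\<eta>. \<eta> \<in> SU \<Longrightarrow> \<bar>l \<eta>\<bar> \<le> K * hnorm p \<eta>" and K: "0 \<le> K" and \<eta>: "\<eta> \<in> SU"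
    and inv: "\<And>\<psi>. \<psi> \<in> Npi \<nu> \<Longrightarrow> l (\<eta> + \<psi>) = l \<eta>"
  shows "\<bar>l \<eta>\<bar> \<le> K * qnorm \<nu> p \<eta>"
proof (cases "K = 0")
  case False
  have add: "\<eta> + \<psi> \<in> SU" if "\<psi> \<in> Npi \<nu>" for \<psi>
    using SU_lin[of \<eta> \<psi> 1 1] \<eta> that by (simp add: Npi_def plus_fun_def)
  have "\<bar>l \<eta>\<bar> / K \<le> qnorm \<nu> p \<eta>"
    unfolding qnorm_def
  proof (rule cINF_greatest)
    have "(\<lambda>_. 0) \<in> Npi \<nu>" by (simp add: Npi_def SU_zero)
    then show "Npi \<nu> \<noteq> {}" by blast
    fix \<psi> assume "\<psi> \<in> Npi \<nu>"
    then show "\<bar>l \<eta>\<bar> / K \<le> hnorm p (\<eta> + \<psi>)"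
      using l[OF add[OF \<open>\<psi> \<in> Npi \<nu>\<close>]] inv False K by (simp add: field_simps)
  qed
  then show ?thesis using False K by (simp add: field_simps)
qed (use l[OF \<eta>] in simp)

lemma noise_add_Npi: "\<eta> \<in> SU \<Longrightarrow> \<psi> \<in> Npi \<nu> \<Longrightarrow> noise t (\<eta> + \<psi>) = noise t \<eta>"
  using noise_lin[of \<eta> \<psi> t 1 1] noise_Npi[of \<psi> t] by (simp add: plus_fun_def Npi_def)

lemma noise_le_qnorm:
  "\<eta> \<in> SU \<Longrightarrow> p \<ge> 2 \<Longrightarrow> \<bar>noise t \<eta>\<bar> \<le> noise_const / Gamma \<beta> * qnorm \<nu> p \<eta>"
  by (rule le_qnorm[where l="noise t"]) (simp_all only: noise_le noise_add_Npi divide_nonneg_pos noise_const_nonneg Gamma_pos)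

lemma noise_diff_le_qnorm:
  assumes "\<eta> \<in> SU" "p \<ge> 2"
  shows "\<bar>noise t \<eta> - noise s \<eta>\<bar> \<le> noise_const / Gamma \<beta> * \<bar>t - s\<bar> * qnorm \<nu> p \<eta>"
  by (rule le_qnorm[where l="\<lambda>\<eta>. noise t \<eta> - noise s \<eta>"])
    (use assms in \<open>simp_all only: noise_diff_le noise_add_Npi divide_nonneg_pos mult_nonneg_nonneg abs_ge_zero noise_const_nonneg Gamma_pos\<close>)


lemma chi_eq: "chi r v = indicator {0<..<r} v - indicator {r<..<0} v"
  by (auto simp: chi_def indicator_def)

lemma chi_measurable [measurable]: "chi r \<in> borel_measurable borel"
  unfolding chi_eq[abs_def] by measurable

definition kernel :: "real \<Rightarrow> real" where
  "kernel w = indicator {0<..} w * w powr (\<beta> - 1)"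

lemma kernel_nonneg: "0 \<le> kernel w" by (simp add: kernel_def)

lemma kernel_measurable [measurable]: "kernel \<in> borel_measurable borel"
  unfolding kernel_def[abs_def] by measurable

lemma frac_int_chi: "frac_int \<beta> f s = (LINT v|lborel. kernel (v - s) * f v) / Gamma \<beta>"
  unfolding frac_int_def set_lebesgue_integral_def kernel_def
  by (intro arg_cong[where f="\<lambda>x. x / Gamma \<beta>"] Bochner_Integration.integral_cong refl) (simp add: indicator_def)

lemma noise_kernel: "noise v \<eta> = (LINT s|lborel. kernel (v - s) * slice \<eta> s) / Gamma \<beta>"
  using lborel_integral_real_affine[of "-1" "\<lambda>s. kernel (v - s) * slice \<eta> s" v]
  by (simp add: noise_def kernel_def)

lemma nn_integral_kernel_chi:
  assumes "\<eta> \<in> SU"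
  shows "(\<integral>\<^sup>+s. \<integral>\<^sup>+v. ennreal (kernel (v - s) * \<bar>chi r v\<bar> * envelope \<eta> s) \<partial>lborel \<partial>lborel) < \<infinity>"
proof -
  have "(\<integral>\<^sup>+s. \<integral>\<^sup>+v. ennreal (kernel (v - s) * \<bar>chi r v\<bar> * envelope \<eta> s) \<partial>lborel \<partial>lborel) =
     (\<integral>\<^sup>+v. \<integral>\<^sup>+s. ennreal (kernel (v - s) * \<bar>chi r v\<bar> * envelope \<eta> s) \<partial>lborel \<partial>lborel)"
    by (rule lborel_pair.Fubini') measurable
  also have "\<dots> \<le> (\<integral>\<^sup>+v. ennreal (noise_const * hnorm 2 \<eta>) * ennreal \<bar>chi r v\<bar> \<partial>lborel)"
  proof (intro nn_integral_mono)
    fix v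
    have "(\<integral>\<^sup>+s. ennreal (kernel (v - s) * \<bar>chi r v\<bar> * envelope \<eta> s) \<partial>lborel) =
        (\<integral>\<^sup>+s. ennreal \<bar>chi r v\<bar> * ennreal (kernel (v - s) * envelope \<eta> s) \<partial>lborel)"
      by (intro nn_integral_cong) (simp add: ennreal_mult'[symmetric] mult_ac)
    also have "\<dots> = ennreal \<bar>chi r v\<bar> * (\<integral>\<^sup>+s. ennreal (kernel (v - s) * envelope \<eta> s) \<partial>lborel)"
      by (rule nn_integral_cmult) measurable
    also have "(\<integral>\<^sup>+s. ennreal (kernel (v - s) * envelope \<eta> s) \<partial>lborel) = (\<integral>\<^sup>+w. ennreal (kernel w * envelope \<eta> (v - w)) \<partial>lborel)"
      using nn_integral_reflect[of "\<lambda>s. ennreal (kernel (v - s) * envelope \<eta> s)" v] by simp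
    also have "ennreal \<bar>chi r v\<bar> * \<dots> \<le> ennreal \<bar>chi r v\<bar> * ennreal (noise_const * hnorm 2 \<eta>)"
      unfolding kernel_def by (rule mult_left_mono[OF kernel_envelope_le[OF assms order_refl]]) simp
    finally show "(\<integral>\<^sup>+s. ennreal (kernel (v - s) * \<bar>chi r v\<bar> * envelope \<eta> s) \<partial>lborel) \<le> ennreal (noise_const * hnorm 2 \<eta>) * ennreal \<bar>chi r v\<bar>"
      by (simp add: mult.commute)
  qed
  also have "\<dots> = ennreal (noise_const * hnorm 2 \<eta>) * (\<integral>\<^sup>+v. ennreal \<bar>chi r v\<bar> \<partial>lborel)"
    by (rule nn_integral_cmult) measurable
  also have "(\<integral>\<^sup>+v. ennreal \<bar>chi r v\<bar> \<partial>lborel) \<le> (\<integral>\<^sup>+v. indicator {- \<bar>r\<bar>..\<bar>r\<bar>} v \<partial>lborel)"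
    by (intro nn_integral_mono) (auto simp: chi_def indicator_def)
  also have "\<dots> = ennreal (2 * \<bar>r\<bar>)" by simp
  finally show ?thesis
    by (auto simp: ennreal_mult_less_top mult_left_mono intro: le_less_trans)
qed

lemma pairing_frac:
  assumes \<eta>: "\<eta> \<in> SU"
  shows "(LINT z|pi_measure \<nu>. K_op \<beta> (chi r) z * \<eta> z) = (LINT v|lborel. chi r v * noise v \<eta>)"
proof -
  interpret nu: sigma_finite_measure \<nu> by (rule sigma_finite_nu)
  interpret P: pair_sigma_finite lborel \<nu> ..
  note [measurable] = SU_measurable_pair[OF \<eta>] slice_measurable[OF \<eta>]
  let ?J = "\<lambda>s. frac_int \<beta> (chi r) s"
  have J_meas [measurable]: "?J \<in> borel_measurable borel"
    unfolding frac_int_chi by measurable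
  have K: "K_op \<beta> (chi r) (s, y) * \<eta> (s, y) = ?J s * (y * \<eta> (s, y))" for s y by (simp add: K_op_def)
  have J_le: "ennreal \<bar>?J s\<bar> \<le> ennreal (1 / Gamma \<beta>) * (\<integral>\<^sup>+v. ennreal (kernel (v - s) * \<bar>chi r v\<bar>) \<partial>lborel)" for s
  proof (cases "integrable lborel (\<lambda>v. kernel (v - s) * chi r v)")
    case True
    have "ennreal \<bar>?J s\<bar> = ennreal (1 / Gamma \<beta>) * ennreal \<bar>LINT v|lborel. kernel (v - s) * chi r v\<bar>"
      using Gamma_pos by (simp add: frac_int_chi ennreal_mult'[symmetric] abs_mult)
    also have "\<dots> \<le> ennreal (1 / Gamma \<beta>) * (\<integral>\<^sup>+v. ennreal (norm (kernel (v - s) * chi r v)) \<partial>lborel)"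
      using integral_norm_bound_ennreal[OF True] by (intro mult_left_mono) auto
    finally show ?thesis by (simp add: abs_mult kernel_nonneg)
  qed (simp add: frac_int_chi not_integrable_integral_eq)
  have int1: "integrable (lborel \<Otimes>\<^sub>M \<nu>) (\<lambda>z. K_op \<beta> (chi r) z * \<eta> z)"
  proof (rule integrableI_bounded)
    show meas: "(\<lambda>z. K_op \<beta> (chi r) z * \<eta> z) \<in> borel_measurable (lborel \<Otimes>\<^sub>M \<nu>)"
      unfolding K_op_def split_beta' by measurable
    have "(\<integral>\<^sup>+z. ennreal (norm (K_op \<beta> (chi r) z * \<eta> z)) \<partial>(lborel \<Otimes>\<^sub>M \<nu>)) =
        (\<integral>\<^sup>+s. \<integral>\<^sup>+y. ennreal (norm (K_op \<beta> (chi r) (s, y) * \<eta> (s, y))) \<partial>\<nu> \<partial>lborel)"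
      using meas by (subst nu.nn_integral_fst) auto
    also have "\<dots> \<le> (\<integral>\<^sup>+s. ennreal (1 / Gamma \<beta>) * (\<integral>\<^sup>+v. ennreal (kernel (v - s) * \<bar>chi r v\<bar> * envelope \<eta> s) \<partial>lborel) \<partial>lborel)"
    proof (intro nn_integral_mono)
      fix s
      let ?E = "\<Sum>k. envelope_coef \<eta> k * \<bar>hermite_fun (hfst k) s\<bar>"
      have E0: "0 \<le> ?E" by (intro suminf_nonneg SU_difference_le(1) \<eta>) (simp add: envelope_coef_nonneg)
      have "(\<integral>\<^sup>+y. ennreal (norm (K_op \<beta> (chi r) (s, y) * \<eta> (s, y))) \<partial>\<nu>) \<le> (\<integral>\<^sup>+y. ennreal (\<bar>?J s\<bar> * ?E) * ennreal (y\<^sup>2) \<partial>\<nu>)"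
      proof (intro nn_integral_mono)
        fix y
        have "\<bar>?J s\<bar> * (\<bar>y\<bar> * \<bar>\<eta> (s, y)\<bar>) \<le> \<bar>?J s\<bar> * (\<bar>y\<bar> * (\<bar>y\<bar> * ?E))"
          by (intro mult_left_mono SU_difference_le(2) \<eta>) auto
        also have "\<bar>y\<bar> * (\<bar>y\<bar> * ?E) = ?E * y\<^sup>2"
          by (simp add: mult.assoc[symmetric] power2_eq_square)
        finally show "ennreal (norm (K_op \<beta> (chi r) (s, y) * \<eta> (s, y))) \<le> ennreal (\<bar>?J s\<bar> * ?E) * ennreal (y\<^sup>2)"
          unfolding K using E0 by (simp add: abs_mult ennreal_mult'[symmetric] mult.assoc ennreal_leI)
      qed
      also have "\<dots> = ennreal (\<bar>?J s\<bar> * ?E) * ennreal M2"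
        using nn_integral_eq_integral[OF integrable_square] by (subst nn_integral_cmult) (auto simp: M2_def)
      also have "\<dots> = ennreal \<bar>?J s\<bar> * ennreal (envelope \<eta> s)"
        using E0 M2_nonneg by (simp add: envelope_def ennreal_mult[symmetric] mult_ac)
      also have "\<dots> \<le> (ennreal (1 / Gamma \<beta>) * (\<integral>\<^sup>+v. ennreal (kernel (v - s) * \<bar>chi r v\<bar>) \<partial>lborel)) * ennreal (envelope \<eta> s)"
        by (intro mult_right_mono J_le) auto
      also have "\<dots> = ennreal (1 / Gamma \<beta>) * (\<integral>\<^sup>+v. ennreal (kernel (v - s) * \<bar>chi r v\<bar>) * ennreal (envelope \<eta> s) \<partial>lborel)"
        by (subst nn_integral_multc) (auto simp: mult.assoc)
      also have "\<dots> = ennreal (1 / Gamma \<beta>) * (\<integral>\<^sup>+v. ennreal (kernel (v - s) * \<bar>chi r v\<bar> * envelope \<eta> s) \<partial>lborel)"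
        by (simp add: ennreal_mult kernel_nonneg envelope_nonneg[OF \<eta>])
      finally show "(\<integral>\<^sup>+y. ennreal (norm (K_op \<beta> (chi r) (s, y) * \<eta> (s, y))) \<partial>\<nu>) \<le> \<dots>" .
    qed
    also have "\<dots> = ennreal (1 / Gamma \<beta>) * (\<integral>\<^sup>+s. \<integral>\<^sup>+v. ennreal (kernel (v - s) * \<bar>chi r v\<bar> * envelope \<eta> s) \<partial>lborel \<partial>lborel)"
      by (rule nn_integral_cmult) measurable
    also have "\<dots> < \<infinity>" using nn_integral_kernel_chi[OF \<eta>, of r] by (simp add: ennreal_mult_less_top)
    finally show "(\<integral>\<^sup>+z. ennreal (norm (K_op \<beta> (chi r) z * \<eta> z)) \<partial>(lborel \<Otimes>\<^sub>M \<nu>)) < \<infinity>" .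
  qed
  have int2: "integrable (lborel \<Otimes>\<^sub>M lborel) (case_prod (\<lambda>s v. kernel (v - s) * chi r v * slice \<eta> s))"
  proof (rule integrableI_bounded)
    show meas: "case_prod (\<lambda>s v. kernel (v - s) * chi r v * slice \<eta> s) \<in> borel_measurable (lborel \<Otimes>\<^sub>M lborel)"
      by measurable
    have "(\<integral>\<^sup>+z. ennreal (norm (case_prod (\<lambda>s v. kernel (v - s) * chi r v * slice \<eta> s) z)) \<partial>(lborel \<Otimes>\<^sub>M lborel)) =
       (\<integral>\<^sup>+s. \<integral>\<^sup>+v. ennreal (norm (kernel (v - s) * chi r v * slice \<eta> s)) \<partial>lborel \<partial>lborel)"
      using meas by (subst lborel.nn_integral_fst[symmetric]) auto
    also have "\<dots> \<le> (\<integral>\<^sup>+s. \<integral>\<^sup>+v. ennreal (kernel (v - s) * \<bar>chi r v\<bar> * envelope \<eta> s) \<partial>lborel \<partial>lborel)"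
      using slice_le[OF \<eta>] by (intro nn_integral_mono ennreal_leI) (auto simp: abs_mult kernel_nonneg intro!: mult_left_mono)
    also have "\<dots> < \<infinity>" by (rule nn_integral_kernel_chi[OF \<eta>])
    finally show "(\<integral>\<^sup>+z. ennreal (norm (case_prod (\<lambda>s v. kernel (v - s) * chi r v * slice \<eta> s) z)) \<partial>(lborel \<Otimes>\<^sub>M lborel)) < \<infinity>" .
  qed
  have "(LINT z|pi_measure \<nu>. K_op \<beta> (chi r) z * \<eta> z) = (LINT s|lborel. LINT y|\<nu>. ?J s * (y * \<eta> (s, y)))"
    unfolding pi_measure_def using P.integral_fst'[OF int1] by (simp only: K)
  also have "\<dots> = (LINT s|lborel. (LINT v|lborel. kernel (v - s) * chi r v * slice \<eta> s) / Gamma \<beta>)"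
    by (intro Bochner_Integration.integral_cong refl) (simp add: slice_def[symmetric] frac_int_chi)
  also have "\<dots> = (LINT s|lborel. LINT v|lborel. kernel (v - s) * chi r v * slice \<eta> s) / Gamma \<beta>"
    by simp
  also have "\<dots> = (LINT v|lborel. LINT s|lborel. kernel (v - s) * chi r v * slice \<eta> s) / Gamma \<beta>"
    by (subst lborel_pair.Fubini_integral[OF int2]) simp
  also have "\<dots> = (LINT v|lborel. (LINT s|lborel. chi r v * (kernel (v - s) * slice \<eta> s)) / Gamma \<beta>)"
    by (simp add: mult_ac)
  also have "\<dots> = (LINT v|lborel. chi r v * noise v \<eta>)"
    by (simp add: noise_kernel)
  finally show ?thesis .
qed

lemma noise_continuous: assumes "\<eta> \<in> SU" shows "continuous_on S (\<lambda>t. noise t \<eta>)"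
proof -
  have h0: "0 \<le> hnorm 2 \<eta>" using quadratic_norm.nonneg[OF quadratic_norm_hnorm SU_schwartz[OF assms]] .
  have "(noise_const / Gamma \<beta> * hnorm 2 \<eta>)-lipschitz_on S (\<lambda>t. noise t \<eta>)"
    using noise_diff_le[OF assms order_refl] noise_const_nonneg Gamma_pos h0
    by (intro lipschitz_onI) (auto simp: dist_real_def mult_ac)
  then show ?thesis by (rule lipschitz_on_continuous_on)
qed

lemma S_transform_frac_levy:
  assumes "\<eta> \<in> SU"
  shows "S_transform (frac_levy \<nu> \<beta> r) \<eta> = (LBINT v=0..ereal r. noise v \<eta>)"
proof -
  have "S_transform (frac_levy \<nu> \<beta> r) \<eta> = (\<Sum>n. if n = 1 then (LINT z|pi_measure \<nu>. K_op \<beta> (chi r) z * \<eta> z) else 0)"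
    unfolding S_transform_def frac_levy_def first_chaos_def using assms by (intro suminf_cong) auto
  also have "\<dots> = (LINT z|pi_measure \<nu>. K_op \<beta> (chi r) z * \<eta> z)"
    using sums_single[of 1 "\<lambda>_. LINT z|pi_measure \<nu>. K_op \<beta> (chi r) z * \<eta> z"] by (simp add: sums_iff)
  also have "\<dots> = (LINT v|lborel. chi r v * noise v \<eta>)" by (rule pairing_frac[OF assms])
  also have "\<dots> = (LBINT v=0..ereal r. noise v \<eta>)"
  proof (cases "0 \<le> r")
    case True
    then have "chi r v = indicator {0<..<r} v" for v by (auto simp: chi_def indicator_def)
    then show ?thesis using True by (simp add: interval_lebesgue_integral_def set_lebesgue_integral_def zero_ereal_def)
  next
    case False
    then have "chi r v = - indicator {r<..<0} v" for v by (auto simp: chi_def indicator_def)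
    then show ?thesis using False by (simp add: interval_lebesgue_integral_def set_lebesgue_integral_def zero_ereal_def)
  qed
  finally show ?thesis .
qed

lemma S_transform_frac_levy_deriv:
  assumes "\<eta> \<in> SU"
  shows "((\<lambda>r. S_transform (frac_levy \<nu> \<beta> r) \<eta>) has_real_derivative noise t \<eta>) (at t)"
proof -
  let ?a = "- \<bar>t\<bar> - 1" and ?b = "\<bar>t\<bar> + 1"
  have "((\<lambda>r. LBINT v=ereal 0..ereal r. noise v \<eta>) has_vector_derivative noise t \<eta>) (at t within {?a..?b})"
    by (rule interval_integral_FTC2) (auto intro: noise_continuous[OF assms])
  moreover have "at t within {?a..?b} = at t" by (rule at_within_interior) auto
  ultimately show ?thesis
    by (simp add: S_transform_frac_levy[OF assms] has_real_derivative_iff_has_vector_derivative zero_ereal_def)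
qed

end

section \<open>Duality of stochastic distributions and polynomials\<close>

lemma sym_inner_eq: "sym_inner \<nu> p \<phi>s \<psi>s = sym_kernel (polar (qnorm \<nu> p)) \<phi>s \<psi>s"
  unfolding sym_inner_def sym_kernel_def prod_kernel_def
  by (intro arg_cong2[where f="(/)"] sum.cong prod.cong refl) simp

definition tensor_form :: "(pfun list \<Rightarrow> pfun list \<Rightarrow> real) \<Rightarrow> tensor \<Rightarrow> real" where
  "tensor_form K t = (\<Sum>(c, \<phi>s)\<leftarrow>t. \<Sum>(d, \<psi>s)\<leftarrow>t. c * d * K \<phi>s \<psi>s)"

lemma sum_list_case_prod_nth: "(\<Sum>(c, x)\<leftarrow>t. f c x) = (\<Sum>i<length t. f (fst (t ! i)) (snd (t ! i)))"
  by (simp add: sum_list_sum_nth split_beta atLeast0LessThan)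

lemma tensorsD: "t \<in> tensors n \<Longrightarrow> i < length t \<Longrightarrow> snd (t ! i) \<in> lists_of SU n"
  unfolding tensors_def lists_of_def by (auto simp: split_beta dest: nth_mem)

lemma tensor_form_nonneg:
  assumes "psd_on (lists_of SU n) K" "t \<in> tensors n"
  shows "0 \<le> tensor_form K t"
  unfolding tensor_form_def sum_list_case_prod_nth
  using tensorsD[OF assms(2)] by (intro psd_on_sum[OF assms(1), where f="\<lambda>i. snd (t ! i)"]) auto

lemma tensor_form_diff: "tensor_form (\<lambda>x y. a * K x y - L x y) t = a * tensor_form K t - tensor_form L t"
  unfolding tensor_form_def sum_list_case_prod_nth
  by (simp add: right_diff_distrib sum_subtractf sum_distrib_left mult_ac)

lemma tensor_norm_eq: "tensor_norm \<nu> p t = sqrt (tensor_form (sym_kernel (polar (qnorm \<nu> p))) t)"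
  unfolding tensor_norm_def tensor_form_def sym_inner_eq ..

definition tensor_scale :: "real \<Rightarrow> tensor \<Rightarrow> tensor" where
  "tensor_scale a t = map (\<lambda>(c, \<phi>s). (a * c, \<phi>s)) t"

lemma tensor_scale_mem [simp]: "t \<in> tensors n \<Longrightarrow> tensor_scale a t \<in> tensors n"
  by (fastforce simp: tensors_def tensor_scale_def)

lemma tensor_scale_Nil [simp]: "tensor_scale a t = [] \<longleftrightarrow> t = []"
  by (simp add: tensor_scale_def)

lemma tensor_pair_scale [simp]: "tensor_pair F (tensor_scale a t) = a * tensor_pair F t"
  unfolding tensor_pair_def tensor_scale_def by (induction t) (auto simp: algebra_simps)

lemma tensor_norm_scale [simp]: "tensor_norm \<nu> p (tensor_scale a t) = \<bar>a\<bar> * tensor_norm \<nu> p t"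
proof -
  have "tensor_form K (tensor_scale a t) = a\<^sup>2 * tensor_form K t" for K
    unfolding tensor_form_def sum_list_case_prod_nth tensor_scale_def
    by (simp add: split_beta sum_distrib_left power2_eq_square mult_ac)
  then show ?thesis by (simp add: tensor_norm_eq real_sqrt_mult)
qed

lemma tensor_pair_Nil [simp]: "tensor_pair F [] = 0" by (simp add: tensor_pair_def)
lemma tensor_norm_Nil [simp]: "tensor_norm \<nu> p [] = 0" by (simp add: tensor_norm_def)
lemma Nil_mem_tensors [simp]: "[] \<in> tensors n" by (simp add: tensors_def)

lemma spoly_pair_eq:
  assumes "finite S" "{n. P n \<noteq> []} \<subseteq> S"
  shows "spoly_pair F P = (\<Sum>n\<in>S. fact n * tensor_pair (F n) (P n))"
  unfolding spoly_pair_def by (rule sum.mono_neutral_left) (use assms in auto)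

lemma spoly_norm_eq:
  assumes "finite S" "{n. P n \<noteq> []} \<subseteq> S"
  shows "spoly_norm \<nu> p P = sqrt (\<Sum>n\<in>S. (fact n)\<^sup>2 * (tensor_norm \<nu> p (P n))\<^sup>2)"
  unfolding spoly_norm_def by (intro arg_cong[where f=sqrt] sum.mono_neutral_left) (use assms in auto)

lemma spoly_norm_nonneg: "0 \<le> spoly_norm \<nu> p P"
  unfolding spoly_norm_def by (intro real_sqrt_ge_zero sum_nonneg) auto

lemma sym_formD:
  assumes "F \<in> sym_form n"
  shows "\<phi>s \<notin> lists_of SU n \<Longrightarrow> F \<phi>s = 0" "mset \<phi>s = mset \<psi>s \<Longrightarrow> F \<phi>s = F \<psi>s"
    "Suc m = n \<Longrightarrow> \<phi>s \<in> lists_of SU m \<Longrightarrow> \<phi> \<in> SU \<Longrightarrow> \<psi> \<in> SU \<Longrightarrow>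
      F ((\<lambda>z. a * \<phi> z + b * \<psi> z) # \<phi>s) = a * F (\<phi> # \<phi>s) + b * F (\<psi> # \<phi>s)"
proof -
  note D = assms[unfolded sym_form_def mem_Collect_eq]
  show "\<phi>s \<notin> lists_of SU n \<Longrightarrow> F \<phi>s = 0"
    using D[THEN conjunct1, rule_format, of \<phi>s] by (auto simp: lists_of_def)
  show "mset \<phi>s = mset \<psi>s \<Longrightarrow> F \<phi>s = F \<psi>s"
    by (rule D[THEN conjunct2, THEN conjunct1, rule_format])
  show "Suc m = n \<Longrightarrow> \<phi>s \<in> lists_of SU m \<Longrightarrow> \<phi> \<in> SU \<Longrightarrow> \<psi> \<in> SU \<Longrightarrow>
      F ((\<lambda>z. a * \<phi> z + b * \<psi> z) # \<phi>s) = a * F (\<phi> # \<phi>s) + b * F (\<psi> # \<phi>s)"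
    by (rule D[THEN conjunct2, THEN conjunct2, rule_format]) (simp_all add: lists_of_def)
qed

lemma sym_formI:
  assumes "\<And>\<phi>s. \<phi>s \<notin> lists_of SU n \<Longrightarrow> F \<phi>s = 0" "\<And>\<phi>s \<psi>s. mset \<phi>s = mset \<psi>s \<Longrightarrow> F \<phi>s = F \<psi>s"
    "\<And>m \<phi>s \<phi> \<psi> a b. Suc m = n \<Longrightarrow> \<phi>s \<in> lists_of SU m \<Longrightarrow> \<phi> \<in> SU \<Longrightarrow> \<psi> \<in> SU \<Longrightarrow>
      F ((\<lambda>z. a * \<phi> z + b * \<psi> z) # \<phi>s) = a * F (\<phi> # \<phi>s) + b * F (\<psi> # \<phi>s)"
  shows "F \<in> sym_form n"
  unfolding sym_form_def mem_Collect_eq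
proof (intro conjI allI impI)
  fix \<phi>s assume "\<not> (length \<phi>s = n \<and> set \<phi>s \<subseteq> SU)"
  then show "F \<phi>s = 0" by (intro assms(1)) (simp add: lists_of_def)
qed (rule assms(2), assumption, rule assms(3), simp_all add: lists_of_def)

lemma spolysD: "P \<in> spolys \<Longrightarrow> finite {n. P n \<noteq> []}" "P \<in> spolys \<Longrightarrow> P n \<in> tensors n"
  by (auto simp: spolys_def)

lemma spoly_single_mem: "t \<in> tensors n \<Longrightarrow> (\<lambda>m. if m = n then t else []) \<in> spolys"
  unfolding spolys_def by (auto intro: finite_subset[of _ "{n}"])

lemma spoly_pair_single: "spoly_pair F (\<lambda>m. if m = n then t else []) = fact n * tensor_pair (F n) t"
  by (subst spoly_pair_eq[of "{n}"]) auto

context levy_noise begin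

lemma psd_on_sym_inner: "psd_on (lists_of SU n) (sym_kernel (polar (qnorm \<nu> p)))"
  by (intro psd_on_sym_kernel quadratic_norm.psd_on_polar quadratic_norm_qnorm)

lemma tensor_norm_square: "t \<in> tensors n \<Longrightarrow> (tensor_norm \<nu> p t)\<^sup>2 = tensor_form (sym_kernel (polar (qnorm \<nu> p))) t"
  unfolding tensor_norm_eq by (intro real_sqrt_pow2 tensor_form_nonneg[OF psd_on_sym_inner])

lemma tensor_norm_nonneg: "t \<in> tensors n \<Longrightarrow> 0 \<le> tensor_norm \<nu> p t"
  unfolding tensor_norm_eq by (intro real_sqrt_ge_zero tensor_form_nonneg[OF psd_on_sym_inner])

lemma tdual_norm_bdd:
  assumes "F \<in> tdual \<nu> p n"
  shows "bdd_above {\<bar>tensor_pair F t\<bar> | t. t \<in> tensors n \<and> tensor_norm \<nu> p t \<le> 1}"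
proof -
  obtain K where K: "\<And>t. t \<in> tensors n \<Longrightarrow> \<bar>tensor_pair F t\<bar> \<le> K * tensor_norm \<nu> p t"
    using assms unfolding tdual_def by blast
  have "\<bar>tensor_pair F t\<bar> \<le> \<bar>K\<bar>" if "t \<in> tensors n" "tensor_norm \<nu> p t \<le> 1" for t
  proof -
    have "K * tensor_norm \<nu> p t \<le> \<bar>K\<bar> * 1"
      using that tensor_norm_nonneg by (intro mult_mono) auto
    then show ?thesis using K[OF that(1)] by simp
  qed
  then show ?thesis by (intro bdd_aboveI[of _ "\<bar>K\<bar>"]) auto
qed

lemma le_tdual_norm:
  "F \<in> tdual \<nu> p n \<Longrightarrow> t \<in> tensors n \<Longrightarrow> tensor_norm \<nu> p t \<le> 1 \<Longrightarrow> \<bar>tensor_pair F t\<bar> \<le> tdual_norm \<nu> p n F"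
  unfolding tdual_norm_def by (intro cSup_upper tdual_norm_bdd) auto

lemma tensor_pair_le:
  assumes F: "F \<in> tdual \<nu> p n" and t: "t \<in> tensors n"
  shows "\<bar>tensor_pair F t\<bar> \<le> tdual_norm \<nu> p n F * tensor_norm \<nu> p t"
proof (cases "tensor_norm \<nu> p t = 0")
  case True
  then show ?thesis using F t unfolding tdual_def by force
next
  case False
  then have pos: "0 < tensor_norm \<nu> p t" using tensor_norm_nonneg[OF t, of p] by simp
  have "\<bar>tensor_pair F (tensor_scale (1 / tensor_norm \<nu> p t) t)\<bar> \<le> tdual_norm \<nu> p n F"
    using pos t by (intro le_tdual_norm F) auto
  then show ?thesis using pos by (simp add: abs_mult field_simps)
qed

lemma spoly_pair_le:
  assumes F: "F \<in> Sminus \<nu> p" and P: "P \<in> spolys"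
  shows "\<bar>spoly_pair F P\<bar> \<le> Snorm \<nu> p F * spoly_norm \<nu> p P"
proof -
  let ?S = "{n. P n \<noteq> []}" and ?a = "\<lambda>n. tdual_norm \<nu> p n (F n)" and ?b = "\<lambda>n. fact n * tensor_norm \<nu> p (P n)"
  have Fd: "F n \<in> tdual \<nu> p n" for n using F by (simp add: Sminus_def)
  have "\<bar>spoly_pair F P\<bar> \<le> (\<Sum>n\<in>?S. \<bar>fact n * tensor_pair (F n) (P n)\<bar>)"
    unfolding spoly_pair_def by (rule sum_abs)
  also have "\<dots> \<le> (\<Sum>n\<in>?S. ?a n * ?b n)"
  proof (intro sum_mono)
    fix n
    have "fact n * \<bar>tensor_pair (F n) (P n)\<bar> \<le> fact n * (?a n * tensor_norm \<nu> p (P n))"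
      by (intro mult_left_mono tensor_pair_le Fd spolysD(2)[OF P]) auto
    then show "\<bar>fact n * tensor_pair (F n) (P n)\<bar> \<le> ?a n * ?b n" by (simp add: abs_mult mult_ac)
  qed
  also have "\<dots> \<le> sqrt ((\<Sum>n\<in>?S. (?a n)\<^sup>2) * (\<Sum>n\<in>?S. (?b n)\<^sup>2))"
    by (intro real_le_rsqrt Cauchy_Schwarz_ineq_sum)
  also have "\<dots> = sqrt (\<Sum>n\<in>?S. (?a n)\<^sup>2) * spoly_norm \<nu> p P"
    by (simp add: real_sqrt_mult spoly_norm_def power_mult_distrib)
  also have "\<dots> \<le> Snorm \<nu> p F * spoly_norm \<nu> p P"
    unfolding Snorm_def using F spolysD(1)[OF P]
    by (intro mult_right_mono real_sqrt_le_mono sum_le_suminf spoly_norm_nonneg) (auto simp: Sminus_def)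
  finally show ?thesis .
qed

lemma Snorm_nonneg: assumes "F \<in> Sminus \<nu> p" shows "0 \<le> Snorm \<nu> p F"
  unfolding Snorm_def using assms by (intro real_sqrt_ge_zero suminf_nonneg) (auto simp: Sminus_def)

lemma SminusI:
  assumes F: "\<And>n. F n \<in> sym_form n" and K0: "0 \<le> K"
    and K: "\<And>P. P \<in> spolys \<Longrightarrow> \<bar>spoly_pair F P\<bar> \<le> K * spoly_norm \<nu> p P"
  shows "F \<in> Sminus \<nu> p" "Snorm \<nu> p F \<le> K"
proof -
  have "\<bar>tensor_pair (F n) t\<bar> \<le> K * tensor_norm \<nu> p t" if "t \<in> tensors n" for n t
  proof -
    have "spoly_norm \<nu> p (\<lambda>m. if m = n then t else []) = fact n * tensor_norm \<nu> p t"
      using tensor_norm_nonneg[OF that] by (subst spoly_norm_eq[of "{n}"]) (auto simp: real_sqrt_mult)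
    then have "fact n * \<bar>tensor_pair (F n) t\<bar> \<le> fact n * (K * tensor_norm \<nu> p t)"
      using K[OF spoly_single_mem[OF that]] by (simp add: spoly_pair_single abs_mult mult_ac)
    then show ?thesis by (rule mult_left_le_imp_le) simp
  qed
  then have Fd: "F n \<in> tdual \<nu> p n" for n using F unfolding tdual_def by blast
  let ?a = "\<lambda>n. tdual_norm \<nu> p n (F n)"
  have pick: "(\<Sum>n<N. (tensor_pair (F n) (t n))\<^sup>2) \<le> K\<^sup>2"
    if t: "\<And>n. t n \<in> tensors n" "\<And>n. tensor_norm \<nu> p (t n) \<le> 1" for t N
  proof -
    let ?x = "\<lambda>n. tensor_pair (F n) (t n)"
    define P where "P n = (if n < N then tensor_scale (?x n / fact n) (t n) else [])" for n
    have sub: "{n. P n \<noteq> []} \<subseteq> {..<N}" by (auto simp: P_def split: if_splits)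
    have P: "P \<in> spolys" unfolding spolys_def using finite_subset[OF sub] t by (auto simp: P_def)
    have "(\<Sum>n<N. (?x n)\<^sup>2) = spoly_pair F P"
      by (subst spoly_pair_eq[OF _ sub]) (auto simp: P_def power2_eq_square)
    also have "\<dots> \<le> K * spoly_norm \<nu> p P" using K[OF P] by linarith
    also have "spoly_norm \<nu> p P = sqrt (\<Sum>n<N. (?x n)\<^sup>2 * (tensor_norm \<nu> p (t n))\<^sup>2)"
      by (subst spoly_norm_eq[OF _ sub]) (auto simp: P_def power_mult_distrib power_divide)
    also have "\<dots> \<le> sqrt (\<Sum>n<N. (?x n)\<^sup>2 * 1)"
      using t tensor_norm_nonneg[OF t(1), of p]
      by (intro real_sqrt_le_mono sum_mono mult_left_mono) (auto simp: abs_square_le_1)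
    finally have le: "(\<Sum>n<N. (?x n)\<^sup>2) \<le> K * sqrt (\<Sum>n<N. (?x n)\<^sup>2)" using K0 by (auto intro: mult_left_mono)
    let ?s = "sqrt (\<Sum>n<N. (?x n)\<^sup>2)"
    have s2: "?s\<^sup>2 = (\<Sum>n<N. (?x n)\<^sup>2)" and s0: "0 \<le> ?s" by (auto intro: sum_nonneg)
    have "?s \<le> K"
    proof (cases "?s = 0")
      case False
      have "?s * ?s \<le> K * ?s" using le by (simp only: s2[unfolded power2_eq_square[of ?s]])
      then show ?thesis by (rule mult_right_le_imp_le) (use False s0 in linarith)
    qed (use K0 in simp)
    then have "?s\<^sup>2 \<le> K\<^sup>2" using s0 by (intro power_mono)
    then show ?thesis using s2 by simp
  qed
  have "\<exists>t. t \<in> tensors n \<and> tensor_norm \<nu> p t \<le> 1 \<and> ?a n - 1 / real (Suc k) < \<bar>tensor_pair (F n) t\<bar>" for n k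
  proof -
    have "\<bar>tensor_pair (F n) []\<bar> \<in> {\<bar>tensor_pair (F n) t\<bar> | t. t \<in> tensors n \<and> tensor_norm \<nu> p t \<le> 1}"
      by (rule CollectI, rule exI[of _ "[]"]) simp
    then have ne: "{\<bar>tensor_pair (F n) t\<bar> | t. t \<in> tensors n \<and> tensor_norm \<nu> p t \<le> 1} \<noteq> {}" by blast
    have "?a n - 1 / real (Suc k) < Sup {\<bar>tensor_pair (F n) t\<bar> | t. t \<in> tensors n \<and> tensor_norm \<nu> p t \<le> 1}"
      unfolding tdual_norm_def by simp
    then obtain x where "x \<in> {\<bar>tensor_pair (F n) t\<bar> | t. t \<in> tensors n \<and> tensor_norm \<nu> p t \<le> 1}" "?a n - 1 / real (Suc k) < x"
      by (rule less_cSupE[OF _ ne])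
    then show ?thesis by auto
  qed
  then obtain t where t: "\<And>n k. t n k \<in> tensors n" "\<And>n k. tensor_norm \<nu> p (t n k) \<le> 1"
      "\<And>n k. ?a n - 1 / real (Suc k) < \<bar>tensor_pair (F n) (t n k)\<bar>" by metis
  have lim: "(\<lambda>k. \<bar>tensor_pair (F n) (t n k)\<bar>) \<longlonglongrightarrow> ?a n" for n
  proof (rule tendsto_sandwich)
    show "(\<lambda>k. ?a n - 1 / real (Suc k)) \<longlonglongrightarrow> ?a n"
      using tendsto_diff[OF tendsto_const LIMSEQ_inverse_real_of_nat, of "?a n"] by (simp add: inverse_eq_divide)
    show "\<forall>\<^sub>F k in sequentially. ?a n - 1 / real (Suc k) \<le> \<bar>tensor_pair (F n) (t n k)\<bar>"
      by (intro always_eventually allI less_imp_le t)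
    show "\<forall>\<^sub>F k in sequentially. \<bar>tensor_pair (F n) (t n k)\<bar> \<le> ?a n"
      by (intro always_eventually allI le_tdual_norm Fd t)
  qed simp
  have bound: "(\<Sum>n<N. (?a n)\<^sup>2) \<le> K\<^sup>2" for N
  proof (rule LIMSEQ_le_const2)
    show "(\<lambda>k. \<Sum>n<N. \<bar>tensor_pair (F n) (t n k)\<bar>\<^sup>2) \<longlonglongrightarrow> (\<Sum>n<N. (?a n)\<^sup>2)"
      by (intro tendsto_sum tendsto_power lim)
    show "\<exists>M. \<forall>k\<ge>M. (\<Sum>n<N. \<bar>tensor_pair (F n) (t n k)\<bar>\<^sup>2) \<le> K\<^sup>2"
      using pick[of "\<lambda>n. t n _"] t by (intro exI[of _ 0]) simp
  qed
  have s: "summable (\<lambda>n. (?a n)\<^sup>2)" by (rule summableI_nonneg_bounded[OF _ bound]) simp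
  then show "F \<in> Sminus \<nu> p" using Fd by (simp add: Sminus_def)
  have "suminf (\<lambda>n. (?a n)\<^sup>2) \<le> K\<^sup>2" by (rule suminf_le_const[OF s bound])
  then show "Snorm \<nu> p F \<le> K" unfolding Snorm_def using K0 real_sqrt_le_mono by fastforce
qed

lemma Sminus_sym_form: "F \<in> Sminus \<nu> p \<Longrightarrow> F n \<in> sym_form n"
  by (simp add: Sminus_def tdual_def)

end

lemma tensor_pair_lin: "tensor_pair (\<lambda>\<phi>s. a * F \<phi>s + b * G \<phi>s) t = a * tensor_pair F t + b * tensor_pair G t"
  unfolding tensor_pair_def by (induction t) (auto simp: algebra_simps)

lemma spoly_pair_lin: "spoly_pair (\<lambda>n \<phi>s. a * F n \<phi>s + b * G n \<phi>s) P = a * spoly_pair F P + b * spoly_pair G P"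
  unfolding spoly_pair_def tensor_pair_lin by (simp add: sum.distrib sum_distrib_left algebra_simps)

lemma spoly_pair_diff: "spoly_pair (F - G) P = spoly_pair F P - spoly_pair G P"
  using spoly_pair_lin[of 1 F "-1" G P] by (simp add: fun_diff_def)

lemma spoly_pair_add: "spoly_pair (F + G) P = spoly_pair F P + spoly_pair G P"
  using spoly_pair_lin[of 1 F 1 G P] by (simp add: plus_fun_def)

lemma sym_form_lin:
  assumes F: "F \<in> sym_form n" and G: "G \<in> sym_form n"
  shows "(\<lambda>\<phi>s. a * F \<phi>s + b * G \<phi>s) \<in> sym_form n"
proof (rule sym_formI)
  fix \<phi>s \<psi>s :: "pfun list" assume "mset \<phi>s = mset \<psi>s"
  then show "a * F \<phi>s + b * G \<phi>s = a * F \<psi>s + b * G \<psi>s"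
    using sym_formD(2)[OF F] sym_formD(2)[OF G] by metis
qed (simp_all add: sym_formD(1)[OF F] sym_formD(1)[OF G] sym_formD(3)[OF F] sym_formD(3)[OF G] algebra_simps)

context levy_noise begin

lemma Sminus_lin:
  assumes F: "F \<in> Sminus \<nu> p" and G: "G \<in> Sminus \<nu> p"
  shows "(\<lambda>n \<phi>s. a * F n \<phi>s + b * G n \<phi>s) \<in> Sminus \<nu> p"
    "Snorm \<nu> p (\<lambda>n \<phi>s. a * F n \<phi>s + b * G n \<phi>s) \<le> \<bar>a\<bar> * Snorm \<nu> p F + \<bar>b\<bar> * Snorm \<nu> p G"
proof -
  have K: "\<bar>spoly_pair (\<lambda>n \<phi>s. a * F n \<phi>s + b * G n \<phi>s) P\<bar> \<le> (\<bar>a\<bar> * Snorm \<nu> p F + \<bar>b\<bar> * Snorm \<nu> p G) * spoly_norm \<nu> p P"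
    if "P \<in> spolys" for P
  proof -
    have "\<bar>a * spoly_pair F P + b * spoly_pair G P\<bar> \<le> \<bar>a\<bar> * \<bar>spoly_pair F P\<bar> + \<bar>b\<bar> * \<bar>spoly_pair G P\<bar>"
      using abs_triangle_ineq[of "a * spoly_pair F P" "b * spoly_pair G P"] by (simp add: abs_mult)
    also have "\<dots> \<le> \<bar>a\<bar> * (Snorm \<nu> p F * spoly_norm \<nu> p P) + \<bar>b\<bar> * (Snorm \<nu> p G * spoly_norm \<nu> p P)"
      by (intro add_mono mult_left_mono spoly_pair_le F G that) auto
    finally show ?thesis by (simp add: spoly_pair_lin distrib_right mult.assoc)
  qed
  have nn: "0 \<le> \<bar>a\<bar> * Snorm \<nu> p F + \<bar>b\<bar> * Snorm \<nu> p G"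
    using Snorm_nonneg[OF F] Snorm_nonneg[OF G] by simp
  show "(\<lambda>n \<phi>s. a * F n \<phi>s + b * G n \<phi>s) \<in> Sminus \<nu> p"
    "Snorm \<nu> p (\<lambda>n \<phi>s. a * F n \<phi>s + b * G n \<phi>s) \<le> \<bar>a\<bar> * Snorm \<nu> p F + \<bar>b\<bar> * Snorm \<nu> p G"
    using SminusI[OF sym_form_lin[OF Sminus_sym_form[OF F] Sminus_sym_form[OF G]] nn K] by auto
qed

lemma Sminus_diff: "F \<in> Sminus \<nu> p \<Longrightarrow> G \<in> Sminus \<nu> p \<Longrightarrow> F - G \<in> Sminus \<nu> p"
  using Sminus_lin(1)[of F p G 1 "-1"] by (simp add: fun_diff_def)

lemma Sminus_add: "F \<in> Sminus \<nu> p \<Longrightarrow> G \<in> Sminus \<nu> p \<Longrightarrow> F + G \<in> Sminus \<nu> p"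
  using Sminus_lin(1)[of F p G 1 1] by (simp add: plus_fun_def)

lemma Sminus_zero: "0 \<in> Sminus \<nu> p"
proof (rule SminusI(1))
  have "(0 :: pfun list \<Rightarrow> real) \<in> sym_form n" for n by (rule sym_formI) auto
  then show "(0 :: sdist) n \<in> sym_form n" for n by simp
  have "tensor_pair 0 t = 0" for t unfolding tensor_pair_def by (induction t) auto
  then show "\<bar>spoly_pair 0 P\<bar> \<le> 0 * spoly_norm \<nu> p P" for P by (simp add: spoly_pair_def)
qed simp

end

section \<open>Wick multiplication by the first chaos\<close>

text \<open>The Wick product of \<open>\<Sum>\<^sub>n \<langle>C\<^sub>n, F\<^sub>n\<rangle>\<close> with \<open>\<langle>C\<^sub>1, l\<rangle>\<close>: the coefficient of degree \<open>n + 1\<close> is the symmetrised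
  tensor product of \<open>F\<^sub>n\<close> and \<open>l\<close>.\<close>

fun wick_first :: "(pfun \<Rightarrow> real) \<Rightarrow> sdist \<Rightarrow> sdist" where
  "wick_first l F 0 \<phi>s = 0"
| "wick_first l F (Suc n) \<phi>s =
     (if \<phi>s \<in> lists_of SU (Suc n) then (\<Sum>x\<leftarrow>\<phi>s. l x * F n (remove1 x \<phi>s)) / real (Suc n) else 0)"

definition contract :: "(pfun \<Rightarrow> real) \<Rightarrow> nat \<Rightarrow> tensor \<Rightarrow> tensor" where
  "contract l n t = concat (map (\<lambda>(c, \<phi>s). map (\<lambda>x. (c * l x / real (Suc n), remove1 x \<phi>s)) \<phi>s) t)"

lemma lists_of_remove1: "\<phi>s \<in> lists_of V (Suc n) \<Longrightarrow> x \<in> set \<phi>s \<Longrightarrow> remove1 x \<phi>s \<in> lists_of V n"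
  using set_remove1_subset[of x \<phi>s] by (auto simp: lists_of_def length_remove1)

lemma contract_mem: assumes "t \<in> tensors (Suc n)" shows "contract l n t \<in> tensors n"
proof -
  have "(c, \<phi>s) \<in> set t \<Longrightarrow> \<phi>s \<in> lists_of SU (Suc n)" for c \<phi>s
    using assms by (auto simp: tensors_def lists_of_def)
  then have "(c, \<phi>s) \<in> set (contract l n t) \<Longrightarrow> \<phi>s \<in> lists_of SU n" for c \<phi>s
    unfolding contract_def using lists_of_remove1 by fastforce
  then show ?thesis by (fastforce simp: tensors_def lists_of_def)
qed

lemma contract_Nil [simp]: "contract l n [] = []" by (simp add: contract_def)

lemma contract_Cons:
  "contract l n ((c, \<phi>s) # t) = map (\<lambda>x. (c * l x / real (Suc n), remove1 x \<phi>s)) \<phi>s @ contract l n t"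
  by (simp add: contract_def)

lemma sum_list_contract:
  "(\<Sum>(c, \<phi>s)\<leftarrow>contract l n t. c * g \<phi>s) = (\<Sum>(c, \<phi>s)\<leftarrow>t. c * ((\<Sum>x\<leftarrow>\<phi>s. l x * g (remove1 x \<phi>s)) / real (Suc n)))"
proof (induction t)
  case (Cons a t)
  obtain c \<phi>s where a: "a = (c, \<phi>s)" by (cases a)
  have "(\<Sum>x\<leftarrow>\<phi>s. c * l x / real (Suc n) * g (remove1 x \<phi>s)) = c * ((\<Sum>x\<leftarrow>\<phi>s. l x * g (remove1 x \<phi>s)) / real (Suc n))"
  proof -
    have "(\<Sum>x\<leftarrow>us. c * l x / N * g (remove1 x \<phi>s)) = c * ((\<Sum>x\<leftarrow>us. l x * g (remove1 x \<phi>s)) / N)" for us N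
      by (induction us) (simp_all add: add_divide_distrib distrib_left)
    then show ?thesis .
  qed
  then show ?case using Cons by (simp add: a contract_Cons o_def del: of_nat_Suc)
qed simp

lemma tensor_pair_contract:
  assumes "t \<in> tensors (Suc n)"
  shows "tensor_pair (wick_first l F (Suc n)) t = tensor_pair (F n) (contract l n t)"
proof -
  have "\<And>c \<phi>s. (c, \<phi>s) \<in> set t \<Longrightarrow> \<phi>s \<in> lists_of SU (Suc n)"
    using assms by (auto simp: tensors_def lists_of_def)
  then show ?thesis
    unfolding tensor_pair_def sum_list_contract
    by (intro arg_cong[where f=sum_list] map_cong refl) auto
qed

lemma tensor_form_contract:
  "tensor_form K (contract l n t) = tensor_form (\<lambda>xs ys. (\<Sum>x\<leftarrow>xs. \<Sum>y\<leftarrow>ys. l x * l y * K (remove1 x xs) (remove1 y ys)) / (real (Suc n))\<^sup>2) t"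
proof -
  have e: "tensor_form K t = (\<Sum>(c, \<phi>s)\<leftarrow>t. c * (\<Sum>(d, \<psi>s)\<leftarrow>t. d * K \<phi>s \<psi>s))" for K t
    unfolding tensor_form_def by (simp add: case_prod_unfold sum_list_const_mult[symmetric] mult.assoc)
  have "(\<Sum>x\<leftarrow>xs. l x * (\<Sum>(d, ys)\<leftarrow>t. d * ((\<Sum>y\<leftarrow>ys. l y * K (remove1 x xs) (remove1 y ys)) / real (Suc n)))) / real (Suc n) =
     (\<Sum>(d, ys)\<leftarrow>t. d * ((\<Sum>x\<leftarrow>xs. \<Sum>y\<leftarrow>ys. l x * l y * K (remove1 x xs) (remove1 y ys)) / (real (Suc n))\<^sup>2))" for xs
  proof (induction t)
    case (Cons a t)
    obtain d ys where a: "a = (d, ys)" by (cases a)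
    have "(\<Sum>x\<leftarrow>xs. l x * (d * ((\<Sum>y\<leftarrow>ys. l y * K (remove1 x xs) (remove1 y ys)) / real (Suc n)))) / real (Suc n) =
       d * ((\<Sum>x\<leftarrow>xs. \<Sum>y\<leftarrow>ys. l x * l y * K (remove1 x xs) (remove1 y ys)) / (real (Suc n))\<^sup>2)"
    proof -
      have "(\<Sum>x\<leftarrow>us. l x * (d * ((\<Sum>y\<leftarrow>ys. l y * K (remove1 x xs) (remove1 y ys)) / N))) / N =
         d * ((\<Sum>x\<leftarrow>us. \<Sum>y\<leftarrow>ys. l x * l y * K (remove1 x xs) (remove1 y ys)) / N\<^sup>2)" for N us
        by (induction us) (simp_all add: sum_list_const_mult mult.assoc add_divide_distrib distrib_left power2_eq_square)
      then show ?thesis .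
    qed
    then show ?case using Cons by (simp add: a distrib_left sum_list_addf add_divide_distrib del: of_nat_Suc)
  qed simp
  then show ?thesis unfolding e sum_list_contract by (simp del: of_nat_Suc)
qed

lemma wick_first_sym_form:
  assumes F: "\<And>n. F n \<in> sym_form n"
    and l: "\<And>\<phi> \<psi> a b. \<phi> \<in> SU \<Longrightarrow> \<psi> \<in> SU \<Longrightarrow> l (\<lambda>z. a * \<phi> z + b * \<psi> z) = a * l \<phi> + b * l \<psi>"
  shows "wick_first l F n \<in> sym_form n"
proof (cases n)
  case 0
  then have "wick_first l F n = (\<lambda>_. 0)" by auto
  then show ?thesis by (auto intro: sym_formI)
next
  case (Suc m)
  show ?thesis unfolding Suc
  proof (rule sym_formI)
    fix \<phi>s \<psi>s :: "pfun list" assume eq: "mset \<phi>s = mset \<psi>s"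
    have "F m (remove1 x \<phi>s) = F m (remove1 x \<psi>s)" for x
      by (rule sym_formD(2)[OF F]) (simp add: eq)
    moreover have "(\<Sum>x\<leftarrow>\<phi>s. g x) = (\<Sum>x\<leftarrow>\<psi>s. g x)" for g :: "pfun \<Rightarrow> real"
      using eq by (metis mset_map sum_mset_sum_list)
    moreover have "\<phi>s \<in> lists_of SU (Suc m) \<longleftrightarrow> \<psi>s \<in> lists_of SU (Suc m)"
      using mset_eq_setD[OF eq] mset_eq_length[OF eq] by (simp add: lists_of_def)
    ultimately show "wick_first l F (Suc m) \<phi>s = wick_first l F (Suc m) \<psi>s" by simp
  next
    fix k \<phi>s \<phi> \<psi> a b assume k: "Suc k = Suc m" and \<phi>s: "\<phi>s \<in> lists_of SU k" and m: "\<phi> \<in> SU" "\<psi> \<in> SU"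
    have k: "k = m" using k by simp
    have step: "wick_first l F (Suc m) (\<theta> # \<phi>s) = (l \<theta> * F m \<phi>s + (\<Sum>x\<leftarrow>\<phi>s. l x * F m (\<theta> # remove1 x \<phi>s))) / real (Suc m)"
      if \<theta>: "\<theta> \<in> SU" for \<theta>
    proof -
      have "F m (remove1 x (\<theta> # \<phi>s)) = F m (\<theta> # remove1 x \<phi>s)" if "x \<in> set \<phi>s" for x
        by (rule sym_formD(2)[OF F]) (use that in auto)
      then have "(\<Sum>x\<leftarrow>\<phi>s. l x * F m (remove1 x (\<theta> # \<phi>s))) = (\<Sum>x\<leftarrow>\<phi>s. l x * F m (\<theta> # remove1 x \<phi>s))"
        by (intro arg_cong[where f=sum_list] map_cong refl) auto
      moreover have "\<theta> # \<phi>s \<in> lists_of SU (Suc m)" using \<theta> \<phi>s k by (auto simp: lists_of_def)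
      ultimately show ?thesis by (simp del: remove1.simps of_nat_Suc) simp
    qed
    have lin: "F m ((\<lambda>z. a * \<phi> z + b * \<psi> z) # remove1 x \<phi>s) = a * F m (\<phi> # remove1 x \<phi>s) + b * F m (\<psi> # remove1 x \<phi>s)"
      if "x \<in> set \<phi>s" for x
    proof (cases m)
      case 0
      then show ?thesis using that \<phi>s k by (simp add: lists_of_def)
    next
      case (Suc j)
      show ?thesis unfolding Suc using that \<phi>s k m Suc
        by (intro sym_formD(3)[OF F, of j]) (auto intro: lists_of_remove1)
    qed
    have "(\<Sum>x\<leftarrow>\<phi>s. l x * F m ((\<lambda>z. a * \<phi> z + b * \<psi> z) # remove1 x \<phi>s)) =
        (\<Sum>x\<leftarrow>\<phi>s. a * (l x * F m (\<phi> # remove1 x \<phi>s)) + b * (l x * F m (\<psi> # remove1 x \<phi>s)))"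
      by (intro arg_cong[where f=sum_list] map_cong refl) (simp add: lin algebra_simps)
    also have "\<dots> = a * (\<Sum>x\<leftarrow>\<phi>s. l x * F m (\<phi> # remove1 x \<phi>s)) + b * (\<Sum>x\<leftarrow>\<phi>s. l x * F m (\<psi> # remove1 x \<phi>s))"
      by (simp add: sum_list_addf sum_list_const_mult)
    finally show "wick_first l F (Suc m) ((\<lambda>z. a * \<phi> z + b * \<psi> z) # \<phi>s) =
        a * wick_first l F (Suc m) (\<phi> # \<phi>s) + b * wick_first l F (Suc m) (\<psi> # \<phi>s)"
      unfolding step[OF SU_lin[OF m]] step[OF m(1)] step[OF m(2)] l[OF m]
      by (simp add: add_divide_distrib algebra_simps del: of_nat_Suc)
  qed simp
qed

context levy_noise begin

lemma tensor_norm_contract: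
  assumes l: "\<And>\<phi> \<psi> a b. \<phi> \<in> SU \<Longrightarrow> \<psi> \<in> SU \<Longrightarrow> l (\<lambda>z. a * \<phi> z + b * \<psi> z) = a * l \<phi> + b * l \<psi>"
    and bd: "\<And>\<phi>. \<phi> \<in> SU \<Longrightarrow> \<bar>l \<phi>\<bar> \<le> L * qnorm \<nu> p \<phi>"
    and t: "t \<in> tensors (Suc n)" and L: "0 \<le> L"
  shows "tensor_norm \<nu> p (contract l n t) \<le> L * tensor_norm \<nu> p t"
proof -
  interpret quadratic_norm SU "qnorm \<nu> p" by (rule quadratic_norm_qnorm)
  let ?Q = "sym_kernel (polar (qnorm \<nu> p))"
  have "0 \<le> L\<^sup>2 * tensor_form ?Q t - tensor_form ?Q (contract l n t)"
    unfolding tensor_form_contract tensor_form_diff[symmetric]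
    by (rule tensor_form_nonneg[OF psd_on_contraction[OF psd_on_polar psd_on_polar_minus_functional[OF l bd]] t])
  then have "(tensor_norm \<nu> p (contract l n t))\<^sup>2 \<le> (L * tensor_norm \<nu> p t)\<^sup>2"
    by (simp add: tensor_norm_square[OF t] tensor_norm_square[OF contract_mem[OF t]] power_mult_distrib)
  then show ?thesis by (rule power2_le_imp_le) (rule mult_nonneg_nonneg[OF L tensor_norm_nonneg[OF t]])
qed

lemma wick_first_Sminus:
  assumes F: "F \<in> Sminus \<nu> p"
    and l: "\<And>\<phi> \<psi> a b. \<phi> \<in> SU \<Longrightarrow> \<psi> \<in> SU \<Longrightarrow> l (\<lambda>z. a * \<phi> z + b * \<psi> z) = a * l \<phi> + b * l \<psi>"
    and bd: "\<And>\<phi>. \<phi> \<in> SU \<Longrightarrow> \<bar>l \<phi>\<bar> \<le> L * qnorm \<nu> p \<phi>" and L: "0 \<le> L"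
  shows "wick_first l F \<in> Sminus \<nu> p" "Snorm \<nu> p (wick_first l F) \<le> L * Snorm \<nu> p F"
proof -
  have K: "\<bar>spoly_pair (wick_first l F) P\<bar> \<le> L * Snorm \<nu> p F * spoly_norm \<nu> p P" if P: "P \<in> spolys" for P
  proof -
    obtain N where "{n. P n \<noteq> []} \<subseteq> {..<N}"
      using spolysD(1)[OF P] unfolding finite_nat_iff_bounded by blast
    then have N: "{n. P n \<noteq> []} \<subseteq> {..<Suc N}" by auto
    define Q where "Q n = tensor_scale (real (Suc n)) (contract l n (P (Suc n)))" for n
    have QN: "{n. Q n \<noteq> []} \<subseteq> {..<N}"
    proof
      fix n assume "n \<in> {n. Q n \<noteq> []}"
      then have "P (Suc n) \<noteq> []" by (auto simp: Q_def)
      then have "Suc n \<in> {..<Suc N}" using N by blast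
      then show "n \<in> {..<N}" by simp
    qed
    have Q: "Q \<in> spolys" unfolding spolys_def
      using finite_subset[OF QN] by (auto simp: Q_def contract_mem spolysD(2)[OF P])
    have "spoly_pair (wick_first l F) P = (\<Sum>n<Suc N. fact n * tensor_pair (wick_first l F n) (P n))"
      by (rule spoly_pair_eq[OF _ N]) simp
    also have "\<dots> = (\<Sum>n<N. fact (Suc n) * tensor_pair (wick_first l F (Suc n)) (P (Suc n)))"
    proof -
      have "tensor_pair (\<lambda>\<phi>s. 0) t = 0" for t unfolding tensor_pair_def by (induction t) auto
      moreover have "wick_first l F 0 = (\<lambda>\<phi>s. 0)" by auto
      ultimately show ?thesis by (subst sum.lessThan_Suc_shift) simp
    qed
    also have "\<dots> = (\<Sum>n<N. fact n * tensor_pair (F n) (Q n))"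
      using spolysD(2)[OF P] by (intro sum.cong refl) (simp add: Q_def tensor_pair_contract)
    also have "\<dots> = spoly_pair F Q" by (rule spoly_pair_eq[OF _ QN, symmetric]) simp
    finally have 1: "\<bar>spoly_pair (wick_first l F) P\<bar> \<le> Snorm \<nu> p F * spoly_norm \<nu> p Q"
      using spoly_pair_le[OF F Q] by simp
    have "(\<Sum>n<N. (fact n)\<^sup>2 * (tensor_norm \<nu> p (Q n))\<^sup>2) \<le> (\<Sum>n<N. L\<^sup>2 * ((fact (Suc n))\<^sup>2 * (tensor_norm \<nu> p (P (Suc n)))\<^sup>2))"
    proof (intro sum_mono)
      fix n
      have "(tensor_norm \<nu> p (contract l n (P (Suc n))))\<^sup>2 \<le> (L * tensor_norm \<nu> p (P (Suc n)))\<^sup>2"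
        by (intro power_mono tensor_norm_contract l bd L spolysD(2)[OF P] tensor_norm_nonneg[OF contract_mem])
      then have "(fact (Suc n))\<^sup>2 * (tensor_norm \<nu> p (contract l n (P (Suc n))))\<^sup>2 \<le> (fact (Suc n))\<^sup>2 * (L * tensor_norm \<nu> p (P (Suc n)))\<^sup>2"
        by (intro mult_left_mono) auto
      then show "(fact n)\<^sup>2 * (tensor_norm \<nu> p (Q n))\<^sup>2 \<le> L\<^sup>2 * ((fact (Suc n))\<^sup>2 * (tensor_norm \<nu> p (P (Suc n)))\<^sup>2)"
        by (simp add: Q_def power_mult_distrib mult_ac)
    qed
    also have "\<dots> = L\<^sup>2 * (\<Sum>n<N. (fact (Suc n))\<^sup>2 * (tensor_norm \<nu> p (P (Suc n)))\<^sup>2)" by (simp add: sum_distrib_left)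
    also have "\<dots> \<le> L\<^sup>2 * (\<Sum>n<Suc N. (fact n)\<^sup>2 * (tensor_norm \<nu> p (P n))\<^sup>2)"
      by (intro mult_left_mono) (auto simp: sum.lessThan_Suc_shift simp del: sum.lessThan_Suc)
    finally have "sqrt (\<Sum>n<N. (fact n)\<^sup>2 * (tensor_norm \<nu> p (Q n))\<^sup>2) \<le> sqrt (L\<^sup>2 * (\<Sum>n<Suc N. (fact n)\<^sup>2 * (tensor_norm \<nu> p (P n))\<^sup>2))"
      by (rule real_sqrt_le_mono)
    then have "spoly_norm \<nu> p Q \<le> L * spoly_norm \<nu> p P"
      unfolding spoly_norm_eq[OF finite_lessThan QN] spoly_norm_eq[OF finite_lessThan N] real_sqrt_mult using L by simp
    then have "Snorm \<nu> p F * spoly_norm \<nu> p Q \<le> Snorm \<nu> p F * (L * spoly_norm \<nu> p P)"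
      by (rule mult_left_mono[OF _ Snorm_nonneg[OF F]])
    with 1 show ?thesis by (simp add: mult_ac)
  qed
  have nn: "0 \<le> L * Snorm \<nu> p F" using L Snorm_nonneg[OF F] by simp
  have sf: "wick_first l F n \<in> sym_form n" for n
    by (rule wick_first_sym_form[OF Sminus_sym_form[OF F] l])
  show "wick_first l F \<in> Sminus \<nu> p" by (rule SminusI(1)[OF sf nn K])
  show "Snorm \<nu> p (wick_first l F) \<le> L * Snorm \<nu> p F" by (rule SminusI(2)[OF sf nn K])
qed

lemma wick_first_diff_functional:
  "wick_first l F - wick_first k F = wick_first (\<lambda>\<phi>. l \<phi> - k \<phi>) F"
proof (intro ext)
  fix n \<phi>s show "(wick_first l F - wick_first k F) n \<phi>s = wick_first (\<lambda>\<phi>. l \<phi> - k \<phi>) F n \<phi>s"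
    by (cases n) (simp_all add: sum_list_subtractf left_diff_distrib diff_divide_distrib del: of_nat_Suc)
qed

lemma wick_first_diff: "wick_first l F - wick_first l G = wick_first l (F - G)"
proof (intro ext)
  fix n \<phi>s show "(wick_first l F - wick_first l G) n \<phi>s = wick_first l (F - G) n \<phi>s"
    by (cases n) (simp_all add: sum_list_subtractf right_diff_distrib diff_divide_distrib del: of_nat_Suc)
qed

end

section \<open>Injectivity of the S-transform\<close>

lemma powser_zero_imp_zero:
  fixes a :: "nat \<Rightarrow> real"
  assumes r: "0 < r" and s: "\<And>x. \<bar>x\<bar> < r \<Longrightarrow> (\<lambda>n. a n * x ^ n) sums 0"
  shows "a n = 0"
proof (induction n rule: less_induct)
  case (less n)
  define f where "f x = (if x = 0 then a n else 0)" for x :: real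
  have "(\<lambda>k. a (k + n) * x ^ k) sums f x" if "norm x < r" for x
  proof (cases "x = 0")
    case True
    then show ?thesis using powser_sums_zero[of "\<lambda>k. a (k + n)"] by (simp add: f_def)
  next
    case False
    have "(\<lambda>k. a (k + n) * x ^ (k + n)) sums 0"
      using sums_split_initial_segment[OF s[of x], of n] that less by simp
    from sums_mult[OF this, of "inverse (x ^ n)"] False show ?thesis
      by (simp add: f_def power_add field_simps)
  qed
  from powser_limit_0[OF r this] have "(f \<longlongrightarrow> a n) (at 0)" by simp
  moreover have "(f \<longlongrightarrow> 0) (at 0)"
    by (rule tendsto_eventually) (simp add: f_def eventually_at_filter)
  ultimately show ?case by (rule LIM_unique)
qed

lemma sym_form_scale:
  assumes F: "F \<in> sym_form n" and \<xi>: "\<xi> \<in> SU"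
  shows "F (replicate n (\<lambda>z. c * \<xi> z)) = c ^ n * F (replicate n \<xi>)"
proof -
  have "m + k = n \<Longrightarrow> F (replicate m (\<lambda>z. c * \<xi> z) @ replicate k \<xi>) = c ^ m * F (replicate n \<xi>)" for m k
  proof (induction m arbitrary: k)
    case (Suc m)
    let ?c = "\<lambda>z. c * \<xi> z"
    have c: "?c \<in> SU" using SU_lin[OF \<xi> \<xi>, of c 0] by simp
    have "F ((\<lambda>z. c * \<xi> z + 0 * \<xi> z) # (replicate m ?c @ replicate k \<xi>)) =
        c * F (\<xi> # (replicate m ?c @ replicate k \<xi>)) + 0 * F (\<xi> # (replicate m ?c @ replicate k \<xi>))"
      using Suc.prems \<xi> c by (intro sym_formD(3)[OF F, of "m + k"]) (auto simp: lists_of_def)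
    moreover have "F (\<xi> # (replicate m ?c @ replicate k \<xi>)) = F (replicate m ?c @ replicate (Suc k) \<xi>)"
      by (rule sym_formD(2)[OF F]) simp
    ultimately show ?case using Suc.IH[of "Suc k"] Suc.prems by simp
  qed simp
  from this[of n 0] show ?thesis by simp
qed

lemma sym_form_deriv:
  assumes F: "F \<in> sym_form n" and \<xi>: "\<xi> \<in> SU" "\<psi> \<in> SU"
  shows "m + length \<rho> = n \<Longrightarrow> set \<rho> \<subseteq> SU \<Longrightarrow>
    ((\<lambda>t. F (replicate m (\<lambda>z. 1 * \<xi> z + t * \<psi> z) @ \<rho>)) has_real_derivative
      real m * F (replicate (m - 1) \<xi> @ \<psi> # \<rho>)) (at 0)"
proof (induction m arbitrary: \<rho>)
  case (Suc m)
  let ?x = "\<lambda>t z. 1 * \<xi> z + t * \<psi> z"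
  have x: "?x t \<in> SU" for t using \<xi> by (rule SU_lin)
  have e: "F (replicate (Suc m) (?x t) @ \<rho>) = F (replicate m (?x t) @ \<xi> # \<rho>) + t * F (replicate m (?x t) @ \<psi> # \<rho>)" for t
  proof -
    have "F (?x t # (replicate m (?x t) @ \<rho>)) = 1 * F (\<xi> # (replicate m (?x t) @ \<rho>)) + t * F (\<psi> # (replicate m (?x t) @ \<rho>))"
      using Suc.prems \<xi> x[of t] by (intro sym_formD(3)[OF F, of "m + length \<rho>"]) (auto simp: lists_of_def)
    moreover have "F (\<theta> # (replicate m (?x t) @ \<rho>)) = F (replicate m (?x t) @ \<theta> # \<rho>)" for \<theta>
      by (rule sym_formD(2)[OF F]) simp
    ultimately show ?thesis by simp
  qed
  have "((\<lambda>t. F (replicate m (?x t) @ \<xi> # \<rho>) + t * F (replicate m (?x t) @ \<psi> # \<rho>)) has_real_derivative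
     real m * F (replicate (m - 1) \<xi> @ \<psi> # \<xi> # \<rho>) +
     (1 * F (replicate m (?x 0) @ \<psi> # \<rho>) + real m * F (replicate (m - 1) \<xi> @ \<psi> # \<psi> # \<rho>) * 0)) (at 0)"
    using Suc.prems \<xi> by (intro DERIV_add DERIV_mult Suc.IH DERIV_ident) auto
  also have "real m * F (replicate (m - 1) \<xi> @ \<psi> # \<xi> # \<rho>) = real m * F (replicate m \<xi> @ \<psi> # \<rho>)"
  proof (cases m)
    case (Suc j)
    have "F (replicate j \<xi> @ \<psi> # \<xi> # \<rho>) = F (replicate (Suc j) \<xi> @ \<psi> # \<rho>)"
      by (rule sym_formD(2)[OF F]) simp
    then show ?thesis by (simp add: Suc)
  qed simp
  finally show ?case unfolding e by (simp add: algebra_simps)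
qed simp

text \<open>Polarisation: differentiating \<open>t \<mapsto> F ((\<xi> + t \<psi>)\<^sup>\<otimes>\<^sup>m, \<dots>)\<close> at \<open>0\<close> replaces one \<open>\<xi>\<close> by \<open>\<psi>\<close>.\<close>

lemma sym_form_zero:
  assumes F: "F \<in> sym_form n" and z: "\<And>\<xi>. \<xi> \<in> SU \<Longrightarrow> F (replicate n \<xi>) = 0"
  shows "F \<phi>s = 0"
proof (cases "\<phi>s \<in> lists_of SU n")
  case True
  have "k \<le> n \<Longrightarrow> length \<rho> = k \<Longrightarrow> set \<rho> \<subseteq> SU \<Longrightarrow> \<xi> \<in> SU \<Longrightarrow> F (replicate (n - k) \<xi> @ \<rho>) = 0" for k \<rho> \<xi>
  proof (induction k arbitrary: \<rho> \<xi>)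
    case (Suc k)
    then obtain \<psi> \<rho>' where \<rho>: "\<rho> = \<psi> # \<rho>'" by (cases \<rho>) auto
    have m: "\<psi> \<in> SU" "set \<rho>' \<subseteq> SU" "length \<rho>' = k" using Suc.prems \<rho> by auto
    have "((\<lambda>t. F (replicate (n - k) (\<lambda>z. 1 * \<xi> z + t * \<psi> z) @ \<rho>')) has_real_derivative
      real (n - k) * F (replicate (n - k - 1) \<xi> @ \<psi> # \<rho>')) (at 0)"
      by (rule sym_form_deriv[OF F]) (use m Suc.prems in auto)
    moreover have "(\<lambda>t. F (replicate (n - k) (\<lambda>z. 1 * \<xi> z + t * \<psi> z) @ \<rho>')) = (\<lambda>t. 0)"
      by (rule ext, rule Suc.IH[OF _ m(3,2) SU_lin[OF Suc.prems(4) m(1)]]) (use Suc.prems in simp)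
    ultimately have "((\<lambda>t. 0) has_real_derivative real (n - k) * F (replicate (n - k - 1) \<xi> @ \<psi> # \<rho>')) (at (0::real))"
      by simp
    then have "real (n - k) * F (replicate (n - k - 1) \<xi> @ \<psi> # \<rho>') = 0"
      by (rule DERIV_unique) simp
    then show ?case using Suc.prems \<rho> by simp
  qed (use z in simp)
  from this[of n \<phi>s "\<lambda>_. 0"] True show ?thesis using SU_zero by (simp add: lists_of_def)
qed (rule sym_formD(1)[OF F])

context levy_noise begin

lemma tensor_norm_power: "\<xi> \<in> SU \<Longrightarrow> tensor_norm \<nu> p [(1, replicate n \<xi>)] = qnorm \<nu> p \<xi> ^ n"
proof -
  interpret quadratic_norm SU "qnorm \<nu> p" by (rule quadratic_norm_qnorm)
  assume \<xi>: "\<xi> \<in> SU"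
  have "prod_kernel (polar (qnorm \<nu> p)) (replicate n \<xi>) (permute_list \<sigma> (replicate n \<xi>)) = (qnorm \<nu> p \<xi> ^ n)\<^sup>2"
    if "\<sigma> permutes {..<n}" for \<sigma>
  proof -
    have "\<sigma> i < n" if "i < n" for i using permutes_in_image[OF \<open>\<sigma> permutes {..<n}\<close>, of i] that by simp
    then show ?thesis using \<xi> by (simp add: prod_kernel_def permute_list_def polar_self power_mult[symmetric] mult.commute)
  qed
  then have "sym_kernel (polar (qnorm \<nu> p)) (replicate n \<xi>) (replicate n \<xi>) = (qnorm \<nu> p \<xi> ^ n)\<^sup>2"
    by (simp add: sym_kernel_right)
  then show ?thesis using nonneg[OF \<xi>] by (simp add: tensor_norm_eq tensor_form_def)
qed

lemma Sminus_power_le: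
  assumes F: "F \<in> Sminus \<nu> p" and \<xi>: "\<xi> \<in> SU"
  shows "\<bar>F n (replicate n \<xi>)\<bar> \<le> Snorm \<nu> p F * qnorm \<nu> p \<xi> ^ n"
proof -
  have t: "[(1, replicate n \<xi>)] \<in> tensors n" using \<xi> by (auto simp: tensors_def)
  have Fd: "F n \<in> tdual \<nu> p n" for n using F by (simp add: Sminus_def)
  have "(tdual_norm \<nu> p n (F n))\<^sup>2 \<le> (\<Sum>n. (tdual_norm \<nu> p n (F n))\<^sup>2)"
    using sum_le_suminf[of "\<lambda>n. (tdual_norm \<nu> p n (F n))\<^sup>2" "{n}"] F by (simp add: Sminus_def)
  then have "tdual_norm \<nu> p n (F n) \<le> Snorm \<nu> p F" unfolding Snorm_def by (rule real_le_rsqrt)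
  moreover have "0 \<le> qnorm \<nu> p \<xi> ^ n" using quadratic_norm.nonneg[OF quadratic_norm_qnorm \<xi>] by simp
  ultimately show ?thesis
    using tensor_pair_le[OF Fd t] by (simp add: tensor_norm_power[OF \<xi>] tensor_pair_def)
      (meson mult_right_mono order_trans)
qed

lemma S_transform_summable:
  assumes F: "F \<in> Sminus \<nu> p" and \<xi>: "\<xi> \<in> SU" and lt: "qnorm \<nu> p \<xi> < 1"
  shows "summable (\<lambda>n. F n (replicate n \<xi>))"
proof (rule summable_comparison_test')
  have "0 \<le> qnorm \<nu> p \<xi>" by (rule quadratic_norm.nonneg[OF quadratic_norm_qnorm \<xi>])
  then show "summable (\<lambda>n. Snorm \<nu> p F * qnorm \<nu> p \<xi> ^ n)" using lt by (intro summable_mult summable_geometric) simp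
qed (use Sminus_power_le[OF F \<xi>] in simp)

lemma S_transform_inject:
  assumes F: "F \<in> Sminus \<nu> r" and G: "G \<in> Sminus \<nu> r'"
    and \<epsilon>: "\<epsilon> > 0" "\<And>\<xi>. \<xi> \<in> SU \<Longrightarrow> qnorm \<nu> s \<xi> < \<epsilon> \<Longrightarrow> qnorm \<nu> s' \<xi> < \<epsilon> \<Longrightarrow> S_transform F \<xi> = S_transform G \<xi>"
  shows "F = G"
proof (intro ext)
  fix n \<phi>s
  have FG: "F n \<in> sym_form n" "G n \<in> sym_form n" for n
    using Sminus_sym_form[OF F] Sminus_sym_form[OF G] .
  have "F n (replicate n \<xi>) - G n (replicate n \<xi>) = 0" if \<xi>: "\<xi> \<in> SU" for \<xi> n
  proof (rule powser_zero_imp_zero)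
    let ?q = "\<lambda>p. qnorm \<nu> p \<xi>"
    define d where "d = min 1 \<epsilon> / (1 + ?q r + ?q r' + ?q s + ?q s')"
    have q0: "0 \<le> ?q p" for p by (rule quadratic_norm.nonneg[OF quadratic_norm_qnorm \<xi>])
    have D: "0 < 1 + ?q r + ?q r' + ?q s + ?q s'" using q0[of r] q0[of r'] q0[of s] q0[of s'] by linarith
    show "0 < d" unfolding d_def using D \<epsilon>(1) by simp
    fix c :: real assume "\<bar>c\<bar> < d"
    then have c: "\<bar>c\<bar> * (1 + ?q r + ?q r' + ?q s + ?q s') < min 1 \<epsilon>" unfolding d_def using D by (simp add: pos_less_divide_eq)
    have lt: "\<bar>c\<bar> * ?q p < min 1 \<epsilon>" if "p \<in> {r, r', s, s'}" for p
    proof -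
      have "?q p \<le> 1 + ?q r + ?q r' + ?q s + ?q s'" using that q0[of r] q0[of r'] q0[of s] q0[of s'] by auto
      then have "\<bar>c\<bar> * ?q p \<le> \<bar>c\<bar> * (1 + ?q r + ?q r' + ?q s + ?q s')" by (rule mult_left_mono) simp
      then show ?thesis using c by linarith
    qed
    let ?c = "\<lambda>z. c * \<xi> z"
    have cS: "?c \<in> SU" using SU_lin[OF \<xi> \<xi>, of c 0] by simp
    have qc: "qnorm \<nu> p ?c = \<bar>c\<bar> * ?q p" for p by (rule quadratic_norm.homog[OF quadratic_norm_qnorm \<xi>])
    have "(\<lambda>n. F n (replicate n ?c) - G n (replicate n ?c)) sums (S_transform F ?c - S_transform G ?c)"
      unfolding S_transform_def using lt
      by (intro sums_diff summable_sums S_transform_summable[OF F cS] S_transform_summable[OF G cS]) (simp_all add: qc)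
    moreover have "S_transform F ?c = S_transform G ?c" using lt[of s] lt[of s'] by (intro \<epsilon>(2) cS) (simp_all add: qc)
    ultimately show "(\<lambda>n. (F n (replicate n \<xi>) - G n (replicate n \<xi>)) * c ^ n) sums 0"
      by (simp add: sym_form_scale[OF FG(1) \<xi>] sym_form_scale[OF FG(2) \<xi>] algebra_simps)
  qed
  then have "1 * F n \<phi>s + (-1) * G n \<phi>s = 0"
    by - (rule sym_form_zero[OF sym_form_lin[OF FG(1)[of n] FG(2)[of n], of 1 "-1"]], simp)
  then show "F n \<phi>s = G n \<phi>s" by simp
qed

lemma S_transform_wick_first:
  assumes "\<xi> \<in> SU" "summable (\<lambda>n. F n (replicate n \<xi>))"
  shows "S_transform (wick_first l F) \<xi> = l \<xi> * S_transform F \<xi>"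
proof -
  have r: "wick_first l F (Suc n) (replicate (Suc n) \<xi>) = l \<xi> * F n (replicate n \<xi>)" for n
  proof -
    have "replicate (Suc n) \<xi> \<in> lists_of SU (Suc n)" using assms by (auto simp: lists_of_def)
    moreover have "(\<Sum>x\<leftarrow>replicate (Suc n) \<xi>. l x * F n (remove1 x (replicate (Suc n) \<xi>))) = real (Suc n) * (l \<xi> * F n (replicate n \<xi>))"
    proof -
      have "(\<Sum>x\<leftarrow>replicate k \<xi>. l x * F n (remove1 x (replicate (Suc n) \<xi>))) = real k * (l \<xi> * F n (replicate n \<xi>))" for k
        by (induction k) (simp_all add: algebra_simps)
      then show ?thesis .
    qed
    ultimately show ?thesis by (simp only: wick_first.simps if_True) simp
  qed
  have "(\<lambda>n. wick_first l F (Suc n) (replicate (Suc n) \<xi>)) sums (l \<xi> * S_transform F \<xi>)"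
    unfolding r S_transform_def by (intro sums_mult summable_sums assms)
  from sums_Suc[OF this] show ?thesis by (simp add: S_transform_def sums_iff)
qed

definition unit_dist :: sdist where
  "unit_dist n \<phi>s = (if n = 0 \<and> \<phi>s = [] then 1 else 0)"

lemma unit_dist_Sminus: "unit_dist \<in> Sminus \<nu> p"
proof (rule SminusI(1)[where K=1])
  show "unit_dist n \<in> sym_form n" for n
  proof (rule sym_formI)
    fix \<phi>s \<psi>s :: "pfun list" assume "mset \<phi>s = mset \<psi>s"
    then have "\<phi>s = [] \<longleftrightarrow> \<psi>s = []" by auto
    then show "unit_dist n \<phi>s = unit_dist n \<psi>s" by (simp add: unit_dist_def)
  qed (auto simp: unit_dist_def lists_of_def)
  fix P assume P: "P \<in> spolys"
  have fin: "finite (insert 0 {n. P n \<noteq> []})" using spolysD(1)[OF P] by simp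
  let ?s = "\<Sum>(c, \<phi>s)\<leftarrow>P 0. c"
  have nil: "\<phi>s = []" if "(c, \<phi>s) \<in> set (P 0)" for c \<phi>s using spolysD(2)[OF P, of 0] that by (auto simp: tensors_def)
  have p0: "tensor_pair (unit_dist 0) (P 0) = ?s"
    unfolding tensor_pair_def by (intro arg_cong[where f=sum_list] map_cong refl) (auto simp: unit_dist_def dest: nil)
  have "tensor_pair (unit_dist n) t = 0" if "n \<noteq> 0" for n t
    unfolding tensor_pair_def by (induction t) (use that in \<open>auto simp: unit_dist_def\<close>)
  then have "spoly_pair unit_dist P = (\<Sum>n\<in>insert 0 {n. P n \<noteq> []}. if n = 0 then ?s else 0)"
    using p0 by (subst spoly_pair_eq[OF fin]) (auto intro!: sum.cong)
  then have "spoly_pair unit_dist P = ?s" using fin by (simp add: sum.delta)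
  have "tensor_form K (P 0) = K [] [] * ?s\<^sup>2" for K
  proof -
    have "tensor_form K (P 0) = (\<Sum>(c, \<phi>s)\<leftarrow>P 0. \<Sum>(d, \<psi>s)\<leftarrow>P 0. c * (d * K [] []))"
      unfolding tensor_form_def by (intro arg_cong[where f=sum_list] map_cong refl) (auto dest!: nil simp: mult.assoc intro!: arg_cong[where f=sum_list])
    also have "\<dots> = K [] [] * ?s\<^sup>2"
      by (simp add: case_prod_unfold sum_list_const_mult sum_list_mult_const power2_eq_square mult_ac)
    finally show ?thesis .
  qed
  then have n0: "tensor_norm \<nu> p (P 0) = \<bar>?s\<bar>" by (simp add: tensor_norm_eq sym_kernel_def prod_kernel_def)
  have "?s\<^sup>2 \<le> (\<Sum>n\<in>insert 0 {n. P n \<noteq> []}. (fact n)\<^sup>2 * (tensor_norm \<nu> p (P n))\<^sup>2)"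
    using member_le_sum[of 0 "insert 0 {n. P n \<noteq> []}" "\<lambda>n. (fact n)\<^sup>2 * (tensor_norm \<nu> p (P n))\<^sup>2"] fin by (simp add: n0)
  then have "\<bar>?s\<bar> \<le> spoly_norm \<nu> p P"
    by (subst spoly_norm_eq[OF fin]) (auto intro: real_le_rsqrt)
  then show "\<bar>spoly_pair unit_dist P\<bar> \<le> 1 * spoly_norm \<nu> p P" using \<open>spoly_pair unit_dist P = ?s\<close> by simp
qed simp

lemma S_transform_unit_dist: "(\<lambda>n. unit_dist n (replicate n \<xi>)) sums 1"
proof -
  have "(\<lambda>n. unit_dist n (replicate n \<xi>)) = (\<lambda>n. if n = 0 then 1 else 0)" by (auto simp: unit_dist_def)
  then show ?thesis using sums_single[of 0 "\<lambda>_. 1::real"] by simp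
qed

lemma wick_noise_Sminus:
  assumes "F \<in> Sminus \<nu> p" "p \<ge> 2"
  shows "wick_first (noise t) F \<in> Sminus \<nu> p"
    "Snorm \<nu> p (wick_first (noise t) F) \<le> noise_const / Gamma \<beta> * Snorm \<nu> p F"
proof -
  have L: "0 \<le> noise_const / Gamma \<beta>" using noise_const_nonneg Gamma_pos by simp
  show "wick_first (noise t) F \<in> Sminus \<nu> p"
    by (rule wick_first_Sminus(1)[OF assms(1) _ _ L]) (rule noise_lin noise_le_qnorm[OF _ assms(2)]; assumption)+
  show "Snorm \<nu> p (wick_first (noise t) F) \<le> noise_const / Gamma \<beta> * Snorm \<nu> p F"
    by (rule wick_first_Sminus(2)[OF assms(1) _ _ L]) (rule noise_lin noise_le_qnorm[OF _ assms(2)]; assumption)+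
qed

lemma wick_noise_diff_le:
  assumes F: "F \<in> Sminus \<nu> p" and p: "p \<ge> 2"
  shows "Snorm \<nu> p (wick_first (noise t) F - wick_first (noise s) F) \<le> noise_const / Gamma \<beta> * \<bar>t - s\<bar> * Snorm \<nu> p F"
  unfolding wick_first_diff_functional
  using noise_const_nonneg Gamma_pos
  by (intro wick_first_Sminus(2)[OF F _ noise_diff_le_qnorm[OF _ p]]) (auto simp: noise_lin algebra_simps)

lemma frac_levy_noise_eq: "frac_levy_noise \<nu> q0 \<beta> t = wick_first (noise t) unit_dist"
  unfolding frac_levy_noise_def
proof (rule the_equality)
  let ?H = "wick_first (noise t) unit_dist"
  have S: "S_transform ?H \<xi> = noise t \<xi>" if "\<xi> \<in> SU" for \<xi>
    using S_transform_wick_first[where F=unit_dist and l="noise t", OF that sums_summable[OF S_transform_unit_dist]]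
      S_transform_unit_dist[of \<xi>]
    by (simp add: S_transform_def sums_iff)
  have H: "?H \<in> Sminus \<nu> (max 2 q0)" by (intro wick_noise_Sminus unit_dist_Sminus) simp
  show "?H \<in> Sdist \<nu> q0 \<and> near_zero \<nu> q0 (\<lambda>\<eta>. ((\<lambda>r. S_transform (frac_levy \<nu> \<beta> r) \<eta>)
        has_real_derivative S_transform ?H \<eta>) (at t))"
  proof
    show "?H \<in> Sdist \<nu> q0" using H unfolding Sdist_def by (intro UN_I[of "max 2 q0"]) auto
  qed (auto simp: near_zero_def S intro!: exI[of _ q0] exI[of _ "1::real"] S_transform_frac_levy_deriv)
  fix G assume G: "G \<in> Sdist \<nu> q0 \<and> near_zero \<nu> q0 (\<lambda>\<eta>. ((\<lambda>r. S_transform (frac_levy \<nu> \<beta> r) \<eta>)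
        has_real_derivative S_transform G \<eta>) (at t))"
  then obtain r where r: "G \<in> Sminus \<nu> r" unfolding Sdist_def by blast
  obtain s \<epsilon> where "\<epsilon> > 0" and \<epsilon>: "\<And>\<xi>. \<xi> \<in> SU \<Longrightarrow> qnorm \<nu> s \<xi> < \<epsilon> \<Longrightarrow>
      ((\<lambda>r. S_transform (frac_levy \<nu> \<beta> r) \<xi>) has_real_derivative S_transform G \<xi>) (at t)"
    using G unfolding near_zero_def by blast
  show "G = ?H"
  proof (rule S_transform_inject[OF r H \<open>\<epsilon> > 0\<close>])
    show "S_transform G \<xi> = S_transform ?H \<xi>" if "\<xi> \<in> SU" "qnorm \<nu> s \<xi> < \<epsilon>" for \<xi>
      using DERIV_unique[OF \<epsilon>[OF that] S_transform_frac_levy_deriv[OF that(1)]] S[OF that(1)] by simp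
  qed
qed

lemma wick_frac_levy_noise:
  assumes F: "F \<in> Sminus \<nu> p" and p: "p \<ge> 2" "p \<ge> q0"
  shows "wick \<nu> q0 F (frac_levy_noise \<nu> q0 \<beta> t) = wick_first (noise t) F"
  unfolding wick_def frac_levy_noise_eq
proof (rule the_equality)
  let ?H = "wick_first (noise t) F"
  have S: "S_transform ?H \<xi> = S_transform F \<xi> * S_transform (wick_first (noise t) unit_dist) \<xi>"
    if "\<xi> \<in> SU" "qnorm \<nu> p \<xi> < 1" for \<xi>
    using S_transform_wick_first[where F=unit_dist and l="noise t", OF that(1) sums_summable[OF S_transform_unit_dist]]
      S_transform_unit_dist[of \<xi>] S_transform_wick_first[where F=F and l="noise t", OF that(1) S_transform_summable[OF F that]]
    by (simp add: S_transform_def sums_iff)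
  note H = wick_noise_Sminus(1)[OF F p(1)]
  show "?H \<in> Sdist \<nu> q0 \<and> near_zero \<nu> q0 (\<lambda>\<xi>. S_transform ?H \<xi> = S_transform F \<xi> * S_transform (wick_first (noise t) unit_dist) \<xi>)"
  proof
    show "?H \<in> Sdist \<nu> q0" using H p(2) unfolding Sdist_def by (intro UN_I[of p]) auto
  qed (use p(2) S in \<open>auto simp: near_zero_def intro!: exI[of _ p] exI[of _ "1::real"]\<close>)
  fix G assume G: "G \<in> Sdist \<nu> q0 \<and> near_zero \<nu> q0 (\<lambda>\<xi>. S_transform G \<xi> = S_transform F \<xi> * S_transform (wick_first (noise t) unit_dist) \<xi>)"
  then obtain r where r: "G \<in> Sminus \<nu> r" unfolding Sdist_def by blast
  obtain s \<epsilon> where "\<epsilon> > 0" and \<epsilon>: "\<And>\<xi>. \<xi> \<in> SU \<Longrightarrow> qnorm \<nu> s \<xi> < \<epsilon> \<Longrightarrow>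
      S_transform G \<xi> = S_transform F \<xi> * S_transform (wick_first (noise t) unit_dist) \<xi>"
    using G unfolding near_zero_def by blast
  show "G = ?H"
  proof (rule S_transform_inject[OF r H, of "min \<epsilon> 1" s p])
    show "0 < min \<epsilon> 1" using \<open>\<epsilon> > 0\<close> by simp
    show "S_transform G \<xi> = S_transform ?H \<xi>" if "\<xi> \<in> SU" "qnorm \<nu> s \<xi> < min \<epsilon> 1" "qnorm \<nu> p \<xi> < min \<epsilon> 1" for \<xi>
      using \<epsilon>[of \<xi>] S[of \<xi>] that by simp
  qed
qed

end

section \<open>Volterra equations in Banach spaces\<close>

lemma integral_mem_closed_subspace:
  fixes f :: "real \<Rightarrow> 'a::banach"
  assumes S: "subspace S" "closed S" and f: "\<And>x. x \<in> {a..b} \<Longrightarrow> f x \<in> S"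
  shows "integral {a..b} f \<in> S"
proof (cases "f integrable_on {a..b}")
  case True
  then have "(f has_integral integral {a..b} f) {a..b}" by (rule integrable_integral)
  then have hi: "\<forall>e>0. \<exists>\<gamma>. gauge \<gamma> \<and> (\<forall>p. p tagged_division_of {a..b} \<and> \<gamma> fine p \<longrightarrow>
      norm ((\<Sum>(x,k)\<in>p. measure lborel k *\<^sub>R f x) - integral {a..b} f) < e)"
    unfolding has_integral_real .
  have "\<exists>y\<in>S. dist y (integral {a..b} f) < e" if "e > 0" for e
  proof -
    obtain \<gamma> where \<gamma>0: "gauge \<gamma> \<and> (\<forall>p. p tagged_division_of {a..b} \<and> \<gamma> fine p \<longrightarrow>
      norm ((\<Sum>(x,k)\<in>p. measure lborel k *\<^sub>R f x) - integral {a..b} f) < e)"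
      using hi[rule_format, OF \<open>e > 0\<close>] by (elim exE)
    note \<gamma> = \<gamma>0[THEN conjunct1] \<gamma>0[THEN conjunct2, rule_format, OF conjI]
    obtain p where p: "p tagged_division_of {a..b}" "\<gamma> fine p"
      using fine_division_exists_real[OF \<gamma>(1)] by blast
    have "(\<Sum>(x,k)\<in>p. measure lborel k *\<^sub>R f x) \<in> S"
    proof (rule subspace_sum[OF S(1)])
      fix z assume "z \<in> p"
      moreover obtain x k where z: "z = (x, k)" by (cases z)
      ultimately have "x \<in> {a..b}" using p(1) by (blast dest: tagged_division_ofD)
      then show "(case z of (x, k) \<Rightarrow> measure lborel k *\<^sub>R f x) \<in> S"
        using f S(1) by (simp add: z subspace_scale)
    qed
    then show ?thesis using \<gamma>(2)[OF p] by (auto simp: dist_norm)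
  qed
  then show ?thesis using closed_approachable[OF S(2)] by blast
qed (simp add: not_integrable_integral subspace_0[OF S(1)])

lemma norm_integral_exp_le:
  fixes f :: "real \<Rightarrow> 'a::banach"
  assumes f: "continuous_on {0..t} f" and t: "0 \<le> t" and M: "0 < M" and B: "0 \<le> B"
    and le: "\<And>s. s \<in> {0..t} \<Longrightarrow> norm (f s) \<le> B * exp (M * s)"
  shows "norm (integral {0..t} f) \<le> B / M * exp (M * t)"
proof -
  have hi: "((\<lambda>s. B * exp (M * s)) has_integral (B / M * exp (M * t) - B / M * exp (M * 0))) {0..t}"
    using M by (intro fundamental_theorem_of_calculus t)
      (auto intro!: derivative_eq_intros simp flip: has_real_derivative_iff_has_vector_derivative)
  have "norm (integral {0..t} f) \<le> integral {0..t} (\<lambda>s. B * exp (M * s))"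
    by (intro integral_norm_bound_integral integrable_continuous_real f le) (auto intro!: continuous_intros)
  also have "\<dots> = B / M * exp (M * t) - B / M * exp (M * 0)" using hi by (rule integral_unique)
  also have "\<dots> \<le> B / M * exp (M * t)" using M B by simp
  finally show ?thesis .
qed

locale volterra =
  fixes S :: "'a::banach set" and G :: "real \<Rightarrow> 'a \<Rightarrow> 'a" and K :: real
  assumes S: "subspace S" "closed S" and K: "0 \<le> K"
    and G_mem: "\<And>t x. 0 \<le> t \<Longrightarrow> x \<in> S \<Longrightarrow> G t x \<in> S"
    and G_lipschitz: "\<And>t x y. 0 \<le> t \<Longrightarrow> x \<in> S \<Longrightarrow> y \<in> S \<Longrightarrow> norm (G t x - G t y) \<le> K * norm (x - y)"
    and G_growth: "\<And>t x. 0 \<le> t \<Longrightarrow> x \<in> S \<Longrightarrow> norm (G t x) \<le> K * (1 + norm x)"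
    and G_continuous: "\<And>x. x \<in> S \<Longrightarrow> continuous_on {0..} (\<lambda>t. G t x)"
begin

lemma G_compose_continuous:
  assumes u: "continuous_on T u" "\<And>t. t \<in> T \<Longrightarrow> u t \<in> S" and T: "T \<subseteq> {0..}"
  shows "continuous_on T (\<lambda>t. G t (u t))"
  unfolding continuous_on_def
proof
  fix t assume t: "t \<in> T"
  have "((\<lambda>s. K * norm (u s - u t) + norm (G s (u t) - G t (u t))) \<longlongrightarrow> K * norm (u t - u t) + norm (G t (u t) - G t (u t))) (at t within T)"
    using u(1) continuous_on_subset[OF G_continuous[OF u(2)[OF t]] T] t
    by (intro tendsto_intros) (auto simp: continuous_on_def)
  then have lim: "((\<lambda>s. K * norm (u s - u t) + norm (G s (u t) - G t (u t))) \<longlongrightarrow> 0) (at t within T)" by simp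
  have "((\<lambda>s. G s (u s) - G t (u t)) \<longlongrightarrow> 0) (at t within T)"
  proof (rule Lim_null_comparison[OF _ lim])
    have "norm (G s (u s) - G t (u t)) \<le> K * norm (u s - u t) + norm (G s (u t) - G t (u t))" if "s \<in> T" for s
    proof -
      have "norm (G s (u s) - G t (u t)) \<le> norm (G s (u s) - G s (u t)) + norm (G s (u t) - G t (u t))"
        using norm_triangle_ineq[of "G s (u s) - G s (u t)" "G s (u t) - G t (u t)"] by simp
      also have "norm (G s (u s) - G s (u t)) \<le> K * norm (u s - u t)"
        using that t T u(2) by (intro G_lipschitz) auto
      finally show ?thesis by simp
    qed
    then show "\<forall>\<^sub>F s in at t within T. norm (G s (u s) - G t (u t)) \<le> K * norm (u s - u t) + norm (G s (u t) - G t (u t))"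
      by (auto simp: eventually_at_filter)
  qed
  then show "((\<lambda>t. G t (u t)) \<longlongrightarrow> G t (u t)) (at t within T)" by (rule LIM_zero_cancel)
qed

lemma unique:
  assumes u: "continuous_on {0..} u" "\<And>t. 0 \<le> t \<Longrightarrow> u t \<in> S" "\<And>t. 0 \<le> t \<Longrightarrow> u t = u0 + integral {0..t} (\<lambda>s. G s (u s))"
    and v: "continuous_on {0..} v" "\<And>t. 0 \<le> t \<Longrightarrow> v t \<in> S" "\<And>t. 0 \<le> t \<Longrightarrow> v t = u0 + integral {0..t} (\<lambda>s. G s (v s))"
    and T: "0 \<le> T"
  shows "u T = v T"
proof -
  define M where "M = 2 * K + 1"
  have M: "0 < M" "K < M" using K by (auto simp: M_def)
  have sub: "{0..t} \<subseteq> {0..}" for t :: real by auto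
  note uc = continuous_on_subset[OF u(1) sub] and vc = continuous_on_subset[OF v(1) sub]
  let ?w = "\<lambda>t. exp (- (M * t)) * norm (u t - v t)"
  have "continuous_on {0..T} ?w" by (intro continuous_intros uc vc)
  then obtain t0 where t0: "t0 \<in> {0..T}" "\<And>t. t \<in> {0..T} \<Longrightarrow> ?w t \<le> ?w t0"
    using continuous_attains_sup[of "{0..T}" ?w] T by auto
  have le: "norm (u s - v s) \<le> ?w t0 * exp (M * s)" if "s \<in> {0..T}" for s
  proof -
    have "norm (u s - v s) = exp (M * s) * ?w s" by (simp add: exp_minus)
    also have "\<dots> \<le> exp (M * s) * ?w t0" by (rule mult_left_mono[OF t0(2)[OF that]]) simp
    finally show ?thesis by (simp only: mult.commute)
  qed
  have sub2: "{0..t0} \<subseteq> {0..T}" using t0 by auto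
  have iu: "continuous_on {0..t0} (\<lambda>s. G s (u s))" "continuous_on {0..t0} (\<lambda>s. G s (v s))"
    using u(2) v(2) by (auto intro!: G_compose_continuous uc vc)
  have "u t0 - v t0 = integral {0..t0} (\<lambda>s. G s (u s) - G s (v s))"
    using u(3)[of t0] v(3)[of t0] t0(1) iu by (simp add: Henstock_Kurzweil_Integration.integral_diff integrable_continuous_real)
  moreover have "norm (integral {0..t0} (\<lambda>s. G s (u s) - G s (v s))) \<le> (K * ?w t0) / M * exp (M * t0)"
  proof (rule norm_integral_exp_le)
    fix s assume s: "s \<in> {0..t0}"
    then have "norm (G s (u s) - G s (v s)) \<le> K * norm (u s - v s)" using u(2) v(2) by (intro G_lipschitz) auto
    also have "\<dots> \<le> K * (?w t0 * exp (M * s))" using s sub2 by (intro mult_left_mono le K) auto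
    finally show "norm (G s (u s) - G s (v s)) \<le> K * ?w t0 * exp (M * s)" by simp
  qed (use t0 M K iu in \<open>auto intro!: continuous_intros\<close>)
  ultimately have "norm (u t0 - v t0) \<le> (K * ?w t0) / M * exp (M * t0)" by simp
  then have "?w t0 \<le> (K * ?w t0) / M"
  proof -
    have "norm (u t0 - v t0) = ?w t0 * exp (M * t0)" by (simp add: exp_minus)
    with \<open>norm (u t0 - v t0) \<le> (K * ?w t0) / M * exp (M * t0)\<close>
    have "?w t0 * exp (M * t0) \<le> (K * ?w t0) / M * exp (M * t0)" by (simp only:)
    then show ?thesis by (rule mult_right_le_imp_le) simp
  qed
  then have "M * ?w t0 \<le> K * ?w t0" using M by (simp add: field_simps)
  then have "(M - K) * ?w t0 \<le> 0" by (simp add: left_diff_distrib)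
  then have "?w t0 \<le> 0" using M by (simp add: mult_le_0_iff)
  then have "norm (u T - v T) \<le> 0" using le[of T] T by (auto simp: mult_le_0_iff intro: order_trans)
  then show ?thesis by simp
qed

lemma ex_solution:
  assumes u0: "u0 \<in> S"
  shows "\<exists>u. continuous_on {0..} u \<and> (\<forall>t\<ge>0. u t \<in> S \<and> u t = u0 + integral {0..t} (\<lambda>s. G s (u s)))"
proof -
  define M where "M = 2 * K + 1"
  have M: "0 < M" "2 * K \<le> M" using K by (auto simp: M_def)
  define C :: "(real \<Rightarrow>\<^sub>C 'a) set" where "C = {v. \<forall>t. apply_bcontfun v t \<in> S}"
  define J where "J v t = exp (- (M * t)) *\<^sub>R (u0 + integral {0..t} (\<lambda>s. G s (exp (M * s) *\<^sub>R apply_bcontfun v s)))" for v t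
  have vS: "exp (M * s) *\<^sub>R apply_bcontfun v s \<in> S" if "v \<in> C" for v s
    using that S(1) by (auto simp: C_def subspace_scale)
  have vc: "continuous_on T (\<lambda>s. exp (M * s) *\<^sub>R apply_bcontfun v s)" for v :: "real \<Rightarrow>\<^sub>C 'a" and T
    by (rule continuous_on_scaleR) (auto intro!: continuous_intros)
  have Gc: "continuous_on {0..t} (\<lambda>s. G s (exp (M * s) *\<^sub>R apply_bcontfun v s))" if "v \<in> C" for v t
    by (intro G_compose_continuous vc vS that) auto
  have J_mem: "J v t \<in> S" if "v \<in> C" for v t
    unfolding J_def using S u0 that
    by (intro subspace_scale subspace_add integral_mem_closed_subspace G_mem vS) auto
  have J_cont: "continuous_on {0..} (J v)" if "v \<in> C" for v
  proof -
    have "continuous_on {0..} (\<lambda>t. integral {0..t} (\<lambda>s. G s (exp (M * s) *\<^sub>R apply_bcontfun v s)))"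
      unfolding continuous_on_eq_continuous_within
    proof
      fix t :: real assume t: "t \<in> {0..}"
      have "continuous_on {0..t + 1} (\<lambda>t. integral {0..t} (\<lambda>s. G s (exp (M * s) *\<^sub>R apply_bcontfun v s)))"
        by (intro indefinite_integral_continuous_1 integrable_continuous_real Gc that)
      then have "continuous (at t within {0..t + 1}) (\<lambda>t. integral {0..t} (\<lambda>s. G s (exp (M * s) *\<^sub>R apply_bcontfun v s)))"
        using t by (auto simp: continuous_on_eq_continuous_within)
      moreover have "at t within {0..} = at t within {0..t + 1}"
        using t by (intro at_within_nhd[of t "{..<t+1}"]) auto
      ultimately show "continuous (at t within {0..}) (\<lambda>t. integral {0..t} (\<lambda>s. G s (exp (M * s) *\<^sub>R apply_bcontfun v s)))"
        by simp
    qed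
    then show ?thesis unfolding J_def[abs_def] by (intro continuous_intros)
  qed
  have J_bd: "norm (J v t) \<le> norm u0 + K * (1 + norm v)" if "v \<in> C" "0 \<le> t" for v t
  proof -
    have "norm (integral {0..t} (\<lambda>s. G s (exp (M * s) *\<^sub>R apply_bcontfun v s))) \<le> (K * (1 + norm v)) / M * exp (M * t)"
    proof (rule norm_integral_exp_le[OF Gc[OF that(1)] that(2) M(1)])
      fix s assume s: "s \<in> {0..t}"
      have "norm (G s (exp (M * s) *\<^sub>R apply_bcontfun v s)) \<le> K * (1 + norm (exp (M * s) *\<^sub>R apply_bcontfun v s))"
        using s by (intro G_growth vS that) auto
      also have "\<dots> \<le> K * (exp (M * s) + exp (M * s) * norm v)"
        using s M K norm_bounded[of v s] by (intro mult_left_mono add_mono) auto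
      finally show "norm (G s (exp (M * s) *\<^sub>R apply_bcontfun v s)) \<le> K * (1 + norm v) * exp (M * s)"
        by (simp add: algebra_simps)
    qed (use K in simp)
    also have "(K * (1 + norm v)) / M \<le> K * (1 + norm v)"
    proof -
      have "K * (1 + norm v) * 1 \<le> K * (1 + norm v) * M" using K by (intro mult_left_mono) (auto simp: M_def)
      then show ?thesis using M by (simp only: pos_divide_le_eq mult_1_right)
    qed
    finally have "norm (integral {0..t} (\<lambda>s. G s (exp (M * s) *\<^sub>R apply_bcontfun v s))) \<le> K * (1 + norm v) * exp (M * t)"
      by simp
    then have "exp (- (M * t)) * norm (integral {0..t} (\<lambda>s. G s (exp (M * s) *\<^sub>R apply_bcontfun v s))) \<le> K * (1 + norm v)"
      by (simp add: exp_minus field_simps)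
    moreover have "exp (- (M * t)) * norm u0 \<le> 1 * norm u0" using that M by (intro mult_right_mono) auto
    moreover have "norm (J v t) \<le> exp (- (M * t)) * (norm u0 + norm (integral {0..t} (\<lambda>s. G s (exp (M * s) *\<^sub>R apply_bcontfun v s))))"
      unfolding J_def norm_scaleR by (intro mult_mono norm_triangle_ineq) auto
    ultimately show ?thesis by (simp add: distrib_left)
  qed
  define F where "F v = Bcontfun (\<lambda>t. J v (max 0 t))" for v
  have F: "apply_bcontfun (F v) t = J v (max 0 t)" if "v \<in> C" for v t
  proof -
    have "(\<lambda>t. J v (max 0 t)) \<in> bcontfun"
    proof (rule bcontfun_normI)
      show "continuous_on UNIV (\<lambda>t. J v (max 0 t))"
        by (rule continuous_on_compose2[OF J_cont[OF that]]) (auto intro!: continuous_intros)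
      show "norm (J v (max 0 t)) \<le> norm u0 + K * (1 + norm v)" for t by (rule J_bd[OF that]) simp
    qed
    then show ?thesis by (simp add: F_def Bcontfun_inverse)
  qed
  have F_mem: "F v \<in> C" if "v \<in> C" for v using that by (simp add: C_def[of] F J_mem)
  have F_contr: "dist (F v) (F w) \<le> 1/2 * dist v w" if vw: "v \<in> C" "w \<in> C" for v w
  proof (rule dist_bound)
    fix t :: real
    let ?t = "max 0 t"
    let ?g = "\<lambda>v s. G s (exp (M * s) *\<^sub>R apply_bcontfun v s)"
    have "J v ?t - J w ?t = exp (- (M * ?t)) *\<^sub>R integral {0..?t} (\<lambda>s. ?g v s - ?g w s)"
      unfolding J_def using Gc[OF vw(1), of ?t] Gc[OF vw(2), of ?t]
      by (simp add: Henstock_Kurzweil_Integration.integral_diff integrable_continuous_real algebra_simps)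
    moreover have "norm (integral {0..?t} (\<lambda>s. ?g v s - ?g w s)) \<le> (K * dist v w) / M * exp (M * ?t)"
    proof (rule norm_integral_exp_le)
      fix s assume s: "s \<in> {0..?t}"
      then have "norm (?g v s - ?g w s) \<le> K * norm (exp (M * s) *\<^sub>R apply_bcontfun v s - exp (M * s) *\<^sub>R apply_bcontfun w s)"
        by (intro G_lipschitz vS vw) auto
      also have "\<dots> = K * (exp (M * s) * dist (apply_bcontfun v s) (apply_bcontfun w s))"
        by (simp add: scaleR_diff_right[symmetric] dist_norm)
      also have "\<dots> \<le> K * (exp (M * s) * dist v w)" by (intro mult_left_mono K dist_fun_lt_imp_dist_val_lt dist_bounded) auto
      finally show "norm (?g v s - ?g w s) \<le> K * dist v w * exp (M * s)" by (simp add: mult_ac)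
    qed (use M K Gc vw in \<open>auto intro!: continuous_intros\<close>)
    ultimately have "norm (J v ?t - J w ?t) \<le> (K * dist v w) / M"
      by (simp add: exp_minus field_simps)
    also have "\<dots> \<le> 1/2 * dist v w"
    proof -
      have "(2 * K) * dist v w \<le> M * dist v w" using M by (intro mult_right_mono) auto
      then show ?thesis using M by (simp add: field_simps)
    qed
    finally show "dist (apply_bcontfun (F v) t) (apply_bcontfun (F w) t) \<le> 1/2 * dist v w"
      by (simp add: F vw dist_norm)
  qed
  have "closed C"
  proof -
    have "C = (\<Inter>t. (\<lambda>v. apply_bcontfun v t) -` S)" by (auto simp: C_def)
    moreover have "closed ((\<lambda>v::real \<Rightarrow>\<^sub>C 'a. apply_bcontfun v t) -` S)" for t
      by (intro closed_vimage S lipschitz_on_continuous_on[of 1] lipschitz_onI) (auto simp: dist_bounded)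
    ultimately show ?thesis by auto
  qed
  note complete = this[folded complete_eq_closed]
  have "0 \<in> C" using subspace_0[OF S(1)] by (simp add: C_def)
  then have "\<exists>!v. v \<in> C \<and> F v = v"
    by (intro Banach_fix[OF complete, of "1/2" F]) (use F_mem F_contr in auto)
  then obtain v where v: "v \<in> C" "F v = v" by blast
  define u where "u t = exp (M * t) *\<^sub>R apply_bcontfun v t" for t
  have "continuous_on {0..} u" using vc unfolding u_def .
  moreover have "u t \<in> S" for t using vS[OF v(1)] unfolding u_def .
  moreover have "u t = u0 + integral {0..t} (\<lambda>s. G s (u s))" if "0 \<le> t" for t
    using F[OF v(1), of t] v(2) that by (simp add: u_def J_def max_def exp_minus)
  ultimately show ?thesis by blast
qed

end

section \<open>The Banach space of stochastic distributions\<close>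

lemma tensor_pair_diff: "tensor_pair F (tensor_diff t s) = tensor_pair F t - tensor_pair F s"
proof -
  have "tensor_pair F (map (\<lambda>(c, \<phi>s). (- c, \<phi>s)) s) = - tensor_pair F s"
    unfolding tensor_pair_def by (induction s) auto
  then show ?thesis by (simp add: tensor_pair_def tensor_diff_def)
qed

lemma tensor_diff_mem: "t \<in> tensors n \<Longrightarrow> s \<in> tensors n \<Longrightarrow> tensor_diff t s \<in> tensors n"
  by (fastforce simp: tensors_def tensor_diff_def)

lemma tensor_norm_diff_self: "tensor_norm \<nu> p (tensor_diff t t) = 0"
proof -
  have "(\<Sum>(d, \<psi>s)\<leftarrow>map (\<lambda>(c, \<phi>s). (- c, \<phi>s)) s. c * d * k \<psi>s) = - (\<Sum>(d, \<psi>s)\<leftarrow>s. c * d * k \<psi>s)"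
    for s :: tensor and c and k :: "pfun list \<Rightarrow> real"
    by (induction s) auto
  then have "(\<Sum>(d, \<psi>s)\<leftarrow>tensor_diff t t. c * d * k \<psi>s) = 0" for c and k :: "pfun list \<Rightarrow> real"
    by (simp add: tensor_diff_def)
  then show ?thesis unfolding tensor_norm_def by (simp add: case_prod_unfold)
qed

lemma spolys_diff:
  assumes "P \<in> spolys" "Q \<in> spolys"
  shows "(\<lambda>n. tensor_diff (P n) (Q n)) \<in> spolys"
proof -
  have "{n. tensor_diff (P n) (Q n) \<noteq> []} \<subseteq> {n. P n \<noteq> []} \<union> {n. Q n \<noteq> []}"
    by (auto simp: tensor_diff_def)
  then show ?thesis
    using assms by (auto simp: spolys_def tensor_diff_mem intro: finite_subset)
qed

lemma spoly_pair_tensor_diff: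
  assumes P: "P \<in> spolys" and Q: "Q \<in> spolys"
  shows "spoly_pair F (\<lambda>n. tensor_diff (P n) (Q n)) = spoly_pair F P - spoly_pair F Q"
proof -
  let ?S = "{n. P n \<noteq> []} \<union> {n. Q n \<noteq> []}"
  have fin: "finite ?S" using spolysD(1)[OF P] spolysD(1)[OF Q] by simp
  have sub: "{n. tensor_diff (P n) (Q n) \<noteq> []} \<subseteq> ?S" by (auto simp: tensor_diff_def)
  show ?thesis
    unfolding spoly_pair_eq[OF fin sub] spoly_pair_eq[OF fin Un_upper1] spoly_pair_eq[OF fin Un_upper2]
    by (simp add: tensor_pair_diff sum_subtractf right_diff_distrib)
qed

lemma const_test_funs:
  assumes "P \<in> spolys"
  shows "(\<lambda>k. P) \<in> test_funs \<nu> q0"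
  unfolding test_funs_def using assms
  by (auto simp: spoly_norm_def tensor_norm_diff_self)

lemma test_pair_const: "test_pair F (\<lambda>k. P) = spoly_pair F P"
  by (simp add: test_pair_def)

lemma test_pair_zero: "test_pair 0 f = 0"
proof -
  have "tensor_pair 0 t = 0" for t unfolding tensor_pair_def by (induction t) auto
  then show ?thesis by (simp add: test_pair_def spoly_pair_def)
qed

lemma sym_form_closed:
  assumes F: "\<And>k. F k \<in> sym_form n" and lim: "\<And>\<phi>s. (\<lambda>k. F k \<phi>s) \<longlonglongrightarrow> G \<phi>s"
  shows "G \<in> sym_form n"
proof (rule sym_formI)
  show "G \<phi>s = 0" if "\<phi>s \<notin> lists_of SU n" for \<phi>s
    using lim[of \<phi>s] sym_formD(1)[OF F that] by (simp add: LIMSEQ_const_iff)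
  show "G \<phi>s = G \<psi>s" if "mset \<phi>s = mset \<psi>s" for \<phi>s \<psi>s
  proof (rule LIMSEQ_unique[OF lim])
    show "(\<lambda>k. F k \<phi>s) \<longlonglongrightarrow> G \<psi>s" using lim[of \<psi>s] by (simp add: sym_formD(2)[OF F that])
  qed
  fix m \<phi>s \<phi> \<psi> and a b :: real
  assume m: "Suc m = n" "\<phi>s \<in> lists_of SU m" "\<phi> \<in> SU" "\<psi> \<in> SU"
  show "G ((\<lambda>z. a * \<phi> z + b * \<psi> z) # \<phi>s) = a * G (\<phi> # \<phi>s) + b * G (\<psi> # \<phi>s)"
  proof (rule LIMSEQ_unique[OF lim])
    show "(\<lambda>k. F k ((\<lambda>z. a * \<phi> z + b * \<psi> z) # \<phi>s)) \<longlonglongrightarrow> a * G (\<phi> # \<phi>s) + b * G (\<psi> # \<phi>s)"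
      unfolding sym_formD(3)[OF F m] by (intro tendsto_intros lim)
  qed
qed

lemma tendsto_spoly_pair:
  assumes "\<And>n \<phi>s. (\<lambda>k. F k n \<phi>s) \<longlonglongrightarrow> G n \<phi>s"
  shows "(\<lambda>k. spoly_pair (F k) P) \<longlonglongrightarrow> spoly_pair G P"
  unfolding spoly_pair_def tensor_pair_def sum_list_case_prod_nth
  by (intro tendsto_intros assms)

lemma spoly_pair_monomial:
  "spoly_pair F (\<lambda>m. if m = n then [(1, \<phi>s)] else []) = fact n * F n \<phi>s"
  by (simp add: spoly_pair_single tensor_pair_def)

lemma monomial_mem: "\<phi>s \<in> lists_of SU n \<Longrightarrow> (\<lambda>m. if m = n then [(1, \<phi>s)] else []) \<in> spolys"
  by (rule spoly_single_mem) (simp add: tensors_def lists_of_def)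

lemma sdist_eqI:
  assumes F: "\<And>n. F n \<in> sym_form n" and G: "\<And>n. G n \<in> sym_form n"
    and eq: "\<And>P. P \<in> spolys \<Longrightarrow> spoly_pair F P = spoly_pair G P"
  shows "F = G"
proof (intro ext)
  fix n \<phi>s
  show "F n \<phi>s = G n \<phi>s"
  proof (cases "\<phi>s \<in> lists_of SU n")
    case True
    then show ?thesis using eq[OF monomial_mem[OF True]] by (simp add: spoly_pair_monomial)
  qed (simp add: sym_formD(1)[OF F] sym_formD(1)[OF G])
qed

instance bcontfun :: (metric_space, banach) banach ..

lemma bounded_linear_apply_bcontfun: "bounded_linear (\<lambda>x. apply_bcontfun x d)"
  by (rule bounded_linear_intro[where K=1]) (auto simp: norm_bounded)

lemma continuous_apply_bcontfun:
  fixes h :: "_ \<Rightarrow> 'a::topological_space \<Rightarrow>\<^sub>C 'b::real_normed_vector"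
  shows "continuous_on T h \<Longrightarrow> continuous_on T (\<lambda>s. apply_bcontfun (h s) d)"
  by (rule bounded_linear.continuous_on[OF bounded_linear_apply_bcontfun])

lemma integral_apply_bcontfun:
  fixes h :: "real \<Rightarrow> 'a::metric_space \<Rightarrow>\<^sub>C 'b::banach"
  assumes "continuous_on {0..t} h"
  shows "apply_bcontfun (integral {0..t} h) d = integral {0..t} (\<lambda>s. apply_bcontfun (h s) d)"
  using integral_linear[OF integrable_continuous_real[OF assms] bounded_linear_apply_bcontfun[of d]]
  by (simp add: o_def)

text \<open>Stochastic distributions of order \<open>-p\<close> form a Banach space, but not one that is a type.
  It is embedded isometrically in the bounded functions on the polynomials, restricted to the
  unit ball of \<^const>\<open>spoly_norm\<close>; the discrete topology makes all of them continuous.\<close>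

definition sdist_emb :: "real measure \<Rightarrow> nat \<Rightarrow> sdist \<Rightarrow> (spoly discrete \<Rightarrow>\<^sub>C real)" where
  "sdist_emb \<nu> p F = Bcontfun (\<lambda>d. if of_discrete d \<in> spolys \<and> spoly_norm \<nu> p (of_discrete d) \<le> 1
     then spoly_pair F (of_discrete d) else 0)"

context levy_noise begin

lemma apply_sdist_emb:
  assumes F: "F \<in> Sminus \<nu> p"
  shows "apply_bcontfun (sdist_emb \<nu> p F) d =
    (if of_discrete d \<in> spolys \<and> spoly_norm \<nu> p (of_discrete d) \<le> 1 then spoly_pair F (of_discrete d) else 0)"
proof -
  have "(\<lambda>d. if of_discrete d \<in> spolys \<and> spoly_norm \<nu> p (of_discrete d) \<le> 1
     then spoly_pair F (of_discrete d) else 0) \<in> bcontfun" (is "?f \<in> _")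
  proof (rule bcontfun_normI)
    show "continuous_on UNIV ?f" by (auto simp: continuous_on_open_vimage open_discrete)
    show "norm (?f d) \<le> Snorm \<nu> p F" for d
    proof (cases "of_discrete d \<in> spolys \<and> spoly_norm \<nu> p (of_discrete d) \<le> 1")
      case True
      then have "\<bar>spoly_pair F (of_discrete d)\<bar> \<le> Snorm \<nu> p F * spoly_norm \<nu> p (of_discrete d)"
        by (intro spoly_pair_le F) auto
      also have "\<dots> \<le> Snorm \<nu> p F * 1" using True Snorm_nonneg[OF F] by (intro mult_left_mono) auto
      finally show ?thesis using True by simp
    qed (auto simp: Snorm_nonneg[OF F])
  qed
  then show ?thesis by (simp add: sdist_emb_def Bcontfun_inverse)
qed

lemma sdist_emb_lin:
  assumes F: "F \<in> Sminus \<nu> p" and G: "G \<in> Sminus \<nu> p"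
  shows "sdist_emb \<nu> p (\<lambda>n \<phi>s. a * F n \<phi>s + b * G n \<phi>s) = a *\<^sub>R sdist_emb \<nu> p F + b *\<^sub>R sdist_emb \<nu> p G"
  by (rule bcontfun_eqI) (simp add: apply_sdist_emb F G Sminus_lin(1) spoly_pair_lin)

lemma sdist_emb_diff:
  assumes F: "F \<in> Sminus \<nu> p" and G: "G \<in> Sminus \<nu> p"
  shows "sdist_emb \<nu> p (F - G) = sdist_emb \<nu> p F - sdist_emb \<nu> p G"
  by (rule bcontfun_eqI) (simp add: apply_sdist_emb F G Sminus_diff spoly_pair_diff)

lemma sdist_emb_add:
  assumes F: "F \<in> Sminus \<nu> p" and G: "G \<in> Sminus \<nu> p"
  shows "sdist_emb \<nu> p (F + G) = sdist_emb \<nu> p F + sdist_emb \<nu> p G"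
  by (rule bcontfun_eqI) (simp add: apply_sdist_emb F G Sminus_add spoly_pair_add)

lemma sdist_emb_zero: "sdist_emb \<nu> p 0 = 0"
  using sdist_emb_diff[OF Sminus_zero Sminus_zero] by simp

lemma spoly_pair_sdist_emb:
  assumes P: "P \<in> spolys"
  obtains c d where "\<And>F. F \<in> Sminus \<nu> p \<Longrightarrow> spoly_pair F P = c * apply_bcontfun (sdist_emb \<nu> p F) d"
    "\<bar>c\<bar> = spoly_norm \<nu> p P"
proof
  let ?c = "spoly_norm \<nu> p P"
  let ?Q = "\<lambda>n. tensor_scale (1 / ?c) (P n)"
  have Q: "?Q \<in> spolys" using P by (simp add: spolys_def)
  have pQ: "spoly_pair F ?Q = spoly_pair F P / ?c" for F
    by (simp add: spoly_pair_def sum_divide_distrib)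
  have nQ: "spoly_norm \<nu> p ?Q = ?c / ?c"
  proof -
    have "spoly_norm \<nu> p ?Q = sqrt ((1 / ?c)\<^sup>2 * (\<Sum>n | P n \<noteq> []. (fact n)\<^sup>2 * (tensor_norm \<nu> p (P n))\<^sup>2))"
      by (simp add: spoly_norm_def[of \<nu> p ?Q] sum_distrib_left power_mult_distrib power_divide mult_ac)
    also have "\<dots> = \<bar>1 / ?c\<bar> * ?c" by (simp only: real_sqrt_mult real_sqrt_abs spoly_norm_def[of \<nu> p P])
    finally show ?thesis using spoly_norm_nonneg[of \<nu> p P] by simp
  qed
  show "spoly_pair F P = ?c * apply_bcontfun (sdist_emb \<nu> p F) (discrete ?Q)" if F: "F \<in> Sminus \<nu> p" for F
  proof (cases "?c = 0")
    case True
    then show ?thesis using spoly_pair_le[OF F P] by simp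
  next
    case False
    then show ?thesis using Q pQ nQ by (simp add: apply_sdist_emb[OF F] discrete_inverse)
  qed
  show "\<bar>?c\<bar> = ?c" using spoly_norm_nonneg[of \<nu> p P] by simp
qed

lemma spoly_pair_le_norm_emb:
  assumes "F \<in> Sminus \<nu> p" "P \<in> spolys"
  shows "\<bar>spoly_pair F P\<bar> \<le> norm (sdist_emb \<nu> p F) * spoly_norm \<nu> p P"
proof -
  obtain c d where "spoly_pair F P = c * apply_bcontfun (sdist_emb \<nu> p F) d" "\<bar>c\<bar> = spoly_norm \<nu> p P"
    using spoly_pair_sdist_emb[OF assms(2), of p] assms(1) by metis
  then show ?thesis using norm_bounded[of "sdist_emb \<nu> p F" d] spoly_norm_nonneg[of \<nu> p P]
    by (simp add: abs_mult mult.commute mult_left_mono)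
qed

lemma norm_sdist_emb:
  assumes F: "F \<in> Sminus \<nu> p"
  shows "norm (sdist_emb \<nu> p F) = Snorm \<nu> p F"
proof (rule antisym)
  show "norm (sdist_emb \<nu> p F) \<le> Snorm \<nu> p F"
  proof (rule norm_bound)
    fix d
    show "norm (apply_bcontfun (sdist_emb \<nu> p F) d) \<le> Snorm \<nu> p F"
    proof (cases "of_discrete d \<in> spolys \<and> spoly_norm \<nu> p (of_discrete d) \<le> 1")
      case True
      then have "\<bar>spoly_pair F (of_discrete d)\<bar> \<le> Snorm \<nu> p F * spoly_norm \<nu> p (of_discrete d)"
        by (intro spoly_pair_le F) auto
      also have "\<dots> \<le> Snorm \<nu> p F * 1" using True Snorm_nonneg[OF F] by (intro mult_left_mono) auto
      finally show ?thesis using True by (simp add: apply_sdist_emb[OF F])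
    qed (auto simp: apply_sdist_emb[OF F] Snorm_nonneg[OF F])
  qed
  show "Snorm \<nu> p F \<le> norm (sdist_emb \<nu> p F)"
    by (rule SminusI(2)[OF Sminus_sym_form[OF F] _ spoly_pair_le_norm_emb[OF F]]) auto
qed

lemma inj_sdist_emb: "inj_on (sdist_emb \<nu> p) (Sminus \<nu> p)"
proof (rule inj_onI)
  fix F G assume F: "F \<in> Sminus \<nu> p" and G: "G \<in> Sminus \<nu> p" and eq: "sdist_emb \<nu> p F = sdist_emb \<nu> p G"
  have "\<bar>spoly_pair (F - G) P\<bar> \<le> norm (sdist_emb \<nu> p (F - G)) * spoly_norm \<nu> p P" if "P \<in> spolys" for P
    by (intro spoly_pair_le_norm_emb Sminus_diff F G that)
  then show "F = G"
    by (intro sdist_eqI Sminus_sym_form[OF F] Sminus_sym_form[OF G])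
      (simp add: sdist_emb_diff[OF F G] eq spoly_pair_diff)
qed

lemma subspace_sdist_emb: "subspace (sdist_emb \<nu> p ` Sminus \<nu> p)"
proof (rule subspaceI)
  show "0 \<in> sdist_emb \<nu> p ` Sminus \<nu> p" using sdist_emb_zero Sminus_zero by (metis imageI)
  show "x + y \<in> sdist_emb \<nu> p ` Sminus \<nu> p" if "x \<in> sdist_emb \<nu> p ` Sminus \<nu> p" "y \<in> sdist_emb \<nu> p ` Sminus \<nu> p" for x y
    using that by (auto simp: sdist_emb_add[symmetric] intro: Sminus_add)
  show "c *\<^sub>R x \<in> sdist_emb \<nu> p ` Sminus \<nu> p" if x: "x \<in> sdist_emb \<nu> p ` Sminus \<nu> p" for c x
  proof -
    obtain F where F: "F \<in> Sminus \<nu> p" "x = sdist_emb \<nu> p F" using x by blast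
    have "c *\<^sub>R x = sdist_emb \<nu> p (\<lambda>n \<phi>s. c * F n \<phi>s + 0 * F n \<phi>s)"
      unfolding sdist_emb_lin[OF F(1) F(1)] F(2) by simp
    then show ?thesis using Sminus_lin(1)[OF F(1) F(1)] by (rule image_eqI)
  qed
qed

lemma closed_sdist_emb: "closed (sdist_emb \<nu> p ` Sminus \<nu> p)"
  unfolding closed_sequential_limits
proof (intro allI impI, elim conjE)
  fix x y assume x: "\<forall>k. x k \<in> sdist_emb \<nu> p ` Sminus \<nu> p" and lim: "x \<longlonglongrightarrow> y"
  define F where "F k = inv_into (Sminus \<nu> p) (sdist_emb \<nu> p) (x k)" for k
  have F: "F k \<in> Sminus \<nu> p" "x k = sdist_emb \<nu> p (F k)" for k
    using x by (simp_all add: F_def inv_into_into f_inv_into_f)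
  have limd: "(\<lambda>k. apply_bcontfun (sdist_emb \<nu> p (F k)) d) \<longlonglongrightarrow> apply_bcontfun y d" for d
    using bounded_linear.tendsto[OF bounded_linear_apply_bcontfun lim] by (simp add: F)
  have limP: "convergent (\<lambda>k. spoly_pair (F k) P)" if P: "P \<in> spolys" for P
  proof -
    obtain c d where cd: "\<And>F. F \<in> Sminus \<nu> p \<Longrightarrow> spoly_pair F P = c * apply_bcontfun (sdist_emb \<nu> p F) d"
      using spoly_pair_sdist_emb[OF P, of p] by metis
    show ?thesis unfolding cd[OF F(1)] convergent_def using tendsto_mult_left[OF limd] by blast
  qed
  define G where "G n \<phi>s = lim (\<lambda>k. F k n \<phi>s)" for n \<phi>s
  have G: "(\<lambda>k. F k n \<phi>s) \<longlonglongrightarrow> G n \<phi>s" for n \<phi>s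
  proof -
    have "convergent (\<lambda>k. F k n \<phi>s)"
    proof (cases "\<phi>s \<in> lists_of SU n")
      case True
      have "convergent (\<lambda>k. fact n * F k n \<phi>s)"
        using limP[OF monomial_mem[OF True]] by (simp add: spoly_pair_monomial)
      then show ?thesis by (subst (asm) convergent_mult_const_iff) auto
    next
      case False
      then show ?thesis by (simp add: sym_formD(1)[OF Sminus_sym_form[OF F(1)]] convergent_const)
    qed
    then show ?thesis unfolding G_def by (simp add: convergent_LIMSEQ_iff)
  qed
  note pair = tendsto_spoly_pair[OF G]
  have "G \<in> Sminus \<nu> p"
  proof (rule SminusI(1))
    show "G n \<in> sym_form n" for n by (rule sym_form_closed[OF Sminus_sym_form[OF F(1)] G])
    show "\<bar>spoly_pair G P\<bar> \<le> norm y * spoly_norm \<nu> p P" if P: "P \<in> spolys" for P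
    proof (rule LIMSEQ_le[OF tendsto_rabs[OF pair]])
      show "(\<lambda>k. norm (x k) * spoly_norm \<nu> p P) \<longlonglongrightarrow> norm y * spoly_norm \<nu> p P"
        by (intro tendsto_intros lim)
      show "\<exists>N. \<forall>n\<ge>N. \<bar>spoly_pair (F n) P\<bar> \<le> norm (x n) * spoly_norm \<nu> p P"
        using spoly_pair_le_norm_emb[OF F(1) P] F(2) by auto
    qed
  qed auto
  moreover have "sdist_emb \<nu> p G = y"
  proof (rule bcontfun_eqI)
    fix d
    show "apply_bcontfun (sdist_emb \<nu> p G) d = apply_bcontfun y d"
    proof (rule LIMSEQ_unique[OF _ limd])
      show "(\<lambda>k. apply_bcontfun (sdist_emb \<nu> p (F k)) d) \<longlonglongrightarrow> apply_bcontfun (sdist_emb \<nu> p G) d"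
        unfolding apply_sdist_emb[OF F(1)] apply_sdist_emb[OF \<open>G \<in> Sminus \<nu> p\<close>] using pair by auto
    qed
  qed
  ultimately show "y \<in> sdist_emb \<nu> p ` Sminus \<nu> p" by blast
qed


section \<open>Weak integrals and the equation\<close>

lemma sdist_emb_integral:
  fixes t :: real
  assumes H: "\<And>s. s \<in> {0..t} \<Longrightarrow> H s \<in> Sminus \<nu> p"
    and c: "continuous_on {0..t} (\<lambda>s. sdist_emb \<nu> p (H s))"
    and P: "P \<in> spolys"
  shows "continuous_on {0..t} (\<lambda>s. spoly_pair (H s) P)"
    and "I \<in> Sminus \<nu> p \<Longrightarrow> sdist_emb \<nu> p I = integral {0..t} (\<lambda>s. sdist_emb \<nu> p (H s)) \<Longrightarrow>
      spoly_pair I P = integral {0..t} (\<lambda>s. spoly_pair (H s) P)"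
proof -
  obtain a d where ad: "\<And>F. F \<in> Sminus \<nu> p \<Longrightarrow> spoly_pair F P = a * apply_bcontfun (sdist_emb \<nu> p F) d"
    using spoly_pair_sdist_emb[OF P, of p] by metis
  have "continuous_on {0..t} (\<lambda>s. a * apply_bcontfun (sdist_emb \<nu> p (H s)) d)"
    by (intro continuous_intros continuous_apply_bcontfun c)
  then show "continuous_on {0..t} (\<lambda>s. spoly_pair (H s) P)"
    by (subst continuous_on_cong[OF refl ad[OF H]])
  assume I: "I \<in> Sminus \<nu> p" "sdist_emb \<nu> p I = integral {0..t} (\<lambda>s. sdist_emb \<nu> p (H s))"
  have "spoly_pair I P = a * integral {0..t} (\<lambda>s. apply_bcontfun (sdist_emb \<nu> p (H s)) d)"
    by (simp add: ad[OF I(1)] I(2) integral_apply_bcontfun[OF c])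
  also have "\<dots> = integral {0..t} (\<lambda>s. a * apply_bcontfun (sdist_emb \<nu> p (H s)) d)"
    by simp
  also have "\<dots> = integral {0..t} (\<lambda>s. spoly_pair (H s) P)"
    by (rule Henstock_Kurzweil_Integration.integral_cong) (simp add: ad[OF H])
  finally show "spoly_pair I P = integral {0..t} (\<lambda>s. spoly_pair (H s) P)" .
qed

lemma uniform_limit_test_pair:
  assumes H: "\<And>s. s \<in> T \<Longrightarrow> H s \<in> Sminus \<nu> p" and B: "\<And>s. s \<in> T \<Longrightarrow> Snorm \<nu> p (H s) \<le> B"
    and p: "q0 \<le> p" and f: "f \<in> test_funs \<nu> q0"
  shows "uniform_limit T (\<lambda>k s. spoly_pair (H s) (f k)) (\<lambda>s. test_pair (H s) f) sequentially"
proof -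
  have fs: "f k \<in> spolys" for k using f by (simp add: test_funs_def)
  have "uniformly_Cauchy_on T (\<lambda>k s. spoly_pair (H s) (f k))"
    unfolding uniformly_Cauchy_on_def
  proof (intro allI impI)
    fix e :: real assume e: "0 < e"
    have B1: "0 < \<bar>B\<bar> + 1" by simp
    then have "0 < e / (\<bar>B\<bar> + 1)" using e by simp
    then obtain N where N: "\<And>j k. j \<ge> N \<Longrightarrow> k \<ge> N \<Longrightarrow>
        spoly_norm \<nu> p (\<lambda>n. tensor_diff (f j n) (f k n)) < e / (\<bar>B\<bar> + 1)"
      using f p unfolding test_funs_def by blast
    have "dist (spoly_pair (H s) (f j)) (spoly_pair (H s) (f k)) < e" if s: "s \<in> T" and jk: "j \<ge> N" "k \<ge> N" for s j k
    proof -
      have "dist (spoly_pair (H s) (f j)) (spoly_pair (H s) (f k)) = \<bar>spoly_pair (H s) (\<lambda>n. tensor_diff (f j n) (f k n))\<bar>"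
        by (simp add: dist_real_def spoly_pair_tensor_diff fs)
      also have "\<dots> \<le> Snorm \<nu> p (H s) * spoly_norm \<nu> p (\<lambda>n. tensor_diff (f j n) (f k n))"
        by (intro spoly_pair_le H s spolys_diff fs)
      also have "\<dots> \<le> (\<bar>B\<bar> + 1) * spoly_norm \<nu> p (\<lambda>n. tensor_diff (f j n) (f k n))"
        using B[OF s] by (intro mult_right_mono spoly_norm_nonneg) auto
      also have "\<dots> < (\<bar>B\<bar> + 1) * (e / (\<bar>B\<bar> + 1))" using B1 N[OF jk] by (intro mult_strict_left_mono) auto
      finally show ?thesis using B1 by simp
    qed
    then show "\<exists>M. \<forall>x\<in>T. \<forall>m\<ge>M. \<forall>n\<ge>M. dist (spoly_pair (H x) (f m)) (spoly_pair (H x) (f n)) < e" by blast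
  qed
  then have "uniformly_convergent_on T (\<lambda>k s. spoly_pair (H s) (f k))" by (rule Cauchy_uniformly_convergent)
  then show ?thesis unfolding test_pair_def by (simp add: uniformly_convergent_uniform_limit_iff)
qed

lemma sdist_has_integral_toI:
  assumes H: "\<And>s. s \<in> {0..t} \<Longrightarrow> H s \<in> Sminus \<nu> p"
    and c: "continuous_on {0..t} (\<lambda>s. sdist_emb \<nu> p (H s))"
    and p: "q0 \<le> p" and I: "I \<in> Sminus \<nu> p" "sdist_emb \<nu> p I = integral {0..t} (\<lambda>s. sdist_emb \<nu> p (H s))"
  shows "sdist_has_integral_to \<nu> q0 H t I"
  unfolding sdist_has_integral_to_def sdist_has_integral_def
proof (intro conjI allI ballI)
  have sub: "F \<in> Sdist \<nu> q0" if "F \<in> Sminus \<nu> p" for F using that p by (auto simp: Sdist_def)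
  show "I \<in> Sdist \<nu> q0" using I(1) by (rule sub)
  show "(if s \<in> {0..t} then H s else 0) \<in> Sdist \<nu> q0" for s using H Sminus_zero by (auto intro: sub)
  fix f assume f: "f \<in> test_funs \<nu> q0"
  then have fs: "f k \<in> spolys" for k by (simp add: test_funs_def)
  have "bounded ((\<lambda>s. sdist_emb \<nu> p (H s)) ` {0..t})"
    by (intro compact_imp_bounded compact_continuous_image c) simp
  then obtain B where "\<And>s. s \<in> {0..t} \<Longrightarrow> norm (sdist_emb \<nu> p (H s)) \<le> B"
    unfolding bounded_iff by blast
  then have B: "\<And>s. s \<in> {0..t} \<Longrightarrow> Snorm \<nu> p (H s) \<le> B" by (simp add: norm_sdist_emb[OF H])
  note ul = uniform_limit_test_pair[OF H B p f]
  note cP = sdist_emb_integral(1)[OF H c fs]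
  have cg: "continuous_on {0..t} (\<lambda>s. test_pair (H s) f)"
    by (rule uniform_limit_theorem[OF always_eventually ul]) (auto intro: cP)
  obtain Ik J where IJ: "\<And>k. ((\<lambda>s. spoly_pair (H s) (f k)) has_integral Ik k) {0..t}"
      "((\<lambda>s. test_pair (H s) f) has_integral J) {0..t}" "Ik \<longlonglongrightarrow> J"
    using uniform_limit_integral[OF ul cP] by auto
  have "Ik = (\<lambda>k. spoly_pair I (f k))"
    using sdist_emb_integral(2)[OF H c fs I] integral_unique[OF IJ(1)] by auto
  then have tI: "test_pair I f = J" unfolding test_pair_def using IJ(3) by (simp add: limI)
  have si: "set_integrable lborel {0..t} (\<lambda>s. test_pair (H s) f)"
    by (rule borel_integrable_atLeastAtMost'[OF cg])
  have e: "test_pair (if s \<in> {0..t} then H s else 0) f = indicator {0..t} s *\<^sub>R test_pair (H s) f" for s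
    by (simp add: test_pair_zero)
  show "integrable lborel (\<lambda>s. test_pair (if s \<in> {0..t} then H s else 0) f)"
    using si unfolding e set_integrable_def .
  show "test_pair I f = (LINT s|lborel. test_pair (if s \<in> {0..t} then H s else 0) f)"
    using set_borel_integral_eq_integral(2)[OF si] integral_unique[OF IJ(2)]
    unfolding e tI set_lebesgue_integral_def by simp
qed

lemma ex_sdist_emb_integral:
  fixes t :: real
  assumes H: "\<And>s. s \<in> {0..t} \<Longrightarrow> H s \<in> Sminus \<nu> p"
  shows "\<exists>I\<in>Sminus \<nu> p. sdist_emb \<nu> p I = integral {0..t} (\<lambda>s. sdist_emb \<nu> p (H s))"
proof -
  have "integral {0..t} (\<lambda>s. sdist_emb \<nu> p (H s)) \<in> sdist_emb \<nu> p ` Sminus \<nu> p"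
    by (rule integral_mem_closed_subspace[OF subspace_sdist_emb closed_sdist_emb imageI[OF H]])
  then show ?thesis by force
qed

lemma sdist_has_integral_toD:
  assumes H: "\<And>s. s \<in> {0..t} \<Longrightarrow> H s \<in> Sminus \<nu> p"
    and c: "continuous_on {0..t} (\<lambda>s. sdist_emb \<nu> p (H s))"
    and p: "q0 \<le> p" and I: "sdist_has_integral_to \<nu> q0 H t I"
  shows "I \<in> Sminus \<nu> p \<and> sdist_emb \<nu> p I = integral {0..t} (\<lambda>s. sdist_emb \<nu> p (H s))"
proof -
  obtain I' where I': "I' \<in> Sminus \<nu> p" "sdist_emb \<nu> p I' = integral {0..t} (\<lambda>s. sdist_emb \<nu> p (H s))"
    using ex_sdist_emb_integral[where H=H and t=t and p=p] H by blast
  note I'_int = sdist_has_integral_toI[OF H c p I']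
  have "I \<in> Sdist \<nu> q0" using I by (simp add: sdist_has_integral_to_def sdist_has_integral_def)
  then obtain r where r: "I \<in> Sminus \<nu> r" by (auto simp: Sdist_def)
  have "I = I'"
  proof (rule sdist_eqI)
    fix P assume P: "P \<in> spolys"
    let ?J = "LINT s|lborel. test_pair (if s \<in> {0..t} then H s else 0) (\<lambda>k. P)"
    have "test_pair I'' (\<lambda>k. P) = ?J" if "sdist_has_integral_to \<nu> q0 H t I''" for I''
      using that const_test_funs[OF P] unfolding sdist_has_integral_to_def sdist_has_integral_def by blast
    from this[OF I] this[OF I'_int] have "test_pair I (\<lambda>k. P) = test_pair I' (\<lambda>k. P)" by simp
    then show "spoly_pair I P = spoly_pair I' P" by (simp add: test_pair_const)
  qed (rule Sminus_sym_form[OF r] Sminus_sym_form[OF I'(1)])+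
  then show ?thesis using I' by simp
qed

lemma unique_continuous_solution:
  assumes p: "2 \<le> p" "q0 \<le> p"
    and b_mem: "b \<in> Sminus \<nu> p \<rightarrow> Sminus \<nu> p" and s_mem: "\<sigma> \<in> Sminus \<nu> p \<rightarrow> Sminus \<nu> p"
    and b_growth: "\<And>Y. Y \<in> Sminus \<nu> p \<Longrightarrow> Snorm \<nu> p (b Y) \<le> C * (1 + Snorm \<nu> p Y)"
    and b_lip: "\<And>Y Z. Y \<in> Sminus \<nu> p \<Longrightarrow> Z \<in> Sminus \<nu> p \<Longrightarrow> Snorm \<nu> p (b Y - b Z) \<le> C * Snorm \<nu> p (Y - Z)"
    and s_growth: "\<And>Y. Y \<in> Sminus \<nu> p \<Longrightarrow> Snorm \<nu> p (\<sigma> Y) \<le> C * (1 + Snorm \<nu> p Y)"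
    and s_lip: "\<And>Y Z. Y \<in> Sminus \<nu> p \<Longrightarrow> Z \<in> Sminus \<nu> p \<Longrightarrow> Snorm \<nu> p (\<sigma> Y - \<sigma> Z) \<le> C * Snorm \<nu> p (Y - Z)"
    and U0: "U0 \<in> Sminus \<nu> p"
  shows "\<exists>U. continuous_solution \<nu> q0 \<beta> p b \<sigma> U0 U \<and>
           (\<forall>V. continuous_solution \<nu> q0 \<beta> p b \<sigma> U0 V \<longrightarrow> (\<forall>t\<ge>0. V t = U t))"
proof -
  let ?S = "Sminus \<nu> p" and ?N = "Snorm \<nu> p" and ?e = "sdist_emb \<nu> p"
  let ?R = "?e ` ?S" and ?i = "inv_into ?S ?e"
  let ?w = "\<lambda>t F. wick_first (noise t) F"
  define L where "L = noise_const / Gamma \<beta>"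
  have L: "0 \<le> L" using noise_const_nonneg Gamma_pos by (simp add: L_def)
  define K where "K = \<bar>C\<bar> + \<bar>C\<bar> * L"
  have i: "?i (?e F) = F" if "F \<in> ?S" for F using inj_sdist_emb that by (rule inv_into_f_f)
  have b: "b F \<in> ?S" and s: "\<sigma> F \<in> ?S" if "F \<in> ?S" for F using b_mem s_mem that by auto
  have w: "?w t F \<in> ?S" and w_le: "?N (?w t F) \<le> L * ?N F" if "F \<in> ?S" for t F
    using wick_noise_Sminus[OF that p(1)] by (auto simp: L_def)
  define G where "G t x = ?e (b (?i x)) + ?e (?w t (\<sigma> (?i x)))" for t x
  have G: "G t (?e F) = ?e (b F) + ?e (?w t (\<sigma> F))" if "F \<in> ?S" for t F by (simp add: G_def i that)
  have C_le: "C * x \<le> \<bar>C\<bar> * x" if "0 \<le> x" for x using that by (intro mult_right_mono) auto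
  have wc: "continuous_on T (\<lambda>t. ?e (?w t F))" if F: "F \<in> ?S" for T F
  proof (rule lipschitz_on_continuous_on)
    show "(L * ?N F)-lipschitz_on T (\<lambda>t. ?e (?w t F))"
    proof (rule lipschitz_onI)
      fix x y
      have "dist (?e (?w x F)) (?e (?w y F)) = ?N (?w x F - ?w y F)"
        by (simp add: dist_norm sdist_emb_diff[symmetric] norm_sdist_emb Sminus_diff w F)
      also have "\<dots> \<le> L * \<bar>x - y\<bar> * ?N F" unfolding L_def by (rule wick_noise_diff_le[OF F p(1)])
      finally show "dist (?e (?w x F)) (?e (?w y F)) \<le> L * ?N F * dist x y" by (simp add: dist_real_def mult_ac)
    qed (simp add: L Snorm_nonneg[OF F])
  qed
  interpret volterra ?R G K
  proof
    show "subspace ?R" by (rule subspace_sdist_emb)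
    show "closed ?R" by (rule closed_sdist_emb)
    show "0 \<le> K" using L by (simp add: K_def)
    show "G t x \<in> ?R" if x: "x \<in> ?R" for t x
    proof -
      obtain F where F: "F \<in> ?S" "x = ?e F" using x by blast
      show ?thesis unfolding F(2) G[OF F(1)]
        by (intro subspace_add subspace_sdist_emb imageI b w s F)
    qed
    show "norm (G t x - G t y) \<le> K * norm (x - y)" if x: "x \<in> ?R" and y: "y \<in> ?R" for t x y
    proof -
      obtain F where F: "F \<in> ?S" "x = ?e F" using x by blast
      obtain H where H: "H \<in> ?S" "y = ?e H" using y by blast
      have "G t x - G t y = ?e (b F - b H) + ?e (?w t (\<sigma> F - \<sigma> H))"
        unfolding F(2) H(2) G[OF F(1)] G[OF H(1)] wick_first_diff[symmetric]
        by (simp add: sdist_emb_diff b w s F H)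
      then have "norm (G t x - G t y) \<le> ?N (b F - b H) + ?N (?w t (\<sigma> F - \<sigma> H))"
        using norm_triangle_ineq[of "?e (b F - b H)" "?e (?w t (\<sigma> F - \<sigma> H))"]
        by (simp add: norm_sdist_emb b w s F H Sminus_diff)
      also have "\<dots> \<le> \<bar>C\<bar> * ?N (F - H) + L * (\<bar>C\<bar> * ?N (F - H))"
      proof (rule add_mono)
        note nn = Snorm_nonneg[OF Sminus_diff[OF F(1) H(1)]]
        show "?N (b F - b H) \<le> \<bar>C\<bar> * ?N (F - H)" using b_lip[OF F(1) H(1)] C_le[OF nn] by simp
        have "?N (\<sigma> F - \<sigma> H) \<le> \<bar>C\<bar> * ?N (F - H)" using s_lip[OF F(1) H(1)] C_le[OF nn] by simp
        then show "?N (?w t (\<sigma> F - \<sigma> H)) \<le> L * (\<bar>C\<bar> * ?N (F - H))"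
          using w_le[OF Sminus_diff[OF s[OF F(1)] s[OF H(1)]], of t] mult_left_mono[OF _ L] by (meson order_trans)
      qed
      also have "\<dots> = K * norm (x - y)"
        by (simp add: K_def F(2) H(2) sdist_emb_diff[symmetric] norm_sdist_emb Sminus_diff F(1) H(1) algebra_simps)
      finally show ?thesis .
    qed
    show "norm (G t x) \<le> K * (1 + norm x)" if x: "x \<in> ?R" for t x
    proof -
      obtain F where F: "F \<in> ?S" "x = ?e F" using x by blast
      have "norm (G t x) \<le> ?N (b F) + ?N (?w t (\<sigma> F))"
        unfolding F(2) G[OF F(1)] using norm_triangle_ineq[of "?e (b F)" "?e (?w t (\<sigma> F))"]
        by (simp add: norm_sdist_emb b w s F(1))
      also have "\<dots> \<le> \<bar>C\<bar> * (1 + ?N F) + L * (\<bar>C\<bar> * (1 + ?N F))"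
      proof (rule add_mono)
        have nn: "0 \<le> 1 + ?N F" using Snorm_nonneg[OF F(1)] by simp
        show "?N (b F) \<le> \<bar>C\<bar> * (1 + ?N F)" using b_growth[OF F(1)] C_le[OF nn] by simp
        have "?N (\<sigma> F) \<le> \<bar>C\<bar> * (1 + ?N F)" using s_growth[OF F(1)] C_le[OF nn] by simp
        then show "?N (?w t (\<sigma> F)) \<le> L * (\<bar>C\<bar> * (1 + ?N F))"
          using w_le[OF s[OF F(1)], of t] mult_left_mono[OF _ L] by (meson order_trans)
      qed
      also have "\<dots> = K * (1 + norm x)" by (simp add: K_def F(2) norm_sdist_emb F(1) algebra_simps)
      finally show ?thesis .
    qed
    show "continuous_on {0..} (\<lambda>t. G t x)" if x: "x \<in> ?R" for x
    proof -
      obtain F where F: "F \<in> ?S" "x = ?e F" using x by blast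
      show ?thesis unfolding F(2) G[OF F(1)] by (intro continuous_intros wc s F(1))
    qed
  qed
  have wick: "wick \<nu> q0 (\<sigma> F) (frac_levy_noise \<nu> q0 \<beta> t) = ?w t (\<sigma> F)" if "F \<in> ?S" for F t
    by (rule wick_frac_levy_noise[OF s[OF that] p])
  let ?r = "\<lambda>U s. wick \<nu> q0 (\<sigma> (U s)) (frac_levy_noise \<nu> q0 \<beta> s)"
  have cont: "continuous_on {0..} (\<lambda>t. ?e (U t)) \<longleftrightarrow> (\<forall>t\<ge>0. ((\<lambda>s. ?N (U s - U t)) \<longlongrightarrow> 0) (at t within {0..}))"
    if U: "\<forall>t\<ge>0. U t \<in> ?S" for U
  proof -
    have "((\<lambda>s. ?e (U s)) \<longlongrightarrow> ?e (U t)) (at t within {0..}) \<longleftrightarrow> ((\<lambda>s. ?N (U s - U t)) \<longlongrightarrow> 0) (at t within {0..})"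
      if t: "0 \<le> t" for t
    proof -
      have "((\<lambda>s. dist (?e (U s)) (?e (U t))) \<longlongrightarrow> 0) (at t within {0..}) \<longleftrightarrow> ((\<lambda>s. ?N (U s - U t)) \<longlongrightarrow> 0) (at t within {0..})"
        by (intro tendsto_cong)
          (simp add: eventually_at_filter dist_norm sdist_emb_diff[symmetric] norm_sdist_emb Sminus_diff U t)
      then show ?thesis by (subst tendsto_dist_iff)
    qed
    then show ?thesis by (auto simp: continuous_on_def)
  qed
  have lip: "continuous_on T (\<lambda>t. ?e (g (U t)))"
    if g: "\<And>F. F \<in> ?S \<Longrightarrow> g F \<in> ?S" "\<And>F H. F \<in> ?S \<Longrightarrow> H \<in> ?S \<Longrightarrow> ?N (g F - g H) \<le> C * ?N (F - H)"
      and U: "\<And>t. t \<in> T \<Longrightarrow> U t \<in> ?S" and cU: "continuous_on T (\<lambda>t. ?e (U t))" for g U T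
  proof -
    have "\<bar>C\<bar>-lipschitz_on ?R (\<lambda>x. ?e (g (?i x)))"
    proof (rule lipschitz_onI)
      fix x y assume x: "x \<in> ?R" and y: "y \<in> ?R"
      obtain F where F: "F \<in> ?S" "x = ?e F" using x by blast
      obtain H where H: "H \<in> ?S" "y = ?e H" using y by blast
      have "?N (g F - g H) \<le> \<bar>C\<bar> * ?N (F - H)"
        using g(2)[OF F(1) H(1)] C_le[OF Snorm_nonneg[OF Sminus_diff[OF F(1) H(1)]]] by simp
      then show "dist (?e (g (?i x))) (?e (g (?i y))) \<le> \<bar>C\<bar> * dist x y"
        by (simp add: F H i dist_norm sdist_emb_diff[symmetric] norm_sdist_emb Sminus_diff g(1))
    qed simp
    then have "continuous_on ?R (\<lambda>x. ?e (g (?i x)))" by (rule lipschitz_on_continuous_on)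
    then have "continuous_on T (\<lambda>t. ?e (g (?i (?e (U t)))))"
      by (rule continuous_on_compose2[OF _ cU]) (use U in auto)
    then show ?thesis by (rule continuous_on_cong[THEN iffD1, rotated -1]) (simp_all add: i U)
  qed
  have G_U: "G t (?e (U t)) = ?e (b (U t)) + ?e (?r U t)" if "U t \<in> ?S" for U t
    by (simp add: G that wick)
  have eqn: "continuous_on {0..t} (\<lambda>s. ?e (b (U s)))" "continuous_on {0..t} (\<lambda>s. ?e (?r U s))"
      "integral {0..t} (\<lambda>s. G s (?e (U s))) = integral {0..t} (\<lambda>s. ?e (b (U s))) + integral {0..t} (\<lambda>s. ?e (?r U s))"
    if U': "\<forall>t\<ge>0. U t \<in> ?S" and cU: "continuous_on {0..} (\<lambda>s. ?e (U s))" for U t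
  proof -
    have U: "\<And>s. 0 \<le> s \<Longrightarrow> U s \<in> ?S" using U' by simp
    have sub: "{0..t} \<subseteq> {0..}" by auto
    note c' = continuous_on_subset[OF cU sub]
    show bc: "continuous_on {0..t} (\<lambda>s. ?e (b (U s)))" using U by (intro lip[OF b b_lip _ c']) auto
    have "continuous_on {0..t} (\<lambda>s. G s (?e (U s)))" using U by (intro G_compose_continuous c') auto
    then have "continuous_on {0..t} (\<lambda>s. G s (?e (U s)) - ?e (b (U s)))" by (intro continuous_intros bc)
    then show rc: "continuous_on {0..t} (\<lambda>s. ?e (?r U s))"
      by (rule continuous_on_cong[THEN iffD1, rotated -1]) (simp_all add: G_U U)
    have "integral {0..t} (\<lambda>s. G s (?e (U s))) = integral {0..t} (\<lambda>s. ?e (b (U s)) + ?e (?r U s))"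
      by (rule Henstock_Kurzweil_Integration.integral_cong) (simp add: G_U U)
    then show "integral {0..t} (\<lambda>s. G s (?e (U s))) = integral {0..t} (\<lambda>s. ?e (b (U s))) + integral {0..t} (\<lambda>s. ?e (?r U s))"
      using bc rc by (simp add: Henstock_Kurzweil_Integration.integral_add integrable_continuous_real)
  qed
  have volterra: "?e (V t) = ?e U0 + integral {0..t} (\<lambda>s. G s (?e (V s)))"
      "continuous_on {0..} (\<lambda>s. ?e (V s))" "V t \<in> ?S"
    if V: "continuous_solution \<nu> q0 \<beta> p b \<sigma> U0 V" and t: "0 \<le> t" for V t
  proof -
    have VS: "\<forall>t\<ge>0. V t \<in> ?S" using V by (simp add: continuous_solution_def)
    have cV: "continuous_on {0..} (\<lambda>s. ?e (V s))" using V cont[of V] by (simp add: continuous_solution_def)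
    show "continuous_on {0..} (\<lambda>s. ?e (V s))" "V t \<in> ?S" using cV VS t by auto
    note e = eqn[OF VS cV]
    have m: "b (V s) \<in> ?S" "?r V s \<in> ?S" if "s \<in> {0..t}" for s
      using that VS by (simp_all add: b wick w s)
    obtain I J where IJ: "sdist_has_integral_to \<nu> q0 (\<lambda>s. b (V s)) t I"
        "sdist_has_integral_to \<nu> q0 (?r V) t J" "V t = U0 + I + J"
      using V t unfolding continuous_solution_def by blast
    note I = sdist_has_integral_toD[OF m(1) e(1) p(2) IJ(1)]
    note J = sdist_has_integral_toD[OF m(2) e(2) p(2) IJ(2)]
    show "?e (V t) = ?e U0 + integral {0..t} (\<lambda>s. G s (?e (V s)))"
      unfolding e(3) IJ(3) using I J U0 by (simp add: sdist_emb_add Sminus_add)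
  qed
  obtain u where u: "continuous_on {0..} u" "\<And>t. 0 \<le> t \<Longrightarrow> u t \<in> ?R"
      "\<And>t. 0 \<le> t \<Longrightarrow> u t = ?e U0 + integral {0..t} (\<lambda>s. G s (u s))"
    using ex_solution[OF imageI[OF U0]] by blast
  define U where "U t = ?i (u t)" for t
  have US: "U t \<in> ?S" and eU: "?e (U t) = u t" if "0 \<le> t" for t
    unfolding U_def using u(2)[OF that] by (rule inv_into_into, rule f_inv_into_f)
  have cU: "continuous_on {0..} (\<lambda>s. ?e (U s))"
    using u(1) by (rule continuous_on_cong[THEN iffD1, rotated -1]) (simp_all add: eU)
  have "continuous_solution \<nu> q0 \<beta> p b \<sigma> U0 U"
    unfolding continuous_solution_def
  proof (intro conjI)
    show "\<forall>t\<ge>0. U t \<in> ?S" using US by simp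
    then show "\<forall>t\<ge>0. ((\<lambda>s. ?N (U s - U t)) \<longlongrightarrow> 0) (at t within {0..})" using cont cU by blast
    show "\<forall>t\<ge>0. \<exists>I J. sdist_has_integral_to \<nu> q0 (\<lambda>s. b (U s)) t I \<and>
        sdist_has_integral_to \<nu> q0 (?r U) t J \<and> U t = U0 + I + J"
    proof (intro allI impI)
      fix t :: real assume t: "0 \<le> t"
      have "\<forall>t\<ge>0. U t \<in> ?S" using US by simp
      note e = eqn[OF this cU]
      have m: "b (U s) \<in> ?S" "?r U s \<in> ?S" if "s \<in> {0..t}" for s
        using that US[of s] by (simp_all add: b wick w s)
      obtain I where I: "I \<in> ?S" "?e I = integral {0..t} (\<lambda>s. ?e (b (U s)))"
        using ex_sdist_emb_integral[where t=t and p=p and H="\<lambda>s. b (U s)", OF m(1)] by blast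
      obtain J where J: "J \<in> ?S" "?e J = integral {0..t} (\<lambda>s. ?e (?r U s))"
        using ex_sdist_emb_integral[where t=t and p=p and H="?r U", OF m(2)] by blast
      have "?e (U t) = ?e U0 + integral {0..t} (\<lambda>s. G s (u s))" using u(3) eU t by simp
      also have "integral {0..t} (\<lambda>s. G s (u s)) = integral {0..t} (\<lambda>s. G s (?e (U s)))"
        by (rule Henstock_Kurzweil_Integration.integral_cong) (simp add: eU)
      finally have "?e (U t) = ?e (U0 + I + J)"
        by (simp add: e(3) I J U0 sdist_emb_add Sminus_add)
      then have "U t = U0 + I + J"
        by (rule inj_onD[OF inj_sdist_emb]) (auto intro: Sminus_add U0 I J US t)
      then show "\<exists>I J. sdist_has_integral_to \<nu> q0 (\<lambda>s. b (U s)) t I \<and>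
          sdist_has_integral_to \<nu> q0 (?r U) t J \<and> U t = U0 + I + J"
        using sdist_has_integral_toI[OF m(1) e(1) p(2) I] sdist_has_integral_toI[OF m(2) e(2) p(2) J] by blast
    qed
  qed
  moreover have "V t = U t" if V: "continuous_solution \<nu> q0 \<beta> p b \<sigma> U0 V" and t: "0 \<le> t" for V t
  proof -
    have "?e (V t) = ?e (U t)"
      unfolding eU[OF t]
      by (rule unique[OF volterra(2)[OF V order_refl] imageI[OF volterra(3)[OF V]] volterra(1)[OF V] u t])
    then show ?thesis by (rule inj_onD[OF inj_sdist_emb]) (use volterra(3)[OF V t] US[OF t] in auto)
  qed
  ultimately show ?thesis by blast
qed

end

theorem theorem5p2:
  fixes \<nu> :: "real measure" and \<mu> :: "functional measure"
    and p0 q0 p :: nat and \<beta> C :: real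
    and b \<sigma> :: "sdist \<Rightarrow> sdist" and U0 :: sdist
  assumes "levy_measure \<nu>" and "(\<integral>\<^sup>+x. ennreal (\<bar>x\<bar>\<^sup>2) \<partial>\<nu>) < \<infinity>"
    and "white_noise_measure \<nu> \<mu>"
    and "p0 < q0" and "one_nudot \<nu> \<in> Sdual \<nu> p0" and "HS_embedding \<nu> p0 q0"
    and "emeasure \<mu> (Sdual \<nu> q0) = 1"
    and "0 < \<beta>" and "\<beta> < 1/2" and "p > max 1 q0"
    and "b \<in> Sminus \<nu> p \<rightarrow> Sminus \<nu> p" and "\<sigma> \<in> Sminus \<nu> p \<rightarrow> Sminus \<nu> p"
    and "\<And>Y. Y \<in> Sminus \<nu> p \<Longrightarrow> Snorm \<nu> p (b Y) \<le> C * (1 + Snorm \<nu> p Y)"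
    and "\<And>Y Z. Y \<in> Sminus \<nu> p \<Longrightarrow> Z \<in> Sminus \<nu> p \<Longrightarrow>
           Snorm \<nu> p (b Y - b Z) \<le> C * Snorm \<nu> p (Y - Z)"
    and "\<And>Y. Y \<in> Sminus \<nu> p \<Longrightarrow> Snorm \<nu> p (\<sigma> Y) \<le> C * (1 + Snorm \<nu> p Y)"
    and "\<And>Y Z. Y \<in> Sminus \<nu> p \<Longrightarrow> Z \<in> Sminus \<nu> p \<Longrightarrow>
           Snorm \<nu> p (\<sigma> Y - \<sigma> Z) \<le> C * Snorm \<nu> p (Y - Z)"
    and "U0 \<in> Sminus \<nu> p"
  shows "\<exists>U. continuous_solution \<nu> q0 \<beta> p b \<sigma> U0 U \<and>
           (\<forall>V. continuous_solution \<nu> q0 \<beta> p b \<sigma> U0 V \<longrightarrow> (\<forall>t\<ge>0. V t = U t))"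
proof -
  interpret levy_noise \<nu> \<beta>
    using assms by unfold_locales (auto simp: levy_measure_def)
  show ?thesis
    using assms(10) by (intro unique_continuous_solution[OF _ _ assms(11-17)]) auto
qed

end
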